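(* Let $A$ be an Artin algebra with Loewy length $L$ such that all indecomposable projective $A$-modules $P_1,\dots,P_n$ have Loewy length $L$ and are rigid. Let $(k,l)\in\Lambda$, and suppose that the socle layers of the injective hull $Q_k$ of $L_k=\operatorname{Top}P_k$ are $$\operatorname{Soc}_iQ_k/\operatorname{Soc}_{i-1}Q_k\;\cong\;\bigoplus_{\omega\in\Omega^k_i}L_{x_\omega},\qquad i=1,\dots,\operatorname{LL}(Q_k),$$ for finite index sets $\Omega_i^k$ and $x_\omega\in\{1,\dots,n\}$. Then the tilting module $T(k,l)$ over the ADR algebra $R_A$ satisfies $$\delta_i(T(k,l))/\delta_{i-1}(T(k,l))\;\cong\;\bigoplus_{\omega\in\Omega^k_i}\Delta(x_\omega,\,l+i-1)$$ for $i=1,\dots,\Delta.\mathrm{ssl}\,T(k,l)$.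
   Context: Algebras are Artin algebras over a commutative artinian ring; modules are finitely generated left modules. $\operatorname{Rad}^jM$, $\operatorname{Soc}_jM$ are the terms of the radical and socle series ($\operatorname{Soc}_0M=0$), $\operatorname{LL}(M)$ is the Loewy length. A module is rigid if its radical series coincides with its socle series. Quasihereditary algebras. For an Artin algebra $B$ with simple modules $L_i$ labelled by a finite poset $(\Phi,\sqsubseteq)$, projective covers $P_i$ and injective hulls $Q_i$: the standard module $\Delta(i)$ is the largest quotient of $P_i$ with all composition factors $L_j$, $j\sqsubseteq i$; the costandard module $\nabla(i)$ is the largest submodule of $Q_i$ with all composition factors $L_j$, $j\sqsubseteq i$. $\mathcal{F}(\Delta)$, $\mathcal{F}(\nabla)$ are the categories of modules filtered by standard, resp. costandard modules. $(B,\Phi,\sqsubseteq)$ is quasihereditary if for all $i$: $[\Delta(i):L_i]=1$; $P_i\in\mathcal{F}(\Delta)$; $\Delta(i)$ occurs once in a $\Delta$-filtration of $P_i$ and any other factor $\Delta(j)$ satisfies $j\sqsupseteq i$. The indecomposable modules in $\mathcal{F}(\Delta)\cap\mathcal{F}(\nabla)$ (tilting modules) are modules $T(i)$, $i\in\Phi$, where there is a monomorphism $\Delta(i)\to T(i)$ with cokernel filtered by modules $\Delta(j)$, $j\sqsubset i$. ADR algebra. Let $P_1,\dots,P_n$ be a complete irredundant list of indecomposable projective $A$-modules, $l_i=\operatorname{LL}(P_i)$, $G=\bigoplus_{i=1}^n\bigoplus_{j=1}^{l_i}P_i/\operatorname{Rad}^jP_i$ and $R_A=\operatorname{End}_A(G)^{op}$.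 Its indecomposable projectives $P_{i,j}=\operatorname{Hom}_A(G,P_i/\operatorname{Rad}^jP_i)$ (with tops $L_{i,j}$) are labelled by $\Lambda=\{(i,j):1\le i\le n,1\le j\le l_i\}$, ordered by $(i,j)\lhd(k,l)\Leftrightarrow j>l$; it is known that $(R_A,\Lambda,\unlhd)$ is quasihereditary. $\Delta$-semisimple filtration. For an $R_A$-module $M$ let $\delta_0(M)=0$, let $\delta(M)=\delta_1(M)$ be the trace of $\Delta$ in $M$, i.e. the sum of the images of all homomorphisms from standard modules to $M$, and define $\delta_{i+1}(M)$ by $\delta_{i+1}(M)/\delta_i(M)=\delta(M/\delta_i(M))$. It is known that for $M\in\mathcal{F}(\Delta)$ this gives a finite filtration $0\subset\delta_1(M)\subset\dots\subset\delta_m(M)=M$ with proper inclusions, whose factors are direct sums of standard modules; $\Delta.\mathrm{ssl}\,M:=m$. *)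

theory Defs
  imports "HOL-Algebra.Module" "HOL-Algebra.QuotRing"
begin

section \<open>Left modules over a ring\<close>

text \<open>The library locale \<^locale>\<open>module\<close> requires a commutative ring of scalars; we keep its record
  type and its notion of \<^locale>\<open>submodule\<close> and drop commutativity. The record fields \<open>mult\<close> and
  \<open>one\<close>, inherited from the type of rings, play no role for a module.\<close>

locale left_module = R?: ring R + M?: abelian_group M for R :: "('a, 'e) ring_scheme" and M :: "('a, 'v) module" (structure) +
  assumes smult_closed: "\<lbrakk>a \<in> carrier R; x \<in> carrier M\<rbrakk> \<Longrightarrow> a \<odot>\<^bsub>M\<^esub> x \<in> carrier M"
    and smult_l_distr: "\<lbrakk>a \<in> carrier R; b \<in> carrier R; x \<in> carrier M\<rbrakk> \<Longrightarrow>
      (a \<oplus>\<^bsub>R\<^esub> b) \<odot>\<^bsub>M\<^esub> x = a \<odot>\<^bsub>M\<^esub> x \<oplus>\<^bsub>M\<^esub> b \<odot>\<^bsub>M\<^esub> x"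
    and smult_r_distr: "\<lbrakk>a \<in> carrier R; x \<in> carrier M; y \<in> carrier M\<rbrakk> \<Longrightarrow>
      a \<odot>\<^bsub>M\<^esub> (x \<oplus>\<^bsub>M\<^esub> y) = a \<odot>\<^bsub>M\<^esub> x \<oplus>\<^bsub>M\<^esub> a \<odot>\<^bsub>M\<^esub> y"
    and smult_assoc: "\<lbrakk>a \<in> carrier R; b \<in> carrier R; x \<in> carrier M\<rbrakk> \<Longrightarrow>
      (a \<otimes>\<^bsub>R\<^esub> b) \<odot>\<^bsub>M\<^esub> x = a \<odot>\<^bsub>M\<^esub> (b \<odot>\<^bsub>M\<^esub> x)"
    and smult_one: "x \<in> carrier M \<Longrightarrow> \<one>\<^bsub>R\<^esub> \<odot>\<^bsub>M\<^esub> x = x"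

definition msub :: "('a, 'v) module \<Rightarrow> 'v set \<Rightarrow> ('a, 'v) module" where
  "msub M N = M\<lparr>carrier := N\<rparr>"

definition mspan :: "('a, 'e) ring_scheme \<Rightarrow> ('a, 'v) module \<Rightarrow> 'v set \<Rightarrow> 'v set" where
  "mspan R M S = \<Inter>{N. submodule N R M \<and> S \<subseteq> N}"

definition fg_module :: "('a, 'e) ring_scheme \<Rightarrow> ('a, 'v) module \<Rightarrow> bool" where
  "fg_module R M \<longleftrightarrow> left_module R M \<and>
     (\<exists>S. finite S \<and> S \<subseteq> carrier M \<and> mspan R M S = carrier M)"

definition regular_module :: "('a, 'e) ring_scheme \<Rightarrow> ('a, 'a) module" where
  "regular_module R =
     \<lparr>carrier = carrier R, mult = mult R, one = one R, zero = zero R, add = add R, smult = mult R\<rparr>"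

definition quot_module :: "('a, 'v) module \<Rightarrow> 'v set \<Rightarrow> ('a, 'v set) module" where
  "quot_module M N =
     \<lparr>carrier = a_rcosets\<^bsub>M\<^esub> N, mult = undefined, one = undefined, zero = N, add = set_add M,
      smult = (\<lambda>a X. \<Union>x\<in>X. N +>\<^bsub>M\<^esub> (a \<odot>\<^bsub>M\<^esub> x))\<rparr>"

definition subquot :: "('a, 'v) module \<Rightarrow> 'v set \<Rightarrow> 'v set \<Rightarrow> ('a, 'v set) module" where
  "subquot M N N' = quot_module (msub M N) N'"

text \<open>Only used for finite index sets, where the product is the direct sum.\<close>

definition dir_sum :: "'i set \<Rightarrow> ('i \<Rightarrow> ('a, 'v) module) \<Rightarrow> ('a, 'i \<Rightarrow> 'v) module" where
  "dir_sum I M =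
     \<lparr>carrier = (\<Pi>\<^sub>E i\<in>I. carrier (M i)), mult = undefined, one = undefined,
      zero = (\<lambda>i\<in>I. \<zero>\<^bsub>M i\<^esub>), add = (\<lambda>f g. \<lambda>i\<in>I. f i \<oplus>\<^bsub>M i\<^esub> g i),
      smult = (\<lambda>a f. \<lambda>i\<in>I. a \<odot>\<^bsub>M i\<^esub> f i)\<rparr>"

text \<open>Homomorphisms are extensional functions, so that equality of homomorphisms is equality on the
  carrier.\<close>

definition mod_hom ::
    "('a, 'e) ring_scheme \<Rightarrow> ('a, 'v) module \<Rightarrow> ('a, 'w) module \<Rightarrow> ('v \<Rightarrow> 'w) set" where
  "mod_hom R M N = {f \<in> carrier M \<rightarrow>\<^sub>E carrier N.
     (\<forall>x\<in>carrier M. \<forall>y\<in>carrier M. f (x \<oplus>\<^bsub>M\<^esub> y) = f x \<oplus>\<^bsub>N\<^esub> f y) \<and>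
     (\<forall>a\<in>carrier R. \<forall>x\<in>carrier M. f (a \<odot>\<^bsub>M\<^esub> x) = a \<odot>\<^bsub>N\<^esub> f x)}"

definition mod_iso :: "('a, 'e) ring_scheme \<Rightarrow> ('a, 'v) module \<Rightarrow> ('a, 'w) module \<Rightarrow> bool" where
  "mod_iso R M N \<longleftrightarrow> (\<exists>f\<in>mod_hom R M N. bij_betw f (carrier M) (carrier N))"

definition nonzero_module :: "('a, 'v) module \<Rightarrow> bool" where
  "nonzero_module M \<longleftrightarrow> carrier M \<noteq> {\<zero>\<^bsub>M\<^esub>}"

definition simple_module :: "('a, 'e) ring_scheme \<Rightarrow> ('a, 'v) module \<Rightarrow> bool" where
  "simple_module R M \<longleftrightarrow> left_module R M \<and> nonzero_module M \<and>
     (\<forall>N. submodule N R M \<longrightarrow> N = {\<zero>\<^bsub>M\<^esub>} \<or> N = carrier M)"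

definition indecomposable :: "('a, 'e) ring_scheme \<Rightarrow> ('a, 'v) module \<Rightarrow> bool" where
  "indecomposable R M \<longleftrightarrow> nonzero_module M \<and>
     (\<forall>N N'. submodule N R M \<longrightarrow> submodule N' R M \<longrightarrow>
        N \<inter> N' = {\<zero>\<^bsub>M\<^esub>} \<longrightarrow> N <+>\<^bsub>M\<^esub> N' = carrier M \<longrightarrow> N = {\<zero>\<^bsub>M\<^esub>} \<or> N' = {\<zero>\<^bsub>M\<^esub>})"


subsection \<open>Radical and socle series\<close>

definition maximal_submodule ::
    "('a, 'e) ring_scheme \<Rightarrow> ('a, 'v) module \<Rightarrow> 'v set \<Rightarrow> bool" where
  "maximal_submodule R M N \<longleftrightarrow> submodule N R M \<and> N \<noteq> carrier M \<and>
     (\<forall>N'. submodule N' R M \<longrightarrow> N \<subseteq> N' \<longrightarrow> N' = N \<or> N' = carrier M)"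

definition radical :: "('a, 'e) ring_scheme \<Rightarrow> ('a, 'v) module \<Rightarrow> 'v set" where
  "radical R M = carrier M \<inter> \<Inter>{N. maximal_submodule R M N}"

definition socle :: "('a, 'e) ring_scheme \<Rightarrow> ('a, 'v) module \<Rightarrow> 'v set" where
  "socle R M = mspan R M (\<Union>{N. submodule N R M \<and> simple_module R (msub M N)})"

primrec rad_series :: "('a, 'e) ring_scheme \<Rightarrow> ('a, 'v) module \<Rightarrow> nat \<Rightarrow> 'v set" where
  "rad_series R M 0 = carrier M"
| "rad_series R M (Suc j) = radical R (msub M (rad_series R M j))"

primrec soc_series :: "('a, 'e) ring_scheme \<Rightarrow> ('a, 'v) module \<Rightarrow> nat \<Rightarrow> 'v set" where
  "soc_series R M 0 = {\<zero>\<^bsub>M\<^esub>}"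
| "soc_series R M (Suc j) = {x \<in> carrier M.
     soc_series R M j +>\<^bsub>M\<^esub> x \<in> socle R (quot_module M (soc_series R M j))}"

definition loewy_length :: "('a, 'e) ring_scheme \<Rightarrow> ('a, 'v) module \<Rightarrow> nat" where
  "loewy_length R M = (LEAST j. rad_series R M j = {\<zero>\<^bsub>M\<^esub>})"

definition rigid :: "('a, 'e) ring_scheme \<Rightarrow> ('a, 'v) module \<Rightarrow> bool" where
  "rigid R M \<longleftrightarrow>
     (\<forall>j\<le>loewy_length R M. rad_series R M j = soc_series R M (loewy_length R M - j))"

definition mtop :: "('a, 'e) ring_scheme \<Rightarrow> ('a, 'v) module \<Rightarrow> ('a, 'v set) module" where
  "mtop R M = quot_module M (radical R M)"


subsection \<open>Projective and injective modules\<close>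

text \<open>HOL cannot quantify over modules on all types at once. Statements about all finitely generated
  modules over a ring with elements of type \<open>'a\<close> therefore range over modules of the following type;
  this loses nothing, by lemma \<open>fg_module_representable\<close> below.\<close>

type_synonym 'a umodule = "('a, (nat \<Rightarrow> 'a) set) module"

context left_module
begin

primrec lincomb :: "(nat \<Rightarrow> 'a) \<Rightarrow> (nat \<Rightarrow> 'v) \<Rightarrow> nat \<Rightarrow> 'v" where
  "lincomb c s 0 = \<zero>\<^bsub>M\<^esub>"
| "lincomb c s (Suc m) = lincomb c s m \<oplus>\<^bsub>M\<^esub> c m \<odot>\<^bsub>M\<^esub> s m"

lemma zero_smult: "\<zero>\<^bsub>R\<^esub> \<odot>\<^bsub>M\<^esub> x = \<zero>\<^bsub>M\<^esub>" if "x \<in> carrier M"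
proof -
  have "\<zero>\<^bsub>R\<^esub> \<odot>\<^bsub>M\<^esub> x \<oplus>\<^bsub>M\<^esub> \<zero>\<^bsub>R\<^esub> \<odot>\<^bsub>M\<^esub> x = \<zero>\<^bsub>R\<^esub> \<odot>\<^bsub>M\<^esub> x"
    using smult_l_distr[of "\<zero>\<^bsub>R\<^esub>" "\<zero>\<^bsub>R\<^esub>" x] that by simp
  then show ?thesis using smult_closed[of "\<zero>\<^bsub>R\<^esub>" x] that
    M.add.r_cancel_one'[of "\<zero>\<^bsub>R\<^esub> \<odot>\<^bsub>M\<^esub> x" "\<zero>\<^bsub>R\<^esub> \<odot>\<^bsub>M\<^esub> x"] by simp
qed

lemma lsubmoduleI:
  assumes H: "H \<subseteq> carrier M" "\<zero>\<^bsub>M\<^esub> \<in> H" "\<And>x y. x \<in> H \<Longrightarrow> y \<in> H \<Longrightarrow> x \<oplus>\<^bsub>M\<^esub> y \<in> H"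
    "\<And>a x. a \<in> carrier R \<Longrightarrow> x \<in> H \<Longrightarrow> a \<odot>\<^bsub>M\<^esub> x \<in> H"
  shows "submodule H R M"
proof -
  have "\<ominus>\<^bsub>M\<^esub> x \<in> H" if "x \<in> H" for x
  proof -
    have x: "x \<in> carrier M" using that H(1) by auto
    have "(\<ominus>\<^bsub>R\<^esub> \<one>\<^bsub>R\<^esub>) \<odot>\<^bsub>M\<^esub> x \<oplus>\<^bsub>M\<^esub> x = \<zero>\<^bsub>M\<^esub>"
      using smult_l_distr[of "\<ominus>\<^bsub>R\<^esub> \<one>\<^bsub>R\<^esub>" "\<one>\<^bsub>R\<^esub>" x] x zero_smult smult_one by (simp add: R.l_neg)
    then have "\<ominus>\<^bsub>M\<^esub> x = (\<ominus>\<^bsub>R\<^esub> \<one>\<^bsub>R\<^esub>) \<odot>\<^bsub>M\<^esub> x"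
      using x smult_closed by (simp add: M.minus_equality)
    then show ?thesis using H(4)[OF _ that] by simp
  qed
  then show ?thesis
    by (intro submodule.intro subgroup.intro submodule_axioms.intro) (use H in \<open>auto simp: a_inv_def\<close>)
qed

lemma fg_module_transport:
  fixes g :: "'v \<Rightarrow> 'u"
  assumes fg: "fg_module R M" and g: "inj_on g (carrier M)"
  shows "\<exists>N :: ('a, 'u) module. fg_module R N \<and> mod_iso R M N"
proof -
  define h where "h = inv_into (carrier M) g"
  have hg [simp]: "h (g x) = x" if "x \<in> carrier M" for x
    using that g by (simp add: h_def)
  define N :: "('a, 'u) module" where "N = \<lparr>carrier = g ` carrier M, mult = undefined,
     one = undefined, zero = g \<zero>\<^bsub>M\<^esub>, add = (\<lambda>u v. g (h u \<oplus>\<^bsub>M\<^esub> h v)),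
     smult = (\<lambda>a u. g (a \<odot>\<^bsub>M\<^esub> h u))\<rparr>"
  have grp: "abelian_group N"
  proof (rule abelian_groupI)
    fix u v w assume "u \<in> carrier N" "v \<in> carrier N" "w \<in> carrier N"
    then show "u \<oplus>\<^bsub>N\<^esub> v \<in> carrier N" "(u \<oplus>\<^bsub>N\<^esub> v) \<oplus>\<^bsub>N\<^esub> w = u \<oplus>\<^bsub>N\<^esub> (v \<oplus>\<^bsub>N\<^esub> w)"
      "u \<oplus>\<^bsub>N\<^esub> v = v \<oplus>\<^bsub>N\<^esub> u" "\<zero>\<^bsub>N\<^esub> \<oplus>\<^bsub>N\<^esub> u = u"
      by (auto simp: N_def M.add.m_assoc M.add.m_comm M.add.m_lcomm)
    from \<open>u \<in> carrier N\<close> obtain x where x: "x \<in> carrier M" "u = g x" by (auto simp: N_def)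
    then show "\<exists>v\<in>carrier N. v \<oplus>\<^bsub>N\<^esub> u = \<zero>\<^bsub>N\<^esub>"
      by (intro bexI[of _ "g (\<ominus>\<^bsub>M\<^esub> x)"]) (auto simp: N_def M.l_neg)
  qed (simp add: N_def)
  have mod: "left_module R N"
    by (intro left_module.intro left_module_axioms.intro R.ring_axioms grp)
      (auto simp: N_def smult_closed smult_l_distr smult_r_distr smult_assoc smult_one)
  have hom: "restrict g (carrier M) \<in> mod_hom R M N"
    by (auto simp: mod_hom_def N_def smult_closed)
  have bij: "bij_betw (restrict g (carrier M)) (carrier M) (carrier N)"
    using g by (auto simp: bij_betw_def N_def)
  obtain S where S: "finite S" "S \<subseteq> carrier M" "mspan R M S = carrier M"
    using fg by (auto simp: fg_module_def)
  have cN: "carrier N = g ` carrier M" by (simp add: N_def)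
  have "carrier M \<subseteq> {x \<in> carrier M. g x \<in> H}" if H: "submodule H R N" "g ` S \<subseteq> H" for H
  proof -
    interpret H: submodule H R N by (rule H)
    have "submodule {x \<in> carrier M. g x \<in> H} R M"
    proof (rule lsubmoduleI)
      show "\<zero>\<^bsub>M\<^esub> \<in> {x \<in> carrier M. g x \<in> H}" using H.one_closed by (simp add: N_def)
      fix x y assume "x \<in> {x \<in> carrier M. g x \<in> H}" "y \<in> {x \<in> carrier M. g x \<in> H}"
      then show "x \<oplus>\<^bsub>M\<^esub> y \<in> {x \<in> carrier M. g x \<in> H}"
        using H.m_closed[of "g x" "g y"] by (simp add: N_def)
    next
      fix a x assume "a \<in> carrier R" "x \<in> {x \<in> carrier M. g x \<in> H}"
      then show "a \<odot>\<^bsub>M\<^esub> x \<in> {x \<in> carrier M. g x \<in> H}"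
        using H.smult_closed[of a "g x"] smult_closed by (simp add: N_def)
    qed auto
    then have "mspan R M S \<subseteq> {x \<in> carrier M. g x \<in> H}"
      using H(2) S(2) unfolding mspan_def by (intro Inter_lower) auto
    then show ?thesis using S(3) by simp
  qed
  then have "carrier N \<subseteq> mspan R N (g ` S)" by (auto simp: mspan_def cN)
  moreover have "submodule (carrier N) R N"
  proof -
    interpret N: left_module R N by (rule mod)
    show ?thesis
      by (intro submodule.intro submodule_axioms.intro N.add.subgroup_self) (auto intro: N.smult_closed)
  qed
  then have "mspan R N (g ` S) \<subseteq> carrier N"
    unfolding mspan_def by (rule Inter_lower[OF CollectI, OF conjI]) (use S(2) cN in auto)
  ultimately have "fg_module R N"
    using S mod unfolding fg_module_def by (intro conjI exI[of _ "g ` S"]) (auto simp: cN)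
  then show ?thesis using hom bij unfolding mod_iso_def by blast
qed

lemma fg_module_representable:
  assumes "fg_module R M"
  shows "\<exists>N :: 'a umodule. fg_module R N \<and> mod_iso R M N"
proof -
  obtain S where S: "finite S" "S \<subseteq> carrier M" "mspan R M S = carrier M"
    using assms by (auto simp: fg_module_def)
  obtain m s where s: "S = s ` {i::nat. i < m}"
    using S(1) finite_imp_nat_seg_image_inj_on by blast
  have sc: "s i \<in> carrier M" if "i < m" for i using that S(2) s by auto
  let ?C = "UNIV \<rightarrow> carrier R :: (nat \<Rightarrow> 'a) set"
  have cR: "c j \<in> carrier R" if "c \<in> ?C" for c j using that by auto
  have cs: "c j \<odot>\<^bsub>M\<^esub> s j \<in> carrier M" if "c \<in> ?C" "j < m" for c j
    using that sc smult_closed by (simp add: cR)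
  have lc: "lincomb c s j \<in> carrier M" if "c \<in> ?C" "j \<le> m" for c j
    using that(2) by (induction j) (use that(1) cs in auto)
  have ladd: "lincomb (\<lambda>i. c i \<oplus>\<^bsub>R\<^esub> d i) s j = lincomb c s j \<oplus>\<^bsub>M\<^esub> lincomb d s j"
    if "c \<in> ?C" "d \<in> ?C" "j \<le> m" for c d j
    using that(3)
  proof (induction j)
    case (Suc j)
    have "lincomb c s j \<in> carrier M" "lincomb d s j \<in> carrier M" "c j \<in> carrier R" "d j \<in> carrier R"
      "c j \<odot>\<^bsub>M\<^esub> s j \<in> carrier M" "d j \<odot>\<^bsub>M\<^esub> s j \<in> carrier M" "s j \<in> carrier M"
      using Suc.prems that(1,2) lc[of c j] lc[of d j] cs[of c j] cs[of d j] sc[of j] by auto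
    then show ?case using Suc by (simp add: smult_l_distr M.add.m_ac)
  qed auto
  have lsm: "lincomb (\<lambda>i. a \<otimes>\<^bsub>R\<^esub> c i) s j = a \<odot>\<^bsub>M\<^esub> lincomb c s j"
    if "a \<in> carrier R" "c \<in> ?C" "j \<le> m" for a c j
    using that(3)
  proof (induction j)
    case 0
    have z: "a \<odot>\<^bsub>M\<^esub> \<zero>\<^bsub>M\<^esub> \<in> carrier M" using that(1) smult_closed by auto
    have "a \<odot>\<^bsub>M\<^esub> \<zero>\<^bsub>M\<^esub> \<oplus>\<^bsub>M\<^esub> a \<odot>\<^bsub>M\<^esub> \<zero>\<^bsub>M\<^esub> = a \<odot>\<^bsub>M\<^esub> \<zero>\<^bsub>M\<^esub>"
      using smult_r_distr[of a "\<zero>\<^bsub>M\<^esub>" "\<zero>\<^bsub>M\<^esub>"] that(1) by simp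
    then show ?case using z M.add.r_cancel_one'[OF z z] by simp
  next
    case (Suc j)
    have "lincomb c s j \<in> carrier M" "c j \<in> carrier R"
      "c j \<odot>\<^bsub>M\<^esub> s j \<in> carrier M" "s j \<in> carrier M"
      using Suc.prems that(1,2) lc[of c j] cs[of c j] sc[of j] by auto
    then show ?case using Suc that by (simp add: smult_r_distr smult_assoc)
  qed
  have inH: "lincomb c s m \<in> (\<lambda>c. lincomb c s m) ` ?C" if "c \<in> ?C" for c
    using that by (rule imageI)
  have "submodule ((\<lambda>c. lincomb c s m) ` ?C) R M" (is "submodule ?H R M")
  proof (rule lsubmoduleI)
    show "?H \<subseteq> carrier M" using lc by auto
    have "lincomb (\<lambda>_. \<zero>\<^bsub>R\<^esub>) s m = \<zero>\<^bsub>R\<^esub> \<odot>\<^bsub>M\<^esub> lincomb (\<lambda>_. \<zero>\<^bsub>R\<^esub>) s m"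
      using lsm[of "\<zero>\<^bsub>R\<^esub>" "\<lambda>_. \<zero>\<^bsub>R\<^esub>" m] by simp
    then have "lincomb (\<lambda>_. \<zero>\<^bsub>R\<^esub>) s m = \<zero>\<^bsub>M\<^esub>" using lc[of "\<lambda>_. \<zero>\<^bsub>R\<^esub>" m] by (auto simp: zero_smult)
    then show "\<zero>\<^bsub>M\<^esub> \<in> ?H" using inH[of "\<lambda>_. \<zero>\<^bsub>R\<^esub>"] by auto
    fix x y assume "x \<in> ?H" "y \<in> ?H"
    then obtain c d where c: "c \<in> ?C" "x = lincomb c s m" and d: "d \<in> ?C" "y = lincomb d s m"
      by blast
    show "x \<oplus>\<^bsub>M\<^esub> y \<in> ?H"
      using c d ladd[of c d m] inH[of "\<lambda>i. c i \<oplus>\<^bsub>R\<^esub> d i"] by (simp add: Pi_iff)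
    fix a assume "a \<in> carrier R"
    then show "a \<odot>\<^bsub>M\<^esub> x \<in> ?H"
      using c lsm[of a c m] inH[of "\<lambda>i. a \<otimes>\<^bsub>R\<^esub> c i"] by (simp add: Pi_iff)
  qed
  moreover have "S \<subseteq> ?H"
  proof
    have unit: "lincomb (\<lambda>j. if j = i then \<one>\<^bsub>R\<^esub> else \<zero>\<^bsub>R\<^esub>) s j = (if i < j then s i else \<zero>\<^bsub>M\<^esub>)"
      if "j \<le> m" for i j
      using that by (induction j) (auto simp: sc smult_one zero_smult less_Suc_eq)
    fix x assume "x \<in> S"
    then obtain i where i: "i < m" "x = s i" using s by auto
    then have "x = lincomb (\<lambda>j. if j = i then \<one>\<^bsub>R\<^esub> else \<zero>\<^bsub>R\<^esub>) s m"
      using unit[of m i] by simp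
    then show "x \<in> ?H" by auto
  qed
  ultimately have H: "carrier M \<subseteq> ?H" using S(3) by (auto simp: mspan_def)
  have "inj_on (\<lambda>x. {c \<in> ?C. lincomb c s m = x}) (carrier M)"
  proof (rule inj_onI)
    fix x y assume x: "x \<in> carrier M"
      and e: "{c \<in> ?C. lincomb c s m = x} = {c \<in> ?C. lincomb c s m = y}"
    obtain c where "c \<in> ?C" "x = lincomb c s m" using H x by auto
    with e show "x = y" by blast
  qed
  from fg_module_transport[OF assms this] show ?thesis by blast
qed

end

definition projective :: "('a, 'e) ring_scheme \<Rightarrow> ('a, 'v) module \<Rightarrow> bool" where
  "projective R P \<longleftrightarrow>
     (\<forall>(M :: 'a umodule) (N :: 'a umodule). fg_module R M \<longrightarrow> fg_module R N \<longrightarrow>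
        (\<forall>f\<in>mod_hom R M N. \<forall>g\<in>mod_hom R P N. f ` carrier M = carrier N \<longrightarrow>
           (\<exists>h\<in>mod_hom R P M. compose (carrier P) f h = g)))"

definition injective :: "('a, 'e) ring_scheme \<Rightarrow> ('a, 'v) module \<Rightarrow> bool" where
  "injective R Q \<longleftrightarrow>
     (\<forall>(M :: 'a umodule) (N :: 'a umodule). fg_module R M \<longrightarrow> fg_module R N \<longrightarrow>
        (\<forall>f\<in>mod_hom R M N. \<forall>g\<in>mod_hom R M Q. inj_on f (carrier M) \<longrightarrow>
           (\<exists>h\<in>mod_hom R N Q. compose (carrier M) h f = g)))"

definition injective_hull ::
    "('a, 'e) ring_scheme \<Rightarrow> ('a, 'v) module \<Rightarrow> ('a, 'w) module \<Rightarrow> bool" where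
  "injective_hull R S Q \<longleftrightarrow> fg_module R Q \<and> injective R Q \<and>
     (\<exists>f\<in>mod_hom R S Q. inj_on f (carrier S) \<and>
        (\<forall>N. submodule N R Q \<longrightarrow> N \<inter> f ` carrier S = {\<zero>\<^bsub>Q\<^esub>} \<longrightarrow> N = {\<zero>\<^bsub>Q\<^esub>}))"

definition complete_proj_list ::
    "('a, 'e) ring_scheme \<Rightarrow> nat \<Rightarrow> (nat \<Rightarrow> ('a, 'v) module) \<Rightarrow> bool" where
  "complete_proj_list R n P \<longleftrightarrow>
     (\<forall>i\<in>{1..n}. fg_module R (P i) \<and> projective R (P i) \<and> indecomposable R (P i)) \<and>
     (\<forall>i\<in>{1..n}. \<forall>j\<in>{1..n}. mod_iso R (P i) (P j) \<longrightarrow> i = j) \<and>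
     (\<forall>N :: 'a umodule. fg_module R N \<longrightarrow> projective R N \<longrightarrow> indecomposable R N \<longrightarrow>
        (\<exists>i\<in>{1..n}. mod_iso R N (P i)))"


subsection \<open>Filtrations\<close>

definition filtration ::
    "('a, 'e) ring_scheme \<Rightarrow> ('a, 'v) module \<Rightarrow> nat \<Rightarrow> (nat \<Rightarrow> 'v set) \<Rightarrow> bool" where
  "filtration R M m F \<longleftrightarrow> F 0 = {\<zero>\<^bsub>M\<^esub>} \<and> F m = carrier M \<and>
     (\<forall>i\<le>m. submodule (F i) R M) \<and> (\<forall>i<m. F i \<subseteq> F (Suc i))"

definition filtered_by ::
    "('a, 'e) ring_scheme \<Rightarrow> ('i \<Rightarrow> ('a, 'w) module) \<Rightarrow> 'i set \<Rightarrow> ('a, 'v) module \<Rightarrow> bool" where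
  "filtered_by R X J M \<longleftrightarrow> (\<exists>m F. filtration R M m F \<and>
     (\<forall>i<m. \<exists>j\<in>J. mod_iso R (subquot M (F (Suc i)) (F i)) (X j)))"

definition composition_series ::
    "('a, 'e) ring_scheme \<Rightarrow> ('a, 'v) module \<Rightarrow> nat \<Rightarrow> (nat \<Rightarrow> 'v set) \<Rightarrow> bool" where
  "composition_series R M m F \<longleftrightarrow> filtration R M m F \<and>
     (\<forall>i<m. simple_module R (subquot M (F (Suc i)) (F i)))"

text \<open>The module has finite length and all its composition factors are among the modules \<open>L j\<close>, \<open>j \<in> J\<close>.
  By Jordan--Hoelder it does not matter which composition series is used.\<close>

definition composition_factors_among ::
    "('a, 'e) ring_scheme \<Rightarrow> ('i \<Rightarrow> ('a, 'w) module) \<Rightarrow> 'i set \<Rightarrow> ('a, 'v) module \<Rightarrow> bool" where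
  "composition_factors_among R L J M \<longleftrightarrow> (\<exists>m F. composition_series R M m F \<and>
     (\<forall>i<m. \<exists>j\<in>J. mod_iso R (subquot M (F (Suc i)) (F i)) (L j)))"


section \<open>Artin algebras\<close>

definition artinian_cring :: "('k, 'e) ring_scheme \<Rightarrow> bool" where
  "artinian_cring K \<longleftrightarrow> cring K \<and>
     (\<forall>I :: nat \<Rightarrow> 'k set. (\<forall>i. ideal (I i) K \<and> I (Suc i) \<subseteq> I i) \<longrightarrow> (\<exists>m. \<forall>i\<ge>m. I i = I m))"

definition restrict_scalars :: "('k \<Rightarrow> 'a) \<Rightarrow> ('a, 'v) module \<Rightarrow> ('k, 'v) module" where
  "restrict_scalars \<phi> M = \<lparr>carrier = carrier M, mult = mult M, one = one M, zero = zero M,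
     add = add M, smult = (\<lambda>c. smult M (\<phi> c))\<rparr>"

definition artin_algebra ::
    "('k, 'e) ring_scheme \<Rightarrow> ('a, 'f) ring_scheme \<Rightarrow> ('k \<Rightarrow> 'a) \<Rightarrow> bool" where
  "artin_algebra K A \<phi> \<longleftrightarrow> artinian_cring K \<and> ring A \<and> \<phi> \<in> ring_hom K A \<and>
     (\<forall>c\<in>carrier K. \<forall>a\<in>carrier A. \<phi> c \<otimes>\<^bsub>A\<^esub> a = a \<otimes>\<^bsub>A\<^esub> \<phi> c) \<and>
     fg_module K (restrict_scalars \<phi> (regular_module A))"


section \<open>Standard, costandard and tilting modules\<close>

text \<open>Throughout, \<open>P\<close> is the family of indecomposable projective \<open>R\<close>-modules labelled by the finite
  poset \<open>(\<Phi>, leq)\<close>, \<open>L\<close> is the family of their tops, and \<open>Q\<close> is a family of injective hulls of the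
  simple modules \<open>L i\<close>. The largest quotient with a given property is the quotient by the least
  submodule with a quotient of that kind.\<close>

definition standard_module :: "('a, 'e) ring_scheme \<Rightarrow> 'i set \<Rightarrow> ('i \<Rightarrow> 'i \<Rightarrow> bool) \<Rightarrow>
    ('i \<Rightarrow> ('a, 'v) module) \<Rightarrow> 'i \<Rightarrow> ('a, 'v set) module" where
  "standard_module R \<Phi> leq P i = quot_module (P i)
     (LEAST N. submodule N R (P i) \<and>
        composition_factors_among R (\<lambda>j. mtop R (P j)) {j\<in>\<Phi>. leq j i} (quot_module (P i) N))"

definition costandard_module :: "('a, 'e) ring_scheme \<Rightarrow> 'i set \<Rightarrow> ('i \<Rightarrow> 'i \<Rightarrow> bool) \<Rightarrow>
    ('i \<Rightarrow> ('a, 'l) module) \<Rightarrow> ('i \<Rightarrow> ('a, 'w) module) \<Rightarrow> 'i \<Rightarrow> ('a, 'w) module" where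
  "costandard_module R \<Phi> leq L Q i = msub (Q i)
     (GREATEST N. submodule N R (Q i) \<and>
        composition_factors_among R L {j\<in>\<Phi>. leq j i} (msub (Q i) N))"

text \<open>\<open>T\<close> is the tilting module with label \<open>i\<close>.\<close>

definition tilting_module :: "('a, 'e) ring_scheme \<Rightarrow> 'i set \<Rightarrow> ('i \<Rightarrow> 'i \<Rightarrow> bool) \<Rightarrow>
    ('i \<Rightarrow> ('a, 'v) module) \<Rightarrow> ('i \<Rightarrow> ('a, 'w) module) \<Rightarrow> 'i \<Rightarrow> ('a, 't) module \<Rightarrow> bool" where
  "tilting_module R \<Phi> leq P Q i T \<longleftrightarrow> fg_module R T \<and> indecomposable R T \<and>
     filtered_by R (standard_module R \<Phi> leq P) \<Phi> T \<and>
     filtered_by R (costandard_module R \<Phi> leq (\<lambda>j. mtop R (P j)) Q) \<Phi> T \<and>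
     (\<exists>f\<in>mod_hom R (standard_module R \<Phi> leq P i) T.
        inj_on f (carrier (standard_module R \<Phi> leq P i)) \<and>
        filtered_by R (standard_module R \<Phi> leq P) {j\<in>\<Phi>. leq j i \<and> j \<noteq> i}
          (quot_module T (f ` carrier (standard_module R \<Phi> leq P i))))"

definition trace_of :: "('a, 'e) ring_scheme \<Rightarrow> ('i \<Rightarrow> ('a, 'w) module) \<Rightarrow> 'i set \<Rightarrow>
    ('a, 'v) module \<Rightarrow> 'v set" where
  "trace_of R D J M = mspan R M (\<Union>j\<in>J. \<Union>f\<in>mod_hom R (D j) M. f ` carrier (D j))"

primrec delta_series :: "('a, 'e) ring_scheme \<Rightarrow> ('i \<Rightarrow> ('a, 'w) module) \<Rightarrow> 'i set \<Rightarrow>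
    ('a, 'v) module \<Rightarrow> nat \<Rightarrow> 'v set" where
  "delta_series R D J M 0 = {\<zero>\<^bsub>M\<^esub>}"
| "delta_series R D J M (Suc i) = {x \<in> carrier M.
     delta_series R D J M i +>\<^bsub>M\<^esub> x \<in> trace_of R D J (quot_module M (delta_series R D J M i))}"

definition delta_ssl :: "('a, 'e) ring_scheme \<Rightarrow> ('i \<Rightarrow> ('a, 'w) module) \<Rightarrow> 'i set \<Rightarrow>
    ('a, 'v) module \<Rightarrow> nat" where
  "delta_ssl R D J M = (LEAST m. delta_series R D J M m = carrier M)"


section \<open>The ADR algebra\<close>

definition opposite_ring :: "('a, 'e) ring_scheme \<Rightarrow> 'a ring" where
  "opposite_ring R = \<lparr>carrier = carrier R, mult = (\<lambda>a b. b \<otimes>\<^bsub>R\<^esub> a), one = one R,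
     zero = zero R, add = add R\<rparr>"

definition end_ring :: "('a, 'e) ring_scheme \<Rightarrow> ('a, 'v) module \<Rightarrow> ('v \<Rightarrow> 'v) ring" where
  "end_ring A G = \<lparr>carrier = mod_hom A G G, mult = compose (carrier G), one = (\<lambda>x\<in>carrier G. x),
     zero = (\<lambda>x\<in>carrier G. \<zero>\<^bsub>G\<^esub>), add = (\<lambda>f g. \<lambda>x\<in>carrier G. f x \<oplus>\<^bsub>G\<^esub> g x)\<rparr>"

text \<open>\<open>Hom(G, X)\<close> as a left module over \<open>opposite_ring (end_ring A G)\<close>, acting by precomposition.\<close>

definition hom_module :: "('a, 'e) ring_scheme \<Rightarrow> ('a, 'v) module \<Rightarrow> ('a, 'w) module \<Rightarrow>
    ('v \<Rightarrow> 'v, 'v \<Rightarrow> 'w) module" where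
  "hom_module A G X = \<lparr>carrier = mod_hom A G X, mult = undefined, one = undefined,
     zero = (\<lambda>x\<in>carrier G. \<zero>\<^bsub>X\<^esub>), add = (\<lambda>f g. \<lambda>x\<in>carrier G. f x \<oplus>\<^bsub>X\<^esub> g x),
     smult = (\<lambda>r f. compose (carrier G) f r)\<rparr>"

definition adr_labels ::
    "('a, 'e) ring_scheme \<Rightarrow> nat \<Rightarrow> (nat \<Rightarrow> ('a, 'v) module) \<Rightarrow> (nat \<times> nat) set" where
  "adr_labels A n P = {(i, j). i \<in> {1..n} \<and> j \<in> {1..loewy_length A (P i)}}"

definition adr_le :: "nat \<times> nat \<Rightarrow> nat \<times> nat \<Rightarrow> bool" where
  "adr_le p q \<longleftrightarrow> p = q \<or> snd p > snd q"

definition adr_summand :: "('a, 'e) ring_scheme \<Rightarrow> (nat \<Rightarrow> ('a, 'v) module) \<Rightarrow> nat \<times> nat \<Rightarrow>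
    ('a, 'v set) module" where
  "adr_summand A P = (\<lambda>(i, j). quot_module (P i) (rad_series A (P i) j))"

definition adr_generator :: "('a, 'e) ring_scheme \<Rightarrow> nat \<Rightarrow> (nat \<Rightarrow> ('a, 'v) module) \<Rightarrow>
    ('a, nat \<times> nat \<Rightarrow> 'v set) module" where
  "adr_generator A n P = dir_sum (adr_labels A n P) (adr_summand A P)"

type_synonym 'v adr = "(nat \<times> nat \<Rightarrow> 'v set) \<Rightarrow> (nat \<times> nat \<Rightarrow> 'v set)"

definition adr_algebra :: "('a, 'e) ring_scheme \<Rightarrow> nat \<Rightarrow> (nat \<Rightarrow> ('a, 'v) module) \<Rightarrow>
    'v adr ring" where
  "adr_algebra A n P = opposite_ring (end_ring A (adr_generator A n P))"

definition adr_proj :: "('a, 'e) ring_scheme \<Rightarrow> nat \<Rightarrow> (nat \<Rightarrow> ('a, 'v) module) \<Rightarrow>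
    nat \<times> nat \<Rightarrow> ('v adr, (nat \<times> nat \<Rightarrow> 'v set) \<Rightarrow> 'v set) module" where
  "adr_proj A n P p = hom_module A (adr_generator A n P) (adr_summand A P p)"

definition adr_simple :: "('a, 'e) ring_scheme \<Rightarrow> nat \<Rightarrow> (nat \<Rightarrow> ('a, 'v) module) \<Rightarrow>
    nat \<times> nat \<Rightarrow> ('v adr, ((nat \<times> nat \<Rightarrow> 'v set) \<Rightarrow> 'v set) set) module" where
  "adr_simple A n P p = mtop (adr_algebra A n P) (adr_proj A n P p)"

definition adr_standard :: "('a, 'e) ring_scheme \<Rightarrow> nat \<Rightarrow> (nat \<Rightarrow> ('a, 'v) module) \<Rightarrow>
    nat \<times> nat \<Rightarrow> ('v adr, ((nat \<times> nat \<Rightarrow> 'v set) \<Rightarrow> 'v set) set) module" where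
  "adr_standard A n P =
     standard_module (adr_algebra A n P) (adr_labels A n P) adr_le (adr_proj A n P)"

definition adr_tilting :: "('a, 'e) ring_scheme \<Rightarrow> nat \<Rightarrow> (nat \<Rightarrow> ('a, 'v) module) \<Rightarrow>
    (nat \<times> nat \<Rightarrow> ('v adr, 'w) module) \<Rightarrow> nat \<times> nat \<Rightarrow> ('v adr, 't) module \<Rightarrow> bool" where
  "adr_tilting A n P Q =
     tilting_module (adr_algebra A n P) (adr_labels A n P) adr_le (adr_proj A n P) Q"

definition adr_delta :: "('a, 'e) ring_scheme \<Rightarrow> nat \<Rightarrow> (nat \<Rightarrow> ('a, 'v) module) \<Rightarrow>
    ('v adr, 't) module \<Rightarrow> nat \<Rightarrow> 't set" where
  "adr_delta A n P = delta_series (adr_algebra A n P) (adr_standard A n P) (adr_labels A n P)"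

definition adr_delta_ssl :: "('a, 'e) ring_scheme \<Rightarrow> nat \<Rightarrow> (nat \<Rightarrow> ('a, 'v) module) \<Rightarrow>
    ('v adr, 't) module \<Rightarrow> nat" where
  "adr_delta_ssl A n P = delta_ssl (adr_algebra A n P) (adr_standard A n P) (adr_labels A n P)"

end

theory Submission
  imports Defs
begin

text \<open>Write \<open>H X = Hom(G, X)\<close>. The standard module with label \<open>(i, j)\<close> is the submodule of
  \<open>H (Top P\<^sub>i)\<close> of the maps that vanish on all summands \<open>P\<^sub>a / Rad\<^sup>b P\<^sub>a\<close> with \<open>b < j\<close>. The tilting module
  \<open>T(k, l)\<close> is realised as the submodule \<open>TT\<close> of \<open>H Q\<^sub>k\<close> of the maps that send \<open>P\<^sub>a / Rad\<^sup>b P\<^sub>a\<close> into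
  \<open>Soc\<^sub>b\<^sub>+\<^sub>1\<^sub>-\<^sub>l Q\<^sub>k\<close>; rigidity makes this a submodule. Lifting maps along the projectives shows that the maps in
  \<open>TT\<close> with values in \<open>Soc\<^sub>i Q\<^sub>k\<close> form a filtration whose \<open>i\<close>-th factor is the direct sum of the standard
  modules \<open>(x\<^sub>\<omega>, l + i - 1)\<close> for the composition factors \<open>x\<^sub>\<omega>\<close> of the \<open>i\<close>-th socle layer of \<open>Q\<^sub>k\<close>, and
  that it is the iterated trace of the standard modules.

  To identify \<open>TT\<close> with \<open>T(k, l)\<close>, note that both contain the standard module \<open>(k, l)\<close> with a cokernel filtered
  by standard modules and have no extensions by standard modules: for \<open>TT\<close> by injectivity of \<open>Q\<^sub>k\<close>, for \<open>T(k, l)\<close>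
  by its costandard filtration. Hence the inclusions extend to maps \<open>T(k, l) \<rightarrow> TT \<rightarrow> T(k, l)\<close>. The
  composite endomorphism of \<open>TT\<close> is the identity on the standard submodule; it is composition with an endomorphism of a
  submodule of \<open>Q\<^sub>k\<close> that fixes the simple socle, so it is bijective. Since \<open>T(k, l)\<close> is indecomposable, the two
  maps are isomorphisms.\<close>

section \<open>Modules and linear maps\<close>

text \<open>Since J^b kills P_a/Rad^b, every map from \<open>Gs (a, b)\<close> to Q_k has values in
  Soc_b. Hence for l = 1 the condition in \<open>TT\<close> is automatic and T(k, 1) is all of
  \<open>H Qk\<close>. For larger l the bound is lowered by l - 1, and the obstacle is that it has
  to survive precomposition with maps P_a/Rad^b -> P_c/Rad^d. For d > b such a map lands in Soc_b of
  its target, and the lowered bound is respected because this socle term equals Rad^(d-b). The same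
  equality shows that Hom(G, Rad(P_i/Rad^j)) is generated by its components at the labels (c, j -
  1). This makes it the least submodule in the definition of the standard module, and it is behind
  the vanishing of extensions of standard by costandard modules. Extension groups occur only as
  extendability of maps from \<open>K p\<close> to \<open>H (Gs p)\<close>, so each exact sequence
  argument becomes the construction of one map. Composition factors are detected by the idempotents
  \<open>e p\<close>, which turns order conditions on labels into equations. Maps between modules of
  homomorphisms are recognised as compositions by testing them on maps of the form p(g) x with p
  from G to A.\<close>

context left_module
begin

lemmas [simp] = smult_closed zero_smult smult_one

lemma smult_zero [simp]: "a \<odot>\<^bsub>M\<^esub> \<zero>\<^bsub>M\<^esub> = \<zero>\<^bsub>M\<^esub>" if "a \<in> carrier R"
proof -
  have "a \<odot>\<^bsub>M\<^esub> \<zero>\<^bsub>M\<^esub> = a \<odot>\<^bsub>M\<^esub> (\<zero>\<^bsub>R\<^esub> \<odot>\<^bsub>M\<^esub> \<zero>\<^bsub>M\<^esub>)" by simp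
  also have "\<dots> = (a \<otimes>\<^bsub>R\<^esub> \<zero>\<^bsub>R\<^esub>) \<odot>\<^bsub>M\<^esub> \<zero>\<^bsub>M\<^esub>" using that by (subst smult_assoc) auto
  finally show ?thesis using that by simp
qed

lemma smult_neg: "a \<odot>\<^bsub>M\<^esub> (\<ominus>\<^bsub>M\<^esub> x) = \<ominus>\<^bsub>M\<^esub> (a \<odot>\<^bsub>M\<^esub> x)" if "a \<in> carrier R" "x \<in> carrier M"
proof -
  have "a \<odot>\<^bsub>M\<^esub> (\<ominus>\<^bsub>M\<^esub> x) \<oplus>\<^bsub>M\<^esub> a \<odot>\<^bsub>M\<^esub> x = \<zero>\<^bsub>M\<^esub>"
    using that by (simp flip: smult_r_distr add: M.l_neg)
  then show ?thesis using that by (simp add: M.minus_equality)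
qed

lemma diff_zero_iff: "x \<ominus>\<^bsub>M\<^esub> y = \<zero>\<^bsub>M\<^esub> \<longleftrightarrow> x = y" if "x \<in> carrier M" "y \<in> carrier M"
  using that M.minus_equality[of x "\<ominus>\<^bsub>M\<^esub> y"] by (auto simp: a_minus_def M.r_neg)

lemma diff_zero [simp]: "x \<ominus>\<^bsub>M\<^esub> \<zero>\<^bsub>M\<^esub> = x" if "x \<in> carrier M"
  using that M.r_neg[of "\<zero>\<^bsub>M\<^esub>"] by (simp add: a_minus_def)

lemma submodule_carrier [simp]: "submodule (carrier M) R M"
  by (rule lsubmoduleI) auto

lemma submodule_zero [simp]: "submodule {\<zero>\<^bsub>M\<^esub>} R M"
  by (rule lsubmoduleI) auto

lemma submoduleD:
  assumes "submodule N R M"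
  shows "N \<subseteq> carrier M" "x \<in> N \<Longrightarrow> x \<in> carrier M" "\<zero>\<^bsub>M\<^esub> \<in> N"
    "x \<in> N \<Longrightarrow> y \<in> N \<Longrightarrow> x \<oplus>\<^bsub>M\<^esub> y \<in> N" "a \<in> carrier R \<Longrightarrow> x \<in> N \<Longrightarrow> a \<odot>\<^bsub>M\<^esub> x \<in> N"
    "x \<in> N \<Longrightarrow> \<ominus>\<^bsub>M\<^esub> x \<in> N" "x \<in> N \<Longrightarrow> y \<in> N \<Longrightarrow> x \<ominus>\<^bsub>M\<^esub> y \<in> N"
proof -
  interpret N: submodule N R M by fact
  show *: "N \<subseteq> carrier M" "x \<in> N \<Longrightarrow> x \<in> carrier M" "\<zero>\<^bsub>M\<^esub> \<in> N"
    "x \<in> N \<Longrightarrow> y \<in> N \<Longrightarrow> x \<oplus>\<^bsub>M\<^esub> y \<in> N" "a \<in> carrier R \<Longrightarrow> x \<in> N \<Longrightarrow> a \<odot>\<^bsub>M\<^esub> x \<in> N" for x y a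
    using N.subset N.one_closed N.m_closed by auto
  show neg: "x \<in> N \<Longrightarrow> \<ominus>\<^bsub>M\<^esub> x \<in> N" for x
    using N.m_inv_closed[of x] by (simp add: a_inv_def)
  show "x \<in> N \<Longrightarrow> y \<in> N \<Longrightarrow> x \<ominus>\<^bsub>M\<^esub> y \<in> N"
    using neg *(4) by (simp add: a_minus_def)
qed

lemma abelian_subgroup_submodule: "submodule N R M \<Longrightarrow> abelian_subgroup N M"
  by (intro abelian_subgroupI3 additive_subgroup.intro M.abelian_group_axioms)
    (auto simp: submodule_def)

lemma submodule_Int: "submodule N R M \<Longrightarrow> submodule N' R M \<Longrightarrow> submodule (N \<inter> N') R M"
  by (rule lsubmoduleI) (auto dest: submoduleD)

lemma submodule_Inter:
  assumes "\<N> \<noteq> {}" "\<And>N. N \<in> \<N> \<Longrightarrow> submodule N R M"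
  shows "submodule (\<Inter>\<N>) R M"
  by (rule lsubmoduleI) (use assms in \<open>auto dest: submoduleD\<close>)

text \<open>An elementwise form of \<open><+>\<close>, the sum in which
  \<open>indecomposable\<close> is phrased; \<open>ssum_eq\<close> translates.\<close>

definition ssum :: "'v set \<Rightarrow> 'v set \<Rightarrow> 'v set" where
  "ssum N N' = {x \<oplus>\<^bsub>M\<^esub> y | x y. x \<in> N \<and> y \<in> N'}"

lemma ssum_eq: "N <+>\<^bsub>M\<^esub> N' = ssum N N'"
  by (auto simp: ssum_def set_add_def')

lemma ssumI: "x \<in> N \<Longrightarrow> y \<in> N' \<Longrightarrow> x \<oplus>\<^bsub>M\<^esub> y \<in> ssum N N'"
  unfolding ssum_def by blast

lemma submodule_ssum:
  assumes N: "submodule N R M" and N': "submodule N' R M"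
  shows "submodule (ssum N N') R M"
proof (rule lsubmoduleI)
  note d = submoduleD[OF N] submoduleD[OF N']
  show "ssum N N' \<subseteq> carrier M" using d by (auto simp: ssum_def)
  show "\<zero>\<^bsub>M\<^esub> \<in> ssum N N'" using d(3,10) unfolding ssum_def
    by (intro CollectI exI[of _ "\<zero>\<^bsub>M\<^esub>"]) auto
  fix u v assume "u \<in> ssum N N'" "v \<in> ssum N N'"
  then obtain a b c e where *: "u = a \<oplus>\<^bsub>M\<^esub> b" "v = c \<oplus>\<^bsub>M\<^esub> e" "a \<in> N" "c \<in> N" "b \<in> N'" "e \<in> N'"
    by (auto simp: ssum_def)
  then have "a \<in> carrier M" "b \<in> carrier M" "c \<in> carrier M" "e \<in> carrier M" using d by auto
  then have "u \<oplus>\<^bsub>M\<^esub> v = (a \<oplus>\<^bsub>M\<^esub> c) \<oplus>\<^bsub>M\<^esub> (b \<oplus>\<^bsub>M\<^esub> e)" by (simp add: * M.add.m_ac)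
  moreover have "a \<oplus>\<^bsub>M\<^esub> c \<in> N" "b \<oplus>\<^bsub>M\<^esub> e \<in> N'"
    using * submoduleD(4)[OF N] submoduleD(4)[OF N'] by auto
  ultimately show "u \<oplus>\<^bsub>M\<^esub> v \<in> ssum N N'" by (simp add: ssumI)
next
  fix a u assume a: "a \<in> carrier R" and "u \<in> ssum N N'"
  then obtain x y where *: "u = x \<oplus>\<^bsub>M\<^esub> y" "x \<in> N" "y \<in> N'" by (auto simp: ssum_def)
  then have "a \<odot>\<^bsub>M\<^esub> u = a \<odot>\<^bsub>M\<^esub> x \<oplus>\<^bsub>M\<^esub> a \<odot>\<^bsub>M\<^esub> y"
    using a submoduleD(2)[OF N] submoduleD(2)[OF N'] by (simp add: smult_r_distr)
  then show "a \<odot>\<^bsub>M\<^esub> u \<in> ssum N N'" 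
    using * submoduleD(5)[OF N a] submoduleD(5)[OF N' a] by (simp add: ssumI)
qed

lemma ssum_upper:
  assumes N: "submodule N R M" and N': "submodule N' R M"
  shows "N \<subseteq> ssum N N'" "N' \<subseteq> ssum N N'"
proof -
  note d = submoduleD[OF N] submoduleD[OF N']
  show "N \<subseteq> ssum N N'"
  proof
    fix x assume "x \<in> N"
    then have "x = x \<oplus>\<^bsub>M\<^esub> \<zero>\<^bsub>M\<^esub>" "\<zero>\<^bsub>M\<^esub> \<in> N'" using d by auto
    then show "x \<in> ssum N N'" using \<open>x \<in> N\<close> unfolding ssum_def by blast
  qed
  show "N' \<subseteq> ssum N N'"
  proof
    fix x assume "x \<in> N'"
    then have "x = \<zero>\<^bsub>M\<^esub> \<oplus>\<^bsub>M\<^esub> x" "\<zero>\<^bsub>M\<^esub> \<in> N" using d by auto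
    then show "x \<in> ssum N N'" using \<open>x \<in> N'\<close> unfolding ssum_def by blast
  qed
qed

lemma ssum_least: "submodule H R M \<Longrightarrow> N \<subseteq> H \<Longrightarrow> N' \<subseteq> H \<Longrightarrow> ssum N N' \<subseteq> H"
  by (auto simp: ssum_def dest: submoduleD)

lemma ssum_comm:
  assumes N: "submodule N R M" and N': "submodule N' R M"
  shows "ssum N N' = ssum N' N"
proof -
  have "ssum X Y \<subseteq> ssum Y X" if X: "submodule X R M" and Y: "submodule Y R M" for X Y
  proof
    fix z assume "z \<in> ssum X Y"
    then obtain x y where xy: "x \<in> X" "y \<in> Y" "z = x \<oplus>\<^bsub>M\<^esub> y" by (auto simp: ssum_def)
    then have "z = y \<oplus>\<^bsub>M\<^esub> x" using submoduleD(2)[OF X xy(1)] submoduleD(2)[OF Y xy(2)] by (simp add: M.a_comm)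
    then show "z \<in> ssum Y X" using ssumI xy by simp
  qed
  then show ?thesis using assms by blast
qed

lemma mspan_submodule:
  assumes "S \<subseteq> carrier M"
  shows "submodule (mspan R M S) R M"
  unfolding mspan_def by (rule submodule_Inter) (use assms submodule_carrier in blast)+

lemma mspan_upper: "S \<subseteq> mspan R M S"
  by (auto simp: mspan_def)

lemma mspan_least: "submodule N R M \<Longrightarrow> S \<subseteq> N \<Longrightarrow> mspan R M S \<subseteq> N"
  by (auto simp: mspan_def)

lemma msub_simps [simp]: "carrier (msub M N) = N" "\<zero>\<^bsub>msub M N\<^esub> = \<zero>\<^bsub>M\<^esub>" "add (msub M N) = add M"
    "smult (msub M N) = smult M" "msub (msub M N) N' = msub M N'"
  by (auto simp: msub_def)

lemma left_module_msub:
  assumes N: "submodule N R M"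
  shows "left_module R (msub M N)"
proof -
  note d = submoduleD[OF N]
  have "abelian_group (msub M N)"
  proof (rule abelian_groupI)
    fix x y z assume xyz: "x \<in> carrier (msub M N)" "y \<in> carrier (msub M N)" "z \<in> carrier (msub M N)"
    then show "x \<oplus>\<^bsub>msub M N\<^esub> y \<in> carrier (msub M N)" using d by simp
    have "x \<in> carrier M" "y \<in> carrier M" "z \<in> carrier M" using xyz d by auto
    then show "x \<oplus>\<^bsub>msub M N\<^esub> y \<oplus>\<^bsub>msub M N\<^esub> z = x \<oplus>\<^bsub>msub M N\<^esub> (y \<oplus>\<^bsub>msub M N\<^esub> z)"
      "x \<oplus>\<^bsub>msub M N\<^esub> y = y \<oplus>\<^bsub>msub M N\<^esub> x" "\<zero>\<^bsub>msub M N\<^esub> \<oplus>\<^bsub>msub M N\<^esub> x = x"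
      by (simp add: M.a_assoc, simp add: M.a_comm, simp)
    show "\<exists>y\<in>carrier (msub M N). y \<oplus>\<^bsub>msub M N\<^esub> x = \<zero>\<^bsub>msub M N\<^esub>"
      using xyz d by (intro bexI[of _ "\<ominus>\<^bsub>M\<^esub> x"]) (auto simp: M.l_neg)
  qed (use d in simp)
  then show ?thesis
    by (intro left_module.intro left_module_axioms.intro R.ring_axioms)
      (use d in \<open>auto simp: smult_l_distr smult_r_distr smult_assoc\<close>)
qed

lemma submodule_msub:
  assumes N: "submodule N R M"
  shows "submodule H R (msub M N) \<longleftrightarrow> submodule H R M \<and> H \<subseteq> N"
proof -
  interpret N: left_module R "msub M N" by (rule left_module_msub[OF N])
  show ?thesis
  proof
    assume H: "submodule H R (msub M N)"
    note d = N.submoduleD[OF H, simplified]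
    show "submodule H R M \<and> H \<subseteq> N"
      using d submoduleD[OF N] by (intro conjI lsubmoduleI) auto
  next
    assume H: "submodule H R M \<and> H \<subseteq> N"
    then show "submodule H R (msub M N)"
      by (intro N.lsubmoduleI) (auto dest: submoduleD)
  qed
qed

lemma submoduleI_msub: "submodule N R M \<Longrightarrow> submodule H R M \<Longrightarrow> H \<subseteq> N \<Longrightarrow> submodule H R (msub M N)"
  by (simp add: submodule_msub)

end

text \<open>Homomorphisms as bare functions, constrained only on the carrier. Without the
  extensionality that \<open>mod_hom\<close> demands, composites, sums and restrictions are plain
  lambda terms; \<open>mod_hom_iff\<close> and \<open>restrict_mod_hom\<close> convert where a
  definition asks for \<open>mod_hom\<close>.\<close>

locale lmap = dom: left_module R M + cod: left_module R N
  for R :: "('a, 'e) ring_scheme" and M :: "('a, 'v) module" and N :: "('a, 'w) module" +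
  fixes f :: "'v \<Rightarrow> 'w"
  assumes closed [simp]: "x \<in> carrier M \<Longrightarrow> f x \<in> carrier N"
    and add: "x \<in> carrier M \<Longrightarrow> y \<in> carrier M \<Longrightarrow> f (x \<oplus>\<^bsub>M\<^esub> y) = f x \<oplus>\<^bsub>N\<^esub> f y"
    and smult: "a \<in> carrier R \<Longrightarrow> x \<in> carrier M \<Longrightarrow> f (a \<odot>\<^bsub>M\<^esub> x) = a \<odot>\<^bsub>N\<^esub> f x"
begin

lemma zero [simp]: "f \<zero>\<^bsub>M\<^esub> = \<zero>\<^bsub>N\<^esub>"
  using smult[of "\<zero>\<^bsub>R\<^esub>" "\<zero>\<^bsub>M\<^esub>"] by simp

lemma neg: "x \<in> carrier M \<Longrightarrow> f (\<ominus>\<^bsub>M\<^esub> x) = \<ominus>\<^bsub>N\<^esub> f x"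
  using add[of "\<ominus>\<^bsub>M\<^esub> x" x] by (simp add: dom.M.l_neg cod.M.minus_equality)

lemma diff: "x \<in> carrier M \<Longrightarrow> y \<in> carrier M \<Longrightarrow> f (x \<ominus>\<^bsub>M\<^esub> y) = f x \<ominus>\<^bsub>N\<^esub> f y"
  by (simp add: a_minus_def add neg)

lemma vimage_submodule: "submodule H R N \<Longrightarrow> submodule {x \<in> carrier M. f x \<in> H} R M"
  by (rule dom.lsubmoduleI) (auto simp: add smult dest: cod.submoduleD)

definition ker :: "'v set" where "ker = {x \<in> carrier M. f x = \<zero>\<^bsub>N\<^esub>}"

lemma ker_submodule: "submodule ker R M"
  using vimage_submodule[OF cod.submodule_zero] by (simp add: ker_def)

lemma image_submodule:
  assumes H: "submodule H R M"
  shows "submodule (f ` H) R N"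
proof -
  note d = dom.submoduleD[OF H]
  show ?thesis
  proof (rule cod.lsubmoduleI)
    show "\<zero>\<^bsub>N\<^esub> \<in> f ` H" using d(3) by (metis zero imageI)
    fix x y assume "x \<in> f ` H" "y \<in> f ` H"
    then obtain u v where "u \<in> H" "v \<in> H" "x = f u" "y = f v" by auto
    then show "x \<oplus>\<^bsub>N\<^esub> y \<in> f ` H" using d by (auto intro!: image_eqI[of _ f "u \<oplus>\<^bsub>M\<^esub> v"] simp: add)
  next
    fix a x assume a: "a \<in> carrier R" and "x \<in> f ` H"
    then obtain u where "u \<in> H" "x = f u" by auto
    then show "a \<odot>\<^bsub>N\<^esub> x \<in> f ` H" using d a by (auto intro!: image_eqI[of _ f "a \<odot>\<^bsub>M\<^esub> u"] simp: smult)
  qed (use d in auto)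
qed

lemma eq_iff_diff_ker: "x \<in> carrier M \<Longrightarrow> y \<in> carrier M \<Longrightarrow> f x = f y \<longleftrightarrow> x \<ominus>\<^bsub>M\<^esub> y \<in> ker"
  by (simp add: ker_def diff cod.diff_zero_iff)

lemma inj_iff_ker: "inj_on f (carrier M) \<longleftrightarrow> ker = {\<zero>\<^bsub>M\<^esub>}"
proof
  assume "inj_on f (carrier M)"
  then have "x = \<zero>\<^bsub>M\<^esub>" if "x \<in> carrier M" "f x = \<zero>\<^bsub>N\<^esub>" for x
    using that by (auto dest: inj_onD[of f _ x "\<zero>\<^bsub>M\<^esub>"])
  then show "ker = {\<zero>\<^bsub>M\<^esub>}" by (auto simp: ker_def)
next
  assume k: "ker = {\<zero>\<^bsub>M\<^esub>}"
  show "inj_on f (carrier M)"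
    by (rule inj_onI) (use k eq_iff_diff_ker in \<open>auto simp: dom.diff_zero_iff\<close>)
qed

lemma lmap_axioms': "lmap R M N f" ..

end

lemma lmapI:
  assumes "left_module R M" "left_module R N" "\<And>x. x \<in> carrier M \<Longrightarrow> f x \<in> carrier N"
    "\<And>x y. x \<in> carrier M \<Longrightarrow> y \<in> carrier M \<Longrightarrow> f (x \<oplus>\<^bsub>M\<^esub> y) = f x \<oplus>\<^bsub>N\<^esub> f y"
    "\<And>a x. a \<in> carrier R \<Longrightarrow> x \<in> carrier M \<Longrightarrow> f (a \<odot>\<^bsub>M\<^esub> x) = a \<odot>\<^bsub>N\<^esub> f x"
  shows "lmap R M N f"
  using assms by (simp add: lmap_def lmap_axioms_def)

lemma lmapD:
  assumes "lmap R M N f"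
  shows "left_module R M" "left_module R N"
proof -
  interpret lmap R M N f by fact
  show "left_module R M" "left_module R N" by unfold_locales
qed

lemma lmap_cong: "(\<And>x. x \<in> carrier M \<Longrightarrow> f x = g x) \<Longrightarrow> lmap R M N f \<longleftrightarrow> lmap R M N g"
proof -
  have *: "lmap R M N g" if f: "lmap R M N f" and eq: "\<And>x. x \<in> carrier M \<Longrightarrow> f x = g x" for f g
  proof -
    interpret lmap R M N f by (rule f)
    show ?thesis
      by (rule lmapI[OF lmapD[OF f]]) (auto simp flip: eq simp: add smult)
  qed
  show "(\<And>x. x \<in> carrier M \<Longrightarrow> f x = g x) \<Longrightarrow> lmap R M N f \<longleftrightarrow> lmap R M N g"
    using *[of f g] *[of g f] by auto
qed

lemma mod_hom_iff:
  assumes "left_module R M" "left_module R N"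
  shows "f \<in> mod_hom R M N \<longleftrightarrow> lmap R M N f \<and> f \<in> extensional (carrier M)"
  using assms by (auto simp: mod_hom_def lmap_def lmap_axioms_def PiE_def)

lemma mod_hom_lmap: "f \<in> mod_hom R M N \<Longrightarrow> left_module R M \<Longrightarrow> left_module R N \<Longrightarrow> lmap R M N f"
  by (simp add: mod_hom_iff)

lemma restrict_mod_hom: "lmap R M N f \<Longrightarrow> restrict f (carrier M) \<in> mod_hom R M N"
  by (subst mod_hom_iff) (auto dest: lmapD simp: lmap_cong[of M "restrict f (carrier M)" f])

lemma lmap_comp:
  assumes f: "lmap R M N f" and g: "lmap R N X g"
  shows "lmap R M X (\<lambda>x. g (f x))"
proof -
  interpret f: lmap R M N f by fact
  interpret g: lmap R N X g by fact
  show ?thesis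
    by (rule lmapI) (auto simp: f.add f.smult g.add g.smult f.dom.left_module_axioms g.cod.left_module_axioms)
qed

lemma lmap_id: "left_module R M \<Longrightarrow> lmap R M M (\<lambda>x. x)"
  by (rule lmapI) auto

lemma lmap_const0: 
  assumes "left_module R M" "left_module R N"
  shows "lmap R M N (\<lambda>x. \<zero>\<^bsub>N\<^esub>)"
proof -
  interpret N: left_module R N by fact
  show ?thesis by (rule lmapI[OF assms]) auto
qed

lemma lmap_add:
  assumes f: "lmap R M N f" and g: "lmap R M N g"
  shows "lmap R M N (\<lambda>x. f x \<oplus>\<^bsub>N\<^esub> g x)"
proof -
  interpret f: lmap R M N f by fact
  interpret g: lmap R M N g by fact
  show ?thesis
    by (rule lmapI) (auto simp: f.add f.smult g.add g.smult f.cod.M.add.m_ac f.cod.smult_r_distr 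
      f.dom.left_module_axioms f.cod.left_module_axioms)
qed

lemma lmap_diff:
  assumes f: "lmap R M N f" and g: "lmap R M N g"
  shows "lmap R M N (\<lambda>x. f x \<ominus>\<^bsub>N\<^esub> g x)"
proof -
  interpret f: lmap R M N f by fact
  interpret g: lmap R M N g by fact
  have "lmap R M N (\<lambda>x. \<ominus>\<^bsub>N\<^esub> g x)"
    by (rule lmapI) (auto simp: g.add g.smult f.cod.M.minus_add f.cod.smult_neg 
      f.dom.left_module_axioms f.cod.left_module_axioms)
  from lmap_add[OF f this] show ?thesis by (simp add: a_minus_def)
qed

lemma lmap_msub_dom:
  assumes f: "lmap R M N f" and U: "submodule U R M"
  shows "lmap R (msub M U) N f"
proof -
  interpret f: lmap R M N f by fact
  note d = f.dom.submoduleD[OF U]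
  show ?thesis
    by (rule lmapI) (use d in \<open>auto simp: f.add f.smult f.dom.left_module_msub[OF U] f.cod.left_module_axioms\<close>)
qed

lemma lmap_msub_cod:
  assumes f: "lmap R M N f" and U: "submodule U R N" and im: "\<And>x. x \<in> carrier M \<Longrightarrow> f x \<in> U"
  shows "lmap R M (msub N U) f"
proof -
  interpret f: lmap R M N f by fact
  show ?thesis
    by (rule lmapI) (auto simp: f.add f.smult im f.cod.left_module_msub[OF U] f.dom.left_module_axioms)
qed

lemma lmap_of_msub:
  assumes f: "lmap R M (msub N U) f" and N: "left_module R N" and U: "submodule U R N"
  shows "lmap R M N f"
proof -
  interpret N: left_module R N by fact
  interpret f: lmap R M "msub N U" f by fact
  show ?thesis
    by (rule lmapI) (use f.closed f.add f.smult N.submoduleD[OF U] in \<open>auto simp: N f.dom.left_module_axioms\<close>)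
qed

lemma lmap_incl:
  assumes "left_module R M" "submodule U R M"
  shows "lmap R (msub M U) M (\<lambda>x. x)"
  using lmap_msub_dom[OF lmap_id] assms by blast

lemma lmap_inv:
  assumes f: "lmap R M N f" and b: "bij_betw f (carrier M) (carrier N)"
  shows "lmap R N M (inv_into (carrier M) f)" (is "lmap R N M ?g")
proof -
  interpret f: lmap R M N f by fact
  have g: "?g y \<in> carrier M" "f (?g y) = y" if "y \<in> carrier N" for y
    using b that by (auto simp: bij_betw_def inv_into_into f_inv_into_f)
  have gi: "?g y = x" if "x \<in> carrier M" "f x = y" for x y
    using b that by (auto simp: bij_betw_def inv_into_f_eq)
  show ?thesis
    by (rule lmapI) (auto simp: g f.dom.left_module_axioms f.cod.left_module_axioms f.add f.smult intro!: gi)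
qed

lemma mod_iso_iff:
  assumes "left_module R M" "left_module R N"
  shows "mod_iso R M N \<longleftrightarrow> (\<exists>f. lmap R M N f \<and> bij_betw f (carrier M) (carrier N))"
proof
  assume "mod_iso R M N"
  then show "\<exists>f. lmap R M N f \<and> bij_betw f (carrier M) (carrier N)"
    using assms by (auto simp: mod_iso_def mod_hom_iff)
next
  assume "\<exists>f. lmap R M N f \<and> bij_betw f (carrier M) (carrier N)"
  then obtain f where f: "lmap R M N f" "bij_betw f (carrier M) (carrier N)" by blast
  have "bij_betw (restrict f (carrier M)) (carrier M) (carrier N)"
    using f(2) by (simp cong: bij_betw_cong)
  with restrict_mod_hom[OF f(1)] show "mod_iso R M N" unfolding mod_iso_def by blast
qed

lemma mod_iso_sym:
  assumes "left_module R M" "left_module R N" "mod_iso R M N"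
  shows "mod_iso R N M"
  using assms lmap_inv bij_betw_inv_into by (metis mod_iso_iff)

section \<open>Quotients\<close>

context left_module
begin

context
  fixes N assumes N: "submodule N R M"
begin

interpretation N: abelian_subgroup N M by (rule abelian_subgroup_submodule[OF N])

lemma quot_simps: "carrier (quot_module M N) = (\<lambda>x. N +>\<^bsub>M\<^esub> x) ` carrier M"
    "\<zero>\<^bsub>quot_module M N\<^esub> = N"
    "x \<in> carrier M \<Longrightarrow> y \<in> carrier M \<Longrightarrow> 
      (N +>\<^bsub>M\<^esub> x) \<oplus>\<^bsub>quot_module M N\<^esub> (N +>\<^bsub>M\<^esub> y) = N +>\<^bsub>M\<^esub> (x \<oplus>\<^bsub>M\<^esub> y)"
  by (auto simp: quot_module_def A_RCOSETS_def' N.a_rcos_sum)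

lemma coset_eq_iff: "x \<in> carrier M \<Longrightarrow> y \<in> carrier M \<Longrightarrow> N +>\<^bsub>M\<^esub> x = N +>\<^bsub>M\<^esub> y \<longleftrightarrow> x \<ominus>\<^bsub>M\<^esub> y \<in> N"
  by (metis N.a_rcos_module N.a_rcos_self N.a_repr_independence' N.a_repr_independenceD a_minus_def)

lemma coset_zero: "N +>\<^bsub>M\<^esub> \<zero>\<^bsub>M\<^esub> = N"
  using N.a_subset by (rule a_coset_add_zero)

lemma coset_eq_zero_iff: "x \<in> carrier M \<Longrightarrow> N +>\<^bsub>M\<^esub> x = N \<longleftrightarrow> x \<in> N"
  using coset_eq_iff[of x "\<zero>\<^bsub>M\<^esub>"] by (simp add: coset_zero)

lemma quot_smult: 
  assumes a: "a \<in> carrier R" and x: "x \<in> carrier M"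
  shows "a \<odot>\<^bsub>quot_module M N\<^esub> (N +>\<^bsub>M\<^esub> x) = N +>\<^bsub>M\<^esub> (a \<odot>\<^bsub>M\<^esub> x)"
proof -
  have "N +>\<^bsub>M\<^esub> (a \<odot>\<^bsub>M\<^esub> y) = N +>\<^bsub>M\<^esub> (a \<odot>\<^bsub>M\<^esub> x)" if "y \<in> N +>\<^bsub>M\<^esub> x" for y
  proof -
    from that x have y: "y \<in> carrier M" "y \<ominus>\<^bsub>M\<^esub> x \<in> N"
      using N.a_elemrcos_carrier[OF x that] N.a_rcos_module_imp[OF x that]
      by (simp_all add: a_minus_def)
    then have "a \<odot>\<^bsub>M\<^esub> (y \<ominus>\<^bsub>M\<^esub> x) \<in> N" using submoduleD(5)[OF N a] by blast
    also have "a \<odot>\<^bsub>M\<^esub> (y \<ominus>\<^bsub>M\<^esub> x) = a \<odot>\<^bsub>M\<^esub> y \<ominus>\<^bsub>M\<^esub> a \<odot>\<^bsub>M\<^esub> x"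
      using a x y by (simp add: a_minus_def smult_r_distr smult_neg)
    finally show ?thesis using a x y by (simp add: coset_eq_iff)
  qed
  then have "(\<Union>y\<in>N +>\<^bsub>M\<^esub> x. N +>\<^bsub>M\<^esub> (a \<odot>\<^bsub>M\<^esub> y)) = (\<Union>y\<in>N +>\<^bsub>M\<^esub> x. N +>\<^bsub>M\<^esub> (a \<odot>\<^bsub>M\<^esub> x))"
    by (intro SUP_cong refl)
  also have "\<dots> = N +>\<^bsub>M\<^esub> (a \<odot>\<^bsub>M\<^esub> x)"
    using N.a_rcos_self[OF x] by (intro SUP_eq_const) auto
  finally show ?thesis by (simp add: quot_module_def)
qed

lemma left_module_quot: "left_module R (quot_module M N)"
proof -
  have "abelian_group (quot_module M N)"
  proof (rule abelian_groupI)
    fix u v w assume "u \<in> carrier (quot_module M N)" "v \<in> carrier (quot_module M N)" "w \<in> carrier (quot_module M N)"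
    then obtain x y z where *: "u = N +>\<^bsub>M\<^esub> x" "v = N +>\<^bsub>M\<^esub> y" "w = N +>\<^bsub>M\<^esub> z"
      "x \<in> carrier M" "y \<in> carrier M" "z \<in> carrier M" by (auto simp: quot_simps)
    then show "u \<oplus>\<^bsub>quot_module M N\<^esub> v \<in> carrier (quot_module M N)" 
      "(u \<oplus>\<^bsub>quot_module M N\<^esub> v) \<oplus>\<^bsub>quot_module M N\<^esub> w = u \<oplus>\<^bsub>quot_module M N\<^esub> (v \<oplus>\<^bsub>quot_module M N\<^esub> w)"
      "u \<oplus>\<^bsub>quot_module M N\<^esub> v = v \<oplus>\<^bsub>quot_module M N\<^esub> u"
      by (simp add: quot_simps, simp add: quot_simps M.a_assoc, simp add: quot_simps M.a_comm)
    have z: "\<zero>\<^bsub>quot_module M N\<^esub> = N +>\<^bsub>M\<^esub> \<zero>\<^bsub>M\<^esub>" by (simp add: quot_simps coset_zero)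
    show "\<zero>\<^bsub>quot_module M N\<^esub> \<oplus>\<^bsub>quot_module M N\<^esub> u = u"
      unfolding z using * by (simp add: quot_simps(3))
    have "(N +>\<^bsub>M\<^esub> (\<ominus>\<^bsub>M\<^esub> x)) \<oplus>\<^bsub>quot_module M N\<^esub> u = \<zero>\<^bsub>quot_module M N\<^esub>"
      unfolding z using * by (simp add: quot_simps(3) M.l_neg)
    then show "\<exists>v\<in>carrier (quot_module M N). v \<oplus>\<^bsub>quot_module M N\<^esub> u = \<zero>\<^bsub>quot_module M N\<^esub>"
      using * by (intro bexI[of _ "N +>\<^bsub>M\<^esub> (\<ominus>\<^bsub>M\<^esub> x)"]) (auto simp: quot_simps(1))
  qed (auto simp: quot_simps coset_zero intro!: image_eqI[of _ _ "\<zero>\<^bsub>M\<^esub>"])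
  then show ?thesis
    by (intro left_module.intro left_module_axioms.intro R.ring_axioms)
      (auto simp: quot_simps quot_smult smult_l_distr smult_r_distr smult_assoc)
qed

lemma lmap_quot: "lmap R M (quot_module M N) (\<lambda>x. N +>\<^bsub>M\<^esub> x)"
  by (rule lmapI) (auto simp: left_module_quot left_module_axioms quot_simps quot_smult)

end

end

text \<open>\<open>epik R M U V X\<close>: the subquotient \<open>U/V\<close> of \<open>M\<close> is isomorphic to \<open>X\<close>.\<close>

definition epik :: "('a, 'e) ring_scheme \<Rightarrow> ('a, 'v) module \<Rightarrow> 'v set \<Rightarrow> 'v set \<Rightarrow> ('a, 'w) module \<Rightarrow> bool" where
  "epik R M U V X \<longleftrightarrow> submodule U R M \<and> submodule V R M \<and> V \<subseteq> U \<and>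
     (\<exists>f. lmap R (msub M U) X f \<and> f ` U = carrier X \<and> {u \<in> U. f u = \<zero>\<^bsub>X\<^esub>} = V)"

lemma lmap_factor:
  assumes f: "lmap R M X f" and N: "submodule N R M" and z: "\<And>x. x \<in> N \<Longrightarrow> f x = \<zero>\<^bsub>X\<^esub>"
  shows "\<exists>g. lmap R (quot_module M N) X g \<and> (\<forall>x\<in>carrier M. g (N +>\<^bsub>M\<^esub> x) = f x)"
proof -
  interpret f: lmap R M X f by fact
  define g where "g u = f (SOME x. x \<in> carrier M \<and> u = N +>\<^bsub>M\<^esub> x)" for u
  have g: "g (N +>\<^bsub>M\<^esub> x) = f x" if x: "x \<in> carrier M" for x
  proof -
    define y where "y = (SOME y. y \<in> carrier M \<and> N +>\<^bsub>M\<^esub> x = N +>\<^bsub>M\<^esub> y)"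
    have "y \<in> carrier M \<and> N +>\<^bsub>M\<^esub> x = N +>\<^bsub>M\<^esub> y"
      unfolding y_def by (rule someI[of _ x]) (use x in auto)
    then have "y \<in> carrier M" "x \<ominus>\<^bsub>M\<^esub> y \<in> N" using x by (auto simp: f.dom.coset_eq_iff[OF N])
    then have "f x = f y" using z[of "x \<ominus>\<^bsub>M\<^esub> y"] x by (simp add: f.diff f.cod.diff_zero_iff)
    then show ?thesis by (simp add: g_def y_def)
  qed
  have "lmap R (quot_module M N) X g"
    by (rule lmapI) (auto simp: f.dom.left_module_quot[OF N] f.cod.left_module_axioms
      f.dom.quot_simps[OF N] f.dom.quot_smult[OF N] g f.add f.smult)
  with g show ?thesis by blast
qed

lemma first_iso:
  assumes f: "lmap R M X f" and s: "f ` carrier M = carrier X" and N: "N = {x \<in> carrier M. f x = \<zero>\<^bsub>X\<^esub>}"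
  shows "mod_iso R (quot_module M N) X"
proof -
  interpret f: lmap R M X f by fact
  have N': "submodule N R M" using f.ker_submodule by (simp add: N f.ker_def)
  obtain g where g: "lmap R (quot_module M N) X g" "\<And>x. x \<in> carrier M \<Longrightarrow> g (N +>\<^bsub>M\<^esub> x) = f x"
    using lmap_factor[OF f N'] N by auto
  have "bij_betw g (carrier (quot_module M N)) (carrier X)"
    unfolding bij_betw_def
  proof
    show "inj_on g (carrier (quot_module M N))"
      unfolding f.dom.quot_simps[OF N']
    proof (rule inj_onI, elim imageE)
      fix u v x y assume "g u = g v" "u = N +>\<^bsub>M\<^esub> x" "v = N +>\<^bsub>M\<^esub> y" "x \<in> carrier M" "y \<in> carrier M"
      then show "u = v"
        by (simp add: g f.dom.coset_eq_iff[OF N'] f.diff f.cod.diff_zero_iff) 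
          (simp add: N f.diff f.cod.diff_zero_iff)
    qed
    show "g ` carrier (quot_module M N) = carrier X"
      by (simp add: f.dom.quot_simps[OF N'] image_image g s)
  qed
  then show ?thesis using g(1) by (auto simp: mod_iso_iff[OF lmapD[OF g(1)]])
qed

text \<open>Trades cosets for a surjection defined on \<open>U\<close> itself. Such surjections can
  be composed with isomorphisms and pulled back along surjections, which is how layers are moved
  between modules later.\<close>

lemma mod_iso_subquot_iff:
  assumes M: "left_module R M" and X: "left_module R X" and U: "submodule U R M" and V: "submodule V R M" "V \<subseteq> U"
  shows "mod_iso R (subquot M U V) X \<longleftrightarrow> epik R M U V X"
proof -
  interpret M: left_module R M by fact
  interpret U: left_module R "msub M U" by (rule M.left_module_msub[OF U])
  have V': "submodule V R (msub M U)" using M.submodule_msub[OF U] V by auto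
  note lq = U.left_module_quot[OF V']
  show ?thesis
  proof
    assume "mod_iso R (subquot M U V) X"
    then obtain f where f: "lmap R (quot_module (msub M U) V) X f" 
      "bij_betw f (carrier (quot_module (msub M U) V)) (carrier X)"
      using X lq by (auto simp: subquot_def mod_iso_iff)
    interpret f: lmap R "quot_module (msub M U) V" X f by fact
    let ?g = "\<lambda>x. f (V +>\<^bsub>msub M U\<^esub> x)"
    have "lmap R (msub M U) X ?g" by (rule lmap_comp[OF U.lmap_quot[OF V'] f(1)])
    moreover have "?g ` U = carrier X"
      using f(2) by (auto simp: bij_betw_def U.quot_simps[OF V'] image_image)
    moreover have "{u \<in> U. ?g u = \<zero>\<^bsub>X\<^esub>} = V"
    proof -
      have "?g u = \<zero>\<^bsub>X\<^esub> \<longleftrightarrow> u \<in> V" if "u \<in> U" for u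
      proof -
        have V0: "f V = \<zero>\<^bsub>X\<^esub>" "V \<in> carrier (quot_module (msub M U) V)"
          using f.zero f.dom.M.zero_closed by (simp_all only: U.quot_simps(2)[OF V'])
        have "inj_on f (carrier (quot_module (msub M U) V))" using f(2) by (simp add: bij_betw_def)
        moreover have "V +>\<^bsub>msub M U\<^esub> u \<in> carrier (quot_module (msub M U) V)"
          using that by (simp add: U.quot_simps(1)[OF V'])
        ultimately have "?g u = \<zero>\<^bsub>X\<^esub> \<longleftrightarrow> V +>\<^bsub>msub M U\<^esub> u = V"
          using V0 by (metis inj_onD)
        then show ?thesis using U.coset_eq_zero_iff[OF V'] that by simp
      qed
      then show ?thesis using V by auto
    qed
    ultimately show "epik R M U V X" using U V by (auto simp: epik_def)
  next
    assume "epik R M U V X"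
    then obtain f where "lmap R (msub M U) X f" "f ` U = carrier X" "{u \<in> U. f u = \<zero>\<^bsub>X\<^esub>} = V"
      by (auto simp: epik_def)
    then show "mod_iso R (subquot M U V) X" unfolding subquot_def
      by (intro first_iso) auto
  qed
qed

section \<open>Chain conditions and composition series\<close>

text \<open>The flag lets both chain conditions share one relation, so that each closure property is
  proved once for both.\<close>

definition sub_rel :: "bool \<Rightarrow> ('a, 'e) ring_scheme \<Rightarrow> ('a, 'v) module \<Rightarrow> ('v set \<times> 'v set) set" where
  "sub_rel d R M = {(X, Y). submodule X R M \<and> submodule Y R M \<and> (if d then X \<subset> Y else Y \<subset> X)}"

text \<open>\<open>chain_cond True\<close> is the descending, \<open>chain_cond False\<close> the ascending chain condition.\<close>

definition chain_cond :: "bool \<Rightarrow> ('a, 'e) ring_scheme \<Rightarrow> ('a, 'v) module \<Rightarrow> bool" where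
  "chain_cond d R M \<longleftrightarrow> left_module R M \<and> wf (sub_rel d R M)"

definition finlen :: "('a, 'e) ring_scheme \<Rightarrow> ('a, 'v) module \<Rightarrow> bool" where
  "finlen R M \<longleftrightarrow> chain_cond True R M \<and> chain_cond False R M"

lemma finlen_left_module: "finlen R M \<Longrightarrow> left_module R M"
  by (simp add: finlen_def chain_cond_def)

text \<open>By the modular law, nested submodules with the same image under \<open>f\<close> and the
  same intersection with the kernel coincide. So a strict step between submodules of
  \<open>M\<close> is a strict step, in the same direction, between the pairs (image, intersection)
  in the lexicographic order.\<close>

lemma chain_cond_ext:
  assumes f: "lmap R M N f" and K: "chain_cond d R (msub M (lmap.ker M N f))" and N: "chain_cond d R N"
  shows "chain_cond d R M"
proof -
  interpret f: lmap R M N f by fact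
  let ?g = "\<lambda>X. (f ` X, X \<inter> f.ker)"
  have eq: "X = Y" if "submodule X R M" "submodule Y R M" "X \<subseteq> Y" "f ` X = f ` Y" "X \<inter> f.ker = Y \<inter> f.ker" for X Y
  proof -
    have "y \<in> X" if y: "y \<in> Y" for y
    proof -
      obtain x where x: "x \<in> X" "f y = f x" using \<open>f ` X = f ` Y\<close> y by (metis imageE imageI)
      have c: "x \<in> carrier M" "y \<in> carrier M" using x y f.dom.submoduleD(2) that(1) \<open>submodule Y R M\<close> \<open>submodule X R M\<close> by auto
      have "y \<ominus>\<^bsub>M\<^esub> x \<in> Y \<inter> f.ker"
        using x y c f.eq_iff_diff_ker[of y x] f.dom.submoduleD(7)[OF \<open>submodule Y R M\<close>] \<open>X \<subseteq> Y\<close> by auto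
      then have "y \<ominus>\<^bsub>M\<^esub> x \<in> X" using \<open>X \<inter> f.ker = Y \<inter> f.ker\<close> by auto
      then have "(y \<ominus>\<^bsub>M\<^esub> x) \<oplus>\<^bsub>M\<^esub> x \<in> X" using x f.dom.submoduleD(4)[OF \<open>submodule X R M\<close>] by auto
      then show "y \<in> X" using c by (simp add: a_minus_def f.dom.M.a_assoc f.dom.M.l_neg)
    qed
    with \<open>X \<subseteq> Y\<close> show ?thesis by auto
  qed
  have "(?g X, ?g Y) \<in> sub_rel d R N <*lex*> sub_rel d R (msub M f.ker)" if "(X, Y) \<in> sub_rel d R M" for X Y
  proof -
    from that have s: "submodule X R M" "submodule Y R M" by (auto simp: sub_rel_def)
    have "submodule (f ` X) R N" "submodule (f ` Y) R N" "submodule (X \<inter> f.ker) R (msub M f.ker)"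
      "submodule (Y \<inter> f.ker) R (msub M f.ker)"
      using s by (auto simp: f.image_submodule f.dom.submodule_msub[OF f.ker_submodule] f.dom.submodule_Int f.ker_submodule)
    moreover have "f ` X \<subset> f ` Y \<or> f ` X = f ` Y \<and> X \<inter> f.ker \<subset> Y \<inter> f.ker" if "X \<subset> Y" 
      using eq[OF s] that by blast
    moreover have "f ` Y \<subset> f ` X \<or> f ` Y = f ` X \<and> Y \<inter> f.ker \<subset> X \<inter> f.ker" if "Y \<subset> X" 
      using eq[OF s(2,1)] that by blast
    ultimately show ?thesis using that unfolding sub_rel_def by (cases d) auto
  qed
  then have "sub_rel d R M \<subseteq> inv_image (sub_rel d R N <*lex*> sub_rel d R (msub M f.ker)) ?g" by auto
  moreover have "wf (sub_rel d R N <*lex*> sub_rel d R (msub M f.ker))"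
    using K N by (auto simp: chain_cond_def)
  ultimately show ?thesis using wf_subset[OF wf_inv_image]
    by (auto simp: chain_cond_def f.dom.left_module_axioms)
qed

lemma chain_cond_inj:
  assumes f: "lmap R M N f" "inj_on f (carrier M)" and N: "chain_cond d R N"
  shows "chain_cond d R M"
proof -
  interpret f: lmap R M N f by fact
  have "(f ` X, f ` Y) \<in> sub_rel d R N" if "(X, Y) \<in> sub_rel d R M" for X Y
  proof -
    from that have s: "submodule X R M" "submodule Y R M" by (auto simp: sub_rel_def)
    have *: "f ` X \<subset> f ` Y" if "submodule X R M" "submodule Y R M" "X \<subset> Y" for X Y
      using inj_on_image_eq_iff[OF f(2) f.dom.submoduleD(1)[OF that(1)] f.dom.submoduleD(1)[OF that(2)]] that(3)
      by (simp add: psubset_eq image_mono)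
    show ?thesis using that s *[OF s] *[OF s(2,1)] f.image_submodule by (simp add: sub_rel_def split: if_splits)
  qed
  then have "sub_rel d R M \<subseteq> inv_image (sub_rel d R N) (image f)" by auto
  then show ?thesis using N wf_subset[OF wf_inv_image]
    by (auto simp: chain_cond_def f.dom.left_module_axioms)
qed

lemma chain_cond_surj:
  assumes f: "lmap R M N f" "f ` carrier M = carrier N" and M: "chain_cond d R M"
  shows "chain_cond d R N"
proof -
  interpret f: lmap R M N f by fact
  let ?g = "\<lambda>Y. {x \<in> carrier M. f x \<in> Y}"
  have "(?g X, ?g Y) \<in> sub_rel d R M" if "(X, Y) \<in> sub_rel d R N" for X Y
  proof -
    from that have s: "submodule X R N" "submodule Y R N" by (auto simp: sub_rel_def)
    have *: "?g X \<subset> ?g Y" if "submodule Y R N" "X \<subset> Y" for X Y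
    proof -
      obtain y where y: "y \<in> Y - X" using \<open>X \<subset> Y\<close> by auto
      then have "y \<in> f ` carrier M" using f(2) f.cod.submoduleD(2)[OF that(1)] by auto
      then obtain x where "x \<in> carrier M" "f x = y" by auto
      then have "x \<in> ?g Y - ?g X" using y by auto
      then show ?thesis using \<open>X \<subset> Y\<close> by blast
    qed
    show ?thesis using that s *[OF s(2), of X] *[OF s(1), of Y] f.vimage_submodule
      by (auto simp: sub_rel_def)
  qed
  then have "sub_rel d R N \<subseteq> inv_image (sub_rel d R M) ?g" by auto
  then show ?thesis using M wf_subset[OF wf_inv_image]
    by (auto simp: chain_cond_def f.cod.left_module_axioms)
qed

lemma chain_cond_sub: 
  assumes M: "chain_cond d R M" and U: "submodule U R M"
  shows "chain_cond d R (msub M U)"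
proof -
  have "left_module R M" using M by (simp add: chain_cond_def)
  then show ?thesis 
    using chain_cond_inj[OF lmap_incl[OF _ U] _ M] by (simp add: left_module.msub_simps[OF \<open>left_module R M\<close>])
qed

lemma chain_cond_quot:
  assumes M: "chain_cond d R M" and U: "submodule U R M"
  shows "chain_cond d R (quot_module M U)"
proof -
  interpret left_module R M using M by (simp add: chain_cond_def)
  show ?thesis by (rule chain_cond_surj[OF lmap_quot[OF U] _ M]) (simp add: quot_simps[OF U])
qed

text \<open>Modulo \<open>U\<close> every element of \<open>U + V\<close> has a representative in
  \<open>V\<close>. So \<open>U + V\<close> is an extension of a quotient of \<open>V\<close> by
  \<open>U\<close>.\<close>

lemma chain_cond_ssum:
  assumes M: "left_module R M" and U: "submodule U R M" "chain_cond d R (msub M U)"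
    and V: "submodule V R M" "chain_cond d R (msub M V)"
  shows "chain_cond d R (msub M (left_module.ssum M U V))"
proof -
  interpret M: left_module R M by fact
  let ?\<pi> = "\<lambda>x. U +>\<^bsub>M\<^esub> x" and ?Q = "quot_module M U"
  interpret pi: lmap R M ?Q ?\<pi> by (rule M.lmap_quot[OF U(1)])
  have pV: "submodule (?\<pi> ` V) R ?Q" by (rule pi.image_submodule[OF V(1)])
  note W = M.submodule_ssum[OF U(1) V(1)]
  have im: "?\<pi> x \<in> ?\<pi> ` V" if "x \<in> M.ssum U V" for x
  proof -
    from that obtain u v where uv: "u \<in> U" "v \<in> V" "x = u \<oplus>\<^bsub>M\<^esub> v" by (auto simp: M.ssum_def)
    have c: "u \<in> carrier M" "v \<in> carrier M" using uv M.submoduleD(2) U V by auto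
    then have "x \<ominus>\<^bsub>M\<^esub> v = u" by (simp add: uv a_minus_def M.M.a_assoc M.M.r_neg)
    then have "?\<pi> x = ?\<pi> v" using c uv by (subst M.coset_eq_iff[OF U(1)]) auto
    then show ?thesis using uv by auto
  qed
  have f: "lmap R (msub M (M.ssum U V)) (msub ?Q (?\<pi> ` V)) ?\<pi>"
    by (rule lmap_msub_cod[OF lmap_msub_dom[OF M.lmap_quot[OF U(1)] W] pV]) (use im in simp)
  have "chain_cond d R (msub ?Q (?\<pi> ` V))"
    by (rule chain_cond_surj[OF lmap_msub_cod[OF lmap_msub_dom[OF M.lmap_quot[OF U(1)] V(1)] pV] _ V(2)]) auto
  moreover have "lmap.ker (msub M (M.ssum U V)) (msub ?Q (?\<pi> ` V)) ?\<pi> = U"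
  proof -
    have "?\<pi> x = U \<longleftrightarrow> x \<in> U" if "x \<in> M.ssum U V" for x
      by (rule M.coset_eq_zero_iff[OF U(1) M.submoduleD(2)[OF W that]])
    then show ?thesis using M.ssum_upper(1)[OF U(1) V(1)]
      by (auto simp: lmap.ker_def[OF f] M.quot_simps(2)[OF U(1)])
  qed
  ultimately show ?thesis using U by (intro chain_cond_ext[OF f]) auto
qed

section \<open>Finitely generated modules and restriction of scalars\<close>

lemma left_module_regular: "ring R \<Longrightarrow> left_module R (regular_module R)"
proof -
  assume "ring R"
  then interpret R: ring R .
  have "abelian_group (regular_module R)"
    by (rule abelian_groupI) (simp_all add: regular_module_def R.add.m_ac R.add.l_inv_ex)
  then show ?thesis
    by (intro left_module.intro left_module_axioms.intro R.ring_axioms)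
      (auto simp: regular_module_def R.l_distr R.r_distr R.m_assoc)
qed

lemma regular_simps [simp]: "carrier (regular_module R) = carrier R" "\<zero>\<^bsub>regular_module R\<^esub> = \<zero>\<^bsub>R\<^esub>"
    "add (regular_module R) = add R" "smult (regular_module R) = mult R"
  by (simp_all add: regular_module_def)

lemma lmap_orbit:
  assumes "left_module R M" "x \<in> carrier M"
  shows "lmap R (regular_module R) M (\<lambda>a. a \<odot>\<^bsub>M\<^esub> x)"
proof -
  interpret left_module R M by fact
  show ?thesis
    by (rule lmapI[OF left_module_regular]) (auto simp: left_module_axioms R.ring_axioms smult_l_distr smult_assoc assms)
qed

lemma mspan_insert_subset:
  assumes M: "left_module R M" and "S \<subseteq> carrier M" "x \<in> carrier M"
  shows "mspan R M (insert x S) \<subseteq> left_module.ssum M ((\<lambda>a. a \<odot>\<^bsub>M\<^esub> x) ` carrier R) (mspan R M S)"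
proof -
  interpret M: left_module R M by fact
  have "submodule ((\<lambda>a. a \<odot>\<^bsub>M\<^esub> x) ` carrier R) R M"
    using lmap.image_submodule[OF lmap_orbit[OF M assms(3)]]
      left_module.submodule_carrier[OF left_module_regular[OF M.R.ring_axioms]] by simp
  note s = M.submodule_ssum[OF this M.mspan_submodule[OF assms(2)]] 
    M.ssum_upper[OF this M.mspan_submodule[OF assms(2)]]
  have "x \<in> (\<lambda>a. a \<odot>\<^bsub>M\<^esub> x) ` carrier R" using assms(3) by (intro image_eqI[of _ _ "\<one>\<^bsub>R\<^esub>"]) auto
  then show ?thesis using s M.mspan_upper[of S] by (intro M.mspan_least) auto
qed

lemma chain_cond_zero:
  assumes "left_module R M" "carrier M = {\<zero>\<^bsub>M\<^esub>}"
  shows "chain_cond d R M"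
proof -
  interpret left_module R M by fact
  have z: "X = {\<zero>\<^bsub>M\<^esub>}" if "submodule X R M" for X
    using submoduleD(1,3)[OF that] assms(2) by auto
  have "(X, Y) \<notin> sub_rel d R M" for X Y
  proof
    assume r: "(X, Y) \<in> sub_rel d R M"
    then have "submodule X R M" "submodule Y R M" by (auto simp: sub_rel_def)
    then have "X = {\<zero>\<^bsub>M\<^esub>}" "Y = {\<zero>\<^bsub>M\<^esub>}" using z[of X] z[of Y] by auto
    then show False using r unfolding sub_rel_def by (cases d) simp_all
  qed
  then have "sub_rel d R M = {}" by auto
  then show ?thesis using assms by (simp add: chain_cond_def)
qed

lemma restrict_scalars_simps [simp]: "carrier (restrict_scalars \<gamma> M) = carrier M" "\<zero>\<^bsub>restrict_scalars \<gamma> M\<^esub> = \<zero>\<^bsub>M\<^esub>"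
    "add (restrict_scalars \<gamma> M) = add M" "c \<odot>\<^bsub>restrict_scalars \<gamma> M\<^esub> x = \<gamma> c \<odot>\<^bsub>M\<^esub> x"
  by (simp_all add: restrict_scalars_def)

text \<open>Serves three times: for the structure map of the Artin algebra, for the map from the
  base ring to the ADR algebra in \<open>finlen_H\<close>, and with the identity map in
  \<open>chain_cond_fg\<close>.\<close>

locale scalars = \<gamma>: ring_hom_ring C A \<gamma> for C :: "('c, 'd) ring_scheme" and A :: "('a, 'e) ring_scheme" and \<gamma> :: "'c \<Rightarrow> 'a"
begin

abbreviation "restr M \<equiv> restrict_scalars \<gamma> M"

lemma left_module_restr:
  assumes "left_module A M"
  shows "left_module C (restr M)"
proof -
  interpret M: left_module A M by fact
  have "abelian_group (restr M)"
    by (rule abelian_groupI) (simp_all add: M.M.add.m_ac M.M.add.l_inv_ex)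
  then show ?thesis
    by (intro left_module.intro left_module_axioms.intro \<gamma>.R.ring_axioms)
      (simp_all add: M.smult_l_distr M.smult_r_distr M.smult_assoc)
qed

lemma lmap_restr: "lmap A M N f \<Longrightarrow> lmap C (restr M) (restr N) f"
  by (rule lmapI[OF left_module_restr left_module_restr]) (simp_all add: lmapD lmap.closed lmap.add lmap.smult)

lemma submodule_restr: "left_module A M \<Longrightarrow> submodule X A M \<Longrightarrow> submodule X C (restr M)"
  using left_module.submoduleD[of A M X] by (intro left_module.lsubmoduleI[OF left_module_restr]) auto

lemma chain_cond_of_restr:
  assumes M: "left_module A M" and c: "chain_cond d C (restr M)"
  shows "chain_cond d A M"
proof -
  have "sub_rel d A M \<subseteq> sub_rel d C (restr M)" using submodule_restr[OF M] by (auto simp: sub_rel_def)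
  then show ?thesis using c M by (auto simp: chain_cond_def intro: wf_subset)
qed

text \<open>Induction on a finite generating set: a new generator \<open>x\<close> enlarges the span
  at most by \<open>A x\<close>, which is an image of the regular module.\<close>

lemma chain_cond_restr:
  assumes A: "chain_cond d C (restr (regular_module A))" and M: "fg_module A M"
  shows "chain_cond d C (restr M)"
proof -
  interpret M: left_module A M using M by (simp add: fg_module_def)
  interpret N: left_module C "restr M" by (rule left_module_restr[OF M.left_module_axioms])
  note sub = submodule_restr[OF M.left_module_axioms]
  have *: "chain_cond d C (msub (restr M) (mspan A M S))" if "finite S" "S \<subseteq> carrier M" for S
    using that
  proof (induction S rule: finite_induct)
    case empty
    have e: "mspan A M {} = {\<zero>\<^bsub>M\<^esub>}"
      using M.mspan_least[OF M.submodule_zero, of "{}"] M.submoduleD(3)[OF M.mspan_submodule, of "{}"] by auto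
    show ?case unfolding e
      by (rule chain_cond_zero[OF N.left_module_msub[OF sub[OF M.submodule_zero]]]) simp
  next
    case (insert x S)
    let ?U = "(\<lambda>a. a \<odot>\<^bsub>M\<^esub> x) ` carrier A"
    have x: "x \<in> carrier M" and S: "S \<subseteq> carrier M" using insert by auto
    note o = lmap_orbit[OF M.left_module_axioms x]
    have U: "submodule ?U A M"
      using lmap.image_submodule[OF o]
        left_module.submodule_carrier[OF left_module_regular[OF \<gamma>.S.ring_axioms]] by simp
    have "chain_cond d C (msub (restr M) ?U)"
      by (rule chain_cond_surj[OF lmap_msub_cod[OF lmap_restr[OF o] sub[OF U]] _ A]) auto
    then have "chain_cond d C (msub (restr M) (N.ssum ?U (mspan A M S)))" (is "chain_cond d C ?W")
      using insert.IH[OF S] sub[OF U] sub[OF M.mspan_submodule[OF S]] by (intro chain_cond_ssum N.left_module_axioms)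
    moreover have "submodule (mspan A M (insert x S)) C ?W"
    proof (rule N.submoduleI_msub[OF N.submodule_ssum[OF sub[OF U] sub[OF M.mspan_submodule[OF S]]]])
      show "submodule (mspan A M (insert x S)) C (restr M)" by (rule sub[OF M.mspan_submodule]) (use x S in simp)
      show "mspan A M (insert x S) \<subseteq> N.ssum ?U (mspan A M S)"
        using mspan_insert_subset[OF M.left_module_axioms S x] by (simp add: M.ssum_def N.ssum_def)
    qed
    ultimately show ?case using chain_cond_sub[of d C ?W "mspan A M (insert x S)"] by simp
  qed
  obtain S where "finite S" "S \<subseteq> carrier M" "mspan A M S = carrier M" using M by (auto simp: fg_module_def)
  with *[of S] show ?thesis by (simp add: msub_def restrict_scalars_def)
qed

end

text \<open>The case of one ring is restriction of scalars along the identity.\<close>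

lemma chain_cond_fg:
  assumes R: "chain_cond d R (regular_module R)" and M: "fg_module R M"
  shows "chain_cond d R M"
proof -
  interpret left_module R M using M by (simp add: fg_module_def)
  interpret scalars R R "\<lambda>x. x" 
    by (intro scalars.intro ring_hom_ring.intro ring_hom_ring_axioms.intro R.ring_axioms) (simp add: ring_hom_def)
  have e: "restr N = N" for N :: "('a, 'y) module" by (simp add: restrict_scalars_def)
  show ?thesis using chain_cond_restr[of d M] R M unfolding e by blast
qed

lemma chain_cond_extremal:
  assumes M: "chain_cond d R M" and ne: "\<N> \<noteq> {}" and s: "\<And>N. N \<in> \<N> \<Longrightarrow> submodule N R M"
  obtains N where "N \<in> \<N>" "\<And>N'. N' \<in> \<N> \<Longrightarrow> (if d then N' \<subseteq> N else N \<subseteq> N') \<Longrightarrow> N' = N"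
proof -
  have "wf (sub_rel d R M)" using M by (simp add: chain_cond_def)
  from wfE_min'[OF this ne] obtain N where N: "N \<in> \<N>" "\<And>N'. (N', N) \<in> sub_rel d R M \<Longrightarrow> N' \<notin> \<N>" by blast
  have "N' = N" if N': "N' \<in> \<N>" "if d then N' \<subseteq> N else N \<subseteq> N'" for N'
  proof (rule ccontr)
    assume "N' \<noteq> N"
    then have "(N', N) \<in> sub_rel d R M" using s[OF N(1)] s[OF N'(1)] N'(2) by (simp add: sub_rel_def psubset_eq split: if_splits)
    then show False using N N' by blast
  qed
  with N(1) show thesis by (rule that)
qed

lemmas dcc_minimal = chain_cond_extremal[where d=True, simplified]
lemmas acc_maximal = chain_cond_extremal[where d=False, simplified]

lemma finlen_closure:
  shows finlen_sub: "finlen R M \<Longrightarrow> submodule U R M \<Longrightarrow> finlen R (msub M U)"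
    and finlen_quot: "finlen R M \<Longrightarrow> submodule U R M \<Longrightarrow> finlen R (quot_module M U)"
    and finlen_inj: "lmap R M N f \<Longrightarrow> inj_on f (carrier M) \<Longrightarrow> finlen R N \<Longrightarrow> finlen R M"
    and finlen_surj: "lmap R M N f \<Longrightarrow> f ` carrier M = carrier N \<Longrightarrow> finlen R M \<Longrightarrow> finlen R N"
    and finlen_ext: "lmap R M N f \<Longrightarrow> finlen R (msub M (lmap.ker M N f)) \<Longrightarrow> finlen R N \<Longrightarrow> finlen R M"
    and finlen_fg: "finlen R (regular_module R) \<Longrightarrow> fg_module R M \<Longrightarrow> finlen R M"
  unfolding finlen_def 
  by (auto intro: chain_cond_sub chain_cond_quot chain_cond_inj chain_cond_surj chain_cond_ext chain_cond_fg)

text \<open>A maximal finitely generated submodule absorbs every further element, so it is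
  everything.\<close>

lemma fg_finlen:
  assumes "finlen R M"
  shows "fg_module R M"
proof -
  interpret M: left_module R M using assms by (rule finlen_left_module)
  have acc: "chain_cond False R M" using assms by (simp add: finlen_def)
  obtain N where N: "N \<in> {mspan R M S | S. finite S \<and> S \<subseteq> carrier M}"
    and max: "\<And>N'. N' \<in> {mspan R M S | S. finite S \<and> S \<subseteq> carrier M} \<Longrightarrow> N \<subseteq> N' \<Longrightarrow> N' = N"
    by (rule acc_maximal[OF acc, of "{mspan R M S | S. finite S \<and> S \<subseteq> carrier M}"]) (auto intro: M.mspan_submodule)
  obtain S where S: "finite S" "S \<subseteq> carrier M" "N = mspan R M S" using N by auto
  have "x \<in> N" if "x \<in> carrier M" for x
  proof -
    have "N \<subseteq> mspan R M (insert x S)" unfolding S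
      using M.mspan_upper[of "insert x S"] that S(2) by (intro M.mspan_least M.mspan_submodule) auto
    then have "mspan R M (insert x S) = N" using that S by (intro max) auto
    then show ?thesis using M.mspan_upper[of "insert x S"] by auto
  qed
  then have "mspan R M S = carrier M" using S M.submoduleD(1)[OF M.mspan_submodule[OF S(2)]] by auto
  then show ?thesis using S M.left_module_axioms by (auto simp: fg_module_def)
qed

text \<open>The correspondence theorem: image and preimage under the projection are mutually inverse
  between the submodules above \<open>N\<close> and the submodules of the quotient.\<close>

lemma (in left_module) maximal_iff_simple_quot:
  assumes N: "submodule N R M"
  shows "maximal_submodule R M N \<longleftrightarrow> simple_module R (quot_module M N)"
proof -
  interpret pi: lmap R M "quot_module M N" "\<lambda>x. N +>\<^bsub>M\<^esub> x" by (rule lmap_quot[OF N])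
  let ?\<pi> = "\<lambda>x. N +>\<^bsub>M\<^esub> x" and ?Q = "quot_module M N"
  have nz: "nonzero_module ?Q \<longleftrightarrow> N \<noteq> carrier M"
  proof -
    have "carrier ?Q = {\<zero>\<^bsub>?Q\<^esub>} \<longleftrightarrow> (\<forall>x\<in>carrier M. ?\<pi> x = N)"
      using pi.cod.M.zero_closed by (auto simp: quot_simps[OF N])
    also have "\<dots> \<longleftrightarrow> carrier M \<subseteq> N" using coset_eq_zero_iff[OF N] by auto
    finally show ?thesis using submoduleD(1)[OF N] by (auto simp: nonzero_module_def)
  qed
  have pre: "H = ?\<pi> ` {x \<in> carrier M. ?\<pi> x \<in> H}" if "submodule H R ?Q" for H
    using pi.cod.submoduleD(1)[OF that] by (auto simp: quot_simps[OF N])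
  have preN: "N \<subseteq> {x \<in> carrier M. ?\<pi> x \<in> H}" if "submodule H R ?Q" for H
  proof
    fix x assume x: "x \<in> N"
    then have "?\<pi> x = N" using submoduleD(2)[OF N] coset_eq_zero_iff[OF N] by blast
    then show "x \<in> {x \<in> carrier M. ?\<pi> x \<in> H}"
      using pi.cod.submoduleD(3)[OF that] submoduleD(2)[OF N x] by (simp add: quot_simps[OF N])
  qed
  have im: "{x \<in> carrier M. ?\<pi> x \<in> ?\<pi> ` H} = H" if H: "submodule H R M" "N \<subseteq> H" for H
  proof -
    have "x \<in> H" if "x \<in> carrier M" "y \<in> H" "?\<pi> x = ?\<pi> y" for x y
    proof -
      have y: "y \<in> carrier M" using submoduleD(2)[OF H(1)] that by auto
      have "x \<ominus>\<^bsub>M\<^esub> y \<in> H" using that coset_eq_iff[OF N \<open>x \<in> _\<close> y] H by auto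
      then have "(x \<ominus>\<^bsub>M\<^esub> y) \<oplus>\<^bsub>M\<^esub> y \<in> H" using that submoduleD(4)[OF H(1)] by auto
      then show ?thesis using that y by (simp add: a_minus_def M.a_assoc M.l_neg)
    qed
    then show ?thesis using submoduleD(2)[OF H(1)] by auto
  qed
  have N0: "?\<pi> ` N = {\<zero>\<^bsub>?Q\<^esub>}" 
  proof -
    have "?\<pi> x = N" if "x \<in> N" for x using that submoduleD(2)[OF N that] coset_eq_zero_iff[OF N] by blast
    then show ?thesis using submoduleD(3)[OF N] by (auto simp: quot_simps[OF N] cong: image_cong_simp)
  qed
  show ?thesis
  proof
    assume max: "maximal_submodule R M N"
    have "H = {\<zero>\<^bsub>?Q\<^esub>} \<or> H = carrier ?Q" if H: "submodule H R ?Q" for H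
    proof -
      have "{x \<in> carrier M. ?\<pi> x \<in> H} = N \<or> {x \<in> carrier M. ?\<pi> x \<in> H} = carrier M"
        using max pi.vimage_submodule[OF H] preN[OF H] unfolding maximal_submodule_def by blast
      then show ?thesis using pre[OF H] N0 by (auto simp: quot_simps(1)[OF N])
    qed
    then show "simple_module R ?Q"
      using max nz by (auto simp: simple_module_def pi.cod.left_module_axioms maximal_submodule_def)
  next
    assume s: "simple_module R ?Q"
    have "H = N \<or> H = carrier M" if H: "submodule H R M" "N \<subseteq> H" for H
    proof -
      have "?\<pi> ` H = {\<zero>\<^bsub>?Q\<^esub>} \<or> ?\<pi> ` H = carrier ?Q"
        using s pi.image_submodule[OF H(1)] by (auto simp: simple_module_def)
      then show ?thesis
      proof
        assume "?\<pi> ` H = {\<zero>\<^bsub>?Q\<^esub>}"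
        then have e: "?\<pi> ` H = ?\<pi> ` N" by (simp only: N0)
        have "H = {x \<in> carrier M. ?\<pi> x \<in> ?\<pi> ` H}" by (rule im[OF H, symmetric])
        also have "\<dots> = {x \<in> carrier M. ?\<pi> x \<in> ?\<pi> ` N}" by (simp only: e)
        also have "\<dots> = N" by (rule im[OF N order_refl])
        finally show ?thesis ..
      next
        assume "?\<pi> ` H = carrier ?Q"
        then have e: "?\<pi> ` H = ?\<pi> ` carrier M" by (simp add: quot_simps[OF N])
        have "H = {x \<in> carrier M. ?\<pi> x \<in> ?\<pi> ` H}" by (rule im[OF H, symmetric])
        also have "\<dots> = {x \<in> carrier M. ?\<pi> x \<in> ?\<pi> ` carrier M}" by (simp only: e)
        also have "\<dots> = carrier M" by (rule im[OF submodule_carrier submoduleD(1)[OF N]])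
        finally show ?thesis ..
      qed
    qed
    then show "maximal_submodule R M N" using s nz N by (auto simp: simple_module_def maximal_submodule_def)
  qed
qed

lemma simple_iso:
  assumes f: "lmap R M N f" "bij_betw f (carrier M) (carrier N)" and M: "simple_module R M"
  shows "simple_module R N"
proof -
  interpret f: lmap R M N f by fact
  have im: "f ` carrier M = carrier N" using f(2) by (simp add: bij_betw_def)
  have "H = {\<zero>\<^bsub>N\<^esub>} \<or> H = carrier N" if H: "submodule H R N" for H
  proof -
    have e: "H = f ` {x \<in> carrier M. f x \<in> H}" using f.cod.submoduleD(1)[OF H] im by auto
    have "{x \<in> carrier M. f x \<in> H} = {\<zero>\<^bsub>M\<^esub>} \<or> {x \<in> carrier M. f x \<in> H} = carrier M"
      using M f.vimage_submodule[OF H] unfolding simple_module_def by blast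
    then show ?thesis using e im by auto
  qed
  moreover have "carrier N \<noteq> {\<zero>\<^bsub>N\<^esub>}"
  proof
    assume "carrier N = {\<zero>\<^bsub>N\<^esub>}"
    then have "x = \<zero>\<^bsub>M\<^esub>" if "x \<in> carrier M" for x
      using f(2) that f.closed[OF that] f.dom.M.zero_closed by (auto simp: bij_betw_def dest: inj_onD[of f _ x "\<zero>\<^bsub>M\<^esub>"])
    then have "carrier M = {\<zero>\<^bsub>M\<^esub>}" using f.dom.M.zero_closed by blast
    then show False using M by (simp add: simple_module_def nonzero_module_def)
  qed
  ultimately show ?thesis by (simp add: simple_module_def f.cod.left_module_axioms nonzero_module_def)
qed

lemma simple_iso_iff:
  assumes "left_module R M" "left_module R N" "mod_iso R M N"
  shows "simple_module R M \<longleftrightarrow> simple_module R N"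
  using assms mod_iso_sym[OF assms] simple_iso[of R M N] simple_iso[of R N M] by (auto simp: mod_iso_iff)

context left_module
begin

lemma simple_subquot_iff:
  assumes U: "submodule U R M" and V: "submodule V R M" "V \<subseteq> U"
  shows "simple_module R (subquot M U V) \<longleftrightarrow> V \<noteq> U \<and> (\<forall>W. submodule W R M \<longrightarrow> V \<subseteq> W \<longrightarrow> W \<subseteq> U \<longrightarrow> W = V \<or> W = U)"
  unfolding subquot_def
  using left_module.maximal_iff_simple_quot[OF left_module_msub[OF U] submoduleI_msub[OF U V]] V
  by (auto simp: maximal_submodule_def submodule_msub[OF U])

text \<open>Well-founded induction along the descending chain condition. The ascending one supplies
  a maximal proper submodule, whose series is prolonged by one step.\<close>

lemma composition_series_exists:
  assumes "finlen R M"
  shows "\<exists>m F. composition_series R M m F"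
proof -
  have wf: "wf (sub_rel True R M)" and acc: "chain_cond False R M" using assms by (auto simp: finlen_def chain_cond_def)
  have "submodule U R M \<Longrightarrow> \<exists>m F. F 0 = {\<zero>\<^bsub>M\<^esub>} \<and> F m = U \<and> (\<forall>i\<le>m. submodule (F i) R M) \<and> (\<forall>i<m. F i \<subseteq> F (Suc i)) \<and>
     (\<forall>i<m. simple_module R (subquot M (F (Suc i)) (F i)))" for U
    using wf
  proof (induction U rule: wf_induct_rule)
    case (less U)
    show ?case
    proof (cases "U = {\<zero>\<^bsub>M\<^esub>}")
      case True
      then show ?thesis by (intro exI[of _ 0] exI[of _ "\<lambda>_. {\<zero>\<^bsub>M\<^esub>}"]) auto
    next
      case False
      let ?N = "{V. submodule V R M \<and> V \<subset> U}"
      have "{\<zero>\<^bsub>M\<^esub>} \<in> ?N" using False submoduleD(3)[OF less.prems] by auto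
      then have ne: "?N \<noteq> {}" by blast
      obtain V where V: "V \<in> ?N" "\<And>V'. V' \<in> ?N \<Longrightarrow> V \<subseteq> V' \<Longrightarrow> V' = V"
        by (rule acc_maximal[OF acc ne]) auto
      then have "(V, U) \<in> sub_rel True R M" using less.prems by (auto simp: sub_rel_def)
      then obtain m F where F: "F 0 = {\<zero>\<^bsub>M\<^esub>}" "F m = V" "\<And>i. i \<le> m \<Longrightarrow> submodule (F i) R M"
        "\<And>i. i < m \<Longrightarrow> F i \<subseteq> F (Suc i)" "\<And>i. i < m \<Longrightarrow> simple_module R (subquot M (F (Suc i)) (F i))"
        using less.IH[of V] V by blast
      have "simple_module R (subquot M U V)"
        using V less.prems by (subst simple_subquot_iff) auto
      then show ?thesis using F V less.prems
        by (intro exI[of _ "Suc m"] exI[of _ "F(Suc m := U)"]) (auto simp: less_Suc_eq le_Suc_eq)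
    qed
  qed
  from this[OF submodule_carrier] show ?thesis
    unfolding composition_series_def filtration_def by blast
qed

end

lemma simple_finlen:
  assumes "simple_module R M"
  shows "finlen R M"
proof -
  interpret left_module R M using assms by (simp add: simple_module_def)
  have "wf (sub_rel d R M)" for d
  proof (rule wf_subset[OF wf_measure])
    show "sub_rel d R M \<subseteq> measure (\<lambda>X. if (X = carrier M) = d then 1 else 0)"
    proof (intro subrelI)
      fix X Y assume r: "(X, Y) \<in> sub_rel d R M"
      then have "X = {\<zero>\<^bsub>M\<^esub>} \<or> X = carrier M" "Y = {\<zero>\<^bsub>M\<^esub>} \<or> Y = carrier M"
        using assms unfolding sub_rel_def simple_module_def by blast+
      moreover have "{\<zero>\<^bsub>M\<^esub>} \<subseteq> carrier M" by simp
      ultimately show "(X, Y) \<in> measure (\<lambda>X. if (X = carrier M) = d then 1 else 0)"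
        using r unfolding sub_rel_def by (cases d) auto
    qed
  qed
  then show ?thesis by (simp add: finlen_def chain_cond_def left_module_axioms)
qed

section \<open>Artinian rings\<close>

lemma (in left_module) radical_submodule: "submodule (radical R M) R M"
proof -
  have "radical R M = \<Inter>(insert (carrier M) {N. maximal_submodule R M N})" by (auto simp: radical_def)
  also have "submodule \<dots> R M" by (rule submodule_Inter) (auto simp: maximal_submodule_def)
  finally show ?thesis .
qed

text \<open>If a maximal submodule of \<open>N\<close> missed \<open>f x\<close>, its preimage would
  be a maximal submodule of \<open>M\<close> missing \<open>x\<close>.\<close>

lemma radical_lmap:
  assumes f: "lmap R M N f" and x: "x \<in> radical R M"
  shows "f x \<in> radical R N"
proof -
  interpret f: lmap R M N f by fact
  have xc: "x \<in> carrier M" using x by (simp add: radical_def)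
  have "f x \<in> N'" if N': "maximal_submodule R N N'" for N'
  proof (rule ccontr)
    assume no: "f x \<notin> N'"
    have sN': "submodule N' R N" using N' by (simp add: maximal_submodule_def)
    let ?V = "{x \<in> carrier M. f x \<in> N'}"
    have "maximal_submodule R M ?V" unfolding maximal_submodule_def
    proof (intro conjI allI impI)
      show "submodule ?V R M" by (rule f.vimage_submodule[OF sN'])
      show "?V \<noteq> carrier M" using no xc by auto
      fix H assume H: "submodule H R M" "?V \<subseteq> H"
      show "H = ?V \<or> H = carrier M"
      proof (rule disjCI)
        assume "H \<noteq> carrier M"
        note s = f.image_submodule[OF H(1)]
        have "f.cod.ssum N' (f ` H) = N' \<or> f.cod.ssum N' (f ` H) = carrier N"
          using N' f.cod.submodule_ssum[OF sN' s] f.cod.ssum_upper(1)[OF sN' s] 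
          unfolding maximal_submodule_def by blast
        moreover have "f.cod.ssum N' (f ` H) \<noteq> carrier N"
        proof
          assume e: "f.cod.ssum N' (f ` H) = carrier N"
          have "y \<in> H" if y: "y \<in> carrier M" for y
          proof -
            have "f y \<in> f.cod.ssum N' (f ` H)" using y e by simp
            then obtain n h where nh: "n \<in> N'" "h \<in> H" "f y = n \<oplus>\<^bsub>N\<^esub> f h" by (auto simp: f.cod.ssum_def)
            have hc: "h \<in> carrier M" "n \<in> carrier N" using nh f.dom.submoduleD(2)[OF H(1)] f.cod.submoduleD(2)[OF sN'] by auto
            then have "f (y \<ominus>\<^bsub>M\<^esub> h) = n" using y nh 
              by (simp only: f.diff) (simp add: a_minus_def f.cod.M.a_assoc f.cod.M.r_neg)
            then have "y \<ominus>\<^bsub>M\<^esub> h \<in> H" using nh hc y H(2) by auto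
            then have "(y \<ominus>\<^bsub>M\<^esub> h) \<oplus>\<^bsub>M\<^esub> h \<in> H" using nh f.dom.submoduleD(4)[OF H(1)] by auto
            then show ?thesis using y hc by (simp add: a_minus_def f.dom.M.a_assoc f.dom.M.l_neg)
          qed
          then show False using \<open>H \<noteq> carrier M\<close> f.dom.submoduleD(1)[OF H(1)] by auto
        qed
        ultimately have "f ` H \<subseteq> N'" using f.cod.ssum_upper(2)[OF sN' s] by simp
        then show "H = ?V" using H f.dom.submoduleD(1)[OF H(1)] by auto
      qed
    qed
    then show False using x no by (auto simp: radical_def)
  qed
  then show ?thesis using xc by (auto simp: radical_def)
qed

text \<open>Zorn's lemma, because no ascending chain condition is at hand:
  \<open>left_inverse_J\<close> applies this to the regular module before that condition has been
  derived, and \<open>radical_le\<close> applies it to arbitrary modules.\<close>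

lemma (in left_module) maximal_avoiding:
  assumes L: "submodule L R M" and x: "x \<notin> L"
  obtains N where "submodule N R M" "L \<subseteq> N" "x \<notin> N" 
    "\<And>H. submodule H R M \<Longrightarrow> N \<subseteq> H \<Longrightarrow> x \<notin> H \<Longrightarrow> H = N"
proof -
  let ?\<A> = "{N. submodule N R M \<and> L \<subseteq> N \<and> x \<notin> N}"
  have "\<exists>N\<in>?\<A>. \<forall>X\<in>?\<A>. N \<subseteq> X \<longrightarrow> X = N"
  proof (rule subset_Zorn_nonempty)
    show "?\<A> \<noteq> {}" using L x by auto
    fix \<C> assume ne: "\<C> \<noteq> {}" and c: "subset.chain ?\<A> \<C>"
    then have mem: "submodule N R M" "L \<subseteq> N" "x \<notin> N" if "N \<in> \<C>" for N
      using that by (auto simp: subset.chain_def)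
    have cmp: "N \<subseteq> N' \<or> N' \<subseteq> N" if "N \<in> \<C>" "N' \<in> \<C>" for N N'
      using that c by (auto simp: subset.chain_def)
    have "submodule (\<Union>\<C>) R M"
    proof (rule lsubmoduleI)
      show "\<Union>\<C> \<subseteq> carrier M" using mem(1) submoduleD(1) by blast
      show "\<zero>\<^bsub>M\<^esub> \<in> \<Union>\<C>" using ne mem(1) submoduleD(3) by blast
      fix u v assume "u \<in> \<Union>\<C>" "v \<in> \<Union>\<C>"
      then obtain N N' where N: "N \<in> \<C>" "u \<in> N" "N' \<in> \<C>" "v \<in> N'" by blast
      from cmp[OF N(1,3)] show "u \<oplus>\<^bsub>M\<^esub> v \<in> \<Union>\<C>"
      proof
        assume "N \<subseteq> N'"
        then have "u \<oplus>\<^bsub>M\<^esub> v \<in> N'" using N submoduleD(4)[OF mem(1)[OF N(3)]] by blast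
        then show ?thesis using N by blast
      next
        assume "N' \<subseteq> N"
        then have "u \<oplus>\<^bsub>M\<^esub> v \<in> N" using N submoduleD(4)[OF mem(1)[OF N(1)]] by blast
        then show ?thesis using N by blast
      qed
    next
      fix a u assume a: "a \<in> carrier R" and "u \<in> \<Union>\<C>"
      then obtain N where N: "N \<in> \<C>" "u \<in> N" by blast
      then show "a \<odot>\<^bsub>M\<^esub> u \<in> \<Union>\<C>" using submoduleD(5)[OF mem(1)[OF N(1)] a] by blast
    qed
    then show "\<Union>\<C> \<in> ?\<A>" using ne mem(2,3) by blast
  qed
  then obtain N where N: "N \<in> ?\<A>" and max: "\<forall>X\<in>?\<A>. N \<subseteq> X \<longrightarrow> X = N" by blast
  show thesis
  proof (rule that[of N])
    fix H assume H: "submodule H R M" "N \<subseteq> H" "x \<notin> H"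
    then have "H \<in> ?\<A>" using N by auto
    with H max show "H = N" by simp
  qed (use N in auto)
qed

text \<open>The kernel of \<open>M/V -> M/U\<close> is an image of \<open>U/V\<close>, so the
  extension lemma applies. It lets a quotient of the regular module grow by one simple factor in
  \<open>finlen_regular\<close>.\<close>

lemma chain_cond_between:
  assumes M: "left_module R M" and U: "submodule U R M" and V: "submodule V R M" "V \<subseteq> U"
    and c: "chain_cond d R (subquot M U V)" "chain_cond d R (quot_module M U)"
  shows "chain_cond d R (quot_module M V)"
proof -
  interpret M: left_module R M by fact
  interpret mU: left_module R "msub M U" by (rule M.left_module_msub[OF U])
  have V': "submodule V R (msub M U)" by (rule M.submoduleI_msub[OF U V])
  have "U +>\<^bsub>M\<^esub> x = \<zero>\<^bsub>quot_module M U\<^esub>" if "x \<in> V" for x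
    using that V(2) M.submoduleD(2)[OF U, of x] M.coset_eq_zero_iff[OF U, of x] by (auto simp: M.quot_simps(2)[OF U])
  from lmap_factor[OF M.lmap_quot[OF U] V(1) this]
  obtain g where g: "lmap R (quot_module M V) (quot_module M U) g" 
    "\<And>x. x \<in> carrier M \<Longrightarrow> g (V +>\<^bsub>M\<^esub> x) = U +>\<^bsub>M\<^esub> x" by auto
  interpret g: lmap R "quot_module M V" "quot_module M U" g by fact
  have ker: "g.ker = (\<lambda>x. V +>\<^bsub>M\<^esub> x) ` U"
  proof -
    have "g (V +>\<^bsub>M\<^esub> x) = U \<longleftrightarrow> x \<in> U" if "x \<in> carrier M" for x
      using M.coset_eq_zero_iff[OF U that] g(2)[OF that] by simp
    then show ?thesis using M.submoduleD(2)[OF U]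
      by (auto simp: g.ker_def M.quot_simps(1)[OF V(1)] M.quot_simps(2)[OF U])
  qed
  have f: "lmap R (msub M U) (msub (quot_module M V) g.ker) (\<lambda>x. V +>\<^bsub>M\<^esub> x)"
    by (rule lmap_msub_cod[OF lmap_msub_dom[OF M.lmap_quot[OF V(1)] U] g.ker_submodule]) (simp add: ker)
  have "V +>\<^bsub>M\<^esub> x = \<zero>\<^bsub>msub (quot_module M V) g.ker\<^esub>" if "x \<in> V" for x
    using that M.submoduleD(2)[OF V(1), of x] M.coset_eq_zero_iff[OF V(1), of x] by (auto simp: M.quot_simps(2)[OF V(1)])
  from lmap_factor[OF f V' this]
  obtain h where h: "lmap R (quot_module (msub M U) V) (msub (quot_module M V) g.ker) h" 
    "\<And>x. x \<in> U \<Longrightarrow> h (V +>\<^bsub>msub M U\<^esub> x) = V +>\<^bsub>M\<^esub> x" by auto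
  have "chain_cond d R (msub (quot_module M V) g.ker)"
    by (rule chain_cond_surj[OF h(1) _ c(1)[unfolded subquot_def]])
      (auto simp: mU.quot_simps(1)[OF V'] ker h(2) image_image)
  then show ?thesis by (rule chain_cond_ext[OF g(1) _ c(2)])
qed

subsection \<open>The radical series\<close>

lemma (in left_module) rad_series_submodule: "submodule (rad_series R M t) R M"
proof (induction t)
  case (Suc t)
  then show ?case 
    using left_module.radical_submodule[OF left_module_msub[OF Suc]] submodule_msub[OF Suc] by simp
qed simp

lemma (in left_module) rad_series_add: "rad_series R M (s + t) = rad_series R (msub M (rad_series R M s)) t"
  by (induction t) (simp_all)

lemma (in left_module) rad_series_Suc_subset: "rad_series R M (Suc t) \<subseteq> rad_series R M t"
  by (auto simp: radical_def)

lemma (in left_module) rad_series_mono: "s \<le> t \<Longrightarrow> rad_series R M t \<subseteq> rad_series R M s"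
  by (rule lift_Suc_antimono_le) (use rad_series_Suc_subset in auto)

lemma rad_series_lmap:
  assumes f: "lmap R M N f" and x: "x \<in> rad_series R M t"
  shows "f x \<in> rad_series R N t"
  using x
proof (induction t arbitrary: x)
  case 0
  then show ?case using f by (auto simp: lmap.closed)
next
  case (Suc t)
  interpret f: lmap R M N f by fact
  have "lmap R (msub M (rad_series R M t)) (msub N (rad_series R N t)) f"
    by (rule lmap_msub_cod[OF lmap_msub_dom[OF f f.dom.rad_series_submodule] f.cod.rad_series_submodule]) (use Suc in simp)
  from radical_lmap[OF this] Suc.prems show ?case by simp
qed

text \<open>The powers of the Jacobson radical, encoded as the radical series of the regular module.
  Products of ideals are never formed; \<open>Jpow_mult\<close> and \<open>Jpow_ann_add\<close>
  supply what is needed of them.\<close>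

definition Jpow :: "('a, 'e) ring_scheme \<Rightarrow> nat \<Rightarrow> 'a set" where
  "Jpow A t = rad_series A (regular_module A) t"

section \<open>The Jacobson radical of a left artinian ring\<close>

locale artin_ring = ring A for A :: "('a, 'e) ring_scheme" (structure) +
  assumes dcc: "chain_cond True A (regular_module A)"
begin

abbreviation "J \<equiv> Jpow A (Suc 0)"

sublocale reg: left_module A "regular_module A"
  by (rule left_module_regular) (rule ring_axioms)

lemma reg_minus [simp]: "x \<ominus>\<^bsub>regular_module A\<^esub> y = x \<ominus> y"
  by (simp add: a_minus_def a_inv_def m_inv_def)

lemma Jpow_0 [simp]: "Jpow A 0 = carrier A" by (simp add: Jpow_def)

lemma J_eq: "J = radical A (regular_module A)"
  by (simp add: Jpow_def msub_def regular_module_def)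

lemma Jpow_submodule: "submodule (Jpow A t) A (regular_module A)"
  by (simp add: Jpow_def reg.rad_series_submodule)

lemma Jpow_closed: "c \<in> Jpow A t \<Longrightarrow> c \<in> carrier A"
  using reg.submoduleD(2)[OF Jpow_submodule] by simp

lemma Jpow_mono: "s \<le> t \<Longrightarrow> Jpow A t \<subseteq> Jpow A s"
  by (simp add: Jpow_def reg.rad_series_mono)

text \<open>The orbit map of \<open>y\<close> goes from the regular module to the
  \<open>t\<close>-th radical term of \<open>M\<close>, and the radical series is
  functorial.\<close>

lemma Jpow_smult:
  assumes M: "left_module A M" and c: "c \<in> Jpow A s" and y: "y \<in> rad_series A M t"
  shows "c \<odot>\<^bsub>M\<^esub> y \<in> rad_series A M (t + s)"
proof -
  interpret M: left_module A M by fact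
  have "lmap A (regular_module A) (msub M (rad_series A M t)) (\<lambda>a. a \<odot>\<^bsub>M\<^esub> y)"
    using lmap_orbit[OF M.left_module_msub[OF M.rad_series_submodule], of y t] y by simp
  from rad_series_lmap[OF this c[unfolded Jpow_def]] show ?thesis by (simp add: M.rad_series_add)
qed

lemma Jpow_mult: "c \<in> Jpow A s \<Longrightarrow> d \<in> Jpow A t \<Longrightarrow> c \<otimes> d \<in> Jpow A (t + s)"
  using Jpow_smult[OF reg.left_module_axioms, of c s d t] by (simp add: Jpow_def)

lemma Jpow_ideal:
  assumes "c \<in> Jpow A t" "a \<in> carrier A"
  shows "c \<otimes> a \<in> Jpow A t" "a \<otimes> c \<in> Jpow A t"
  using Jpow_mult[of c t a 0] Jpow_mult[of a 0 c t] assms by auto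

text \<open>Otherwise the left ideal generated by \<open>1 - c\<close> lies in a maximal left ideal.
  That ideal contains \<open>c\<close> as well, hence the unit.\<close>

lemma left_inverse_J:
  assumes c: "c \<in> J"
  shows "\<exists>u\<in>carrier A. u \<otimes> (\<one> \<ominus> c) = \<one>"
proof (rule ccontr)
  assume no: "\<not> ?thesis"
  have cc: "c \<in> carrier A" using c by (rule Jpow_closed)
  let ?L = "(\<lambda>u. u \<otimes> (\<one> \<ominus> c)) ` carrier A"
  have "submodule ?L A (regular_module A)"
    using lmap.image_submodule[OF lmap_orbit[OF reg.left_module_axioms, of "\<one> \<ominus> c"] reg.submodule_carrier] cc by simp
  moreover have "\<one> \<notin> ?L" using no by (auto dest: sym)
  ultimately obtain N where N: "submodule N A (regular_module A)" "?L \<subseteq> N" "\<one> \<notin> N"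
    and max: "\<And>H. submodule H A (regular_module A) \<Longrightarrow> N \<subseteq> H \<Longrightarrow> \<one> \<notin> H \<Longrightarrow> H = N"
    by (rule reg.maximal_avoiding) blast
  have "H = carrier A" if H: "submodule H A (regular_module A)" "\<one> \<in> H" for H
  proof -
    have "a \<in> H" if "a \<in> carrier A" for a using reg.submoduleD(5)[OF H(1), of a \<one>] H(2) that by simp
    then show ?thesis using reg.submoduleD(1)[OF H(1)] by auto
  qed
  then have "H = N \<or> H = carrier A" if "submodule H A (regular_module A)" "N \<subseteq> H" for H
    using max that by blast
  moreover have "N \<noteq> carrier A" using N(3) by auto
  ultimately have "maximal_submodule A (regular_module A) N"
    using N(1) by (simp add: maximal_submodule_def)
  then have cN: "c \<in> N" using c by (auto simp: J_eq radical_def)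
  have "\<one> \<otimes> (\<one> \<ominus> c) \<in> ?L" by (rule imageI) simp
  then have "\<one> \<ominus> c \<in> N" using N(2) cc by auto
  then have "(\<one> \<ominus> c) \<oplus> c \<in> N" using cN reg.submoduleD(4)[OF N(1)] by simp
  then show False using N(3) cc by (simp add: a_minus_def a_assoc l_neg)
qed

lemma ann_submodule: 
  assumes M: "left_module A M" and x: "x \<in> carrier M"
  shows "submodule {c \<in> carrier A. c \<odot>\<^bsub>M\<^esub> x = \<zero>\<^bsub>M\<^esub>} A (regular_module A)"
  using lmap.ker_submodule[OF lmap_orbit[OF M x]] by (simp add: lmap.ker_def[OF lmap_orbit[OF M x]])

lemma socle_upper:
  assumes M: "left_module A M" and S: "submodule S A M" "simple_module A (msub M S)" and x: "x \<in> S"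
  shows "x \<in> socle A M"
  unfolding socle_def by (rule subsetD[OF left_module.mspan_upper[OF M]]) (use S x in auto)

lemma socle_submodule: "left_module A M \<Longrightarrow> submodule (socle A M) A M"
  unfolding socle_def by (rule left_module.mspan_submodule) (auto simp: left_module.submoduleD)

text \<open>For \<open>x\<close> non-zero the annihilator of \<open>x\<close> is exactly
  \<open>m\<close>, so the submodule generated by \<open>x\<close> is isomorphic to the simple
  module \<open>A/m\<close>.\<close>

lemma socle_of_maximal_ann:
  assumes M: "left_module A M" and x: "x \<in> carrier M" and m: "maximal_submodule A (regular_module A) m"
    and z: "\<And>c. c \<in> m \<Longrightarrow> c \<odot>\<^bsub>M\<^esub> x = \<zero>\<^bsub>M\<^esub>"
  shows "x \<in> socle A M"
proof (cases "x = \<zero>\<^bsub>M\<^esub>")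
  case True
  then show ?thesis using left_module.submoduleD(3)[OF M socle_submodule[OF M]] by simp
next
  case False
  interpret M: left_module A M by fact
  let ?C = "(\<lambda>a. a \<odot>\<^bsub>M\<^esub> x) ` carrier A"
  note o = lmap_orbit[OF M x]
  have C: "submodule ?C A M" using lmap.image_submodule[OF o reg.submodule_carrier] by simp
  have sm: "submodule m A (regular_module A)" using m by (simp add: maximal_submodule_def)
  have "m = {c \<in> carrier A. c \<odot>\<^bsub>M\<^esub> x = \<zero>\<^bsub>M\<^esub>}"
  proof -
    have "m \<subseteq> {c \<in> carrier A. c \<odot>\<^bsub>M\<^esub> x = \<zero>\<^bsub>M\<^esub>}" using z reg.submoduleD(2)[OF sm] by auto
    moreover have "{c \<in> carrier A. c \<odot>\<^bsub>M\<^esub> x = \<zero>\<^bsub>M\<^esub>} \<noteq> carrier A" 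
      using False x one_closed by (metis (mono_tags, lifting) M.smult_one mem_Collect_eq)
    ultimately show ?thesis using m ann_submodule[OF M x] unfolding maximal_submodule_def by fastforce
  qed
  then have iso: "mod_iso A (quot_module (regular_module A) m) (msub M ?C)"
    by (intro first_iso[OF lmap_msub_cod[OF o C]]) auto
  have "simple_module A (quot_module (regular_module A) m)"
    using reg.maximal_iff_simple_quot[OF sm] m by simp
  then have "simple_module A (msub M ?C)"
    using simple_iso_iff[OF reg.left_module_quot[OF sm] M.left_module_msub[OF C] iso] by simp
  moreover have "x \<in> ?C" using x by (intro image_eqI[of _ _ \<one>]) auto
  ultimately show ?thesis using socle_upper[OF M C] by blast
qed

text \<open>By the descending chain condition some finite intersection of maximal left ideals is
  minimal; intersecting it with one more changes nothing, so it lies in all of them.\<close>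

lemma J_finite_Inter:
  obtains F where "finite F" "\<And>m. m \<in> F \<Longrightarrow> maximal_submodule A (regular_module A) m" "carrier A \<inter> \<Inter>F = J"
proof -
  let ?\<F> = "{carrier A \<inter> \<Inter>F | F. finite F \<and> (\<forall>m\<in>F. maximal_submodule A (regular_module A) m)}"
  have sub: "submodule (carrier A \<inter> \<Inter>F) A (regular_module A)" if "\<forall>m\<in>F. maximal_submodule A (regular_module A) m" for F
    using reg.submodule_Inter[of "insert (carrier A) F"] that reg.submodule_carrier by (auto simp: maximal_submodule_def)
  have "carrier A \<inter> \<Inter>{} \<in> ?\<F>" by blast
  then have ne: "?\<F> \<noteq> {}" by blast
  obtain I where I: "I \<in> ?\<F>" "\<And>I'. I' \<in> ?\<F> \<Longrightarrow> I' \<subseteq> I \<Longrightarrow> I' = I"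
    by (rule dcc_minimal[OF dcc ne]) (use sub in auto)
  then obtain F where F: "finite F" "\<forall>m\<in>F. maximal_submodule A (regular_module A) m" "I = carrier A \<inter> \<Inter>F" by auto
  have "I \<subseteq> m" if m: "maximal_submodule A (regular_module A) m" for m
  proof -
    have "carrier A \<inter> \<Inter>(insert m F) \<in> ?\<F>" using F m by blast
    then have "carrier A \<inter> \<Inter>(insert m F) = I" using F(3) by (intro I(2)) auto
    then show ?thesis by auto
  qed
  then have "I = J" using F by (auto simp: J_eq radical_def)
  then show thesis using that F by blast
qed

text \<open>Semisimplicity of \<open>A/J\<close> in elementwise form. The induction is over finite
  sets \<open>F\<close> of maximal left ideals and shows that every element killed by their
  intersection lies in the socle.\<close>

lemma socle_of_J_ann:
  assumes M: "left_module A M" and x: "x \<in> carrier M" and z: "\<And>c. c \<in> J \<Longrightarrow> c \<odot>\<^bsub>M\<^esub> x = \<zero>\<^bsub>M\<^esub>"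
  shows "x \<in> socle A M"
proof -
  interpret M: left_module A M by fact
  have *: "x \<in> socle A M" if "finite F" "\<And>m. m \<in> F \<Longrightarrow> maximal_submodule A (regular_module A) m" "x \<in> carrier M"
    "\<And>c. c \<in> carrier A \<Longrightarrow> (\<And>m. m \<in> F \<Longrightarrow> c \<in> m) \<Longrightarrow> c \<odot>\<^bsub>M\<^esub> x = \<zero>\<^bsub>M\<^esub>" for F x
    using that
  proof (induction F arbitrary: x rule: finite_induct)
    case empty
    then have "\<one> \<odot>\<^bsub>M\<^esub> x = \<zero>\<^bsub>M\<^esub>" by simp
    then show ?case using empty M.submoduleD(3)[OF socle_submodule[OF M]] by simp
  next
    case (insert m F)
    let ?I = "carrier A \<inter> \<Inter>F"
    have m: "maximal_submodule A (regular_module A) m" using insert by simp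
    then have sm: "submodule m A (regular_module A)" by (simp add: maximal_submodule_def)
    have sI: "submodule ?I A (regular_module A)"
      using reg.submodule_Inter[of "insert (carrier A) F"] insert.prems(1) reg.submodule_carrier 
      by (auto simp: maximal_submodule_def)
    show ?case
    proof (cases "?I \<subseteq> m")
      case True
      show ?thesis
      proof (rule insert.IH[OF insert.prems(1) insert.prems(2)])
        fix c assume "c \<in> carrier A" "\<And>m. m \<in> F \<Longrightarrow> c \<in> m"
        then show "c \<odot>\<^bsub>M\<^esub> x = \<zero>\<^bsub>M\<^esub>" using True by (intro insert.prems(3)) auto
      qed auto
    next
      case False
      have "reg.ssum m ?I = m \<or> reg.ssum m ?I = carrier A"
        using m reg.submodule_ssum[OF sm sI] reg.ssum_upper(1)[OF sm sI] unfolding maximal_submodule_def by simp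
      \<comment> \<open>Comaximality gives 1 = u + v and splits x = u x + v x. For d in
        \<open>m\<close> the product d v = d - d u lies in \<open>m\<close> and in
        \<open>?I\<close>, so \<open>m\<close> kills v x. Symmetrically \<open>?I\<close> kills u x,
        to which the induction hypothesis applies.\<close>
      then have "\<one> \<in> reg.ssum m ?I" using False reg.ssum_upper(2)[OF sm sI] by auto
      then obtain u v where uv: "u \<in> m" "v \<in> ?I" "\<one> = u \<oplus> v" by (auto simp: reg.ssum_def)
      have c: "u \<in> carrier A" "v \<in> carrier A" using uv reg.submoduleD(2)[OF sm] by auto
      have sF: "submodule m' A (regular_module A)" if "m' \<in> F" for m'
        using insert.prems(1) that by (simp add: maximal_submodule_def)
      have "\<one> \<ominus> u = (v \<oplus> u) \<ominus> u" using c by (simp add: uv(3) a_comm)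
      also have "\<dots> = v" using c by (simp add: a_minus_def a_assoc r_neg)
      finally have v1: "v = \<one> \<ominus> u" ..
      have "\<one> \<ominus> v = (u \<oplus> v) \<ominus> v" by (simp add: uv(3))
      also have "\<dots> = u" using c by (simp add: a_minus_def a_assoc r_neg)
      finally have ve: "v = \<one> \<ominus> u" "u = \<one> \<ominus> v" using v1 by auto
      have v: "v \<odot>\<^bsub>M\<^esub> x \<in> socle A M"
      proof (rule socle_of_maximal_ann[OF M _ m])
        fix d assume d: "d \<in> m"
        then have dc: "d \<in> carrier A" using reg.submoduleD(2)[OF sm] by simp
        have "(d \<otimes> v) \<odot>\<^bsub>M\<^esub> x = \<zero>\<^bsub>M\<^esub>"
        proof (rule insert.prems(3))
          show "d \<otimes> v \<in> carrier A" using c dc by simp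
          fix m' assume "m' \<in> insert m F"
          moreover have "d \<otimes> v \<in> m" 
          proof -
            have "d \<otimes> v = d \<ominus> d \<otimes> u" using c dc by (simp add: ve(1) a_minus_def r_distr r_minus)
            moreover have "d \<otimes> u \<in> m" using reg.submoduleD(5)[OF sm, of d u] dc uv by simp
            ultimately show ?thesis using reg.submoduleD(7)[OF sm d, of "d \<otimes> u"] by simp
          qed
          moreover have "d \<otimes> v \<in> m'" if "m' \<in> F" using reg.submoduleD(5)[OF sF[OF that], of d v] dc uv that by simp
          ultimately show "d \<otimes> v \<in> m'" by auto
        qed
        then show "d \<odot>\<^bsub>M\<^esub> (v \<odot>\<^bsub>M\<^esub> x) = \<zero>\<^bsub>M\<^esub>" using c dc insert.prems(2) by (simp add: M.smult_assoc)
      qed (use c insert.prems(2) in simp)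
      have u: "u \<odot>\<^bsub>M\<^esub> x \<in> socle A M"
      proof (rule insert.IH)
        fix d assume d: "d \<in> carrier A" "\<And>m'. m' \<in> F \<Longrightarrow> d \<in> m'"
        have "(d \<otimes> u) \<odot>\<^bsub>M\<^esub> x = \<zero>\<^bsub>M\<^esub>"
        proof (rule insert.prems(3))
          show "d \<otimes> u \<in> carrier A" using c d by simp
          fix m' assume "m' \<in> insert m F"
          moreover have "d \<otimes> u \<in> m" using reg.submoduleD(5)[OF sm, of d u] d uv by simp
          moreover have "d \<otimes> u \<in> m'" if "m' \<in> F"
          proof -
            have "d \<otimes> u = d \<ominus> d \<otimes> v" using c d by (simp add: ve(2) a_minus_def r_distr r_minus)
            moreover have "d \<otimes> v \<in> m'" using reg.submoduleD(5)[OF sF[OF that], of d v] d uv that by simp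
            ultimately show ?thesis using reg.submoduleD(7)[OF sF[OF that], of d "d \<otimes> v"] d(2)[OF that]
              by simp
          qed
          ultimately show "d \<otimes> u \<in> m'" by auto
        qed
        then show "d \<odot>\<^bsub>M\<^esub> (u \<odot>\<^bsub>M\<^esub> x) = \<zero>\<^bsub>M\<^esub>" using c d insert.prems(2) by (simp add: M.smult_assoc)
      qed (use c insert.prems in auto)
      have "x = u \<odot>\<^bsub>M\<^esub> x \<oplus>\<^bsub>M\<^esub> v \<odot>\<^bsub>M\<^esub> x"
        using insert.prems(2) c by (simp flip: M.smult_l_distr uv(3))
      then show ?thesis using M.submoduleD(4)[OF socle_submodule[OF M] u v] by simp
    qed
  qed
  obtain F where F: "finite F" "\<And>m. m \<in> F \<Longrightarrow> maximal_submodule A (regular_module A) m" "carrier A \<inter> \<Inter>F = J"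
    by (rule J_finite_Inter) blast
  show ?thesis by (rule *[OF F(1,2) x]) (use F(3) z in blast)+
qed

lemma J_ann_submodule:
  assumes M: "left_module A M"
  shows "submodule {x \<in> carrier M. \<forall>c\<in>Jpow A t. c \<odot>\<^bsub>M\<^esub> x = \<zero>\<^bsub>M\<^esub>} A M"
proof -
  interpret M: left_module A M by fact
  show ?thesis
    by (rule M.lsubmoduleI) (auto simp: Jpow_closed M.smult_r_distr Jpow_ideal simp flip: M.smult_assoc)
qed

text \<open>A simple module has radical zero, so functoriality of the radical along an orbit map
  makes \<open>J\<close> kill it. The other inclusion is \<open>socle_of_J_ann\<close>.\<close>

lemma socle_eq: 
  assumes M: "left_module A M"
  shows "socle A M = {x \<in> carrier M. \<forall>c\<in>J. c \<odot>\<^bsub>M\<^esub> x = \<zero>\<^bsub>M\<^esub>}"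
proof -
  interpret M: left_module A M by fact
  have "c \<odot>\<^bsub>M\<^esub> x = \<zero>\<^bsub>M\<^esub>" if S: "submodule S A M" "simple_module A (msub M S)" "x \<in> S" and c: "c \<in> J" for S x c
  proof -
    interpret S: left_module A "msub M S" by (rule M.left_module_msub[OF S(1)])
    have "maximal_submodule A (msub M S) {\<zero>\<^bsub>M\<^esub>}"
      using S(2) S.submodule_zero by (auto simp: maximal_submodule_def simple_module_def nonzero_module_def)
    then have r: "radical A (msub M S) \<subseteq> {\<zero>\<^bsub>M\<^esub>}" by (auto simp: radical_def)
    have "lmap A (regular_module A) (msub M S) (\<lambda>a. a \<odot>\<^bsub>M\<^esub> x)"
      using lmap_orbit[OF S.left_module_axioms, of x] S(3) by simp
    from radical_lmap[OF this c[unfolded J_eq]] show ?thesis using r by auto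
  qed
  then have "socle A M \<subseteq> {x \<in> carrier M. \<forall>c\<in>J. c \<odot>\<^bsub>M\<^esub> x = \<zero>\<^bsub>M\<^esub>}"
    unfolding socle_def by (intro M.mspan_least J_ann_submodule[OF M]) (auto dest: M.submoduleD)
  then show ?thesis using socle_of_J_ann[OF M] by auto
qed

text \<open>If \<open>N\<close> is maximal among the submodules containing \<open>J M\<close> and avoiding \<open>x\<close>, then \<open>M/N\<close> is
  semisimple and all its nonzero submodules contain the class of \<open>x\<close>, so it is simple.\<close>

lemma radical_le:
  assumes M: "left_module A M" and S: "submodule S A M" and J: "\<And>c y. c \<in> J \<Longrightarrow> y \<in> carrier M \<Longrightarrow> c \<odot>\<^bsub>M\<^esub> y \<in> S"
  shows "radical A M \<subseteq> S"
proof (rule subsetI, rule ccontr)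
  interpret M: left_module A M by fact
  fix x assume x: "x \<in> radical A M" and "x \<notin> S"
  have xc: "x \<in> carrier M" using x by (simp add: radical_def)
  obtain N where N: "submodule N A M" "S \<subseteq> N" "x \<notin> N"
    and max: "\<And>H. submodule H A M \<Longrightarrow> N \<subseteq> H \<Longrightarrow> x \<notin> H \<Longrightarrow> H = N"
    by (rule M.maximal_avoiding[OF S \<open>x \<notin> S\<close>]) blast
  let ?V = "quot_module M N" and ?\<pi> = "\<lambda>x. N +>\<^bsub>M\<^esub> x"
  interpret pi: lmap A M ?V ?\<pi> by (rule M.lmap_quot[OF N(1)])
  note zero = M.quot_simps(2)[OF N(1)] and coset0 = M.coset_eq_zero_iff[OF N(1)]
  have ess: "?\<pi> x \<in> H" if H: "submodule H A ?V" "H \<noteq> {\<zero>\<^bsub>?V\<^esub>}" for H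
  proof (rule ccontr)
    assume no: "?\<pi> x \<notin> H"
    have "?\<pi> y \<in> H" if "y \<in> N" for y
    proof -
      have "?\<pi> y = N" using that M.submoduleD(2)[OF N(1) that] coset0 by blast
      then show ?thesis using pi.cod.submoduleD(3)[OF H(1)] by (simp add: zero)
    qed
    then have "{y \<in> carrier M. ?\<pi> y \<in> H} = N"
      using no M.submoduleD(2)[OF N(1)] by (intro max pi.vimage_submodule[OF H(1)]) auto
    then have "H \<subseteq> {N}" using pi.cod.submoduleD(1)[OF H(1)] coset0 by (auto simp: M.quot_simps(1)[OF N(1)])
    then show False using H pi.cod.submoduleD(3)[OF H(1)] by (auto simp: zero)
  qed
  let ?C = "(\<lambda>a. a \<odot>\<^bsub>?V\<^esub> ?\<pi> x) ` carrier A"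
  have px: "?\<pi> x \<in> carrier ?V" using xc by simp
  have C: "submodule ?C A ?V" 
    using lmap.image_submodule[OF lmap_orbit[OF pi.cod.left_module_axioms px] reg.submodule_carrier] by simp
  have xC: "?\<pi> x \<in> ?C" using px by (intro image_eqI[of _ _ \<one>]) auto
  have xne: "?\<pi> x \<noteq> \<zero>\<^bsub>?V\<^esub>" using coset0[OF xc] N(3) by (simp add: zero)
  have inC: "S' \<subseteq> ?C" if S': "submodule S' A ?V" "simple_module A (msub ?V S')" for S'
  proof -
    have "S' \<noteq> {\<zero>\<^bsub>?V\<^esub>}" using S'(2) by (auto simp: simple_module_def nonzero_module_def)
    then have "?\<pi> x \<in> S'" by (rule ess[OF S'(1)])
    then have "?C \<subseteq> S'" using pi.cod.submoduleD(5)[OF S'(1)] by blast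
    then have "submodule ?C A (msub ?V S')" using C by (simp add: pi.cod.submodule_msub[OF S'(1)])
    then have "?C = {\<zero>\<^bsub>?V\<^esub>} \<or> ?C = S'" using S'(2) unfolding simple_module_def by simp
    then show ?thesis using xC xne by auto
  qed
  have "y \<in> ?C" if y: "y \<in> carrier ?V" for y
  proof -
    have "c \<odot>\<^bsub>?V\<^esub> y = \<zero>\<^bsub>?V\<^esub>" if c: "c \<in> J" for c
    proof -
      obtain z where z: "z \<in> carrier M" "y = ?\<pi> z" using y by (auto simp: M.quot_simps(1)[OF N(1)])
      have "c \<odot>\<^bsub>M\<^esub> z \<in> N" using J[OF c z(1)] N(2) by auto
      then show ?thesis using z c Jpow_closed[OF c] coset0[of "c \<odot>\<^bsub>M\<^esub> z"] M.quot_smult[OF N(1)] by (simp add: zero)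
    qed
    then have "y \<in> socle A ?V" using socle_of_J_ann[OF pi.cod.left_module_axioms y] by blast
    also have "socle A ?V \<subseteq> ?C" unfolding socle_def by (rule pi.cod.mspan_least[OF C]) (use inC in auto)
    finally show ?thesis .
  qed
  then have all: "carrier ?V = ?C" using pi.cod.submoduleD(1)[OF C] by auto
  have "H = {\<zero>\<^bsub>?V\<^esub>} \<or> H = carrier ?V" if H: "submodule H A ?V" for H
  proof (cases "H = {\<zero>\<^bsub>?V\<^esub>}")
    case False
    then have "?\<pi> x \<in> H" by (rule ess[OF H])
    then have "?C \<subseteq> H" using pi.cod.submoduleD(5)[OF H] by blast
    then show ?thesis using all pi.cod.submoduleD(1)[OF H] by auto
  qed simp
  then have "simple_module A ?V"
    using xne px by (auto simp: simple_module_def nonzero_module_def pi.cod.left_module_axioms)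
  then have "maximal_submodule A M N" using M.maximal_iff_simple_quot[OF N(1)] by simp
  then show False using x N(3) by (auto simp: radical_def)
qed

text \<open>The harder half of Rad^t M = J^t M, phrased as a bound so that the submodule generated
  by J^t M need not be named. In the induction step the elements that \<open>J\<close> carries into
  \<open>S\<close> form a submodule which satisfies the hypothesis for \<open>t\<close>.\<close>

lemma rad_series_le:
  assumes M: "left_module A M" and S: "submodule S A M"
    and J: "\<And>c y. c \<in> Jpow A t \<Longrightarrow> y \<in> carrier M \<Longrightarrow> c \<odot>\<^bsub>M\<^esub> y \<in> S"
  shows "rad_series A M t \<subseteq> S"
  using S J
proof (induction t arbitrary: S)
  case 0
  interpret M: left_module A M by fact
  show ?case using 0(2)[of \<one>] by auto
next
  case (Suc t)
  interpret M: left_module A M by fact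
  let ?U = "rad_series A M t" and ?S' = "{y \<in> carrier M. \<forall>d\<in>J. d \<odot>\<^bsub>M\<^esub> y \<in> S}"
  have U: "submodule ?U A M" by (rule M.rad_series_submodule)
  have "submodule ?S' A M"
    by (rule M.lsubmoduleI) (auto simp: Jpow_closed M.smult_r_distr Jpow_ideal M.submoduleD[OF Suc.prems(1)] simp flip: M.smult_assoc)
  moreover have "c \<odot>\<^bsub>M\<^esub> y \<in> ?S'" if c: "c \<in> Jpow A t" "y \<in> carrier M" for c y
  proof -
    have "d \<odot>\<^bsub>M\<^esub> (c \<odot>\<^bsub>M\<^esub> y) \<in> S" if d: "d \<in> J" for d
      using Suc.prems(2)[of "d \<otimes> c" y] Jpow_mult[OF d c(1)] c d by (simp add: M.smult_assoc Jpow_closed)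
    then show ?thesis using c by (simp add: Jpow_closed)
  qed
  ultimately have sub: "?U \<subseteq> ?S'" by (rule Suc.IH)
  have "radical A (msub M ?U) \<subseteq> S \<inter> ?U"
  proof (rule radical_le[OF M.left_module_msub[OF U]])
    show "submodule (S \<inter> ?U) A (msub M ?U)"
      by (simp add: M.submodule_msub[OF U] M.submodule_Int Suc.prems(1) U)
    fix c y assume "c \<in> J" "y \<in> carrier (msub M ?U)"
    then show "c \<odot>\<^bsub>msub M ?U\<^esub> y \<in> S \<inter> ?U" using sub M.submoduleD(5)[OF U] Jpow_closed by auto
  qed
  then show ?case by simp
qed

text \<open>Functoriality gives one inclusion. For the other, c f(x) = f(c x) shows that the image
  of the radical term contains all products of J^t with elements of \<open>N\<close>.\<close>

lemma rad_series_surj: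
  assumes f: "lmap A M N f" "f ` carrier M = carrier N"
  shows "f ` rad_series A M t = rad_series A N t"
proof
  interpret f: lmap A M N f by fact
  show "f ` rad_series A M t \<subseteq> rad_series A N t" using rad_series_lmap[OF f(1)] by auto
  show "rad_series A N t \<subseteq> f ` rad_series A M t"
  proof (rule rad_series_le[OF f.cod.left_module_axioms f.image_submodule[OF f.dom.rad_series_submodule]])
    fix c y assume c: "c \<in> Jpow A t" and "y \<in> carrier N"
    then obtain x where x: "x \<in> carrier M" "y = f x" using f(2) by auto
    then have "c \<odot>\<^bsub>N\<^esub> y = f (c \<odot>\<^bsub>M\<^esub> x)" using c by (simp add: f.smult Jpow_closed)
    then show "c \<odot>\<^bsub>N\<^esub> y \<in> f ` rad_series A M t"
      using Jpow_smult[OF f.dom.left_module_axioms c, of x 0] x by simp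
  qed
qed

text \<open>Replaces J^(s+t) = J^s J^t. The left ideal J^(s+t) is the \<open>s\<close>-th radical
  term of J^t, and by \<open>rad_series_le\<close> it lies in any left ideal inside J^t that
  contains the products, here the part of J^t that kills \<open>x\<close>.\<close>

lemma Jpow_ann_add:
  assumes M: "left_module A M" and x: "x \<in> carrier M"
  shows "(\<forall>c\<in>Jpow A (s + t). c \<odot>\<^bsub>M\<^esub> x = \<zero>\<^bsub>M\<^esub>) \<longleftrightarrow> (\<forall>c\<in>Jpow A s. \<forall>d\<in>Jpow A t. c \<odot>\<^bsub>M\<^esub> (d \<odot>\<^bsub>M\<^esub> x) = \<zero>\<^bsub>M\<^esub>)"
    (is "?l \<longleftrightarrow> ?r")
proof
  interpret M: left_module A M by fact
  show ?r if ?l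
    using that Jpow_mult x by (simp add: add.commute Jpow_closed flip: M.smult_assoc)
  assume r: ?r
  let ?I = "{c \<in> carrier A. c \<odot>\<^bsub>M\<^esub> x = \<zero>\<^bsub>M\<^esub>}"
  note s = reg.rad_series_submodule[of t]
  have "rad_series A (msub (regular_module A) (Jpow A t)) s \<subseteq> ?I \<inter> Jpow A t"
  proof (rule rad_series_le)
    show "left_module A (msub (regular_module A) (Jpow A t))" by (rule reg.left_module_msub[OF Jpow_submodule])
    show "submodule (?I \<inter> Jpow A t) A (msub (regular_module A) (Jpow A t))"
      by (simp add: reg.submodule_msub[OF Jpow_submodule] reg.submodule_Int ann_submodule[OF M x] Jpow_submodule)
    fix c y assume "c \<in> Jpow A s" "y \<in> carrier (msub (regular_module A) (Jpow A t))"
    then show "c \<odot>\<^bsub>msub (regular_module A) (Jpow A t)\<^esub> y \<in> ?I \<inter> Jpow A t"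
      using r x by (auto simp: Jpow_closed M.smult_assoc Jpow_ideal)
  qed
  also have "rad_series A (msub (regular_module A) (Jpow A t)) s = Jpow A (s + t)"
    by (simp add: Jpow_def reg.rad_series_add[symmetric] add.commute)
  finally show ?l by blast
qed

text \<open>Induction with \<open>socle_eq\<close> for the quotient by the preceding term. From here
  on socle terms are treated as annihilators, which makes them functorial and turns rigidity into a
  statement about powers of \<open>J\<close>.\<close>

lemma soc_series_eq:
  assumes M: "left_module A M"
  shows "soc_series A M t = {x \<in> carrier M. \<forall>c\<in>Jpow A t. c \<odot>\<^bsub>M\<^esub> x = \<zero>\<^bsub>M\<^esub>}"
proof (induction t)
  case 0
  interpret M: left_module A M by fact
  have "x = \<zero>\<^bsub>M\<^esub>" if "x \<in> carrier M" "\<forall>c\<in>carrier A. c \<odot>\<^bsub>M\<^esub> x = \<zero>\<^bsub>M\<^esub>" for x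
    using that(2)[rule_format, of \<one>] that(1) by simp
  then show ?case by auto
next
  case (Suc t)
  interpret M: left_module A M by fact
  let ?S = "soc_series A M t"
  have S: "submodule ?S A M" using J_ann_submodule[OF M] by (simp add: Suc)
  have "x \<in> soc_series A M (Suc t) \<longleftrightarrow> (\<forall>c\<in>Jpow A (Suc t). c \<odot>\<^bsub>M\<^esub> x = \<zero>\<^bsub>M\<^esub>)" if x: "x \<in> carrier M" for x
  proof -
    have "x \<in> soc_series A M (Suc t) \<longleftrightarrow> (\<forall>d\<in>J. ?S +>\<^bsub>M\<^esub> (d \<odot>\<^bsub>M\<^esub> x) = ?S)"
      using x by (simp add: socle_eq[OF M.left_module_quot[OF S]] M.quot_simps[OF S] M.quot_smult[OF S] Jpow_closed)
    also have "\<dots> \<longleftrightarrow> (\<forall>d\<in>J. d \<odot>\<^bsub>M\<^esub> x \<in> ?S)"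
      using x by (simp add: M.coset_eq_zero_iff[OF S] Jpow_closed)
    also have "\<dots> \<longleftrightarrow> (\<forall>c\<in>Jpow A t. \<forall>d\<in>J. c \<odot>\<^bsub>M\<^esub> (d \<odot>\<^bsub>M\<^esub> x) = \<zero>\<^bsub>M\<^esub>)"
      unfolding Suc using x by (auto simp: Jpow_closed)
    finally show ?thesis using Jpow_ann_add[OF M x, of t 1] by simp
  qed
  then show ?case by auto
qed

text \<open>The powers become stable at some J^m. If it is non-zero, a left ideal minimal among
  those not annihilated by J^m contains an element with a = j a and j in \<open>J\<close>, and
  invertibility of 1 - j makes it zero.\<close>

lemma J_nilpotent: "\<exists>m. Jpow A m = {\<zero>}"
proof -
  have "Jpow A 0 \<in> range (Jpow A)" by blast
  then have ne: "range (Jpow A) \<noteq> {}" by blast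
  obtain I where "I \<in> range (Jpow A)" "\<And>I'. I' \<in> range (Jpow A) \<Longrightarrow> I' \<subseteq> I \<Longrightarrow> I' = I"
    by (rule dcc_minimal[OF dcc ne]) (auto intro: Jpow_submodule)
  then obtain m where m: "Jpow A (Suc m) = Jpow A m" using Jpow_mono[of _ "Suc _"] by (metis le_SucI order_refl rangeE rangeI)
  have "Jpow A m = {\<zero>}"
  proof (rule ccontr)
    assume "Jpow A m \<noteq> {\<zero>}"
    then obtain c where c: "c \<in> Jpow A m" "c \<noteq> \<zero>" using reg.submoduleD(3)[OF Jpow_submodule, of m] by auto
    let ?\<A> = "{\<aa>. submodule \<aa> A (regular_module A) \<and> (\<exists>c\<in>Jpow A m. \<exists>a\<in>\<aa>. c \<otimes> a \<noteq> \<zero>)}"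
    have "c \<otimes> \<one> \<noteq> \<zero>" using c Jpow_closed[OF c(1)] by simp
    then have "carrier A \<in> ?\<A>" using c(1) one_closed reg.submodule_carrier unfolding regular_simps by blast
    then have ne: "?\<A> \<noteq> {}" by blast
    obtain \<aa> where \<aa>: "\<aa> \<in> ?\<A>" "\<And>\<bb>. \<bb> \<in> ?\<A> \<Longrightarrow> \<bb> \<subseteq> \<aa> \<Longrightarrow> \<bb> = \<aa>"
      by (rule dcc_minimal[OF dcc ne]) auto
    then obtain c a where ca: "submodule \<aa> A (regular_module A)" "c \<in> Jpow A m" "a \<in> \<aa>" "c \<otimes> a \<noteq> \<zero>" by auto
    have a: "a \<in> carrier A" using reg.submoduleD(2)[OF ca(1,3)] by simp
    let ?\<bb> = "(\<lambda>j. j \<otimes> a) ` J"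
    have "submodule ?\<bb> A (regular_module A)"
      using lmap.image_submodule[OF lmap_orbit[OF reg.left_module_axioms, of a] Jpow_submodule[of 1]] a by simp
    \<comment> \<open>J^m does not kill J a, because J^(m+1) = J^m does not kill \<open>a\<close>.
      By minimality J a is then the whole ideal and contains \<open>a\<close>.\<close>
    moreover have "\<exists>c\<in>Jpow A m. \<exists>b\<in>?\<bb>. c \<otimes> b \<noteq> \<zero>"
    proof (rule ccontr)
      assume "\<not> ?thesis"
      then have "\<forall>c\<in>Jpow A (m + 1). c \<otimes> a = \<zero>"
        using Jpow_ann_add[OF reg.left_module_axioms, of a m 1] a by auto
      then show False using ca m by auto
    qed
    moreover have "?\<bb> \<subseteq> \<aa>" using reg.submoduleD(5)[OF ca(1) _ ca(3)] Jpow_closed by auto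
    ultimately have "?\<bb> = \<aa>" by (intro \<aa>(2)) auto
    then obtain j where j: "j \<in> J" "a = j \<otimes> a" using ca(3) by auto
    obtain u where u: "u \<in> carrier A" "u \<otimes> (\<one> \<ominus> j) = \<one>" using left_inverse_J[OF j(1)] by auto
    have jc: "j \<in> carrier A" using j by (simp add: Jpow_closed)
    have "a = (u \<otimes> (\<one> \<ominus> j)) \<otimes> a" using u a by simp
    also have "\<dots> = u \<otimes> ((\<one> \<ominus> j) \<otimes> a)" using u(1) a jc by (intro m_assoc) auto
    also have "(\<one> \<ominus> j) \<otimes> a = a \<ominus> j \<otimes> a" using a jc by (simp add: a_minus_def l_distr l_minus)
    also have "\<dots> = \<zero>" using u a j(2) by (simp add: a_minus_def r_neg)
    finally have "a = \<zero>" using u(1) by simp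
    then show False using ca Jpow_closed[OF ca(2)] by simp
  qed
  then show ?thesis ..
qed

definition nil_index :: nat where "nil_index = (SOME m. Jpow A m = {\<zero>})"

lemma Jpow_nil_index: "Jpow A nil_index = {\<zero>}"
  unfolding nil_index_def by (rule someI_ex[OF J_nilpotent])

lemma rad_series_nil: 
  assumes M: "left_module A M"
  shows "rad_series A M nil_index = {\<zero>\<^bsub>M\<^esub>}"
proof -
  interpret M: left_module A M by fact
  have "rad_series A M nil_index \<subseteq> {\<zero>\<^bsub>M\<^esub>}"
    by (rule rad_series_le[OF M]) (auto simp: Jpow_nil_index)
  then show ?thesis using M.submoduleD(3)[OF M.rad_series_submodule] by blast
qed

lemma rad_series_loewy: "left_module A M \<Longrightarrow> rad_series A M (loewy_length A M) = {\<zero>\<^bsub>M\<^esub>}"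
  unfolding loewy_length_def by (rule LeastI[of _ nil_index]) (rule rad_series_nil)

lemma rad_series_less_loewy: "b < loewy_length A M \<Longrightarrow> rad_series A M b \<noteq> {\<zero>\<^bsub>M\<^esub>}"
  unfolding loewy_length_def by (rule not_less_Least)

lemma rad_series_zero_iff:
  assumes M: "left_module A M"
  shows "rad_series A M t = {\<zero>\<^bsub>M\<^esub>} \<longleftrightarrow> (\<forall>c\<in>Jpow A t. \<forall>y\<in>carrier M. c \<odot>\<^bsub>M\<^esub> y = \<zero>\<^bsub>M\<^esub>)"
proof -
  interpret M: left_module A M by fact
  show ?thesis
    using Jpow_smult[OF M, of _ t _ 0] rad_series_le[OF M M.submodule_zero, of t] 
      M.submoduleD(3)[OF M.rad_series_submodule] by auto
qed

lemma soc_series_full_iff: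
  assumes M: "left_module A M"
  shows "soc_series A M t = carrier M \<longleftrightarrow> loewy_length A M \<le> t"
proof -
  interpret M: left_module A M by fact
  have "soc_series A M t = carrier M \<longleftrightarrow> rad_series A M t = {\<zero>\<^bsub>M\<^esub>}"
    unfolding rad_series_zero_iff[OF M] soc_series_eq[OF M] by auto
  also have "\<dots> \<longleftrightarrow> loewy_length A M \<le> t"
    using rad_series_loewy[OF M] rad_series_less_loewy[of t M] M.rad_series_mono[of "loewy_length A M" t]
      M.submoduleD(3)[OF M.rad_series_submodule, of t] by (metis linorder_not_le insert_absorb subset_singletonD insert_not_empty)
  finally show ?thesis .
qed

lemma soc_series_submodule: "left_module A M \<Longrightarrow> submodule (soc_series A M t) A M"
  using J_ann_submodule by (simp add: soc_series_eq)

lemma soc_series_mono: "left_module A M \<Longrightarrow> s \<le> t \<Longrightarrow> soc_series A M s \<subseteq> soc_series A M t"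
  using Jpow_mono by (auto simp: soc_series_eq)

text \<open>Nakayama's lemma for arbitrary modules: otherwise the radical series would be constant,
  whereas nilpotency of \<open>J\<close> makes it end in zero.\<close>

lemma radical_proper:
  assumes M: "left_module A M" and "carrier M \<noteq> {\<zero>\<^bsub>M\<^esub>}"
  shows "radical A M \<noteq> carrier M"
proof
  assume r: "radical A M = carrier M"
  have e: "msub M (carrier M) = M" by (simp add: msub_def)
  have "rad_series A M t = carrier M" for t by (induction t) (simp_all add: r e)
  then show False using rad_series_nil[OF M] assms by simp
qed

text \<open>Hopkins' theorem. Take a left ideal \<open>N\<close> minimal among those with noetherian
  quotient. A non-zero \<open>N\<close> has a maximal submodule \<open>N'\<close> by
  \<open>radical_proper\<close>, and the quotient by \<open>N'\<close> gains just one simple factor,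
  against minimality.\<close>

lemma finlen_regular: "finlen A (regular_module A)"
proof -
  let ?R = "regular_module A"
  let ?\<N> = "{N. submodule N A ?R \<and> chain_cond False A (quot_module ?R N)}"
  have "carrier (quot_module ?R (carrier A)) = {\<zero>\<^bsub>quot_module ?R (carrier A)\<^esub>}"
  proof -
    have c: "submodule (carrier A) A ?R" using reg.submodule_carrier by simp
    have "carrier A +>\<^bsub>?R\<^esub> x = carrier A" if "x \<in> carrier A" for x using reg.coset_eq_zero_iff[OF c, of x] that by simp
    then show ?thesis using zero_closed by (auto simp: reg.quot_simps[OF c] simp del: zero_closed)
  qed
  then have "carrier A \<in> ?\<N>"
    using reg.submodule_carrier reg.left_module_quot[OF reg.submodule_carrier] by (auto intro!: chain_cond_zero)
  then have ne: "?\<N> \<noteq> {}" by blast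
  obtain N where N: "N \<in> ?\<N>" "\<And>N'. N' \<in> ?\<N> \<Longrightarrow> N' \<subseteq> N \<Longrightarrow> N' = N"
    by (rule dcc_minimal[OF dcc ne]) auto
  then have sN: "submodule N A ?R" by auto
  have "N = {\<zero>}"
  proof (rule ccontr)
    assume "N \<noteq> {\<zero>}"
    then have "radical A (msub ?R N) \<noteq> N" using radical_proper[OF reg.left_module_msub[OF sN]] by simp
    then obtain N' where N': "maximal_submodule A (msub ?R N) N'" by (auto simp: radical_def)
    then have sN': "submodule N' A ?R" "N' \<subseteq> N" "N' \<noteq> N" 
      by (auto simp: maximal_submodule_def reg.submodule_msub[OF sN])
    have "simple_module A (subquot ?R N N')" unfolding subquot_def
      using left_module.maximal_iff_simple_quot[OF reg.left_module_msub[OF sN], of N'] N' by (simp add: maximal_submodule_def)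
    then have "chain_cond False A (quot_module ?R N')"
      using N simple_finlen by (intro chain_cond_between[OF reg.left_module_axioms sN sN'(1,2)]) (auto simp: finlen_def)
    then show False using N(2)[of N'] sN' by auto
  qed
  then have c: "chain_cond False A (quot_module ?R {\<zero>})" and s: "submodule {\<zero>} A ?R" using N by auto
  \<comment> \<open>The quotient by zero has another element type than the ring, so the condition is
    pulled back along the injective projection.\<close>
  interpret pi: lmap A ?R "quot_module ?R {\<zero>}" "\<lambda>x. {\<zero>} +>\<^bsub>?R\<^esub> x" by (rule reg.lmap_quot[OF s])
  have "pi.ker = {\<zero>}"
  proof -
    have "x = \<zero>" if "x \<in> carrier A" "{\<zero>} +>\<^bsub>?R\<^esub> x = {\<zero>}" for x
      using reg.coset_eq_zero_iff[OF s, of x] that by simp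
    moreover have "{\<zero>} +>\<^bsub>?R\<^esub> \<zero> = {\<zero>}" using reg.coset_eq_zero_iff[OF s, of \<zero>] by simp
    ultimately show ?thesis unfolding pi.ker_def by (auto simp: reg.quot_simps(2)[OF s])
  qed
  then have "inj_on (\<lambda>x. {\<zero>} +>\<^bsub>?R\<^esub> x) (carrier ?R)" using pi.inj_iff_ker by simp
  then have "chain_cond False A ?R" by (rule chain_cond_inj[OF pi.lmap_axioms' _ c])
  with dcc show ?thesis by (simp add: finlen_def)
qed

lemma fg_iff_finlen: "fg_module A M \<longleftrightarrow> finlen A M"
  using finlen_fg[OF finlen_regular] fg_finlen by blast

end

section \<open>Artin algebras as artinian rings\<close>

lemma artinian_cring_dcc:
  assumes K: "artinian_cring K"
  shows "chain_cond True K (regular_module K)"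
proof -
  interpret cring K using K by (simp add: artinian_cring_def)
  interpret reg: left_module K "regular_module K" by (rule left_module_regular) (rule ring_axioms)
  have id: "ideal I K" if "submodule I K (regular_module K)" for I
  proof -
    note d = reg.submoduleD[OF that]
    have "\<ominus>\<^bsub>K\<^esub> a \<in> I" if "a \<in> I" for a
    proof -
      have "a \<in> carrier K" using d that by auto
      then have "\<ominus>\<^bsub>K\<^esub> a = (\<ominus>\<^bsub>K\<^esub> \<one>\<^bsub>K\<^esub>) \<otimes>\<^bsub>K\<^esub> a" by (simp add: l_minus)
      then show ?thesis using d(5)[of "\<ominus>\<^bsub>K\<^esub> \<one>\<^bsub>K\<^esub>" a] that by simp
    qed
    then have "subgroup I (add_monoid K)"
      by (intro add.subgroupI) (use d in \<open>auto simp flip: a_inv_def\<close>)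
    moreover have "a \<otimes>\<^bsub>K\<^esub> x \<in> I" "x \<otimes>\<^bsub>K\<^esub> a \<in> I" if "a \<in> I" "x \<in> carrier K" for a x
      using d(5)[of x a] d(2)[of a] that m_comm[of a x] by simp_all
    ultimately show ?thesis by (intro idealI ring_axioms) auto
  qed
  have "wf (sub_rel True K (regular_module K))" unfolding wf_iff_no_infinite_down_chain
  proof
    assume "\<exists>F. \<forall>i. (F (Suc i), F i) \<in> sub_rel True K (regular_module K)"
    then obtain F where F: "\<And>i. (F (Suc i), F i) \<in> sub_rel True K (regular_module K)" by blast
    then have "\<forall>i. ideal (F i) K \<and> F (Suc i) \<subseteq> F i" using id unfolding sub_rel_def by (simp add: psubset_imp_subset)
    then obtain m where "\<forall>i\<ge>m. F i = F m" using K unfolding artinian_cring_def by blast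
    then have "F (Suc m) = F m" by (metis le_SucI order_refl)
    with F[of m] show False by (simp add: sub_rel_def)
  qed
  then show ?thesis by (simp add: chain_cond_def reg.left_module_axioms)
qed

locale artin_alg =
  fixes C :: "('c, 'd) ring_scheme" and A :: "('a, 'e) ring_scheme" and \<gamma> :: "'c \<Rightarrow> 'a"
  assumes artin: "artin_algebra C A \<gamma>"
begin

sublocale scalars C A \<gamma>
  using artin by (intro scalars.intro ring_hom_ring.intro ring_hom_ring_axioms.intro)
    (auto simp: artin_algebra_def artinian_cring_def cring_def)

lemma central: "c \<in> carrier C \<Longrightarrow> a \<in> carrier A \<Longrightarrow> \<gamma> c \<otimes>\<^bsub>A\<^esub> a = a \<otimes>\<^bsub>A\<^esub> \<gamma> c"
  using artin by (simp add: artin_algebra_def)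

lemma artin_ring_C: "artin_ring C"
  using artinian_cring_dcc[of C] artin \<gamma>.R.ring_axioms
  by (intro artin_ring.intro artin_ring_axioms.intro) (simp_all add: artin_algebra_def)

lemma finlen_restr_regular: "finlen C (restr (regular_module A))"
  by (rule finlen_fg[OF artin_ring.finlen_regular[OF artin_ring_C]]) (use artin in \<open>simp add: artin_algebra_def\<close>)

lemma artin_ring_A: "artin_ring A"
  using chain_cond_of_restr[OF left_module_regular[OF \<gamma>.S.ring_axioms]] finlen_restr_regular
  by (intro artin_ring.intro artin_ring_axioms.intro \<gamma>.S.ring_axioms) (simp add: finlen_def)

lemma finlen_restr: "fg_module A M \<Longrightarrow> finlen C (restr M)"
  using chain_cond_restr finlen_restr_regular by (auto simp: finlen_def)

end

section \<open>Direct sums\<close>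

definition single :: "'i set \<Rightarrow> ('i \<Rightarrow> ('a, 'v) module) \<Rightarrow> 'i \<Rightarrow> 'v \<Rightarrow> 'i \<Rightarrow> 'v" where
  "single I M i x = (\<lambda>j\<in>I. if j = i then x else \<zero>\<^bsub>M j\<^esub>)"

lemma dir_sum_simps:
  "carrier (dir_sum I M) = (\<Pi>\<^sub>E i\<in>I. carrier (M i))" "\<zero>\<^bsub>dir_sum I M\<^esub> = (\<lambda>i\<in>I. \<zero>\<^bsub>M i\<^esub>)"
  "f \<oplus>\<^bsub>dir_sum I M\<^esub> g = (\<lambda>i\<in>I. f i \<oplus>\<^bsub>M i\<^esub> g i)"
  "a \<odot>\<^bsub>dir_sum I M\<^esub> f = (\<lambda>i\<in>I. a \<odot>\<^bsub>M i\<^esub> f i)"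
  by (simp_all add: dir_sum_def)

locale module_family =
  fixes R :: "('a, 'e) ring_scheme" and I :: "'i set" and M :: "'i \<Rightarrow> ('a, 'v) module"
  assumes ring: "ring R" and lm: "i \<in> I \<Longrightarrow> left_module R (M i)"
begin

abbreviation "S \<equiv> dir_sum I M"

lemma left_module_dir_sum: "left_module R S"
proof -
  have ab: "abelian_group (M i)" if "i \<in> I" for i using lm[OF that] by (simp add: left_module_def)
  note mon = abelian_group.axioms(1)[OF ab]
  have "abelian_group S"
  proof (rule abelian_groupI)
    fix x y z assume xyz: "x \<in> carrier S" "y \<in> carrier S" "z \<in> carrier S"
    show "x \<oplus>\<^bsub>S\<^esub> y \<oplus>\<^bsub>S\<^esub> z = x \<oplus>\<^bsub>S\<^esub> (y \<oplus>\<^bsub>S\<^esub> z)"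
      using xyz by (intro ext) (auto simp: dir_sum_simps intro!: abelian_monoid.a_assoc[OF mon])
    show "x \<oplus>\<^bsub>S\<^esub> y = y \<oplus>\<^bsub>S\<^esub> x"
      using xyz by (intro ext) (auto simp: dir_sum_simps intro!: abelian_monoid.a_comm[OF mon])
    show "\<zero>\<^bsub>S\<^esub> \<oplus>\<^bsub>S\<^esub> x = x"
      using xyz by (intro ext) (auto simp: dir_sum_simps PiE_def Pi_iff extensional_def abelian_monoid.l_zero[OF mon])
    have "(\<lambda>i\<in>I. \<ominus>\<^bsub>M i\<^esub> x i) \<oplus>\<^bsub>S\<^esub> x = \<zero>\<^bsub>S\<^esub>"
      using xyz by (intro ext) (auto simp: dir_sum_simps intro!: abelian_group.l_neg[OF ab])
    moreover have "(\<lambda>i\<in>I. \<ominus>\<^bsub>M i\<^esub> x i) \<in> carrier S"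
      using xyz by (auto simp: dir_sum_simps intro!: abelian_group.a_inv_closed[OF ab])
    ultimately show "\<exists>y\<in>carrier S. y \<oplus>\<^bsub>S\<^esub> x = \<zero>\<^bsub>S\<^esub>" by blast
  qed (auto simp: dir_sum_simps PiE_iff intro!: abelian_monoid.a_closed[OF mon] abelian_monoid.zero_closed[OF mon])
  then show ?thesis
    by (intro left_module.intro left_module_axioms.intro ring)
      (auto simp: dir_sum_simps PiE_iff extensional_def fun_eq_iff ring.ring_simprules[OF ring] left_module.smult_closed[OF lm] 
        left_module.smult_l_distr[OF lm] left_module.smult_r_distr[OF lm] 
        left_module.smult_assoc[OF lm] left_module.smult_one[OF lm])
qed

sublocale S: left_module R S by (rule left_module_dir_sum)

lemma component_closed: "x \<in> carrier S \<Longrightarrow> i \<in> I \<Longrightarrow> x i \<in> carrier (M i)"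
  by (auto simp: dir_sum_simps)

lemma lmap_component: "i \<in> I \<Longrightarrow> lmap R S (M i) (\<lambda>x. x i)"
  by (rule lmapI[OF left_module_dir_sum lm]) (auto simp: dir_sum_simps)

lemma lmap_tuple:
  assumes X: "left_module R X" and f: "\<And>i. i \<in> I \<Longrightarrow> lmap R X (M i) (f i)"
  shows "lmap R X S (\<lambda>x. \<lambda>i\<in>I. f i x)"
  by (rule lmapI[OF X left_module_dir_sum])
    (auto simp: dir_sum_simps lmap.closed[OF f] lmap.add[OF f] lmap.smult[OF f] intro!: restrict_ext)

lemma lmap_single:
  assumes "i \<in> I"
  shows "lmap R (M i) S (single I M i)"
proof -
  have "lmap R (M i) (M j) (\<lambda>x. if j = i then x else \<zero>\<^bsub>M j\<^esub>)" if "j \<in> I" for j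
    using lmap_id[OF lm[OF that]] lmap_const0[OF lm[OF assms] lm[OF that]] by (cases "j = i") auto
  from lmap_tuple[OF lm[OF assms], of "\<lambda>j x. if j = i then x else \<zero>\<^bsub>M j\<^esub>", OF this]
  show ?thesis unfolding single_def by simp
qed

lemma single_apply: "j \<in> I \<Longrightarrow> single I M i x j = (if j = i then x else \<zero>\<^bsub>M j\<^esub>)"
  by (simp add: single_def)

text \<open>Induction over truncations of \<open>x\<close> to finite sets of coordinates takes the
  place of writing \<open>x\<close> as a finite sum of its components.\<close>

lemma dir_sum_trunc:
  assumes "finite F" "F \<subseteq> I" and N: "submodule N R S" and x: "x \<in> carrier S"
    and s: "\<And>i. i \<in> I \<Longrightarrow> single I M i (x i) \<in> N"
  shows "(\<lambda>j\<in>I. if j \<in> F then x j else \<zero>\<^bsub>M j\<^esub>) \<in> N"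
  using assms(1,2)
proof (induction F rule: finite_induct)
  case empty
  then show ?case using S.submoduleD(3)[OF N] by (simp add: dir_sum_simps restrict_def)
next
  case (insert i F)
  have ab: "abelian_group (M j)" if "j \<in> I" for j using lm[OF that] by (simp add: left_module_def)
  note mon = abelian_group.axioms(1)[OF ab]
  have IH: "(\<lambda>j\<in>I. if j \<in> F then x j else \<zero>\<^bsub>M j\<^esub>) \<in> N" by (rule insert.IH) (use insert.prems in auto)
  have "single I M i (x i) \<in> N" using insert.prems by (intro s) auto
  note S.submoduleD(4)[OF N IH this]
  also have "(\<lambda>j\<in>I. if j \<in> F then x j else \<zero>\<^bsub>M j\<^esub>) \<oplus>\<^bsub>S\<^esub> single I M i (x i)
      = (\<lambda>j\<in>I. if j \<in> insert i F then x j else \<zero>\<^bsub>M j\<^esub>)"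
    using insert(2,4) component_closed[OF x]
    by (intro ext) (auto simp: dir_sum_simps single_def abelian_monoid.l_zero[OF mon] abelian_monoid.r_zero[OF mon]
      abelian_monoid.zero_closed[OF mon])
  finally show ?case .
qed

lemma dir_sum_mem:
  assumes fin: "finite I" and N: "submodule N R S" and x: "x \<in> carrier S"
    and s: "\<And>i. i \<in> I \<Longrightarrow> single I M i (x i) \<in> N"
  shows "x \<in> N"
proof -
  have "(\<lambda>j\<in>I. if j \<in> I then x j else \<zero>\<^bsub>M j\<^esub>) \<in> N" by (rule dir_sum_trunc[OF fin order_refl N x s])
  also have "(\<lambda>j\<in>I. if j \<in> I then x j else \<zero>\<^bsub>M j\<^esub>) = x"
    using x by (auto simp: dir_sum_simps PiE_def extensional_def fun_eq_iff)
  finally show ?thesis .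
qed

end

text \<open>The kernel of one coordinate embeds into the direct sum over the remaining
  indices.\<close>

lemma finlen_dir_sum:
  assumes "finite I" "ring R" "\<And>i. i \<in> I \<Longrightarrow> finlen R (M i)"
  shows "finlen R (dir_sum I M)"
  using assms(1,3)
proof (induction I rule: finite_induct)
  case empty
  interpret module_family R "{}" M by (rule module_family.intro[OF assms(2)]) simp
  show ?case unfolding finlen_def
    by (intro conjI chain_cond_zero left_module_dir_sum) (auto simp: dir_sum_simps)
next
  case (insert i I)
  have lm: "left_module R (M j)" if "j \<in> insert i I" for j
    by (rule finlen_left_module[OF insert.prems[OF that]])
  interpret f: module_family R "insert i I" M 
    by (rule module_family.intro[OF assms(2) lm])
  interpret g: module_family R I M 
    by (rule module_family.intro[OF assms(2) lm]) simp
  have p: "lmap R f.S (M i) (\<lambda>x. x i)" by (rule f.lmap_component) simp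
  interpret p: lmap R f.S "M i" "\<lambda>x. x i" by (rule p)
  have r: "lmap R (msub f.S p.ker) g.S (\<lambda>x. \<lambda>j\<in>I. x j)"
    using g.lmap_tuple[OF f.S.left_module_msub[OF p.ker_submodule], of "\<lambda>j x. x j"]
      lmap_msub_dom[OF f.lmap_component p.ker_submodule] by simp
  have "finlen R (msub f.S p.ker)"
  proof (rule finlen_inj[OF r])
    show "inj_on (\<lambda>x. \<lambda>j\<in>I. x j) (carrier (msub f.S p.ker))"
    proof (rule inj_onI)
      fix x y assume xy: "x \<in> carrier (msub f.S p.ker)" "y \<in> carrier (msub f.S p.ker)" and e: "(\<lambda>j\<in>I. x j) = (\<lambda>j\<in>I. y j)"
      show "x = y"
      proof
        fix j show "x j = y j"
          using xy fun_cong[OF e, of j] 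
          by (cases "j \<in> I"; cases "j = i") (auto simp: p.ker_def dir_sum_simps PiE_def extensional_def)
      qed
    qed
    show "finlen R g.S" using insert by auto
  qed
  then show ?case using insert.prems[of i] by (intro finlen_ext[OF p]) auto
qed

section \<open>Projective and injective modules\<close>

lemma representable_iso:
  fixes M :: "('a, 'v) module"
  assumes "fg_module R M"
  obtains N :: "'a umodule" and f where "fg_module R N" "left_module R N" "lmap R M N f" "bij_betw f (carrier M) (carrier N)"
proof -
  have lm: "left_module R M" using assms by (simp add: fg_module_def)
  obtain N :: "'a umodule" where N: "fg_module R N" "mod_iso R M N"
    using left_module.fg_module_representable[OF lm assms] by blast
  then have "left_module R N" by (simp add: fg_module_def)
  with N that lm show thesis by (auto simp: mod_iso_iff)
qed

text \<open>The definition of \<open>projective\<close> tests against modules of type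
  \<open>umodule\<close> only; conjugating with isomorphisms to such modules gives lifting for
  finitely generated modules over any element type.\<close>

lemma proj_lift:
  fixes M :: "('a, 'v) module" and N :: "('a, 'w) module"
  assumes P: "projective R P" and M: "fg_module R M" and N: "fg_module R N"
    and f: "lmap R M N f" "f ` carrier M = carrier N" and g: "lmap R P N g"
  obtains h where "lmap R P M h" "\<And>x. x \<in> carrier P \<Longrightarrow> f (h x) = g x"
proof -
  obtain M' :: "'a umodule" and a where a: "fg_module R M'" "left_module R M'" "lmap R M M' a" "bij_betw a (carrier M) (carrier M')"
    by (rule representable_iso[OF M])
  obtain N' :: "'a umodule" and b where b: "fg_module R N'" "left_module R N'" "lmap R N N' b" "bij_betw b (carrier N) (carrier N')"
    by (rule representable_iso[OF N])
  let ?a' = "inv_into (carrier M) a"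
  have a': "lmap R M' M ?a'" "bij_betw ?a' (carrier M') (carrier M)"
    using lmap_inv[OF a(3,4)] bij_betw_inv_into[OF a(4)] .
  let ?f = "restrict (\<lambda>x. b (f (?a' x))) (carrier M')" and ?g = "restrict (\<lambda>x. b (g x)) (carrier P)"
  have fh: "?f \<in> mod_hom R M' N'" by (intro restrict_mod_hom lmap_comp[OF a'(1)] lmap_comp[OF f(1)] b)
  have gh: "?g \<in> mod_hom R P N'" by (intro restrict_mod_hom lmap_comp[OF g] b)
  have "?f ` carrier M' = (\<lambda>x. b (f x)) ` (?a' ` carrier M')" by (simp add: image_image)
  also have "\<dots> = b ` (f ` carrier M)" using a'(2) by (simp add: bij_betw_def image_image)
  also have "\<dots> = carrier N'" using b(4) f(2) by (simp add: bij_betw_def)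
  finally have sf: "?f ` carrier M' = carrier N'" .
  from P[unfolded projective_def, rule_format, OF a(1) b(1) fh gh sf]
  obtain h where h: "h \<in> mod_hom R P M'" "compose (carrier P) ?f h = ?g" ..
  have lh: "lmap R P M' h" using h(1) a(2) lmapD(1)[OF g] by (simp add: mod_hom_iff)
  have "f (?a' (h x)) = g x" if x: "x \<in> carrier P" for x
  proof -
    have hx: "h x \<in> carrier M'" using lmap.closed[OF lh x] .
    have "b (f (?a' (h x))) = b (g x)"
      using fun_cong[OF h(2), of x] x hx by (simp add: compose_def)
    moreover have "f (?a' (h x)) \<in> carrier N" "g x \<in> carrier N"
      using lmap.closed[OF f(1)] lmap.closed[OF a'(1) hx] lmap.closed[OF g x] by auto
    ultimately show ?thesis using b(4) by (auto simp: bij_betw_def dest: inj_onD)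
  qed
  then show thesis using that[OF lmap_comp[OF lh a'(1)]] by blast
qed

text \<open>The same transport as in \<open>proj_lift\<close>. Here \<open>Q\<close> stays as it is,
  since only the two test modules in the definition of \<open>injective\<close> have a fixed
  type.\<close>

lemma inj_extend:
  fixes M :: "('a, 'v) module" and N :: "('a, 'w) module"
  assumes Q: "injective R Q" and M: "fg_module R M" and N: "fg_module R N"
    and f: "lmap R M N f" "inj_on f (carrier M)" and g: "lmap R M Q g"
  obtains h where "lmap R N Q h" "\<And>x. x \<in> carrier M \<Longrightarrow> h (f x) = g x"
proof -
  obtain M' :: "'a umodule" and a where a: "fg_module R M'" "left_module R M'" "lmap R M M' a" "bij_betw a (carrier M) (carrier M')"
    by (rule representable_iso[OF M])
  obtain N' :: "'a umodule" and b where b: "fg_module R N'" "left_module R N'" "lmap R N N' b" "bij_betw b (carrier N) (carrier N')"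
    by (rule representable_iso[OF N])
  let ?a' = "inv_into (carrier M) a"
  have a': "lmap R M' M ?a'" "bij_betw ?a' (carrier M') (carrier M)"
    using lmap_inv[OF a(3,4)] bij_betw_inv_into[OF a(4)] .
  let ?f = "restrict (\<lambda>x. b (f (?a' x))) (carrier M')" and ?g = "restrict (\<lambda>x. g (?a' x)) (carrier M')"
  have fh: "?f \<in> mod_hom R M' N'" by (intro restrict_mod_hom lmap_comp[OF a'(1)] lmap_comp[OF f(1)] b)
  have gh: "?g \<in> mod_hom R M' Q" by (intro restrict_mod_hom lmap_comp[OF a'(1)] g)
  have "inj_on (\<lambda>x. b (f (?a' x))) (carrier M')"
  proof (rule inj_onI)
    fix x y assume xy: "x \<in> carrier M'" "y \<in> carrier M'" "b (f (?a' x)) = b (f (?a' y))"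
    have c: "?a' x \<in> carrier M" "?a' y \<in> carrier M" using lmap.closed[OF a'(1)] xy by auto
    then have "f (?a' x) = f (?a' y)" 
      using xy(3) lmap.closed[OF f(1)] b(4) by (auto simp: bij_betw_def dest: inj_onD)
    then have "?a' x = ?a' y" using c f(2) by (auto dest: inj_onD)
    then show "x = y" using a'(2) xy by (auto simp: bij_betw_def dest: inj_onD)
  qed
  then have "inj_on ?f (carrier M')" by (simp cong: inj_on_cong)
  from Q[unfolded injective_def, rule_format, OF a(1) b(1) fh gh this]
  obtain h where h: "h \<in> mod_hom R N' Q" "compose (carrier M') h ?f = ?g" ..
  have lh: "lmap R N' Q h" using h(1) b(2) lmapD(2)[OF g] by (simp add: mod_hom_iff)
  have "h (b (f x)) = g x" if x: "x \<in> carrier M" for x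
  proof -
    have ax: "a x \<in> carrier M'" "?a' (a x) = x" using lmap.closed[OF a(3) x] a(4) x by (auto simp: bij_betw_def)
    then show ?thesis using fun_cong[OF h(2), of "a x"] by (simp add: compose_def)
  qed
  then show thesis using that[OF lmap_comp[OF b(3) lh]] by blast
qed

text \<open>A module \<open>P\<close> with a linear form \<open>\<theta>\<close> and an element \<open>e\<close> with \<open>\<theta> u e = u\<close> is isomorphic to a
  principal left ideal generated by an idempotent.\<close>

lemma projective_dual_basis:
  assumes t: "lmap R P (regular_module R) \<theta>" and e: "e \<in> carrier P" "\<And>u. u \<in> carrier P \<Longrightarrow> \<theta> u \<odot>\<^bsub>P\<^esub> e = u"
  shows "projective R P"
  unfolding projective_def
proof (intro allI impI ballI)
  fix M N :: "'a umodule" and f g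
  assume M: "fg_module R M" "fg_module R N" and f: "f \<in> mod_hom R M N" and g: "g \<in> mod_hom R P N" 
    and s: "f ` carrier M = carrier N"
  have lm: "left_module R M" "left_module R N" "left_module R P" using M t by (auto simp: fg_module_def dest: lmapD)
  interpret f: lmap R M N f by (rule mod_hom_lmap[OF f lm(1,2)])
  interpret g: lmap R P N g by (rule mod_hom_lmap[OF g lm(3,2)])
  interpret t: lmap R P "regular_module R" \<theta> by (rule t)
  obtain m where m: "m \<in> carrier M" "f m = g e" using s g.closed[OF e(1)] by (metis imageE)
  let ?h = "restrict (\<lambda>u. \<theta> u \<odot>\<^bsub>M\<^esub> m) (carrier P)"
  have "lmap R P M (\<lambda>u. \<theta> u \<odot>\<^bsub>M\<^esub> m)" by (rule lmap_comp[OF t lmap_orbit[OF lm(1) m(1)]])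
  then have "?h \<in> mod_hom R P M" by (rule restrict_mod_hom)
  moreover have "f (\<theta> u \<odot>\<^bsub>M\<^esub> m) = g u" if u: "u \<in> carrier P" for u
  proof -
    have "f (\<theta> u \<odot>\<^bsub>M\<^esub> m) = g (\<theta> u \<odot>\<^bsub>P\<^esub> e)"
      using t.closed[OF u] m e(1) by (simp add: f.smult g.smult)
    then show ?thesis using e(2)[OF u] by simp
  qed
  then have "compose (carrier P) f ?h = g"
    using g lm by (auto simp: compose_def mod_hom_iff extensional_def fun_eq_iff)
  ultimately show "\<exists>h\<in>mod_hom R P M. compose (carrier P) f h = g" by blast
qed

section \<open>Fitting's lemma and indecomposable projective modules\<close>

lemma lmap_funpow: "lmap R M M f \<Longrightarrow> lmap R M M (f ^^ m)"
proof (induction m)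
  case 0
  then show ?case using lmap_id[OF lmapD(1)[OF 0]] by (simp add: id_def)
next
  case (Suc m)
  from lmap_comp[OF Suc.IH[OF Suc.prems] Suc.prems] show ?case by (simp add: comp_def)
qed

text \<open>Images and kernels of the powers of \<open>f\<close> are stable from \<open>m\<close>
  on. Then \<open>M\<close> is the direct sum of the kernel and the image of the \<open>m\<close>-th
  power, and indecomposability leaves two cases.\<close>

lemma fitting:
  assumes fin: "finlen R M" and ind: "indecomposable R M" and f: "lmap R M M f"
  shows "bij_betw f (carrier M) (carrier M) \<or> (\<exists>m. \<forall>x\<in>carrier M. (f ^^ m) x = \<zero>\<^bsub>M\<^esub>)"
proof -
  interpret f: lmap R M M f by (rule f)
  have fp: "lmap R M M (f ^^ m)" for m by (rule lmap_funpow[OF f])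
  let ?I = "\<lambda>m. (f ^^ m) ` carrier M" and ?K = "\<lambda>m. {x \<in> carrier M. (f ^^ m) x = \<zero>\<^bsub>M\<^esub>}"
  have sI: "submodule (?I m) R M" for m by (rule lmap.image_submodule[OF fp f.dom.submodule_carrier])
  have sK: "submodule (?K m) R M" for m using lmap.ker_submodule[OF fp] by (simp add: lmap.ker_def[OF fp])
  have fpc: "(f ^^ m) x \<in> carrier M" if "x \<in> carrier M" for m x using lmap.closed[OF fp that] .
  have fadd: "(f ^^ (i + j)) x = (f ^^ i) ((f ^^ j) x)" for i j x by (simp add: funpow_add)
  have Idec: "?I (i + j) \<subseteq> ?I i" for i j by (auto simp: fadd fpc)
  have Kinc: "?K i \<subseteq> ?K (i + j)" for i j
    using lmap.zero[OF fp] by (auto simp: fadd add.commute[of i j])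
  have ne: "range ?I \<noteq> {}" "range ?K \<noteq> {}" by auto
  have dcc: "chain_cond True R M" and acc: "chain_cond False R M" using fin by (auto simp: finlen_def)
  obtain N where "N \<in> range ?I" and N: "\<And>N'. N' \<in> range ?I \<Longrightarrow> N' \<subseteq> N \<Longrightarrow> N' = N"
    by (rule dcc_minimal[OF dcc ne(1)]) (use sI in auto)
  then obtain a where a: "N = ?I a" by blast
  obtain N' where "N' \<in> range ?K" and N': "\<And>N. N \<in> range ?K \<Longrightarrow> N' \<subseteq> N \<Longrightarrow> N = N'"
    by (rule acc_maximal[OF acc ne(2)]) (use sK in auto)
  then obtain b where b: "N' = ?K b" by blast
  have Ia: "?I (a + j) = ?I a" for j using N[of "?I (a + j)"] Idec[of a j] a by blast
  have Kb: "?K (b + j) = ?K b" for j using N'[of "?K (b + j)"] Kinc[of b j] b by blast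
  define m where "m = a + b"
  have Im: "?I (m + j) = ?I m" for j using Ia[of b] Ia[of "b + j"] by (simp add: m_def add.assoc)
  have Km: "?K (m + j) = ?K m" for j using Kb[of a] Kb[of "a + j"] by (simp add: m_def ac_simps)
  have int: "?K m \<inter> ?I m = {\<zero>\<^bsub>M\<^esub>}"
  proof -
    have "x = \<zero>\<^bsub>M\<^esub>" if x: "x \<in> ?K m" "x \<in> ?I m" for x
    proof -
      obtain y where y: "y \<in> carrier M" "x = (f ^^ m) y" using x(2) by blast
      then have "y \<in> ?K (m + m)" using x by (simp add: fadd)
      then have "y \<in> ?K m" using Km[of m] by blast
      then show ?thesis using y by simp
    qed
    then show ?thesis using f.dom.submoduleD(3)[OF sI[of m]] f.dom.submoduleD(3)[OF sK[of m]] by blast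
  qed
  have sum: "?K m <+>\<^bsub>M\<^esub> ?I m = carrier M"
  proof
    show "?K m <+>\<^bsub>M\<^esub> ?I m \<subseteq> carrier M"
      using f.dom.submoduleD(1)[OF f.dom.submodule_ssum[OF sK sI]] by (simp add: f.dom.ssum_eq)
    show "carrier M \<subseteq> ?K m <+>\<^bsub>M\<^esub> ?I m"
    proof
      fix x assume x: "x \<in> carrier M"
      then have "(f ^^ m) x \<in> ?I (m + m)" using Im[of m] by blast
      then obtain y where y: "y \<in> carrier M" "(f ^^ m) x = (f ^^ m) ((f ^^ m) y)" by (auto simp: fadd)
      let ?z = "x \<ominus>\<^bsub>M\<^esub> (f ^^ m) y"
      have "?z \<in> ?K m" using x y lmap.diff[OF fp x fpc[OF y(1)]] f.dom.diff_zero_iff fpc by (simp)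
      moreover have "x = ?z \<oplus>\<^bsub>M\<^esub> (f ^^ m) y" using x fpc[OF y(1)] by (simp add: a_minus_def f.dom.M.a_assoc f.dom.M.l_neg)
      moreover have "(f ^^ m) y \<in> ?I m" using y(1) by (rule imageI)
      ultimately show "x \<in> ?K m <+>\<^bsub>M\<^esub> ?I m" unfolding f.dom.ssum_eq using f.dom.ssumI by metis
    qed
  qed
  have "?K m = {\<zero>\<^bsub>M\<^esub>} \<or> ?I m = {\<zero>\<^bsub>M\<^esub>}" using ind sK sI int sum unfolding indecomposable_def by blast
  then show ?thesis
  proof
    assume "?I m = {\<zero>\<^bsub>M\<^esub>}"
    then have "(f ^^ m) x = \<zero>\<^bsub>M\<^esub>" if "x \<in> carrier M" for x using that by blast
    then show ?thesis by blast
  next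
    assume K0: "?K m = {\<zero>\<^bsub>M\<^esub>}"
    have "f.ker = {\<zero>\<^bsub>M\<^esub>}"
    proof -
      have "x = \<zero>\<^bsub>M\<^esub>" if "x \<in> carrier M" "f x = \<zero>\<^bsub>M\<^esub>" for x
      proof -
        have "(f ^^ Suc m) x = \<zero>\<^bsub>M\<^esub>" using that lmap.zero[OF fp, of m] by (simp add: funpow_Suc_right del: funpow.simps)
        then have "x \<in> ?K m" using Km[of 1] that by auto
        then show ?thesis using K0 by blast
      qed
      then show ?thesis by (auto simp: f.ker_def)
    qed
    then have inj: "inj_on f (carrier M)" by (simp add: f.inj_iff_ker)
    have "carrier M \<subseteq> ?I m" using sum f.dom.ssum_least[OF sI, of "?K m" m "?I m"] K0 f.dom.submoduleD(3)[OF sI] 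
      by (simp add: f.dom.ssum_eq)
    also have "?I m \<subseteq> ?I 1" using Im[of 1] Idec[of 1 m] by (simp add: add.commute)
    finally have "f ` carrier M = carrier M" by auto
    with inj show ?thesis by (simp add: bij_betw_def)
  qed
qed

locale indec_proj = artin_ring A for A :: "('a, 'e) ring_scheme" (structure) +
  fixes P :: "('a, 'v) module"
  assumes fg: "fg_module A P" and proj: "projective A P" and indec: "indecomposable A P"
begin

sublocale P: left_module A P using fg by (simp add: fg_module_def)

lemma finlen_P: "finlen A P" using fg fg_iff_finlen by blast

lemma nonzero_P: "carrier P \<noteq> {\<zero>\<^bsub>P\<^esub>}" using indec by (simp add: indecomposable_def nonzero_module_def)

lemma surj_endo_bij:
  assumes f: "lmap A P P f" "f ` carrier P = carrier P"
  shows "bij_betw f (carrier P) (carrier P)"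
proof (rule ccontr)
  assume "\<not> ?thesis"
  then obtain m where m: "\<And>x. x \<in> carrier P \<Longrightarrow> (f ^^ m) x = \<zero>\<^bsub>P\<^esub>" using fitting[OF finlen_P indec f(1)] by blast
  have "(f ^^ m) ` carrier P = carrier P" by (induction m) (simp_all add: f(2) flip: image_image)
  then show False using m nonzero_P P.M.zero_closed by (metis (no_types, lifting) image_cong image_constant)
qed

text \<open>Lifting the identity along the sum map from the direct sum of \<open>N\<close> and
  \<open>N'\<close> to \<open>P\<close> writes it as a + b with values of a in \<open>N\<close> and
  of b in \<open>N'\<close>. By Fitting's lemma a is bijective, or a is nilpotent and then b is
  bijective.\<close>

lemma local:
  assumes N: "submodule N A P" and N': "submodule N' A P" and sum: "P.ssum N N' = carrier P"
  shows "N = carrier P \<or> N' = carrier P"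
proof -
  let ?X = "\<lambda>b. msub P (if b then N else N')"
  interpret D: module_family A UNIV ?X 
    by (rule module_family.intro) (simp_all add: P.left_module_msub N N' ring_axioms)
  have fin: "finlen A D.S" 
    by (rule finlen_dir_sum) (simp_all add: ring_axioms finlen_sub[OF finlen_P] N N')
  have comp: "lmap A D.S P (\<lambda>x. x b)" for b
    by (rule lmap_of_msub[OF _ P.left_module_axioms, where U = "if b then N else N'"]) (use D.lmap_component[of b] N N' in auto)
  have s: "lmap A D.S P (\<lambda>x. x True \<oplus>\<^bsub>P\<^esub> x False)" by (rule lmap_add[OF comp comp])
  have surj: "(\<lambda>x. x True \<oplus>\<^bsub>P\<^esub> x False) ` carrier D.S = carrier P"
  proof
    show "(\<lambda>x. x True \<oplus>\<^bsub>P\<^esub> x False) ` carrier D.S \<subseteq> carrier P" using lmap.closed[OF s] by blast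
    show "carrier P \<subseteq> (\<lambda>x. x True \<oplus>\<^bsub>P\<^esub> x False) ` carrier D.S"
    proof
      fix x assume "x \<in> carrier P"
      then have "x \<in> P.ssum N N'" by (simp add: sum)
      then obtain u v where "u \<in> N" "v \<in> N'" "x = u \<oplus>\<^bsub>P\<^esub> v" by (auto simp: P.ssum_def)
      then show "x \<in> (\<lambda>x. x True \<oplus>\<^bsub>P\<^esub> x False) ` carrier D.S"
        by (intro image_eqI[of _ _ "\<lambda>b. if b then u else v"]) (auto simp: dir_sum_simps)
    qed
  qed
  obtain h where h: "lmap A P D.S h" "\<And>x. x \<in> carrier P \<Longrightarrow> h x True \<oplus>\<^bsub>P\<^esub> h x False = x"
    by (rule proj_lift[OF proj _ fg s surj lmap_id[OF P.left_module_axioms]]) (use fin fg_finlen in auto)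
  let ?a = "\<lambda>x. h x True" and ?b = "\<lambda>x. h x False"
  have ab: "lmap A P P ?a" "lmap A P P ?b" using lmap_comp[OF h(1) comp] by auto
  have im: "?a x \<in> N" "?b x \<in> N'" if "x \<in> carrier P" for x
    using D.component_closed[OF lmap.closed[OF h(1) that]] P.msub_simps(1) by (metis UNIV_I)+
  from fitting[OF finlen_P indec ab(1)] show ?thesis
  proof
    assume "bij_betw ?a (carrier P) (carrier P)"
    then have "?a ` carrier P = carrier P" by (simp add: bij_betw_def)
    moreover have "?a ` carrier P \<subseteq> N" using im(1) by blast
    ultimately have "carrier P \<subseteq> N" by simp
    then show ?thesis using P.submoduleD(1)[OF N] by auto
  next
    assume "\<exists>m. \<forall>x\<in>carrier P. (?a ^^ m) x = \<zero>\<^bsub>P\<^esub>"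
    then obtain m where m: "\<And>x. x \<in> carrier P \<Longrightarrow> (?a ^^ m) x = \<zero>\<^bsub>P\<^esub>" by blast
    \<comment> \<open>If b x = 0 then a x = x, so a nilpotent a forces x = 0. Hence no power of b
      kills a non-zero element, and b cannot be nilpotent.\<close>
    have binj: "x = \<zero>\<^bsub>P\<^esub>" if x: "x \<in> carrier P" "(?b ^^ k) x = \<zero>\<^bsub>P\<^esub>" for x k
      using x
    proof (induction k arbitrary: x)
      case (Suc k)
      have "(?b ^^ k) (?b x) = \<zero>\<^bsub>P\<^esub>" using Suc.prems(2) by (simp only: funpow_Suc_right comp_apply)
      then have "?b x = \<zero>\<^bsub>P\<^esub>" using Suc.IH lmap.closed[OF ab(2) Suc.prems(1)] by blast
      then have ax: "?a x = x" using h(2)[OF Suc.prems(1)] lmap.closed[OF ab(1) Suc.prems(1)] by simp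
      have "(?a ^^ j) x = x" for j by (induction j) (simp_all add: ax)
      then show ?case using m[OF Suc.prems(1)] by simp
    qed simp
    have "bij_betw ?b (carrier P) (carrier P)"
      using fitting[OF finlen_P indec ab(2)] binj nonzero_P P.M.zero_closed by blast
    then have "?b ` carrier P = carrier P" by (simp add: bij_betw_def)
    moreover have "?b ` carrier P \<subseteq> N'" using im(2) by blast
    ultimately have "carrier P \<subseteq> N'" by simp
    then show ?thesis using P.submoduleD(1)[OF N'] by auto
  qed
qed

abbreviation "radP \<equiv> radical A P"

lemma radP_submodule: "submodule radP A P" by (rule P.radical_submodule)

text \<open>A proper submodule outside some maximal one would add up with it to \<open>P\<close>,
  against \<open>local\<close>. So the radical is the only maximal submodule, and any map hitting an
  element outside it is onto.\<close>

lemma proper_le_rad: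
  assumes N: "submodule N A P" "N \<noteq> carrier P"
  shows "N \<subseteq> radP"
proof -
  have "N \<subseteq> m" if m: "maximal_submodule A P m" for m
  proof (rule ccontr)
    assume no: "\<not> N \<subseteq> m"
    have sm: "submodule m A P" "m \<noteq> carrier P" using m by (auto simp: maximal_submodule_def)
    have "P.ssum N m = carrier P"
      using m P.submodule_ssum[OF N(1) sm(1)] P.ssum_upper[OF N(1) sm(1)] no unfolding maximal_submodule_def by blast
    then show False using local[OF N(1) sm(1)] N(2) sm(2) by blast
  qed
  then show ?thesis using P.submoduleD(1)[OF N(1)] by (auto simp: radical_def)
qed

lemma radP_proper: "radP \<noteq> carrier P" by (rule radical_proper[OF P.left_module_axioms nonzero_P])

lemma radP_maximal: "maximal_submodule A P radP"
  using radP_submodule radP_proper proper_le_rad by (auto simp: maximal_submodule_def)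

lemma top_simple: "simple_module A (mtop A P)"
  using P.maximal_iff_simple_quot[OF radP_submodule] radP_maximal by (simp add: mtop_def)

lemma surj_of_not_rad:
  assumes f: "lmap A X P f" and x: "x \<in> carrier X" "f x \<notin> radP"
  shows "f ` carrier X = carrier P"
proof -
  interpret f: lmap A X P f by (rule f)
  have "submodule (f ` carrier X) A P" by (rule f.image_submodule) simp
  from proper_le_rad[OF this] x show ?thesis by blast
qed

text \<open>Every element outside the radical generates \<open>P\<close>, and projectivity splits
  the resulting surjection from the regular module; \<open>\<theta>\<close> is the splitting. A map
  out of \<open>P\<close> is then determined by its value at \<open>e\<close>.\<close>

lemma cyclic_dual_basis:
  obtains \<theta> e where "lmap A P (regular_module A) \<theta>" "e \<in> carrier P" "\<And>u. u \<in> carrier P \<Longrightarrow> \<theta> u \<odot>\<^bsub>P\<^esub> e = u"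
proof -
  obtain e where e: "e \<in> carrier P" "e \<notin> radP" using radP_proper P.submoduleD(1)[OF radP_submodule] by blast
  note o = lmap_orbit[OF P.left_module_axioms e(1)]
  have "(\<lambda>a. a \<odot>\<^bsub>P\<^esub> e) ` carrier (regular_module A) = carrier P"
    by (rule surj_of_not_rad[OF o, of \<one>]) (use e in auto)
  from proj_lift[OF proj _ fg o this lmap_id[OF P.left_module_axioms]]
  obtain \<theta> where "lmap A P (regular_module A) \<theta>" "\<And>u. u \<in> carrier P \<Longrightarrow> \<theta> u \<odot>\<^bsub>P\<^esub> e = u"
    using fg_finlen[OF finlen_regular] by blast
  then show thesis using that e(1) by blast
qed

end

text \<open>A surjection onto a projective module splits, so its kernel is a direct summand of the
  indecomposable \<open>P\<close>, and the complement is non-zero.\<close>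

lemma indec_proj_surj_bij:
  assumes P: "indec_proj A P" and P': "indec_proj A P'" and f: "lmap A P P' f" "f ` carrier P = carrier P'"
  shows "bij_betw f (carrier P) (carrier P')"
proof -
  interpret P: indec_proj A P by (rule P)
  interpret P': indec_proj A P' by (rule P')
  interpret f: lmap A P P' f by (rule f)
  obtain h where h: "lmap A P' P h" "\<And>x. x \<in> carrier P' \<Longrightarrow> f (h x) = x"
    by (rule proj_lift[OF P'.proj P.fg P'.fg f lmap_id[OF lmapD(2)[OF f(1)]]]) blast
  interpret h: lmap A P' P h by (rule h)
  have sh: "submodule (h ` carrier P') A P" by (rule h.image_submodule) simp
  have int: "f.ker \<inter> h ` carrier P' = {\<zero>\<^bsub>P\<^esub>}"
  proof -
    have "x = \<zero>\<^bsub>P\<^esub>" if x: "x \<in> f.ker" "x \<in> h ` carrier P'" for x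
    proof -
      obtain y where y: "y \<in> carrier P'" "x = h y" using x(2) by blast
      have "f x = \<zero>\<^bsub>P'\<^esub>" using x(1) by (simp add: f.ker_def)
      then have "y = \<zero>\<^bsub>P'\<^esub>" using h(2)[OF y(1)] by (simp add: y(2))
      then show ?thesis unfolding y(2) by (simp only: h.zero)
    qed
    then show ?thesis using P.P.submoduleD(3)[OF f.ker_submodule] P.P.submoduleD(3)[OF sh] by blast
  qed
  have sum: "f.ker <+>\<^bsub>P\<^esub> h ` carrier P' = carrier P"
  proof
    show "f.ker <+>\<^bsub>P\<^esub> h ` carrier P' \<subseteq> carrier P"
      using P.P.submoduleD(1)[OF P.P.submodule_ssum[OF f.ker_submodule sh]] by (simp add: P.P.ssum_eq)
    show "carrier P \<subseteq> f.ker <+>\<^bsub>P\<^esub> h ` carrier P'"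
    proof
      fix x assume x: "x \<in> carrier P"
      let ?z = "x \<ominus>\<^bsub>P\<^esub> h (f x)"
      have "?z \<in> f.ker" using x f.diff[of x "h (f x)"] h(2)[of "f x"] by (simp add: f.ker_def P'.P.diff_zero_iff)
      moreover have "x = ?z \<oplus>\<^bsub>P\<^esub> h (f x)" using x by (simp add: a_minus_def P.P.M.a_assoc P.P.M.l_neg)
      moreover have "h (f x) \<in> h ` carrier P'" using x by simp
      ultimately show "x \<in> f.ker <+>\<^bsub>P\<^esub> h ` carrier P'" unfolding P.P.ssum_eq using P.P.ssumI by metis
    qed
  qed
  have "h ` carrier P' \<noteq> {\<zero>\<^bsub>P\<^esub>}"
  proof
    assume z: "h ` carrier P' = {\<zero>\<^bsub>P\<^esub>}"
    have "x = \<zero>\<^bsub>P'\<^esub>" if "x \<in> carrier P'" for x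
    proof -
      have "h x = \<zero>\<^bsub>P\<^esub>" using z that by blast
      then show ?thesis using h(2)[OF that] by simp
    qed
    then show False using P'.nonzero_P P'.P.M.zero_closed by blast
  qed
  then have "f.ker = {\<zero>\<^bsub>P\<^esub>}"
    using P.indec f.ker_submodule sh int sum unfolding indecomposable_def by blast
  then show ?thesis using f(2) by (simp add: bij_betw_def f.inj_iff_ker)
qed

section \<open>Generation of the ring by its indecomposable projective modules\<close>

locale proj_list = artin_ring A for A :: "('a, 'e) ring_scheme" (structure) +
  fixes n :: nat and P :: "nat \<Rightarrow> ('a, 'v) module"
  assumes complete: "complete_proj_list A n P"
begin

lemma indec_P: "i \<in> {1..n} \<Longrightarrow> indec_proj A (P i)"
  using complete[unfolded complete_proj_list_def, THEN conjunct1] artin_ring_axioms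
  unfolding indec_proj_def indec_proj_axioms_def by blast

lemma left_module_P: "i \<in> {1..n} \<Longrightarrow> left_module A (P i)"
  using indec_P by (simp add: indec_proj_def indec_proj_axioms_def fg_module_def)

lemma P_iso_eq:
  assumes i: "i \<in> {1..n}" "j \<in> {1..n}" and f: "lmap A (P i) (P j) f" "f ` carrier (P i) = carrier (P j)"
  shows "i = j"
proof -
  have "mod_iso A (P i) (P j)"
    using indec_proj_surj_bij[OF indec_P[OF i(1)] indec_P[OF i(2)] f] f(1)
    unfolding mod_iso_iff[OF left_module_P[OF i(1)] left_module_P[OF i(2)]] by blast
  then show ?thesis
    using complete[unfolded complete_proj_list_def, THEN conjunct2, THEN conjunct1] i by blast
qed

text \<open>The traces of the \<open>P i\<close> generate the regular module: a minimal direct summand of the regular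
  module that is not contained in the sum of these traces would be indecomposable.\<close>

lemma regular_generated:
  assumes B: "submodule B A (regular_module A)"
    and p: "\<And>i p y. i \<in> {1..n} \<Longrightarrow> lmap A (P i) (regular_module A) p \<Longrightarrow> y \<in> carrier (P i) \<Longrightarrow> p y \<in> B"
  shows "B = carrier A"
proof (rule ccontr)
  assume BA: "B \<noteq> carrier A"
  let ?R = "regular_module A"
  define summand where "summand X \<longleftrightarrow> submodule X A ?R \<and> (\<exists>Y. submodule Y A ?R \<and> X \<inter> Y = {\<zero>} \<and> carrier A \<subseteq> reg.ssum X Y)" for X
  let ?\<X> = "{X. summand X \<and> \<not> X \<subseteq> B}"
  have "summand (carrier A)" unfolding summand_def
    using reg.submodule_carrier reg.submodule_zero reg.ssum_upper[OF reg.submodule_carrier reg.submodule_zero] by auto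
  moreover have "\<not> carrier A \<subseteq> B" using BA reg.submoduleD(1)[OF B] by auto
  ultimately have ne: "?\<X> \<noteq> {}" by blast
  obtain X where X: "X \<in> ?\<X>" and minX: "\<And>X'. X' \<in> ?\<X> \<Longrightarrow> X' \<subseteq> X \<Longrightarrow> X' = X"
    by (rule dcc_minimal[OF dcc ne]) (auto simp: summand_def)
  then have sX: "submodule X A ?R" and "\<not> X \<subseteq> B" by (auto simp: summand_def)
  from X obtain Y where Y: "submodule Y A ?R" "X \<inter> Y = {\<zero>}" "carrier A \<subseteq> reg.ssum X Y" by (auto simp: summand_def)
  have "\<one> \<in> reg.ssum X Y" using Y(3) by auto
  then obtain e e' where e: "e \<in> X" "e' \<in> Y" "\<one> = e \<oplus> e'" by (auto simp: reg.ssum_def)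
  have xc: "x \<in> carrier A" if "x \<in> X" for x using reg.submoduleD(2)[OF sX that] by simp
  have yc: "y \<in> carrier A" if "y \<in> Y" for y using reg.submoduleD(2)[OF Y(1) that] by simp
  \<comment> \<open>The component of the unit in \<open>X\<close> is a right identity on
    \<open>X\<close>. It provides the dual basis that makes \<open>X\<close> projective.\<close>
  have xe: "x \<otimes> e = x" if x: "x \<in> X" for x
  proof -
    have "x = x \<otimes> (e \<oplus> e')" using xc[OF x] by (simp flip: e(3))
    also have "\<dots> = x \<otimes> e \<oplus> x \<otimes> e'" using xc x e yc by (simp add: r_distr)
    finally have "x \<ominus> x \<otimes> e = x \<otimes> e'" using xc[OF x] xc[OF e(1)] yc[OF e(2)]
      by (metis (no_types, lifting) a_comm a_minus_def add.inv_closed add.m_assoc m_closed r_neg r_zero)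
    moreover have "x \<ominus> x \<otimes> e \<in> X" using reg.submoduleD(7)[OF sX x, of "x \<otimes> e"] reg.submoduleD(5)[OF sX, of x e] e xc[OF x] by simp
    moreover have "x \<otimes> e' \<in> Y" using reg.submoduleD(5)[OF Y(1), of x e'] e xc[OF x] by simp
    ultimately have "x \<ominus> x \<otimes> e = \<zero>" using Y(2) by auto
    then show ?thesis using reg.diff_zero_iff[of x "x \<otimes> e"] xc[OF x] xc[OF e(1)] by auto
  qed
  have fX: "fg_module A (msub ?R X)" by (rule fg_finlen[OF finlen_sub[OF finlen_regular sX]])
  \<comment> \<open>Completeness of the list speaks about modules of type \<open>umodule\<close>, so
    the summand \<open>X\<close> is replaced by a copy \<open>N\<close>.\<close>
  obtain N :: "'a umodule" and g where N: "fg_module A N" "left_module A N" "lmap A (msub ?R X) N g" "bij_betw g (carrier (msub ?R X)) (carrier N)"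
    by (rule representable_iso[OF fX])
  have gb: "bij_betw g X (carrier N)" using N(4) by simp
  let ?\<theta> = "inv_into X g"
  have t: "lmap A N (msub ?R X) ?\<theta>" using lmap_inv[OF N(3,4)] by simp
  have tb: "bij_betw ?\<theta> (carrier N) X" by (rule bij_betw_inv_into[OF gb])
  have gt: "g (?\<theta> u) = u" if "u \<in> carrier N" for u using gb that by (simp add: bij_betw_def f_inv_into_f)
  interpret t: lmap A N ?R ?\<theta> by (rule lmap_of_msub[OF t reg.left_module_axioms sX])
  have tX: "?\<theta> u \<in> X" if "u \<in> carrier N" for u using lmap.closed[OF t that] by simp
  have "projective A N"
  proof (rule projective_dual_basis[OF t.lmap_axioms'])
    show "g e \<in> carrier N" using lmap.closed[OF N(3), of e] e by simp
    fix u assume u: "u \<in> carrier N"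
    have "?\<theta> u \<odot>\<^bsub>N\<^esub> g e = g (?\<theta> u \<otimes> e)"
      using lmap.smult[OF N(3), of "?\<theta> u" e] e xc[OF tX[OF u]] by simp
    then show "?\<theta> u \<odot>\<^bsub>N\<^esub> g e = u" using xe[OF tX[OF u]] gt[OF u] by simp
  qed
  show False
  proof (cases "indecomposable A N")
    case True
    then obtain i where i: "i \<in> {1..n}" "mod_iso A N (P i)"
      using complete N(1) \<open>projective A N\<close> unfolding complete_proj_list_def by blast
    then obtain k where k: "lmap A N (P i) k" "bij_betw k (carrier N) (carrier (P i))"
      using mod_iso_iff[OF N(2) left_module_P[OF i(1)]] by blast
    let ?p = "\<lambda>y. ?\<theta> (inv_into (carrier N) k y)"
    have lp: "lmap A (P i) ?R ?p" by (rule lmap_comp[OF lmap_inv[OF k] t.lmap_axioms'])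
    have "X \<subseteq> B"
    proof
      fix x assume x: "x \<in> X"
      then obtain u where u: "u \<in> carrier N" "x = ?\<theta> u" using tb by (auto simp: bij_betw_def)
      have "k u \<in> carrier (P i)" "inv_into (carrier N) k (k u) = u" using k(2) u by (auto simp: bij_betw_def)
      then show "x \<in> B" using p[OF i(1) lp, of "k u"] u by simp
    qed
    then show False using \<open>\<not> X \<subseteq> B\<close> by simp
  next
    case False
    have "carrier N \<noteq> {\<zero>\<^bsub>N\<^esub>}"
    proof
      assume "carrier N = {\<zero>\<^bsub>N\<^esub>}"
      then have "X = {\<zero>}" using tb by (simp add: bij_betw_def)
      then show False using \<open>\<not> X \<subseteq> B\<close> reg.submoduleD(3)[OF B] by simp
    qed
    then obtain H H' where H: "submodule H A N" "submodule H' A N" "H \<inter> H' = {\<zero>\<^bsub>N\<^esub>}" "H <+>\<^bsub>N\<^esub> H' = carrier N"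
      "H \<noteq> {\<zero>\<^bsub>N\<^esub>}" "H' \<noteq> {\<zero>\<^bsub>N\<^esub>}" using False unfolding indecomposable_def nonzero_module_def by blast
    have inj: "inj_on ?\<theta> (carrier N)" using tb by (simp add: bij_betw_def)
    \<comment> \<open>A proper summand of \<open>X\<close> is again a summand of the ring, with
      complement \<open>\<theta> H' + Y\<close>. By minimality of \<open>X\<close> it must lie in
      \<open>B\<close>; this applied to both halves puts \<open>X\<close> into
      \<open>B\<close>.\<close>
    have *: "?\<theta> ` H \<subseteq> B" if H: "submodule H A N" "submodule H' A N" "H \<inter> H' = {\<zero>\<^bsub>N\<^esub>}" "H <+>\<^bsub>N\<^esub> H' = carrier N" "H' \<noteq> {\<zero>\<^bsub>N\<^esub>}" for H H'
    proof (rule ccontr)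
      assume no: "\<not> ?\<theta> ` H \<subseteq> B"
      have Hc: "x \<in> carrier N" if "x \<in> H \<or> x \<in> H'" for x using that t.dom.submoduleD(2) H(1,2) by blast
      have s1: "submodule (?\<theta> ` H) A ?R" "submodule (?\<theta> ` H') A ?R" by (rule t.image_submodule[OF H(1)], rule t.image_submodule[OF H(2)])
      note s2 = reg.submodule_ssum[OF s1(2) Y(1)]
      have sub: "?\<theta> ` H \<subseteq> X" using tX Hc by auto
      have "?\<theta> ` H \<inter> reg.ssum (?\<theta> ` H') Y \<subseteq> {\<zero>}"
      proof
        fix x assume "x \<in> ?\<theta> ` H \<inter> reg.ssum (?\<theta> ` H') Y"
        then have x: "x \<in> ?\<theta> ` H" "x \<in> reg.ssum (?\<theta> ` H') Y" by simp_all
        from x(2) obtain h' y where h': "h' \<in> H'" "y \<in> Y" "x = ?\<theta> h' \<oplus> y" by (auto simp: reg.ssum_def)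
        from x(1) obtain h where "h \<in> H" "x = ?\<theta> h" by blast
        with h' have h: "x = ?\<theta> h" "h \<in> H" "h' \<in> H'" "y \<in> Y" "x = ?\<theta> h' \<oplus> y" by simp_all
        have c: "?\<theta> h \<in> carrier A" "?\<theta> h' \<in> carrier A" "y \<in> carrier A" using Hc h tX xc yc by auto
        have "?\<theta> h \<ominus> ?\<theta> h' = (y \<oplus> ?\<theta> h') \<ominus> ?\<theta> h'" using h c by (simp add: a_comm)
        also have "\<dots> = y" using c by (simp add: a_minus_def a_assoc r_neg)
        finally have "?\<theta> h \<ominus> ?\<theta> h' = y" .
        moreover have "?\<theta> h \<ominus> ?\<theta> h' \<in> X" using reg.submoduleD(7)[OF sX tX tX, of h h'] Hc h by simp
        ultimately have "y = \<zero>" using Y(2) h(4) by auto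
        then have "?\<theta> h = ?\<theta> h'" using h c by simp
        then have "h = h'" using inj Hc h by (auto dest: inj_onD)
        then have "h = \<zero>\<^bsub>N\<^esub>" using H(3) h by auto
        then show "x \<in> {\<zero>}" using h(1) t.zero by simp
      qed
      then have int: "?\<theta> ` H \<inter> reg.ssum (?\<theta> ` H') Y = {\<zero>}"
        using reg.submoduleD(3)[OF s1(1)] reg.submoduleD(3)[OF s2] by auto
      have "carrier A \<subseteq> reg.ssum (?\<theta> ` H) (reg.ssum (?\<theta> ` H') Y)"
      proof
        fix a assume "a \<in> carrier A"
        then obtain x y where xy: "x \<in> X" "y \<in> Y" "a = x \<oplus> y" using Y(3) by (auto simp: reg.ssum_def)
        obtain u where u: "u \<in> carrier N" "x = ?\<theta> u" using tb xy by (auto simp: bij_betw_def)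
        then have "u \<in> t.dom.ssum H H'" using H(4) by (simp add: t.dom.ssum_eq)
        then obtain h h' where h: "h \<in> H" "h' \<in> H'" "u = h \<oplus>\<^bsub>N\<^esub> h'" by (auto simp: t.dom.ssum_def)
        have c: "?\<theta> h \<in> carrier A" "?\<theta> h' \<in> carrier A" "y \<in> carrier A" using Hc h tX xc yc xy by auto
        have "a = ?\<theta> h \<oplus> (?\<theta> h' \<oplus> y)" using xy u h t.add[of h h'] Hc c by (simp add: a_assoc)
        then show "a \<in> reg.ssum (?\<theta> ` H) (reg.ssum (?\<theta> ` H') Y)"
          using reg.ssumI[of "?\<theta> h'" "?\<theta> ` H'" y Y] reg.ssumI[of "?\<theta> h" "?\<theta> ` H" "?\<theta> h' \<oplus> y"] h xy by simp
      qed
      then have "summand (?\<theta> ` H)" unfolding summand_def using s1 s2 int by blast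
      then have "?\<theta> ` H = X" using no sub by (intro minX) auto
      then have "?\<theta> ` H = ?\<theta> ` carrier N" using tb by (simp add: bij_betw_def)
      then have "H = carrier N" using inj_on_image_eq_iff[OF inj t.dom.submoduleD(1)[OF H(1)] order_refl] by simp
      then show False using H(3,5) t.dom.submoduleD(1)[OF H(2)] by blast
    qed
    have "H' <+>\<^bsub>N\<^esub> H = carrier N"
    proof -
      have "H' <+>\<^bsub>N\<^esub> H = H <+>\<^bsub>N\<^esub> H'" unfolding t.dom.ssum_eq
        by (rule t.dom.ssum_comm[OF H(2,1)])
      then show ?thesis using H by simp
    qed
    then have "?\<theta> ` H \<subseteq> B" "?\<theta> ` H' \<subseteq> B" using H *[of H H'] *[of H' H] by (simp_all add: Int_commute)
    then have hB: "?\<theta> h \<in> B" if "h \<in> H \<or> h \<in> H'" for h using that by blast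
    have "X \<subseteq> B"
    proof
      fix x assume "x \<in> X"
      then obtain u where u: "u \<in> carrier N" "x = ?\<theta> u" using tb by (auto simp: bij_betw_def)
      then have "u \<in> t.dom.ssum H H'" using H(4) by (simp add: t.dom.ssum_eq)
        then obtain h h' where h: "h \<in> H" "h' \<in> H'" "u = h \<oplus>\<^bsub>N\<^esub> h'" by (auto simp: t.dom.ssum_def)
      then show "x \<in> B" using u t.add[of h h'] hB t.dom.submoduleD(2)[OF H(1)] t.dom.submoduleD(2)[OF H(2)]
          reg.submoduleD(4)[OF B] by simp
    qed
    then show False using \<open>\<not> X \<subseteq> B\<close> by simp
  qed
qed

end

section \<open>Modules of homomorphisms\<close>

lemma quot_lmap_surj:
  assumes "left_module R M" "submodule N R M"
  shows "(\<lambda>x. N +>\<^bsub>M\<^esub> x) ` carrier M = carrier (quot_module M N)"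
  using left_module.quot_simps(1)[OF assms] by simp

lemma msub_carrier [simp]: "msub M (carrier M) = M"
  by (simp add: msub_def)

lemma mod_hom_eqI:
  assumes "f \<in> mod_hom A G X" "g \<in> mod_hom A G X" "\<And>x. x \<in> carrier G \<Longrightarrow> f x = g x"
  shows "f = g"
  using assms by (auto simp: mod_hom_def PiE_def intro: extensionalityI)

lemma hom_module_simps:
  "carrier (hom_module A G X) = mod_hom A G X" "\<zero>\<^bsub>hom_module A G X\<^esub> = (\<lambda>x\<in>carrier G. \<zero>\<^bsub>X\<^esub>)"
  "f \<oplus>\<^bsub>hom_module A G X\<^esub> g = (\<lambda>x\<in>carrier G. f x \<oplus>\<^bsub>X\<^esub> g x)"
  "r \<odot>\<^bsub>hom_module A G X\<^esub> f = compose (carrier G) f r"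
  by (simp_all add: hom_module_def)

lemma opp_end_simps:
  "carrier (opposite_ring (end_ring A G)) = mod_hom A G G"
  "\<zero>\<^bsub>opposite_ring (end_ring A G)\<^esub> = (\<lambda>x\<in>carrier G. \<zero>\<^bsub>G\<^esub>)"
  "\<one>\<^bsub>opposite_ring (end_ring A G)\<^esub> = (\<lambda>x\<in>carrier G. x)"
  "r \<oplus>\<^bsub>opposite_ring (end_ring A G)\<^esub> s = (\<lambda>x\<in>carrier G. r x \<oplus>\<^bsub>G\<^esub> s x)"
  "r \<otimes>\<^bsub>opposite_ring (end_ring A G)\<^esub> s = compose (carrier G) s r"
  by (simp_all add: opposite_ring_def end_ring_def)

locale hom_setting = G: left_module A G for A :: "('a, 'e) ring_scheme" and G :: "('a, 'g) module"
begin

abbreviation "E \<equiv> opposite_ring (end_ring A G)"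
abbreviation "H X \<equiv> hom_module A G X"

lemma in_H: "left_module A X \<Longrightarrow> f \<in> carrier (H X) \<longleftrightarrow> lmap A G X f \<and> f \<in> extensional (carrier G)"
  by (simp add: hom_module_simps mod_hom_iff G.left_module_axioms)

lemma H_lmap: "left_module A X \<Longrightarrow> f \<in> carrier (H X) \<Longrightarrow> lmap A G X f"
  by (simp add: in_H)

lemma H_closed: "left_module A X \<Longrightarrow> f \<in> carrier (H X) \<Longrightarrow> x \<in> carrier G \<Longrightarrow> f x \<in> carrier X"
  by (blast intro: lmap.closed H_lmap)

lemma restrict_H: "lmap A G X f \<Longrightarrow> restrict f (carrier G) \<in> carrier (H X)"
  by (simp add: hom_module_simps restrict_mod_hom)

lemma E_lmap: "r \<in> carrier E \<Longrightarrow> lmap A G G r"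
  by (simp add: opp_end_simps mod_hom_iff G.left_module_axioms)

lemma E_closed: "r \<in> carrier E \<Longrightarrow> x \<in> carrier G \<Longrightarrow> r x \<in> carrier G"
  by (blast intro: lmap.closed E_lmap)

lemma restrict_E: "lmap A G G f \<Longrightarrow> restrict f (carrier G) \<in> carrier E"
  by (simp add: opp_end_simps restrict_mod_hom)

lemma compose_mod_hom:
  "left_module A X \<Longrightarrow> left_module A Y \<Longrightarrow> r \<in> mod_hom A G X \<Longrightarrow> lmap A X Y f \<Longrightarrow> compose (carrier G) f r \<in> mod_hom A G Y"
  unfolding compose_def by (intro restrict_mod_hom lmap_comp[of A G X r Y f]) (simp_all add: mod_hom_iff G.left_module_axioms)

lemma H_eqI: "f \<in> carrier (H X) \<Longrightarrow> g \<in> carrier (H X) \<Longrightarrow> (\<And>x. x \<in> carrier G \<Longrightarrow> f x = g x) \<Longrightarrow> f = g"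
  unfolding hom_module_simps by (rule mod_hom_eqI)

lemma E_eqI: "f \<in> carrier E \<Longrightarrow> g \<in> carrier E \<Longrightarrow> (\<And>x. x \<in> carrier G \<Longrightarrow> f x = g x) \<Longrightarrow> f = g"
  unfolding opp_end_simps by (rule mod_hom_eqI)

lemma abelian_group_H:
  assumes X: "left_module A X"
  shows "abelian_group (H X)"
proof -
  interpret X: left_module A X by fact
  show ?thesis
  proof (rule abelian_groupI)
    show c: "f \<oplus>\<^bsub>H X\<^esub> g \<in> carrier (H X)" if "f \<in> carrier (H X)" "g \<in> carrier (H X)" for f g
      unfolding hom_module_simps(3) using that by (intro restrict_H lmap_add H_lmap X)
    show z: "\<zero>\<^bsub>H X\<^esub> \<in> carrier (H X)"
      unfolding hom_module_simps(2) by (intro restrict_H lmap_const0 G.left_module_axioms X)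
    fix f g h assume fgh: "f \<in> carrier (H X)" "g \<in> carrier (H X)" "h \<in> carrier (H X)"
    note cl = fgh[THEN H_closed[OF X]]
    show "f \<oplus>\<^bsub>H X\<^esub> g \<oplus>\<^bsub>H X\<^esub> h = f \<oplus>\<^bsub>H X\<^esub> (g \<oplus>\<^bsub>H X\<^esub> h)"
      by (rule H_eqI[of _ X]) (simp_all add: c fgh, simp add: hom_module_simps cl X.M.a_assoc)
    show "f \<oplus>\<^bsub>H X\<^esub> g = g \<oplus>\<^bsub>H X\<^esub> f"
      by (rule H_eqI[of _ X]) (simp_all add: c fgh, simp add: hom_module_simps cl X.M.a_comm)
    show "\<zero>\<^bsub>H X\<^esub> \<oplus>\<^bsub>H X\<^esub> f = f"
      by (rule H_eqI[of _ X]) (simp_all add: c z fgh, simp add: hom_module_simps cl)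
    let ?n = "\<lambda>x\<in>carrier G. \<zero>\<^bsub>X\<^esub> \<ominus>\<^bsub>X\<^esub> f x"
    have n: "?n \<in> carrier (H X)"
      using fgh by (intro restrict_H lmap_diff lmap_const0 H_lmap X G.left_module_axioms)
    have "?n \<oplus>\<^bsub>H X\<^esub> f = \<zero>\<^bsub>H X\<^esub>"
      by (rule H_eqI[of _ X]) (simp_all add: c z n fgh, simp add: hom_module_simps cl a_minus_def X.M.l_neg)
    with n show "\<exists>g\<in>carrier (H X). g \<oplus>\<^bsub>H X\<^esub> f = \<zero>\<^bsub>H X\<^esub>" by blast
  qed
qed

lemma smult_H_closed: "left_module A X \<Longrightarrow> r \<in> carrier E \<Longrightarrow> f \<in> carrier (H X) \<Longrightarrow> compose (carrier G) f r \<in> carrier (H X)"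
  unfolding hom_module_simps by (intro compose_mod_hom[of G X]) (simp_all add: opp_end_simps G.left_module_axioms mod_hom_iff)

lemma ring_E: "ring E"
proof (rule ringI)
  have ab: "abelian_group (H G)" by (rule abelian_group_H) (rule G.left_module_axioms)
  interpret HG: abelian_group "H G" by (rule ab)
  have eq: "carrier E = carrier (H G)" "add E = add (H G)" "zero E = zero (H G)"
    by (simp_all add: opp_end_simps hom_module_simps fun_eq_iff)
  show "abelian_group E"
    by (rule abelian_groupI) (simp_all add: eq HG.a_ac HG.add.l_inv_ex)
  have mc: "r \<otimes>\<^bsub>E\<^esub> s \<in> carrier E" if "r \<in> carrier E" "s \<in> carrier E" for r s
    using smult_H_closed[OF G.left_module_axioms, of r s] that by (simp add: eq opp_end_simps hom_module_simps)
  have ac: "r \<oplus>\<^bsub>E\<^esub> s \<in> carrier E" if "r \<in> carrier E" "s \<in> carrier E" for r s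
    using HG.a_closed[of r s] that by (simp add: eq)
  have one: "\<one>\<^bsub>E\<^esub> \<in> carrier E" 
    unfolding opp_end_simps(3) by (rule restrict_E) (rule lmap_id[OF G.left_module_axioms])
  show "monoid E"
  proof (rule monoidI)
    fix r s t assume rst: "r \<in> carrier E" "s \<in> carrier E" "t \<in> carrier E"
    show "r \<otimes>\<^bsub>E\<^esub> s \<in> carrier E" by (rule mc[OF rst(1,2)])
    show "r \<otimes>\<^bsub>E\<^esub> s \<otimes>\<^bsub>E\<^esub> t = r \<otimes>\<^bsub>E\<^esub> (s \<otimes>\<^bsub>E\<^esub> t)"
      by (rule E_eqI) (simp_all add: mc rst, simp add: opp_end_simps compose_def E_closed[OF rst(1)])
    show "\<one>\<^bsub>E\<^esub> \<otimes>\<^bsub>E\<^esub> r = r" 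
      by (rule E_eqI) (simp_all add: mc one rst, simp add: opp_end_simps compose_def)
    show "r \<otimes>\<^bsub>E\<^esub> \<one>\<^bsub>E\<^esub> = r"
      by (rule E_eqI) (simp_all add: mc one rst, simp add: opp_end_simps compose_def E_closed[OF rst(1)])
  qed (rule one)
  fix r s t assume rst: "r \<in> carrier E" "s \<in> carrier E" "t \<in> carrier E"
  note cl = rst[THEN E_closed]
  show "(r \<oplus>\<^bsub>E\<^esub> s) \<otimes>\<^bsub>E\<^esub> t = r \<otimes>\<^bsub>E\<^esub> t \<oplus>\<^bsub>E\<^esub> s \<otimes>\<^bsub>E\<^esub> t"
    by (rule E_eqI) (simp_all add: mc ac rst, simp add: opp_end_simps compose_def cl lmap.add[OF E_lmap[OF rst(3)]])
  show "t \<otimes>\<^bsub>E\<^esub> (r \<oplus>\<^bsub>E\<^esub> s) = t \<otimes>\<^bsub>E\<^esub> r \<oplus>\<^bsub>E\<^esub> t \<otimes>\<^bsub>E\<^esub> s"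
    by (rule E_eqI) (simp_all add: mc ac rst, simp add: opp_end_simps compose_def cl)
qed

lemma left_module_H:
  assumes X: "left_module A X"
  shows "left_module E (H X)"
proof -
  interpret E: ring E by (rule ring_E)
  interpret HX: abelian_group "H X" by (rule abelian_group_H[OF X])
  have sc: "r \<odot>\<^bsub>H X\<^esub> f \<in> carrier (H X)" if "r \<in> carrier E" "f \<in> carrier (H X)" for r f
    using smult_H_closed[OF X that] by (simp add: hom_module_simps)
  show ?thesis
  proof (intro left_module.intro left_module_axioms.intro E.ring_axioms HX.abelian_group_axioms)
    show "r \<odot>\<^bsub>H X\<^esub> f \<in> carrier (H X)" if "r \<in> carrier E" "f \<in> carrier (H X)" for r f by (rule sc[OF that])
    fix r s f g assume r: "r \<in> carrier E" "s \<in> carrier E" and f: "f \<in> carrier (H X)" "g \<in> carrier (H X)"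
    note cl = r[THEN E_closed] f[THEN H_closed[OF X]]
    show "(r \<oplus>\<^bsub>E\<^esub> s) \<odot>\<^bsub>H X\<^esub> f = r \<odot>\<^bsub>H X\<^esub> f \<oplus>\<^bsub>H X\<^esub> s \<odot>\<^bsub>H X\<^esub> f"
      by (rule H_eqI[of _ X]) (simp_all add: sc r f, simp add: hom_module_simps opp_end_simps compose_def cl lmap.add[OF H_lmap[OF X f(1)]])
    show "r \<odot>\<^bsub>H X\<^esub> (f \<oplus>\<^bsub>H X\<^esub> g) = r \<odot>\<^bsub>H X\<^esub> f \<oplus>\<^bsub>H X\<^esub> r \<odot>\<^bsub>H X\<^esub> g"
      by (rule H_eqI[of _ X]) (simp_all add: sc r f, simp add: hom_module_simps opp_end_simps compose_def cl)
    show "(r \<otimes>\<^bsub>E\<^esub> s) \<odot>\<^bsub>H X\<^esub> f = r \<odot>\<^bsub>H X\<^esub> (s \<odot>\<^bsub>H X\<^esub> f)"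
      by (rule H_eqI[of _ X]) (simp_all add: sc r f, simp add: hom_module_simps opp_end_simps compose_def cl)
  next
    fix f assume f: "f \<in> carrier (H X)"
    note cl = f[THEN H_closed[OF X]]
    show "\<one>\<^bsub>E\<^esub> \<odot>\<^bsub>H X\<^esub> f = f"
      by (rule H_eqI[of _ X]) (simp_all add: sc f, simp add: hom_module_simps opp_end_simps compose_def cl)
  qed
qed

lemma H_smult_apply: "x \<in> carrier G \<Longrightarrow> (r \<odot>\<^bsub>H X\<^esub> f) x = f (r x)"
  by (simp add: hom_module_simps compose_def)

lemma H_add_apply: "x \<in> carrier G \<Longrightarrow> (f \<oplus>\<^bsub>H X\<^esub> g) x = f x \<oplus>\<^bsub>X\<^esub> g x"
  by (simp add: hom_module_simps)

lemma H_zero_apply: "x \<in> carrier G \<Longrightarrow> \<zero>\<^bsub>H X\<^esub> x = \<zero>\<^bsub>X\<^esub>"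
  by (simp add: hom_module_simps)

lemma H_zero_iff: "left_module A X \<Longrightarrow> f \<in> carrier (H X) \<Longrightarrow> f = \<zero>\<^bsub>H X\<^esub> \<longleftrightarrow> (\<forall>x\<in>carrier G. f x = \<zero>\<^bsub>X\<^esub>)"
  by (metis H_eqI H_zero_apply abelian_group.axioms(1) abelian_group_H abelian_monoid.zero_closed)

lemma lmap_post:
  assumes f: "lmap A X Y \<phi>"
  shows "lmap E (H X) (H Y) (\<lambda>f. compose (carrier G) \<phi> f)"
proof -
  interpret f: lmap A X Y \<phi> by fact
  note X = f.dom.left_module_axioms and Y = f.cod.left_module_axioms
  interpret HX: left_module E "H X" by (rule left_module_H[OF X])
  interpret HY: left_module E "H Y" by (rule left_module_H[OF Y])
  have c: "compose (carrier G) \<phi> h \<in> carrier (H Y)" if "h \<in> carrier (H X)" for h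
    using compose_mod_hom[OF X Y _ f] that by (simp add: hom_module_simps)
  show ?thesis
  proof (rule lmapI[OF left_module_H[OF X] left_module_H[OF Y] c])
    fix h k assume hk: "h \<in> carrier (H X)" "k \<in> carrier (H X)"
    show "compose (carrier G) \<phi> (h \<oplus>\<^bsub>H X\<^esub> k) = compose (carrier G) \<phi> h \<oplus>\<^bsub>H Y\<^esub> compose (carrier G) \<phi> k"
      by (rule H_eqI[of _ Y]) (simp_all add: c hk, simp add: hom_module_simps compose_def f.add hk[THEN H_closed[OF X]])
  next
    fix r h assume rh: "r \<in> carrier E" "h \<in> carrier (H X)"
    show "compose (carrier G) \<phi> (r \<odot>\<^bsub>H X\<^esub> h) = r \<odot>\<^bsub>H Y\<^esub> compose (carrier G) \<phi> h"
      by (rule H_eqI[of _ Y]) (simp_all add: c rh, simp add: hom_module_simps compose_def E_closed[OF rh(1)])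
  qed
qed

lemma H_submoduleI:
  assumes X: "left_module A X" and U: "U \<subseteq> carrier (H X)" "\<zero>\<^bsub>H X\<^esub> \<in> U" 
    "\<And>f g. f \<in> U \<Longrightarrow> g \<in> U \<Longrightarrow> f \<oplus>\<^bsub>H X\<^esub> g \<in> U" "\<And>r f. r \<in> carrier E \<Longrightarrow> f \<in> U \<Longrightarrow> r \<odot>\<^bsub>H X\<^esub> f \<in> U"
  shows "submodule U E (H X)"
  by (rule left_module.lsubmoduleI[OF left_module_H[OF X]]) (use U in auto)

lemma sub_H:
  assumes X: "left_module A X" and Y: "submodule Y A X"
  shows "submodule {f \<in> carrier (H X). \<forall>g\<in>carrier G. f g \<in> Y} E (H X)"
proof -
  interpret X: left_module A X by fact
  interpret HX: left_module E "H X" by (rule left_module_H[OF X])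
  show ?thesis
    by (rule H_submoduleI[OF X]) (auto simp: H_add_apply H_smult_apply H_zero_apply E_closed X.submoduleD[OF Y])
qed

lemma carrier_H_msub:
  assumes X: "left_module A X" and Y: "submodule Y A X"
  shows "carrier (H (msub X Y)) = {f \<in> carrier (H X). \<forall>g\<in>carrier G. f g \<in> Y}"
proof -
  interpret X: left_module A X by fact
  note mY = X.left_module_msub[OF Y]
  have "lmap A G (msub X Y) f \<longleftrightarrow> lmap A G X f \<and> (\<forall>g\<in>carrier G. f g \<in> Y)" for f
    using lmap_msub_cod[of A G X f Y] lmap_of_msub[of A G X Y f] X Y lmap.closed[of A G "msub X Y" f] by auto
  then show ?thesis by (auto simp: in_H[OF mY] in_H[OF X])
qed

lemma msub_H:
  assumes X: "left_module A X" and Y: "submodule Y A X"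
  shows "H (msub X Y) = msub (H X) {f \<in> carrier (H X). \<forall>g\<in>carrier G. f g \<in> Y}"
  using carrier_H_msub[OF assms] left_module.msub_simps[OF X] by (simp add: hom_module_def msub_def)

text \<open>If \<open>F\<close> is composition with \<open>\<phi>\<close>, then \<open>\<phi> x\<close> is determined by the values of \<open>F\<close> on the maps
  \<open>g \<mapsto> p g x\<close>, where \<open>p\<close> runs through maps from \<open>G\<close> to the regular module.\<close>

lemma full_faithful:
  assumes X: "left_module A X" and Y: "left_module A Y"
    and U: "submodule U E (H X)" and F: "lmap E (msub (H X) U) (H Y) F"
    and \<P>: "\<And>p. p \<in> \<P> \<Longrightarrow> lmap A G (regular_module A) p"
    and \<P>U: "\<And>p x. p \<in> \<P> \<Longrightarrow> x \<in> carrier X \<Longrightarrow> (\<lambda>g\<in>carrier G. p g \<odot>\<^bsub>X\<^esub> x) \<in> U"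
    and \<P>a: "\<And>p a. p \<in> \<P> \<Longrightarrow> a \<in> carrier A \<Longrightarrow> \<exists>p'\<in>\<P>. \<forall>g\<in>carrier G. p' g = p g \<otimes>\<^bsub>A\<^esub> a"
    and gen: "\<And>B. submodule B A (regular_module A) \<Longrightarrow> (\<And>p g. p \<in> \<P> \<Longrightarrow> g \<in> carrier G \<Longrightarrow> p g \<in> B) \<Longrightarrow> B = carrier A"
  obtains \<phi> where "lmap A X Y \<phi>" "\<And>f g. f \<in> U \<Longrightarrow> g \<in> carrier G \<Longrightarrow> F f g = \<phi> (f g)"
proof -
  interpret X: left_module A X by fact
  interpret Y: left_module A Y by fact
  interpret HX: left_module E "H X" by (rule left_module_H[OF X])
  interpret F: lmap E "msub (H X) U" "H Y" F by (rule F)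
  interpret reg: left_module A "regular_module A" by (rule left_module_regular[OF G.R.ring_axioms])
  define r where "r p x = (\<lambda>g\<in>carrier G. p g \<odot>\<^bsub>X\<^esub> x)" for p x
  have rU: "r p x \<in> U" if "p \<in> \<P>" "x \<in> carrier X" for p x using \<P>U[OF that] by (simp add: r_def)
  have UH: "f \<in> carrier (H X)" if "f \<in> U" for f using HX.submoduleD(2)[OF U that] .
  have FH: "F f \<in> carrier (H Y)" if "f \<in> U" for f using F.closed that by simp
  have pc: "p g \<in> carrier A" if "p \<in> \<P>" "g \<in> carrier G" for p g using lmap.closed[OF \<P>[OF that(1)] that(2)] by simp
  have Fsm: "F (s \<odot>\<^bsub>H X\<^esub> f) = s \<odot>\<^bsub>H Y\<^esub> F f" if "s \<in> carrier E" "f \<in> U" for s f using F.smult that by simp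
  \<comment> \<open>\<open>rep x y\<close> says that \<open>y\<close> qualifies as the value at
    \<open>x\<close> of the map to be found. Existence and uniqueness of \<open>y\<close> are both
    derived from \<open>gen\<close>.\<close>
  define rep where "rep x y \<longleftrightarrow> y \<in> carrier Y \<and> (\<forall>p\<in>\<P>. \<forall>g\<in>carrier G. F (r p x) g = p g \<odot>\<^bsub>Y\<^esub> y)" for x y
  have key: "rep (f g) (F f g)" if f: "f \<in> U" and g: "g \<in> carrier G" for f g
    unfolding rep_def
  proof (intro conjI ballI)
    show "F f g \<in> carrier Y" using H_closed[OF Y FH[OF f] g] .
    fix p g' assume p: "p \<in> \<P>" and g': "g' \<in> carrier G"
    \<comment> \<open>An endomorphism of \<open>G\<close> chosen such that acting with it on
      \<open>f\<close> gives the test map of \<open>f g\<close>. Linearity of \<open>F\<close> over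
      \<open>E\<close> then computes the value of \<open>F\<close> on that test map.\<close>
    define s where "s = (\<lambda>g'\<in>carrier G. p g' \<odot>\<^bsub>G\<^esub> g)"
    have s: "s \<in> carrier E" unfolding s_def
      by (rule restrict_E) (rule lmap_comp[OF \<P>[OF p] lmap_orbit[OF G.left_module_axioms g]])
    have fl: "lmap A G X f" using H_lmap[OF X UH[OF f]] .
    have fg: "f g \<in> carrier X" using H_closed[OF X UH[OF f] g] .
    have "r p (f g) = s \<odot>\<^bsub>H X\<^esub> f"
    proof (rule H_eqI[of _ X])
      show "r p (f g) \<in> carrier (H X)" using UH rU p fg by blast
      show "s \<odot>\<^bsub>H X\<^esub> f \<in> carrier (H X)" using s UH[OF f] by simp
      fix x assume x: "x \<in> carrier G"
      show "r p (f g) x = (s \<odot>\<^bsub>H X\<^esub> f) x"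
        using x pc[OF p x] g by (simp add: H_smult_apply r_def s_def lmap.smult[OF fl])
    qed
    then have "F (r p (f g)) g' = F f (s g')" using Fsm[OF s f] g' by (simp add: H_smult_apply)
    also have "\<dots> = p g' \<odot>\<^bsub>Y\<^esub> F f g"
      using g' pc[OF p g'] g by (simp add: s_def lmap.smult[OF H_lmap[OF Y FH[OF f]]])
    finally show "F (r p (f g)) g' = p g' \<odot>\<^bsub>Y\<^esub> F f g" .
  qed
  have uniq: "y = y'" if y: "rep x y" "rep x y'" for x y y'
  proof -
    have c: "y \<in> carrier Y" "y' \<in> carrier Y" using y by (auto simp: rep_def)
    let ?d = "y \<ominus>\<^bsub>Y\<^esub> y'"
    \<comment> \<open>The annihilator of the difference of two candidates is a left ideal containing
      all values of the test forms, hence the unit.\<close>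
    let ?B = "{c \<in> carrier A. c \<odot>\<^bsub>Y\<^esub> ?d = \<zero>\<^bsub>Y\<^esub>}"
    note o = lmap_orbit[OF Y, of ?d]
    have "submodule ?B A (regular_module A)"
      using lmap.ker_submodule[OF o] lmap.ker_def[OF o] c by simp
    moreover have "p g \<in> ?B" if "p \<in> \<P>" "g \<in> carrier G" for p g
    proof -
      have "p g \<odot>\<^bsub>Y\<^esub> ?d = p g \<odot>\<^bsub>Y\<^esub> y \<ominus>\<^bsub>Y\<^esub> p g \<odot>\<^bsub>Y\<^esub> y'"
        using pc[OF that] c by (simp add: a_minus_def Y.smult_r_distr Y.smult_neg)
      also have "p g \<odot>\<^bsub>Y\<^esub> y = p g \<odot>\<^bsub>Y\<^esub> y'" using y that unfolding rep_def by metis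
      finally show ?thesis using pc[OF that] c by (simp add: a_minus_def Y.M.r_neg)
    qed
    ultimately have "?B = carrier A" by (rule gen)
    then have "\<one>\<^bsub>A\<^esub> \<odot>\<^bsub>Y\<^esub> ?d = \<zero>\<^bsub>Y\<^esub>" by blast
    then show ?thesis using c Y.diff_zero_iff by simp
  qed
  have radd: "r p (x \<oplus>\<^bsub>X\<^esub> x') = r p x \<oplus>\<^bsub>H X\<^esub> r p x'" if "p \<in> \<P>" "x \<in> carrier X" "x' \<in> carrier X" for p x x'
    using that pc by (intro ext) (simp add: r_def hom_module_simps X.smult_r_distr restrict_def)
  have repadd: "rep (x \<oplus>\<^bsub>X\<^esub> x') (y \<oplus>\<^bsub>Y\<^esub> y')" if "rep x y" "rep x' y'" "x \<in> carrier X" "x' \<in> carrier X" for x x' y y'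
    using that F.add rU pc by (simp add: rep_def radd H_add_apply Y.smult_r_distr)
  have repsm: "rep (a \<odot>\<^bsub>X\<^esub> x) (a \<odot>\<^bsub>Y\<^esub> y)" if xy: "rep x y" "x \<in> carrier X" and a: "a \<in> carrier A" for a x y
    unfolding rep_def
  proof (intro conjI ballI)
    have y: "y \<in> carrier Y" using xy by (simp add: rep_def)
    then show "a \<odot>\<^bsub>Y\<^esub> y \<in> carrier Y" using a by simp
    fix p g assume p: "p \<in> \<P>" and g: "g \<in> carrier G"
    obtain p' where p': "p' \<in> \<P>" "\<And>g. g \<in> carrier G \<Longrightarrow> p' g = p g \<otimes>\<^bsub>A\<^esub> a" using \<P>a[OF p a] by blast
    have "r p (a \<odot>\<^bsub>X\<^esub> x) = r p' x"
      using p' pc[OF p] a xy(2) unfolding r_def by (intro restrict_ext) (simp add: X.smult_assoc)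
    then have "F (r p (a \<odot>\<^bsub>X\<^esub> x)) g = p' g \<odot>\<^bsub>Y\<^esub> y" using xy(1) p'(1) g by (simp add: rep_def)
    then show "F (r p (a \<odot>\<^bsub>X\<^esub> x)) g = p g \<odot>\<^bsub>Y\<^esub> (a \<odot>\<^bsub>Y\<^esub> y)" using p' g pc[OF p g] a y by (simp add: Y.smult_assoc)
  qed
  have rep0: "rep \<zero>\<^bsub>X\<^esub> \<zero>\<^bsub>Y\<^esub>"
  proof -
    have "r p \<zero>\<^bsub>X\<^esub> = \<zero>\<^bsub>H X\<^esub>" if "p \<in> \<P>" for p
      using pc[OF that] unfolding r_def hom_module_simps by (intro restrict_ext) simp
    then show ?thesis using F.zero pc by (simp add: rep_def H_zero_apply)
  qed
  have ex: "\<exists>y. rep x y" if x: "x \<in> carrier X" for x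
  proof -
    \<comment> \<open>The scalars whose multiple of \<open>x\<close> has a candidate form a left
      ideal. It contains the values p g, because p g x is a value of a map in \<open>U\<close> and
      \<open>key\<close> applies.\<close>
    let ?B = "{w \<in> carrier A. \<exists>y. rep (w \<odot>\<^bsub>X\<^esub> x) y}"
    have "submodule ?B A (regular_module A)"
    proof (rule reg.lsubmoduleI)
      show "\<zero>\<^bsub>regular_module A\<^esub> \<in> ?B" using rep0 x by auto
      fix v w assume vw: "v \<in> ?B" "w \<in> ?B"
      then obtain y y' where "rep (v \<odot>\<^bsub>X\<^esub> x) y" "rep (w \<odot>\<^bsub>X\<^esub> x) y'" by auto
      then have "rep (v \<odot>\<^bsub>X\<^esub> x \<oplus>\<^bsub>X\<^esub> w \<odot>\<^bsub>X\<^esub> x) (y \<oplus>\<^bsub>Y\<^esub> y')" using vw x by (intro repadd) auto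
      then show "v \<oplus>\<^bsub>regular_module A\<^esub> w \<in> ?B" using vw x by (auto simp: X.smult_l_distr)
    next
      fix a w assume a: "a \<in> carrier A" and w: "w \<in> ?B"
      then obtain y where "rep (w \<odot>\<^bsub>X\<^esub> x) y" by auto
      then have "rep (a \<odot>\<^bsub>X\<^esub> (w \<odot>\<^bsub>X\<^esub> x)) (a \<odot>\<^bsub>Y\<^esub> y)" using a w x by (intro repsm) auto
      then show "a \<odot>\<^bsub>regular_module A\<^esub> w \<in> ?B" using a w x by (auto simp: X.smult_assoc)
    qed auto
    moreover have "p g \<in> ?B" if "p \<in> \<P>" "g \<in> carrier G" for p g
      using key[OF rU[OF that(1) x] that(2)] that pc by (auto simp: r_def)
    ultimately have "?B = carrier A" by (rule gen)
    then have "\<one>\<^bsub>A\<^esub> \<in> ?B" by simp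
    then show ?thesis using x by auto
  qed
  define \<phi> where "\<phi> x = (SOME y. rep x y)" for x
  have rep: "rep x (\<phi> x)" if "x \<in> carrier X" for x unfolding \<phi>_def by (rule someI_ex[OF ex[OF that]])
  have "lmap A X Y \<phi>"
  proof (rule lmapI[OF X Y])
    fix x assume "x \<in> carrier X" then show "\<phi> x \<in> carrier Y" using rep by (auto simp: rep_def)
  next
    fix x y assume xy: "x \<in> carrier X" "y \<in> carrier X"
    then show "\<phi> (x \<oplus>\<^bsub>X\<^esub> y) = \<phi> x \<oplus>\<^bsub>Y\<^esub> \<phi> y" by (intro uniq[OF rep repadd] rep) auto
  next
    fix a x assume "a \<in> carrier A" "x \<in> carrier X"
    then show "\<phi> (a \<odot>\<^bsub>X\<^esub> x) = a \<odot>\<^bsub>Y\<^esub> \<phi> x" by (intro uniq[OF rep repsm] rep) auto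
  qed
  moreover have "F f g = \<phi> (f g)" if "f \<in> U" "g \<in> carrier G" for f g
    using uniq[OF key[OF that] rep] H_closed[OF X UH[OF that(1)] that(2)] by simp
  ultimately show thesis by (rule that)
qed

end

section \<open>The modules \<open>P i / Rad\<^sup>j P i\<close>\<close>

locale adr = proj_list A n P for A :: "('a, 'e) ring_scheme" (structure) and n :: nat and P :: "nat \<Rightarrow> ('a, 'v) module" +
  fixes L :: nat and C :: "('c, 'd) ring_scheme" and \<gamma> :: "'c \<Rightarrow> 'a"
  assumes artin: "artin_algebra C A \<gamma>"
    and LL: "i \<in> {1..n} \<Longrightarrow> loewy_length A (P i) = L"
    and rigid: "i \<in> {1..n} \<Longrightarrow> rigid A (P i)"
begin

abbreviation "\<Lambda> \<equiv> adr_labels A n P"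
abbreviation "Gs \<equiv> adr_summand A P"
abbreviation "G \<equiv> dir_sum \<Lambda> Gs"
abbreviation "Top i \<equiv> mtop A (P i)"

abbreviation "cls i j \<equiv> \<lambda>x. rad_series A (P i) j +>\<^bsub>P i\<^esub> x"

lemma labels_iff: "(i, j) \<in> \<Lambda> \<longleftrightarrow> i \<in> {1..n} \<and> j \<in> {1..L}"
  by (auto simp: adr_labels_def LL)

lemma labels_eq: "\<Lambda> = {1..n} \<times> {1..L}"
  using labels_iff by auto

lemma finite_labels: "finite \<Lambda>"
  by (simp add: labels_eq)

lemma summand_eq: "Gs (i, j) = quot_module (P i) (rad_series A (P i) j)"
  by (simp add: adr_summand_def)

lemma rad_P_submodule: "i \<in> {1..n} \<Longrightarrow> submodule (rad_series A (P i) j) A (P i)"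
  by (rule left_module.rad_series_submodule[OF left_module_P])

lemma lmap_cls: "i \<in> {1..n} \<Longrightarrow> lmap A (P i) (Gs (i, j)) (cls i j)"
  unfolding summand_eq by (rule left_module.lmap_quot[OF left_module_P rad_P_submodule])

lemma cls_surj: "i \<in> {1..n} \<Longrightarrow> cls i j ` carrier (P i) = carrier (Gs (i, j))"
  unfolding summand_eq by (rule quot_lmap_surj[OF left_module_P rad_P_submodule])

lemma cls_zero_iff: "i \<in> {1..n} \<Longrightarrow> x \<in> carrier (P i) \<Longrightarrow> cls i j x = \<zero>\<^bsub>Gs (i, j)\<^esub> \<longleftrightarrow> x \<in> rad_series A (P i) j"
  unfolding summand_eq
  using left_module.coset_eq_zero_iff[OF left_module_P rad_P_submodule] left_module.quot_simps(2)[OF left_module_P rad_P_submodule] by simp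

lemma left_module_Gs: "p \<in> \<Lambda> \<Longrightarrow> left_module A (Gs p)"
  using lmapD(2)[OF lmap_cls] by (cases p) (simp only: labels_iff)

lemma finlen_P: "i \<in> {1..n} \<Longrightarrow> finlen A (P i)"
  by (rule indec_proj.finlen_P[OF indec_P])

lemma finlen_Gs: "p \<in> \<Lambda> \<Longrightarrow> finlen A (Gs p)"
  using finlen_surj[OF lmap_cls cls_surj finlen_P] by (cases p) (simp only: labels_iff)

lemma fg_P: "i \<in> {1..n} \<Longrightarrow> fg_module A (P i)"
  by (rule indec_proj.fg[OF indec_P])

lemma fg_Gs: "p \<in> \<Lambda> \<Longrightarrow> fg_module A (Gs p)"
  by (rule fg_finlen[OF finlen_Gs])

lemma rad_series_Gs: "i \<in> {1..n} \<Longrightarrow> rad_series A (Gs (i, j)) t = cls i j ` rad_series A (P i) t"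
  by (rule rad_series_surj[OF lmap_cls cls_surj, symmetric])

lemma radical_Gs: "i \<in> {1..n} \<Longrightarrow> radical A (Gs (i, j)) = cls i j ` radical A (P i)"
  using rad_series_Gs[of i j 1] by simp

lemma cls_radical_iff:
  assumes i: "(i, j) \<in> \<Lambda>" and x: "x \<in> carrier (P i)"
  shows "cls i j x \<in> radical A (Gs (i, j)) \<longleftrightarrow> x \<in> radical A (P i)"
proof
  have i': "i \<in> {1..n}" "1 \<le> j" using i by (auto simp: labels_iff)
  interpret Pi: left_module A "P i" by (rule left_module_P[OF i'(1)])
  show "x \<in> radical A (P i) \<Longrightarrow> cls i j x \<in> radical A (Gs (i, j))" by (simp add: radical_Gs[OF i'(1)])
  assume "cls i j x \<in> radical A (Gs (i, j))"
  then obtain y where y: "y \<in> radical A (P i)" "cls i j x = cls i j y" by (auto simp: radical_Gs[OF i'(1)])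
  have yc: "y \<in> carrier (P i)" using y Pi.submoduleD(2)[OF Pi.radical_submodule] by blast
  have "x \<ominus>\<^bsub>P i\<^esub> y \<in> rad_series A (P i) j" using y(2) Pi.coset_eq_iff[OF rad_P_submodule[OF i'(1)] x yc] by simp
  also have "\<dots> \<subseteq> radical A (P i)" using Pi.rad_series_mono[OF i'(2)] by simp
  finally have "(x \<ominus>\<^bsub>P i\<^esub> y) \<oplus>\<^bsub>P i\<^esub> y \<in> radical A (P i)" using y Pi.submoduleD(4)[OF Pi.radical_submodule] by blast
  then show "x \<in> radical A (P i)" using x yc by (simp add: a_minus_def Pi.M.a_assoc Pi.M.l_neg)
qed

lemma proper_le_rad_Gs:
  assumes p: "p \<in> \<Lambda>" and N: "submodule N A (Gs p)" "N \<noteq> carrier (Gs p)"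
  shows "N \<subseteq> radical A (Gs p)"
proof -
  obtain i j where ij: "p = (i, j)" "(i, j) \<in> \<Lambda>" "i \<in> {1..n}" using p by (cases p) (auto simp: labels_iff)
  interpret c: lmap A "P i" "Gs p" "cls i j" unfolding ij by (rule lmap_cls[OF ij(3)])
  interpret Pi: indec_proj A "P i" by (rule indec_P[OF ij(3)])
  let ?V = "{x \<in> carrier (P i). cls i j x \<in> N}"
  have s: "cls i j ` carrier (P i) = carrier (Gs p)" using cls_surj[OF ij(3), of j] by (simp add: ij(1))
  have "N \<subseteq> cls i j ` carrier (P i)" unfolding s by (rule c.cod.submoduleD(1)[OF N(1)])
  then have e: "N = cls i j ` ?V" by auto
  have "?V \<noteq> carrier (P i)"
  proof
    assume "?V = carrier (P i)"
    then have "N = cls i j ` carrier (P i)" using e by simp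
    then show False using N(2) s by simp
  qed
  then have "?V \<subseteq> radical A (P i)" by (rule Pi.proper_le_rad[OF c.vimage_submodule[OF N(1)]])
  then have "cls i j ` ?V \<subseteq> cls i j ` radical A (P i)" by (rule image_mono)
  then show ?thesis using e radical_Gs[OF ij(3), of j] by (simp add: ij(1))
qed

lemma radical_Gs_proper:
  assumes p: "p \<in> \<Lambda>"
  shows "radical A (Gs p) \<noteq> carrier (Gs p)"
proof -
  obtain i j where ij: "p = (i, j)" "(i, j) \<in> \<Lambda>" "i \<in> {1..n}" using p by (cases p) (auto simp: labels_iff)
  interpret Pi: indec_proj A "P i" by (rule indec_P[OF ij(3)])
  obtain x where x: "x \<in> carrier (P i)" "x \<notin> radical A (P i)" 
    using Pi.radP_proper Pi.P.submoduleD(1)[OF Pi.radP_submodule] by blast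
  then have "cls i j x \<in> carrier (Gs p)" "cls i j x \<notin> radical A (Gs p)"
    using cls_radical_iff[OF ij(2)] lmap.closed[OF lmap_cls[OF ij(3)]] unfolding ij by auto
  then show ?thesis by blast
qed

lemma surj_or_rad:
  assumes p: "p \<in> \<Lambda>" and f: "lmap A X (Gs p) f"
  shows "f ` carrier X = carrier (Gs p) \<or> f ` carrier X \<subseteq> radical A (Gs p)"
proof -
  interpret f: lmap A X "Gs p" f by (rule f)
  show ?thesis using proper_le_rad_Gs[OF p f.image_submodule[OF f.dom.submodule_carrier]] by blast
qed

text \<open>The truncations are not projective, so their maps are treated in two steps: they are
  lifted on P_i by this lemma and pushed down again by \<open>factor_Gs\<close> when the relevant
  radical term is killed.\<close>

lemma lift_Gs:
  assumes i: "i \<in> {1..n}" and f: "lmap A (Gs (i, j)) Z f" and v: "lmap A Y Z v" "v ` carrier Y = carrier Z"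
    and fg: "fg_module A Y" "fg_module A Z"
  obtains h where "lmap A (P i) Y h" "\<And>x. x \<in> carrier (P i) \<Longrightarrow> v (h x) = f (cls i j x)"
  by (rule proj_lift[OF indec_proj.proj[OF indec_P[OF i]] fg v lmap_comp[OF lmap_cls[OF i] f]]) blast

lemma factor_Gs:
  assumes i: "i \<in> {1..n}" and h: "lmap A (P i) Y h" and z: "\<And>x. x \<in> rad_series A (P i) j \<Longrightarrow> h x = \<zero>\<^bsub>Y\<^esub>"
  obtains f where "lmap A (Gs (i, j)) Y f" "\<And>x. x \<in> carrier (P i) \<Longrightarrow> f (cls i j x) = h x"
  using lmap_factor[OF h rad_P_submodule[OF i] z] unfolding summand_eq by blast

text \<open>Once two consecutive terms agree the series is constant, so it would already vanish at
  \<open>b\<close>, below the Loewy length.\<close>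

lemma rad_series_P_strict:
  assumes i: "i \<in> {1..n}" and b: "b < L"
  shows "\<not> rad_series A (P i) b \<subseteq> rad_series A (P i) (Suc b)"
proof
  interpret Pi: left_module A "P i" by (rule left_module_P[OF i])
  assume "rad_series A (P i) b \<subseteq> rad_series A (P i) (Suc b)"
  then have e: "rad_series A (P i) (Suc b) = rad_series A (P i) b" using Pi.rad_series_Suc_subset by blast
  have "rad_series A (P i) (b + t) = rad_series A (P i) b" for t
    by (induction t) (use e in auto)
  from this[of "L - b"] have "rad_series A (P i) b = rad_series A (P i) L" using b by simp
  also have "\<dots> = {\<zero>\<^bsub>P i\<^esub>}" using rad_series_loewy[OF left_module_P[OF i]] LL[OF i] by simp
  finally show False using rad_series_less_loewy[of b "P i"] LL[OF i] b by simp
qed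

text \<open>The map lifts to a surjection P_a -> P_i, which is an isomorphism, so a = i. Moreover
  J^b kills the source, hence the target, and strictness of the radical series of P_i gives j \<le>
  b.\<close>

lemma surj_Gs_labels:
  assumes p: "(a, b) \<in> \<Lambda>" and q: "(i, j) \<in> \<Lambda>" and f: "lmap A (Gs (a, b)) (Gs (i, j)) f"
    and s: "f ` carrier (Gs (a, b)) = carrier (Gs (i, j))"
  shows "a = i \<and> j \<le> b"
proof
  have ai: "a \<in> {1..n}" "i \<in> {1..n}" "1 \<le> j" "j \<le> L" using p q by (auto simp: labels_iff)
  interpret Pi: indec_proj A "P i" by (rule indec_P[OF ai(2)])
  obtain h where h: "lmap A (P a) (P i) h" "\<And>x. x \<in> carrier (P a) \<Longrightarrow> cls i j (h x) = f (cls a b x)"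
    by (rule lift_Gs[OF ai(1) f lmap_cls[OF ai(2)] cls_surj[OF ai(2)] fg_P[OF ai(2)] fg_Gs[OF q]]) blast
  obtain y where y: "y \<in> carrier (Gs (i, j))" "y \<notin> radical A (Gs (i, j))" 
    using radical_Gs_proper[OF q] left_module.submoduleD(1)[OF left_module_Gs[OF q] left_module.radical_submodule[OF left_module_Gs[OF q]]] by blast
  then obtain g where g: "g \<in> carrier (Gs (a, b))" "y = f g" using s by blast
  then obtain x where x: "x \<in> carrier (P a)" "g = cls a b x" using cls_surj[OF ai(1), of b] by blast
  have "h x \<notin> radical A (P i)" 
    using y(2) cls_radical_iff[OF q lmap.closed[OF h(1) x(1)]] by (simp add: g(2) x(2) h(2)[OF x(1)])
  from Pi.surj_of_not_rad[OF h(1) x(1) this] show "a = i" using P_iso_eq[OF ai(1,2) h(1)] by blast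
  show "j \<le> b"
  proof (rule ccontr)
    assume "\<not> j \<le> b"
    then have jb: "Suc b \<le> j" "b < L" using ai by auto
    have "rad_series A (P i) b \<subseteq> rad_series A (P i) j"
    proof (rule rad_series_le[OF left_module_P[OF ai(2)] rad_P_submodule[OF ai(2)]])
      fix c z assume c: "c \<in> Jpow A b" and z: "z \<in> carrier (P i)"
      have "cls i j z \<in> carrier (Gs (i, j))" using z by (rule lmap.closed[OF lmap_cls[OF ai(2)]])
      then obtain g where g: "g \<in> carrier (Gs (a, b))" "cls i j z = f g" using s by blast
      then obtain x where x: "x \<in> carrier (P a)" "g = cls a b x" using cls_surj[OF ai(1), of b] by blast
      have cA: "c \<in> carrier A" using c by (rule Jpow_closed)
      have "c \<odot>\<^bsub>P a\<^esub> x \<in> rad_series A (P a) b" using Jpow_smult[OF left_module_P[OF ai(1)] c, of x 0] x by simp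
      then have "cls a b (c \<odot>\<^bsub>P a\<^esub> x) = \<zero>\<^bsub>Gs (a, b)\<^esub>"
        using cls_zero_iff[OF ai(1), of "c \<odot>\<^bsub>P a\<^esub> x" b] left_module.submoduleD(2)[OF left_module_P[OF ai(1)] rad_P_submodule[OF ai(1)]] by blast
      then have "c \<odot>\<^bsub>Gs (a, b)\<^esub> g = \<zero>\<^bsub>Gs (a, b)\<^esub>" using x cA lmap.smult[OF lmap_cls[OF ai(1)] cA x(1)] by simp
      then have "c \<odot>\<^bsub>Gs (i, j)\<^esub> cls i j z = \<zero>\<^bsub>Gs (i, j)\<^esub>"
        using g lmap.smult[OF f cA g(1)] lmap.zero[OF f] by simp
      then have "cls i j (c \<odot>\<^bsub>P i\<^esub> z) = \<zero>\<^bsub>Gs (i, j)\<^esub>" using lmap.smult[OF lmap_cls[OF ai(2)] cA z] by simp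
      then show "c \<odot>\<^bsub>P i\<^esub> z \<in> rad_series A (P i) j"
        using cls_zero_iff[OF ai(2)] left_module.smult_closed[OF left_module_P[OF ai(2)] cA z] by blast
    qed
    also have "\<dots> \<subseteq> rad_series A (P i) (Suc b)" by (rule left_module.rad_series_mono[OF left_module_P[OF ai(2)] jb(1)])
    finally show False using rad_series_P_strict[OF ai(2) jb(2)] by blast
  qed
qed

text \<open>A lift to P_i does not land in the radical, so it is bijective. Its inverse preserves
  Rad^j and therefore descends.\<close>

lemma surj_endo_Gs:
  assumes p: "p \<in> \<Lambda>" and f: "lmap A (Gs p) (Gs p) f" "f ` carrier (Gs p) = carrier (Gs p)"
  obtains g where "lmap A (Gs p) (Gs p) g" "\<And>x. x \<in> carrier (Gs p) \<Longrightarrow> f (g x) = x"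
proof -
  obtain i j where ij: "p = (i, j)" "(i, j) \<in> \<Lambda>" "i \<in> {1..n}" using p by (cases p) (auto simp: labels_iff)
  note f = f[unfolded ij(1)]
  interpret Pi: indec_proj A "P i" by (rule indec_P[OF ij(3)])
  interpret f: lmap A "Gs (i, j)" "Gs (i, j)" f by (rule f)
  obtain h where h: "lmap A (P i) (P i) h" "\<And>x. x \<in> carrier (P i) \<Longrightarrow> cls i j (h x) = f (cls i j x)"
    by (rule lift_Gs[OF ij(3) f(1) lmap_cls[OF ij(3)] cls_surj[OF ij(3)] fg_P[OF ij(3)] fg_Gs[OF ij(2)]]) blast
  obtain y where y: "y \<in> carrier (Gs (i, j))" "y \<notin> radical A (Gs (i, j))" 
    using radical_Gs_proper[OF ij(2)] f.dom.submoduleD(1)[OF f.dom.radical_submodule] by blast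
  then obtain g where g: "g \<in> carrier (Gs (i, j))" "y = f g" using f(2) by blast
  then obtain x where x: "x \<in> carrier (P i)" "g = cls i j x" using cls_surj[OF ij(3), of j] by blast
  have "h x \<notin> radical A (P i)"
    using y(2) cls_radical_iff[OF ij(2) lmap.closed[OF h(1) x(1)]] by (simp add: g(2) x(2) h(2)[OF x(1)])
  from Pi.surj_of_not_rad[OF h(1) x(1) this] have bij: "bij_betw h (carrier (P i)) (carrier (P i))" using Pi.surj_endo_bij[OF h(1)] by blast
  let ?k = "inv_into (carrier (P i)) h"
  have k: "lmap A (P i) (P i) ?k" by (rule lmap_inv[OF h(1) bij])
  have hk: "h (?k x) = x" if "x \<in> carrier (P i)" for x using bij that by (simp add: bij_betw_def f_inv_into_f)
  have "cls i j (?k x) = \<zero>\<^bsub>Gs (i, j)\<^esub>" if x: "x \<in> rad_series A (P i) j" for x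
    using cls_zero_iff[OF ij(3), of "?k x" j] rad_series_lmap[OF k x] Pi.P.submoduleD(2)[OF rad_P_submodule[OF ij(3)]] by blast
  from factor_Gs[OF ij(3) lmap_comp[OF k lmap_cls[OF ij(3)]] this]
  obtain g where g: "lmap A (Gs (i, j)) (Gs (i, j)) g" "\<And>x. x \<in> carrier (P i) \<Longrightarrow> g (cls i j x) = cls i j (?k x)" by blast
  have "f (g x) = x" if "x \<in> carrier (Gs (i, j))" for x
  proof -
    obtain y where y: "y \<in> carrier (P i)" "x = cls i j y" using cls_surj[OF ij(3), of j] \<open>x \<in> _\<close> by blast
    then have "f (g x) = cls i j (h (?k y))" using g(2) h(2)[of "?k y"] lmap.closed[OF k y(1)] by simp
    then show ?thesis using y hk by simp
  qed
  then show thesis using that g(1) ij(1) by blast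
qed

lemma J_kills_Gs:
  assumes p: "(i, j) \<in> \<Lambda>" and c: "c \<in> Jpow A j" and x: "x \<in> carrier (Gs (i, j))"
  shows "c \<odot>\<^bsub>Gs (i, j)\<^esub> x = \<zero>\<^bsub>Gs (i, j)\<^esub>"
proof -
  have i: "i \<in> {1..n}" using p by (auto simp: labels_iff)
  obtain y where y: "y \<in> carrier (P i)" "x = cls i j y" using cls_surj[OF i, of j] x by blast
  have "c \<odot>\<^bsub>P i\<^esub> y \<in> rad_series A (P i) j" using Jpow_smult[OF left_module_P[OF i] c, of y 0] y by simp
  then have "cls i j (c \<odot>\<^bsub>P i\<^esub> y) = \<zero>\<^bsub>Gs (i, j)\<^esub>"
    using cls_zero_iff[OF i, of "c \<odot>\<^bsub>P i\<^esub> y" j] left_module.submoduleD(2)[OF left_module_P[OF i] rad_P_submodule[OF i]] by blast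
  then show ?thesis using y lmap.smult[OF lmap_cls[OF i] Jpow_closed[OF c] y(1)] by simp
qed

subsection \<open>The simple tops\<close>

lemma left_module_top: "i \<in> {1..n} \<Longrightarrow> left_module A (Top i)"
  using indec_proj.top_simple[OF indec_P] by (simp add: simple_module_def)

lemma fg_top: "i \<in> {1..n} \<Longrightarrow> fg_module A (Top i)"
  by (rule fg_finlen[OF simple_finlen[OF indec_proj.top_simple[OF indec_P]]])

abbreviation "tp i \<equiv> \<lambda>x. radical A (P i) +>\<^bsub>P i\<^esub> x"

lemma lmap_tp: "i \<in> {1..n} \<Longrightarrow> lmap A (P i) (Top i) (tp i)"
  unfolding mtop_def by (rule left_module.lmap_quot[OF left_module_P left_module.radical_submodule[OF left_module_P]])

lemma tp_surj: "i \<in> {1..n} \<Longrightarrow> tp i ` carrier (P i) = carrier (Top i)"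
  unfolding mtop_def by (rule quot_lmap_surj[OF left_module_P left_module.radical_submodule[OF left_module_P]])

lemma tp_zero_iff: "i \<in> {1..n} \<Longrightarrow> x \<in> carrier (P i) \<Longrightarrow> tp i x = \<zero>\<^bsub>Top i\<^esub> \<longleftrightarrow> x \<in> radical A (P i)"
  unfolding mtop_def
  using left_module.coset_eq_zero_iff[OF left_module_P left_module.radical_submodule[OF left_module_P]] 
    left_module.quot_simps(2)[OF left_module_P left_module.radical_submodule[OF left_module_P]] by simp

lemma tpG_exists:
  assumes "(i, j) \<in> \<Lambda>"
  obtains t where "lmap A (Gs (i, j)) (Top i) t" "\<And>x. x \<in> carrier (P i) \<Longrightarrow> t (cls i j x) = tp i x"
proof -
  have i: "i \<in> {1..n}" "1 \<le> j" using assms by (auto simp: labels_iff)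
  have "tp i x = \<zero>\<^bsub>Top i\<^esub>" if "x \<in> rad_series A (P i) j" for x
  proof -
    have "x \<in> radical A (P i)" using left_module.rad_series_mono[OF left_module_P[OF i(1)] i(2)] that by auto
    then show ?thesis using tp_zero_iff[OF i(1)] by (simp add: radical_def)
  qed
  from factor_Gs[OF i(1) lmap_tp[OF i(1)] this] show thesis using that by blast
qed

text \<open>The place where rigidity enters. With the common Loewy length \<open>L\<close> it
  identifies Rad^t P_i with the annihilator of J^(L-t). If J^b y lies in Rad^j P_i, then J^(L-j+b)
  kills y, so y lies in Rad^(j-b) P_i.\<close>

lemma rigid_socle:
  assumes p: "(i, j) \<in> \<Lambda>" and b: "b \<le> j" and z: "z \<in> carrier (Gs (i, j))" 
    and k: "\<And>c. c \<in> Jpow A b \<Longrightarrow> c \<odot>\<^bsub>Gs (i, j)\<^esub> z = \<zero>\<^bsub>Gs (i, j)\<^esub>"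
  shows "z \<in> rad_series A (Gs (i, j)) (j - b)"
proof -
  have i: "i \<in> {1..n}" "j \<le> L" using p by (auto simp: labels_iff)
  note lm = left_module_P[OF i(1)]
  obtain y where y: "y \<in> carrier (P i)" "z = cls i j y" using cls_surj[OF i(1), of j] z by blast
  have rig: "rad_series A (P i) t = {x \<in> carrier (P i). \<forall>c\<in>Jpow A (L - t). c \<odot>\<^bsub>P i\<^esub> x = \<zero>\<^bsub>P i\<^esub>}" if "t \<le> L" for t
    using rigid[OF i(1)] that LL[OF i(1)] soc_series_eq[OF lm, of "L - t"] by (simp add: rigid_def)
  have "c \<odot>\<^bsub>P i\<^esub> y \<in> rad_series A (P i) j" if c: "c \<in> Jpow A b" for c
    using k[OF c] y lmap.smult[OF lmap_cls[OF i(1)] Jpow_closed[OF c] y(1), of j] cls_zero_iff[OF i(1), of "c \<odot>\<^bsub>P i\<^esub> y" j]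
      left_module.smult_closed[OF lm Jpow_closed[OF c] y(1)] by simp
  then have "\<forall>d\<in>Jpow A (L - j). \<forall>c\<in>Jpow A b. d \<odot>\<^bsub>P i\<^esub> (c \<odot>\<^bsub>P i\<^esub> y) = \<zero>\<^bsub>P i\<^esub>"
    by (simp add: rig[OF i(2)])
  then have "\<forall>c\<in>Jpow A (L - j + b). c \<odot>\<^bsub>P i\<^esub> y = \<zero>\<^bsub>P i\<^esub>" by (simp add: Jpow_ann_add[OF lm y(1)])
  moreover have "L - (j - b) = L - j + b" using b i(2) by simp
  ultimately have "y \<in> rad_series A (P i) (j - b)" using y i(2) by (subst rig) auto
  then show ?thesis using y by (simp add: rad_series_Gs[OF i(1)])
qed

end

section \<open>Modules over the ADR algebra\<close>

context adr
begin

sublocale Gf: module_family A \<Lambda> Gs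
  by (rule module_family.intro[OF ring_axioms left_module_Gs])

sublocale hs: hom_setting A G
  by (rule hom_setting.intro[OF Gf.left_module_dir_sum])

abbreviation "R \<equiv> opposite_ring (end_ring A G)"
abbreviation "H X \<equiv> hom_module A G X"
abbreviation "\<iota> \<equiv> single \<Lambda> Gs"

sublocale R: ring R by (rule hs.ring_E)

lemmas lmap_iota = Gf.lmap_single
lemmas lmap_pi = Gf.lmap_component

lemma iota_closed: "p \<in> \<Lambda> \<Longrightarrow> x \<in> carrier (Gs p) \<Longrightarrow> \<iota> p x \<in> carrier G"
  by (rule lmap.closed[OF lmap_iota])

lemma pi_closed: "p \<in> \<Lambda> \<Longrightarrow> g \<in> carrier G \<Longrightarrow> g p \<in> carrier (Gs p)"
  by (rule Gf.component_closed)

lemma pi_iota: "q \<in> \<Lambda> \<Longrightarrow> \<iota> p x q = (if q = p then x else \<zero>\<^bsub>Gs q\<^esub>)"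
  by (rule Gf.single_apply)

lemma iota_zero: "p \<in> \<Lambda> \<Longrightarrow> \<iota> p \<zero>\<^bsub>Gs p\<^esub> = \<zero>\<^bsub>G\<^esub>"
  by (rule lmap.zero[OF lmap_iota])

lemma G_mem:
  assumes f: "lmap A G X f" and N: "submodule N A X" and g: "g \<in> carrier G"
    and s: "\<And>p. p \<in> \<Lambda> \<Longrightarrow> f (\<iota> p (g p)) \<in> N"
  shows "f g \<in> N"
proof -
  have "g \<in> {x \<in> carrier G. f x \<in> N}"
    by (rule Gf.dir_sum_mem[OF finite_labels lmap.vimage_submodule[OF f N] g])
      (use s g iota_closed pi_closed in auto)
  then show ?thesis by simp
qed

text \<open>A matrix unit of the endomorphism ring: \<open>w\<close> is the only non-zero entry,
  from summand \<open>p\<close> to summand \<open>q\<close>.\<close>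

definition mat :: "nat \<times> nat \<Rightarrow> nat \<times> nat \<Rightarrow> ('v set \<Rightarrow> 'v set) \<Rightarrow> 'v adr" where
  "mat p q w = (\<lambda>g\<in>carrier G. \<iota> q (w (g p)))"

definition e :: "nat \<times> nat \<Rightarrow> 'v adr" where "e p = mat p p (\<lambda>x. x)"

lemma mat_in_R: "p \<in> \<Lambda> \<Longrightarrow> q \<in> \<Lambda> \<Longrightarrow> lmap A (Gs p) (Gs q) w \<Longrightarrow> mat p q w \<in> carrier R"
  unfolding mat_def by (rule hs.restrict_E) (rule lmap_comp[OF lmap_comp[OF lmap_pi] lmap_iota])

lemma e_in_R: "p \<in> \<Lambda> \<Longrightarrow> e p \<in> carrier R"
  unfolding e_def by (rule mat_in_R[OF _ _ lmap_id[OF left_module_Gs]])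

lemma mat_apply: "g \<in> carrier G \<Longrightarrow> mat p q w g = \<iota> q (w (g p))"
  by (simp add: mat_def)

lemma e_apply: "g \<in> carrier G \<Longrightarrow> e p g = \<iota> p (g p)"
  by (simp add: e_def mat_apply)

lemma e_orth:
  assumes "p \<in> \<Lambda>" "q \<in> \<Lambda>"
  shows "e p \<otimes>\<^bsub>R\<^esub> e q = (if p = q then e p else \<zero>\<^bsub>R\<^esub>)"
proof (rule hs.E_eqI)
  fix g assume g: "g \<in> carrier G"
  then show "(e p \<otimes>\<^bsub>R\<^esub> e q) g = (if p = q then e p else \<zero>\<^bsub>R\<^esub>) g"
    using assms iota_closed[OF assms(1) pi_closed[OF assms(1) g]] 
    by (auto simp: opp_end_simps compose_def e_apply pi_iota iota_zero)
qed (use assms e_in_R in auto)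

text \<open>The \<open>e p\<close> add up to the unit. Their partial sums \<open>t F\<close> are
  written as truncations of coordinates, and the claim is carried along finite sets
  \<open>F\<close>.\<close>

lemma e_decomp:
  assumes M: "left_module R M" and N: "submodule N R M" and x: "x \<in> carrier M"
    and ex: "\<And>p. p \<in> \<Lambda> \<Longrightarrow> e p \<odot>\<^bsub>M\<^esub> x \<in> N"
  shows "x \<in> N"
proof -
  interpret M: left_module R M by fact
  define t where "t F = (\<lambda>g\<in>carrier G. \<lambda>j\<in>\<Lambda>. if j \<in> F then g j else \<zero>\<^bsub>Gs j\<^esub>)" for F
  have tg: "t F g = (\<lambda>j\<in>\<Lambda>. if j \<in> F then g j else \<zero>\<^bsub>Gs j\<^esub>)" if "g \<in> carrier G" for F g
    using that by (simp add: t_def)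
  have tR: "t F \<in> carrier R" for F
  proof -
    have "lmap A G (Gs j) (\<lambda>g. if j \<in> F then g j else \<zero>\<^bsub>Gs j\<^esub>)" if "j \<in> \<Lambda>" for j
      using lmap_pi[OF that] lmap_const0[OF Gf.left_module_dir_sum left_module_Gs[OF that]] by (cases "j \<in> F") simp_all
    from Gf.lmap_tuple[OF Gf.left_module_dir_sum, of "\<lambda>j g. if j \<in> F then g j else \<zero>\<^bsub>Gs j\<^esub>", OF this]
    show ?thesis unfolding t_def by (intro hs.restrict_E) auto
  qed
  have "t F \<odot>\<^bsub>M\<^esub> x \<in> N" if "finite F" "F \<subseteq> \<Lambda>" for F
    using that
  proof (induction F rule: finite_induct)
    case empty
    have "t {} = \<zero>\<^bsub>R\<^esub>"
      by (rule hs.E_eqI) (simp_all add: tR, simp add: opp_end_simps tg dir_sum_simps(2))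
    then show ?case using x M.submoduleD(3)[OF N] by simp
  next
    case (insert p F)
    have p: "p \<in> \<Lambda>" using insert by simp
    have "t (insert p F) = t F \<oplus>\<^bsub>R\<^esub> e p"
    proof (rule hs.E_eqI)
      fix g assume g: "g \<in> carrier G"
      have gz: "g j \<oplus>\<^bsub>Gs j\<^esub> \<zero>\<^bsub>Gs j\<^esub> = g j" "\<zero>\<^bsub>Gs j\<^esub> \<oplus>\<^bsub>Gs j\<^esub> g j = g j" "\<zero>\<^bsub>Gs j\<^esub> \<oplus>\<^bsub>Gs j\<^esub> \<zero>\<^bsub>Gs j\<^esub> = \<zero>\<^bsub>Gs j\<^esub>" if "j \<in> \<Lambda>" for j
      proof -
        interpret j: left_module A "Gs j" by (rule left_module_Gs[OF that])
        show "g j \<oplus>\<^bsub>Gs j\<^esub> \<zero>\<^bsub>Gs j\<^esub> = g j" "\<zero>\<^bsub>Gs j\<^esub> \<oplus>\<^bsub>Gs j\<^esub> g j = g j" "\<zero>\<^bsub>Gs j\<^esub> \<oplus>\<^bsub>Gs j\<^esub> \<zero>\<^bsub>Gs j\<^esub> = \<zero>\<^bsub>Gs j\<^esub>"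
          using pi_closed[OF that g] by auto
      qed
      have "t (insert p F) g = t F g \<oplus>\<^bsub>G\<^esub> \<iota> p (g p)"
        unfolding tg[OF g] dir_sum_simps(3) using insert.hyps gz by (intro restrict_ext) (auto simp: pi_iota)
      then show "t (insert p F) g = (t F \<oplus>\<^bsub>R\<^esub> e p) g" using g by (simp add: opp_end_simps e_apply)
    qed (use tR e_in_R[OF p] in auto)
    then have "t (insert p F) \<odot>\<^bsub>M\<^esub> x = t F \<odot>\<^bsub>M\<^esub> x \<oplus>\<^bsub>M\<^esub> e p \<odot>\<^bsub>M\<^esub> x"
      using x by (simp add: M.smult_l_distr[OF tR e_in_R[OF p]])
    then show ?case using insert ex[OF p] M.submoduleD(4)[OF N] by simp
  qed
  from this[OF finite_labels order_refl] have "t \<Lambda> \<odot>\<^bsub>M\<^esub> x \<in> N" .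
  moreover have "t \<Lambda> = \<one>\<^bsub>R\<^esub>"
  proof (rule hs.E_eqI)
    fix g assume g: "g \<in> carrier G"
    have "g \<in> extensional \<Lambda>" using g by (simp add: dir_sum_simps PiE_def)
    moreover have "(\<lambda>j\<in>\<Lambda>. if j \<in> \<Lambda> then g j else \<zero>\<^bsub>Gs j\<^esub>) = restrict g \<Lambda>" by (rule restrict_ext) simp
    ultimately show "t \<Lambda> g = \<one>\<^bsub>R\<^esub> g" using g by (simp add: tg opp_end_simps extensional_restrict)
  qed (use tR in auto)
  ultimately show ?thesis using x by simp
qed

text \<open>The projective module \<open>H (Gs p)\<close> represents the functor \<open>M \<mapsto> e p M\<close>; its canonical generator is \<open>pr p\<close>.\<close>

definition pr :: "nat \<times> nat \<Rightarrow> (nat \<times> nat \<Rightarrow> 'v set) \<Rightarrow> 'v set" where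
  "pr p = (\<lambda>g\<in>carrier G. g p)"

text \<open>In the opposite of the endomorphism ring the left ideal generated by \<open>e p\<close>
  consists of the endomorphisms with image in summand \<open>p\<close>; \<open>jj p\<close>
  identifies \<open>H (Gs p)\<close> with it.\<close>

definition jj :: "nat \<times> nat \<Rightarrow> ((nat \<times> nat \<Rightarrow> 'v set) \<Rightarrow> 'v set) \<Rightarrow> 'v adr" where
  "jj p f = (\<lambda>g\<in>carrier G. \<iota> p (f g))"

lemma left_module_HG: "p \<in> \<Lambda> \<Longrightarrow> left_module R (H (Gs p))"
  by (rule hs.left_module_H[OF left_module_Gs])

lemma pr_in: "p \<in> \<Lambda> \<Longrightarrow> pr p \<in> carrier (H (Gs p))"
  unfolding pr_def by (rule hs.restrict_H[OF lmap_pi])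

lemma jj_in: "p \<in> \<Lambda> \<Longrightarrow> f \<in> carrier (H (Gs p)) \<Longrightarrow> jj p f \<in> carrier R"
  unfolding jj_def by (intro hs.restrict_E lmap_comp[OF hs.H_lmap lmap_iota] left_module_Gs)

lemma jj_pr: "p \<in> \<Lambda> \<Longrightarrow> jj p (pr p) = e p"
  unfolding jj_def pr_def e_def mat_def by (rule restrict_ext) simp

lemma jj_smult_pr:
  assumes p: "p \<in> \<Lambda>" and f: "f \<in> carrier (H (Gs p))"
  shows "jj p f \<odot>\<^bsub>H (Gs p)\<^esub> pr p = f"
proof (rule hs.H_eqI[of _ "Gs p"])
  interpret Hp: left_module R "H (Gs p)" by (rule left_module_HG[OF p])
  show "jj p f \<odot>\<^bsub>H (Gs p)\<^esub> pr p \<in> carrier (H (Gs p))" using jj_in[OF p f] pr_in[OF p] by simp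
  fix g assume g: "g \<in> carrier G"
  have fg: "f g \<in> carrier (Gs p)" by (rule hs.H_closed[OF left_module_Gs[OF p] f g])
  show "(jj p f \<odot>\<^bsub>H (Gs p)\<^esub> pr p) g = f g"
    using g iota_closed[OF p fg] p by (simp add: hs.H_smult_apply jj_def pr_def pi_iota)
qed (rule f)

lemma lmap_yoneda:
  assumes p: "p \<in> \<Lambda>" and M: "left_module R M" and m: "m \<in> carrier M"
  shows "lmap R (H (Gs p)) M (\<lambda>f. jj p f \<odot>\<^bsub>M\<^esub> m)"
proof -
  interpret M: left_module R M by fact
  interpret Hp: left_module R "H (Gs p)" by (rule left_module_HG[OF p])
  note c = jj_in[OF p] and hc = hs.H_closed[OF left_module_Gs[OF p]]
  show ?thesis
  proof (rule lmapI[OF Hp.left_module_axioms M])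
    fix f g assume fg: "f \<in> carrier (H (Gs p))" "g \<in> carrier (H (Gs p))"
    have "jj p (f \<oplus>\<^bsub>H (Gs p)\<^esub> g) = jj p f \<oplus>\<^bsub>R\<^esub> jj p g"
      by (rule hs.E_eqI) (simp_all add: c fg, simp add: jj_def hs.H_add_apply opp_end_simps lmap.add[OF lmap_iota[OF p]] hc fg)
    then show "jj p (f \<oplus>\<^bsub>H (Gs p)\<^esub> g) \<odot>\<^bsub>M\<^esub> m = jj p f \<odot>\<^bsub>M\<^esub> m \<oplus>\<^bsub>M\<^esub> jj p g \<odot>\<^bsub>M\<^esub> m"
      using m by (simp add: M.smult_l_distr[OF c[OF fg(1)] c[OF fg(2)]])
  next
    fix r f assume rf: "r \<in> carrier R" "f \<in> carrier (H (Gs p))"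
    have "jj p (r \<odot>\<^bsub>H (Gs p)\<^esub> f) = r \<otimes>\<^bsub>R\<^esub> jj p f"
      by (rule hs.E_eqI) (simp_all add: c rf, simp add: jj_def hs.H_smult_apply opp_end_simps compose_def hs.E_closed[OF rf(1)])
    then show "jj p (r \<odot>\<^bsub>H (Gs p)\<^esub> f) \<odot>\<^bsub>M\<^esub> m = r \<odot>\<^bsub>M\<^esub> (jj p f \<odot>\<^bsub>M\<^esub> m)"
      using m rf by (simp add: M.smult_assoc[OF rf(1) c[OF rf(2)]])
  qed (use c m in simp)
qed

lemma yoneda_pr:
  assumes p: "p \<in> \<Lambda>" and h: "lmap R (H (Gs p)) M h" and f: "f \<in> carrier (H (Gs p))"
  shows "h f = jj p f \<odot>\<^bsub>M\<^esub> h (pr p)"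
  using lmap.smult[OF h jj_in[OF p f] pr_in[OF p]] by (simp add: jj_smult_pr[OF p f])

lemma H_submodule_all:
  assumes p: "p \<in> \<Lambda>" and N: "submodule N R (H (Gs p))" and pr: "pr p \<in> N"
  shows "N = carrier (H (Gs p))"
proof -
  interpret Hp: left_module R "H (Gs p)" by (rule left_module_HG[OF p])
  have "f \<in> N" if f: "f \<in> carrier (H (Gs p))" for f
    using Hp.submoduleD(5)[OF N jj_in[OF p f] pr] by (simp add: jj_smult_pr[OF p f])
  then show ?thesis using Hp.submoduleD(1)[OF N] by blast
qed

subsection \<open>Simple modules and composition factors\<close>

text \<open>Only the entry on summand \<open>p\<close> itself is restricted. A map from a longer
  truncation of the same projective may well be onto \<open>Gs p\<close>, but no map in the other
  direction splits it, so it belongs to the radical all the same.\<close>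

definition radH :: "nat \<times> nat \<Rightarrow> ((nat \<times> nat \<Rightarrow> 'v set) \<Rightarrow> 'v set) set" where
  "radH p = {f \<in> carrier (H (Gs p)). \<forall>y\<in>carrier (Gs p). f (\<iota> p y) \<in> radical A (Gs p)}"

lemma rad_submodule_Gs: "p \<in> \<Lambda> \<Longrightarrow> submodule (radical A (Gs p)) A (Gs p)"
  by (rule left_module.radical_submodule[OF left_module_Gs])

lemma surj_labels: "p \<in> \<Lambda> \<Longrightarrow> q \<in> \<Lambda> \<Longrightarrow> lmap A (Gs p) (Gs q) f \<Longrightarrow> f ` carrier (Gs p) = carrier (Gs q) \<Longrightarrow> fst p = fst q \<and> snd q \<le> snd p"
  using surj_Gs_labels by (cases p; cases q) auto

lemma rad_map:
  assumes p: "p \<in> \<Lambda>" and q: "q \<in> \<Lambda>" and f: "lmap A (Gs p) (Gs q) f" and x: "x \<in> carrier (Gs p)"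
    and no: "fst p \<noteq> fst q \<or> snd p < snd q"
  shows "f x \<in> radical A (Gs q)"
  using surj_or_rad[OF q f] surj_labels[OF p q f] no x by auto

lemma lmap_entry:
  assumes X: "left_module A X" and p: "p \<in> \<Lambda>" and f: "f \<in> carrier (H X)"
  shows "lmap A (Gs p) X (\<lambda>y. f (\<iota> p y))"
  by (rule lmap_comp[OF lmap_iota[OF p] hs.H_lmap[OF X f]])

lemma lmap_entry_R:
  assumes p: "p \<in> \<Lambda>" and q: "q \<in> \<Lambda>" and r: "r \<in> carrier R"
  shows "lmap A (Gs p) (Gs q) (\<lambda>y. r (\<iota> p y) q)"
  by (rule lmap_comp[OF lmap_comp[OF lmap_iota[OF p] hs.E_lmap[OF r]] lmap_pi[OF q]])

text \<open>The point is that an endomorphism of \<open>Gs p\<close> passing through another summand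
  \<open>q\<close> is never onto. If its first half is onto, \<open>q\<close> is a strictly shorter
  truncation and the second half lands in the radical; otherwise the first half already
  does.\<close>

lemma radH_submodule:
  assumes p: "p \<in> \<Lambda>"
  shows "submodule (radH p) R (H (Gs p))"
proof -
  interpret Hp: left_module R "H (Gs p)" by (rule left_module_HG[OF p])
  interpret Gp: left_module A "Gs p" by (rule left_module_Gs[OF p])
  note rd = Gp.submoduleD[OF rad_submodule_Gs[OF p]]
  show ?thesis
  proof (rule Hp.lsubmoduleI)
    show "radH p \<subseteq> carrier (H (Gs p))" by (auto simp: radH_def)
    show "\<zero>\<^bsub>H (Gs p)\<^esub> \<in> radH p" using rd(3) iota_closed[OF p] by (simp add: radH_def hs.H_zero_apply)
    fix f g assume "f \<in> radH p" "g \<in> radH p"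
    then show "f \<oplus>\<^bsub>H (Gs p)\<^esub> g \<in> radH p"
      using rd(4) iota_closed[OF p] by (simp add: radH_def hs.H_add_apply)
  next
    fix r f assume r: "r \<in> carrier R" and f: "f \<in> radH p"
    then have fH: "f \<in> carrier (H (Gs p))" by (simp add: radH_def)
    have "f (r (\<iota> p y)) \<in> radical A (Gs p)" if y: "y \<in> carrier (Gs p)" for y
    proof (rule G_mem[OF hs.H_lmap[OF left_module_Gs[OF p] fH] rad_submodule_Gs[OF p]])
      show "r (\<iota> p y) \<in> carrier G" by (rule hs.E_closed[OF r iota_closed[OF p y]])
      fix q assume q: "q \<in> \<Lambda>"
      let ?u = "\<lambda>y. r (\<iota> p y) q"
      have u: "lmap A (Gs p) (Gs q) ?u" by (rule lmap_entry_R[OF p q r])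
      have v: "lmap A (Gs q) (Gs p) (\<lambda>y. f (\<iota> q y))" by (rule lmap_entry[OF left_module_Gs[OF p] q fH])
      have uy: "?u y \<in> carrier (Gs q)" by (rule lmap.closed[OF u y])
      show "f (\<iota> q (?u y)) \<in> radical A (Gs p)"
      proof (cases "q = p")
        case True
        then show ?thesis using f uy by (simp add: radH_def)
      next
        case False
        show ?thesis
        proof (cases "?u ` carrier (Gs p) = carrier (Gs q)")
          case True
          then have "fst p = fst q" "snd q \<le> snd p" using surj_labels[OF p q u] by auto
          then have "snd q < snd p" using False by (metis le_neq_implies_less prod_eqI)
          then show ?thesis using rad_map[OF q p v uy] by simp
        next
          case False
          then have "?u y \<in> radical A (Gs q)" using surj_or_rad[OF q u] y by blast
          then show ?thesis using radical_lmap[OF v] by simp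
        qed
      qed
    qed
    then show "r \<odot>\<^bsub>H (Gs p)\<^esub> f \<in> radH p" using r fH iota_closed[OF p] by (simp add: radH_def hs.H_smult_apply)
  qed
qed

text \<open>The diagonal entry of \<open>f\<close> is onto, so it has a right inverse by
  \<open>surj_endo_Gs\<close>. Acting with the corresponding matrix unit turns \<open>f\<close> into
  the generator \<open>pr p\<close>.\<close>

lemma not_radH_generates:
  assumes p: "p \<in> \<Lambda>" and N: "submodule N R (H (Gs p))" and f: "f \<in> N" "f \<notin> radH p"
  shows "N = carrier (H (Gs p))"
proof -
  interpret Hp: left_module R "H (Gs p)" by (rule left_module_HG[OF p])
  have fH: "f \<in> carrier (H (Gs p))" by (rule Hp.submoduleD(2)[OF N f(1)])
  have l: "lmap A (Gs p) (Gs p) (\<lambda>y. f (\<iota> p y))" by (rule lmap_entry[OF left_module_Gs[OF p] p fH])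
  have "\<exists>y\<in>carrier (Gs p). f (\<iota> p y) \<notin> radical A (Gs p)" using f(2) fH by (auto simp: radH_def)
  then have "(\<lambda>y. f (\<iota> p y)) ` carrier (Gs p) = carrier (Gs p)" using surj_or_rad[OF p l] by blast
  from surj_endo_Gs[OF p l this] obtain s where s: "lmap A (Gs p) (Gs p) s" "\<And>x. x \<in> carrier (Gs p) \<Longrightarrow> f (\<iota> p (s x)) = x" by blast
  have m: "mat p p s \<in> carrier R" by (rule mat_in_R[OF p p s(1)])
  have "mat p p s \<odot>\<^bsub>H (Gs p)\<^esub> f = pr p"
  proof (rule hs.H_eqI[of _ "Gs p"])
    fix g assume "g \<in> carrier G"
    then show "(mat p p s \<odot>\<^bsub>H (Gs p)\<^esub> f) g = pr p g"
      using s(2)[OF pi_closed[OF p]] by (simp add: hs.H_smult_apply mat_apply pr_def)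
  qed (use m fH pr_in[OF p] in auto)
  then have "pr p \<in> N" using Hp.submoduleD(5)[OF N m f(1)] by simp
  then show ?thesis by (rule H_submodule_all[OF p N])
qed

lemma pr_not_radH: "p \<in> \<Lambda> \<Longrightarrow> pr p \<notin> radH p"
proof
  assume p: "p \<in> \<Lambda>" and "pr p \<in> radH p"
  then have "y \<in> radical A (Gs p)" if "y \<in> carrier (Gs p)" for y
    using that iota_closed[OF p that] p by (auto simp: radH_def pr_def pi_iota)
  then show False using radical_Gs_proper[OF p] left_module.submoduleD(1)[OF left_module_Gs[OF p] rad_submodule_Gs[OF p]] by blast
qed

lemma proper_le_radH: "p \<in> \<Lambda> \<Longrightarrow> submodule N R (H (Gs p)) \<Longrightarrow> N \<noteq> carrier (H (Gs p)) \<Longrightarrow> N \<subseteq> radH p"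
  using not_radH_generates by blast

lemma radH_maximal: 
  assumes p: "p \<in> \<Lambda>"
  shows "maximal_submodule R (H (Gs p)) (radH p)"
proof -
  have "radH p \<noteq> carrier (H (Gs p))" using pr_not_radH[OF p] pr_in[OF p] by blast
  then show ?thesis
    using radH_submodule[OF p] proper_le_radH[OF p] unfolding maximal_submodule_def by (metis subset_antisym)
qed

lemma radical_H: 
  assumes p: "p \<in> \<Lambda>"
  shows "radical R (H (Gs p)) = radH p"
proof
  show "radical R (H (Gs p)) \<subseteq> radH p" using radH_maximal[OF p] by (auto simp: radical_def)
  have "radH p \<subseteq> m" if m: "maximal_submodule R (H (Gs p)) m" for m
    using m radH_maximal[OF p] proper_le_radH[OF p, of m] unfolding maximal_submodule_def by (metis order_refl)
  then show "radH p \<subseteq> radical R (H (Gs p))" by (auto simp: radical_def radH_def)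
qed

abbreviation "Ls p \<equiv> mtop R (H (Gs p))"

lemma left_module_Ls: "p \<in> \<Lambda> \<Longrightarrow> left_module R (Ls p)"
  unfolding mtop_def by (rule left_module.left_module_quot[OF left_module_HG left_module.radical_submodule[OF left_module_HG]])

lemma e_Ls_zero:
  assumes p: "p \<in> \<Lambda>" and q: "q \<in> \<Lambda>" and pq: "p \<noteq> q" and x: "x \<in> carrier (Ls q)"
  shows "e p \<odot>\<^bsub>Ls q\<^esub> x = \<zero>\<^bsub>Ls q\<^esub>"
proof -
  interpret Hq: left_module R "H (Gs q)" by (rule left_module_HG[OF q])
  interpret Gq: left_module A "Gs q" by (rule left_module_Gs[OF q])
  note s = radH_submodule[OF q]
  obtain f where f: "f \<in> carrier (H (Gs q))" "x = radH q +>\<^bsub>H (Gs q)\<^esub> f"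
    using x by (auto simp: mtop_def radical_H[OF q] Hq.quot_simps(1)[OF s])
  have "(e p \<odot>\<^bsub>H (Gs q)\<^esub> f) (\<iota> q y) = \<zero>\<^bsub>Gs q\<^esub>" if y: "y \<in> carrier (Gs q)" for y
    using iota_closed[OF q y] pq p iota_zero[OF p] lmap.zero[OF hs.H_lmap[OF Gq.left_module_axioms f(1)]]
    by (simp add: hs.H_smult_apply e_apply pi_iota)
  then have "e p \<odot>\<^bsub>H (Gs q)\<^esub> f \<in> radH q"
    using f e_in_R[OF p] Gq.submoduleD(3)[OF rad_submodule_Gs[OF q]] by (simp add: radH_def)
  then show ?thesis
    using f Hq.quot_smult[OF s e_in_R[OF p] f(1)] Hq.coset_eq_zero_iff[OF s, of "e p \<odot>\<^bsub>H (Gs q)\<^esub> f"] e_in_R[OF p]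
    by (simp add: mtop_def radical_H[OF q] Hq.quot_simps(2)[OF s])
qed

text \<open>A non-zero element of the form \<open>e q\<close> s gives a surjection from
  \<open>H (Gs q)\<close> to \<open>S\<close>; its kernel is maximal and hence equal to
  \<open>radH q\<close>.\<close>

lemma simple_iso_Ls:
  assumes S: "simple_module R S" and s: "s \<in> carrier S" "e q \<odot>\<^bsub>S\<^esub> s \<noteq> \<zero>\<^bsub>S\<^esub>" and q: "q \<in> \<Lambda>"
  shows "mod_iso R S (Ls q)"
proof -
  interpret S: left_module R S using S by (simp add: simple_module_def)
  let ?h = "\<lambda>f. jj q f \<odot>\<^bsub>S\<^esub> s"
  have h: "lmap R (H (Gs q)) S ?h" by (rule lmap_yoneda[OF q S.left_module_axioms s(1)])
  interpret h: lmap R "H (Gs q)" S ?h by (rule h)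
  have hp: "?h (pr q) \<noteq> \<zero>\<^bsub>S\<^esub>" using s by (simp add: jj_pr[OF q])
  have "?h ` carrier (H (Gs q)) = {\<zero>\<^bsub>S\<^esub>} \<or> ?h ` carrier (H (Gs q)) = carrier S"
    using S h.image_submodule[OF h.dom.submodule_carrier] unfolding simple_module_def by blast
  then have surj: "?h ` carrier (H (Gs q)) = carrier S" using hp pr_in[OF q] by blast
  have iso: "mod_iso R (quot_module (H (Gs q)) h.ker) S" by (rule first_iso[OF h surj]) (simp add: h.ker_def)
  have "simple_module R (quot_module (H (Gs q)) h.ker)"
    using simple_iso_iff[OF h.dom.left_module_quot[OF h.ker_submodule] S.left_module_axioms iso] S by simp
  then have "maximal_submodule R (H (Gs q)) h.ker" using h.dom.maximal_iff_simple_quot[OF h.ker_submodule] by simp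
  moreover have "h.ker \<noteq> carrier (H (Gs q))" using hp pr_in[OF q] by (auto simp: h.ker_def)
  ultimately have "h.ker = radH q"
    using proper_le_radH[OF q h.ker_submodule] radH_maximal[OF q] unfolding maximal_submodule_def by blast
  then have "mod_iso R (Ls q) S" using iso by (simp add: mtop_def radical_H[OF q])
  then show ?thesis by (rule mod_iso_sym[OF left_module_Ls[OF q] S.left_module_axioms])
qed

text \<open>The idempotent \<open>e p\<close> kills every simple top with a label other than
  \<open>p\<close>, and a simple module on which \<open>e q\<close> is non-zero is the top with
  label \<open>q\<close>. Thus a condition on some composition series becomes a system of equations
  that passes directly to submodules and quotients.\<close>

lemma composition_factors_iff:
  assumes M: "finlen R M" and \<Phi>: "\<Phi> \<subseteq> \<Lambda>"
  shows "composition_factors_among R Ls \<Phi> M \<longleftrightarrow> (\<forall>p\<in>\<Lambda> - \<Phi>. \<forall>x\<in>carrier M. e p \<odot>\<^bsub>M\<^esub> x = \<zero>\<^bsub>M\<^esub>)"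
proof
  interpret M: left_module R M using M by (rule finlen_left_module)
  assume "composition_factors_among R Ls \<Phi> M"
  then obtain m F where F: "composition_series R M m F" "\<And>i. i < m \<Longrightarrow> \<exists>q\<in>\<Phi>. mod_iso R (subquot M (F (Suc i)) (F i)) (Ls q)"
    by (auto simp: composition_factors_among_def)
  have F': "F 0 = {\<zero>\<^bsub>M\<^esub>}" "F m = carrier M" "\<And>i. i \<le> m \<Longrightarrow> submodule (F i) R M" "\<And>i. i < m \<Longrightarrow> F i \<subseteq> F (Suc i)"
    using F(1) by (auto simp: composition_series_def filtration_def)
  show "\<forall>p\<in>\<Lambda> - \<Phi>. \<forall>x\<in>carrier M. e p \<odot>\<^bsub>M\<^esub> x = \<zero>\<^bsub>M\<^esub>"
  proof
    fix p assume p: "p \<in> \<Lambda> - \<Phi>"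
    have "i \<le> m \<Longrightarrow> \<forall>x\<in>F i. e p \<odot>\<^bsub>M\<^esub> x = \<zero>\<^bsub>M\<^esub>" for i
    proof (induction i)
      case 0
      then show ?case using p e_in_R by (simp add: F')
    next
      case (Suc i)
      have im: "i < m" "i \<le> m" using Suc by auto
      obtain q where q: "q \<in> \<Phi>" "mod_iso R (subquot M (F (Suc i)) (F i)) (Ls q)" using F(2)[OF im(1)] by blast
      have qL: "q \<in> \<Lambda>" "p \<noteq> q" "p \<in> \<Lambda>" using q \<Phi> p by auto
      have "epik R M (F (Suc i)) (F i) (Ls q)"
        using q(2) mod_iso_subquot_iff[OF M.left_module_axioms left_module_Ls[OF qL(1)] F'(3)[OF Suc.prems] F'(3)[OF im(2)] F'(4)[OF im(1)]] by simp
      then obtain f where f: "lmap R (msub M (F (Suc i))) (Ls q) f" "{u \<in> F (Suc i). f u = \<zero>\<^bsub>Ls q\<^esub>} = F i" by (auto simp: epik_def)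
      show ?case
      proof
        fix x assume x: "x \<in> F (Suc i)"
        then have xc: "x \<in> carrier M" "e p \<odot>\<^bsub>M\<^esub> x \<in> F (Suc i)" 
          using M.submoduleD(2)[OF F'(3)[OF Suc.prems]] M.submoduleD(5)[OF F'(3)[OF Suc.prems] e_in_R[OF qL(3)]] by auto
        have "f (e p \<odot>\<^bsub>M\<^esub> x) = e p \<odot>\<^bsub>Ls q\<^esub> f x" using lmap.smult[OF f(1) e_in_R[OF qL(3)], of x] x by simp
        also have "\<dots> = \<zero>\<^bsub>Ls q\<^esub>" using e_Ls_zero[OF qL(3,1,2)] lmap.closed[OF f(1), of x] x by simp
        finally have "e p \<odot>\<^bsub>M\<^esub> x \<in> F i" using f(2) xc by blast
        \<comment> \<open>One application of \<open>e p\<close> goes down one step of the series and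
          a second one gives zero by the induction hypothesis; idempotency merges the two.\<close>
        then have "e p \<odot>\<^bsub>M\<^esub> (e p \<odot>\<^bsub>M\<^esub> x) = \<zero>\<^bsub>M\<^esub>" using Suc.IH im by blast
        then show "e p \<odot>\<^bsub>M\<^esub> x = \<zero>\<^bsub>M\<^esub>"
          using M.smult_assoc[OF e_in_R[OF qL(3)] e_in_R[OF qL(3)] xc(1)] e_orth[OF qL(3) qL(3)] by simp
      qed
    qed
    then show "\<forall>x\<in>carrier M. e p \<odot>\<^bsub>M\<^esub> x = \<zero>\<^bsub>M\<^esub>" using F' by (metis order_refl)
  qed
next
  interpret M: left_module R M using M by (rule finlen_left_module)
  assume z: "\<forall>p\<in>\<Lambda> - \<Phi>. \<forall>x\<in>carrier M. e p \<odot>\<^bsub>M\<^esub> x = \<zero>\<^bsub>M\<^esub>"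
  obtain m F where F: "composition_series R M m F" using M.composition_series_exists[OF M] by blast
  have "\<exists>q\<in>\<Phi>. mod_iso R (subquot M (F (Suc i)) (F i)) (Ls q)" if i: "i < m" for i
  proof -
    have F': "submodule (F (Suc i)) R M" "submodule (F i) R M" "F i \<subseteq> F (Suc i)"
      using F i by (auto simp: composition_series_def filtration_def)
    let ?S = "subquot M (F (Suc i)) (F i)"
    have simple: "simple_module R ?S" using F i by (simp add: composition_series_def)
    interpret S: left_module R ?S using simple by (simp add: simple_module_def)
    have "carrier ?S \<noteq> {\<zero>\<^bsub>?S\<^esub>}" using simple by (simp add: simple_module_def nonzero_module_def)
    then obtain s where s: "s \<in> carrier ?S" "s \<noteq> \<zero>\<^bsub>?S\<^esub>" using S.M.zero_closed by blast
    have "\<exists>q\<in>\<Lambda>. e q \<odot>\<^bsub>?S\<^esub> s \<noteq> \<zero>\<^bsub>?S\<^esub>"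
    proof (rule ccontr)
      assume "\<not> ?thesis"
      then have "s \<in> {\<zero>\<^bsub>?S\<^esub>}" by (intro e_decomp[OF S.left_module_axioms S.submodule_zero s(1)]) auto
      then show False using s by simp
    qed
    then obtain q where q: "q \<in> \<Lambda>" "e q \<odot>\<^bsub>?S\<^esub> s \<noteq> \<zero>\<^bsub>?S\<^esub>" by blast
    have "q \<in> \<Phi>"
    proof (rule ccontr)
      assume "q \<notin> \<Phi>"
      interpret U: left_module R "msub M (F (Suc i))" by (rule M.left_module_msub[OF F'(1)])
      have V: "submodule (F i) R (msub M (F (Suc i)))" by (rule M.submoduleI_msub[OF F'])
      obtain x where x: "x \<in> F (Suc i)" "s = F i +>\<^bsub>msub M (F (Suc i))\<^esub> x"
        using s(1) by (auto simp: subquot_def U.quot_simps(1)[OF V])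
      have "e q \<odot>\<^bsub>M\<^esub> x = \<zero>\<^bsub>M\<^esub>" using z q \<open>q \<notin> \<Phi>\<close> M.submoduleD(2)[OF F'(1) x(1)] by blast
      then have "e q \<odot>\<^bsub>?S\<^esub> s = \<zero>\<^bsub>?S\<^esub>"
        using x U.quot_smult[OF V e_in_R[OF q(1)], of x] U.coset_zero[OF V] by (simp add: subquot_def U.quot_simps(2)[OF V])
      then show False using q by simp
    qed
    then show ?thesis using simple_iso_Ls[OF simple s(1) q(2,1)] by blast
  qed
  then show "composition_factors_among R Ls \<Phi> M" using F by (auto simp: composition_factors_among_def)
qed

end

lemma (in left_module) epikI:
  assumes "lmap R (msub M U) X f" "f ` U = carrier X" "{u \<in> U. f u = \<zero>\<^bsub>X\<^esub>} = V" "submodule U R M"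
  shows "epik R M U V X"
proof -
  have "submodule V R (msub M U)" using lmap.ker_submodule[OF assms(1)] assms(3) by (simp add: lmap.ker_def[OF assms(1)])
  then have "submodule V R M" "V \<subseteq> U" using submodule_msub[OF assms(4)] by auto
  then show ?thesis using assms unfolding epik_def by blast
qed

context adr
begin

subsection \<open>Standard modules\<close>

text \<open>This is Hom(G, Rad(P_i/Rad^j)) for \<open>p\<close> = (i, j), the kernel of the
  projection of \<open>H (Gs p)\<close> onto the standard module; \<open>standard_eq\<close> proves
  that it is the least submodule required there.\<close>

definition K :: "nat \<times> nat \<Rightarrow> ((nat \<times> nat \<Rightarrow> 'v set) \<Rightarrow> 'v set) set" where
  "K p = {f \<in> carrier (H (Gs p)). \<forall>g\<in>carrier G. f g \<in> radical A (Gs p)}"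

lemma K_submodule: "p \<in> \<Lambda> \<Longrightarrow> submodule (K p) R (H (Gs p))"
  unfolding K_def by (rule hs.sub_H[OF left_module_Gs rad_submodule_Gs])

lemma rad_series_Gs_zero:
  assumes "(i, j) \<in> \<Lambda>"
  shows "rad_series A (Gs (i, j)) j = {\<zero>\<^bsub>Gs (i, j)\<^esub>}"
  using J_kills_Gs[OF assms] by (simp add: rad_series_zero_iff[OF left_module_Gs[OF assms]])

lemma rad_killed:
  assumes p: "(i, j) \<in> \<Lambda>" and c: "c \<in> Jpow A (j - 1)" and x: "x \<in> radical A (Gs (i, j))"
  shows "c \<odot>\<^bsub>Gs (i, j)\<^esub> x = \<zero>\<^bsub>Gs (i, j)\<^esub>"
proof -
  have "1 \<le> j" using p by (simp add: labels_iff)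
  then show ?thesis
    using Jpow_smult[OF left_module_Gs[OF p] c, of x 1] x rad_series_Gs_zero[OF p] by simp
qed

definition ent :: "nat \<times> nat \<Rightarrow> ('v set \<Rightarrow> 'x) \<Rightarrow> (nat \<times> nat \<Rightarrow> 'v set) \<Rightarrow> 'x" where
  "ent p w = (\<lambda>g\<in>carrier G. w (g p))"

lemma ent_in: "p \<in> \<Lambda> \<Longrightarrow> lmap A (Gs p) X w \<Longrightarrow> ent p w \<in> carrier (H X)"
  unfolding ent_def by (rule hs.restrict_H) (rule lmap_comp[OF lmap_pi])

lemma ent_apply: "g \<in> carrier G \<Longrightarrow> ent p w g = w (g p)"
  by (simp add: ent_def)

lemma e_smult_apply: "g \<in> carrier G \<Longrightarrow> (e p \<odot>\<^bsub>H X\<^esub> f) g = f (\<iota> p (g p))"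
  by (simp add: hs.H_smult_apply e_apply)

text \<open>The form \<open>q\<close> sends Rad^b P_a into J^b, and J^(j-1) kills the radical of
  P_i/Rad^j. So for b \<ge> j - 1 the map sending v to q(v) z factors through P_a/Rad^b.\<close>

lemma K_orbit:
  assumes p: "(i, j) \<in> \<Lambda>" and z: "z \<in> radical A (Gs (i, j))" and ab: "(a, b) \<in> \<Lambda>" "j - 1 \<le> b"
    and q: "lmap A (P a) (regular_module A) q"
  obtains h where "h \<in> K (i, j)"
    "\<And>v. v \<in> carrier (P a) \<Longrightarrow> h (\<iota> (a, b) (cls a b v)) = q v \<odot>\<^bsub>Gs (i, j)\<^esub> z"
proof -
  have a: "a \<in> {1..n}" using ab by (simp add: labels_iff)
  interpret Gp: left_module A "Gs (i, j)" by (rule left_module_Gs[OF p])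
  note X = rad_submodule_Gs[OF p]
  have zc: "z \<in> carrier (Gs (i, j))" by (rule Gp.submoduleD(2)[OF X z])
  have "q v \<odot>\<^bsub>Gs (i, j)\<^esub> z = \<zero>\<^bsub>Gs (i, j)\<^esub>" if "v \<in> rad_series A (P a) b" for v
    using rad_killed[OF p _ z] rad_series_lmap[OF q that] Jpow_mono[OF ab(2)] by (auto simp: Jpow_def)
  from factor_Gs[OF a lmap_comp[OF q lmap_orbit[OF Gp.left_module_axioms zc]] this]
  obtain h where h: "lmap A (Gs (a, b)) (Gs (i, j)) h" "\<And>v. v \<in> carrier (P a) \<Longrightarrow> h (cls a b v) = q v \<odot>\<^bsub>Gs (i, j)\<^esub> z" by blast
  have hX: "h v \<in> radical A (Gs (i, j))" if v: "v \<in> carrier (Gs (a, b))" for v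
  proof -
    obtain v' where "v' \<in> carrier (P a)" "v = cls a b v'" using v cls_surj[OF a, of b] by blast
    then show ?thesis using h(2) lmap.closed[OF q] Gp.submoduleD(5)[OF X _ z] by simp
  qed
  have "ent (a, b) h \<in> K (i, j)" using ent_in[OF ab(1) h(1)] hX pi_closed[OF ab(1)] by (simp add: K_def ent_apply)
  moreover have "ent (a, b) h (\<iota> (a, b) (cls a b v)) = q v \<odot>\<^bsub>Gs (i, j)\<^esub> z" if v: "v \<in> carrier (P a)" for v
    using iota_closed[OF ab(1) lmap.closed[OF lmap_cls[OF a] v]] ab(1) h(2)[OF v] by (simp add: ent_apply pi_iota)
  ultimately show thesis by (rule that)
qed

text \<open>A map \<open>P a / Rad\<^sup>b \<rightarrow> Rad (P i / Rad\<^sup>j)\<close> is determined by the image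
  \<open>z\<close> of a generator, which lies in \<open>Soc\<^sub>b\<close> and hence, by rigidity, in \<open>Rad\<^sup>j\<^sup>-\<^sup>b\<close>. So \<open>z\<close> is a sum of elements
  \<open>c x\<close> with \<open>c\<close> in the \<open>j-1-b\<close>-th power of the radical and \<open>x\<close> in \<open>Rad (P i / Rad\<^sup>j)\<close>, and the corresponding
  maps factor through copies of \<open>P k / Rad\<^sup>j\<^sup>-\<^sup>1\<close>.\<close>

lemma K_generated:
  assumes p: "(i, j) \<in> \<Lambda>" and N: "submodule N R (H (Gs (i, j)))"
    and gen: "\<And>k h. (k, j - 1) \<in> \<Lambda> \<Longrightarrow> h \<in> K (i, j) \<Longrightarrow> e (k, j - 1) \<odot>\<^bsub>H (Gs (i, j))\<^esub> h \<in> N"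
  shows "K (i, j) \<subseteq> N"
proof
  let ?p = "(i, j)" let ?Gp = "Gs ?p" let ?X = "radical A ?Gp"
  interpret Gp: left_module A ?Gp by (rule left_module_Gs[OF p])
  interpret Hp: left_module R "H ?Gp" by (rule left_module_HG[OF p])
  have j1: "1 \<le> j" "j \<le> L" using p by (auto simp: labels_iff)
  have X: "submodule ?X A ?Gp" by (rule rad_submodule_Gs[OF p])
  fix f assume f: "f \<in> K ?p"
  then have fH: "f \<in> carrier (H ?Gp)" by (simp add: K_def)
  show "f \<in> N"
  proof (rule e_decomp[OF Hp.left_module_axioms N fH])
    fix q assume "q \<in> \<Lambda>"
    then obtain a b where q: "q = (a, b)" "(a, b) \<in> \<Lambda>" by (cases q) auto
    have a: "a \<in> {1..n}" and b: "1 \<le> b" using q by (auto simp: labels_iff)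
    let ?Pa = "P a"
    interpret Pa: indec_proj A ?Pa by (rule indec_P[OF a])
    \<comment> \<open>For b < j the exponent satisfies 1 + t = j - b, the radical term that rigidity
      yields. For b \<ge> j the subtraction truncates to t = 0, and membership in the radical
      suffices.\<close>
    define t where "t = j - 1 - b"
    have tb: "j - 1 \<le> b + t" by (simp add: t_def)
    define rep where "rep l z f' \<longleftrightarrow> f' \<in> carrier (H ?Gp) \<and> (\<forall>g\<in>carrier G. \<forall>x\<in>carrier ?Pa. g (a, b) = cls a b x \<longrightarrow> f' g = l x \<odot>\<^bsub>?Gp\<^esub> z)" for l z f'
    have rep_ex: "\<exists>f'. rep l z f'" if l: "lmap A ?Pa (regular_module A) l" and z: "z \<in> rad_series A ?Gp (1 + t)" for l z
    proof -
      have zc: "z \<in> carrier ?Gp" using z Gp.submoduleD(2)[OF Gp.rad_series_submodule] by blast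
      have h: "lmap A ?Pa ?Gp (\<lambda>x. l x \<odot>\<^bsub>?Gp\<^esub> z)" by (rule lmap_comp[OF l lmap_orbit[OF Gp.left_module_axioms zc]])
      have "l x \<odot>\<^bsub>?Gp\<^esub> z = \<zero>\<^bsub>?Gp\<^esub>" if x: "x \<in> rad_series A ?Pa b" for x
      proof -
        have "l x \<in> Jpow A b" using rad_series_lmap[OF l x] by (simp add: Jpow_def)
        then have "l x \<odot>\<^bsub>?Gp\<^esub> z \<in> rad_series A ?Gp (1 + t + b)" by (rule Jpow_smult[OF Gp.left_module_axioms _ z])
        moreover have "j \<le> 1 + t + b" using j1 tb by linarith
        ultimately show ?thesis using Gp.rad_series_mono rad_series_Gs_zero[OF p] by blast
      qed
      from factor_Gs[OF a h this] obtain w where w: "lmap A (Gs (a, b)) ?Gp w" "\<And>x. x \<in> carrier ?Pa \<Longrightarrow> w (cls a b x) = l x \<odot>\<^bsub>?Gp\<^esub> z" by blast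
      have "rep l z (ent (a, b) w)" using ent_in[OF q(2) w(1)] w(2) by (simp add: rep_def ent_apply)
      then show ?thesis by blast
    qed
    have gx: "\<exists>x\<in>carrier ?Pa. g (a, b) = cls a b x" if "g \<in> carrier G" for g
      using pi_closed[OF q(2) that] cls_surj[OF a, of b] by blast
    have rep_uniq: "f' = f''" if "rep l z f'" "rep l z f''" for l z f' f''
    proof (rule hs.H_eqI[of _ ?Gp])
      show "f' g = f'' g" if "g \<in> carrier G" for g
        using gx[OF that] \<open>rep l z f'\<close> \<open>rep l z f''\<close> that unfolding rep_def by metis
    qed (use that in \<open>auto simp: rep_def\<close>)
    have lc: "l x \<in> carrier A" if "lmap A ?Pa (regular_module A) l" "x \<in> carrier ?Pa" for l x
      using lmap.closed[OF that] by simp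
    define good where "good z \<longleftrightarrow> (\<forall>l f'. lmap A ?Pa (regular_module A) l \<longrightarrow> rep l z f' \<longrightarrow> f' \<in> N)" for z
    have rad1: "rad_series A ?Gp (1 + t) \<subseteq> ?X" using Gp.rad_series_mono[of 1 "1 + t"] by simp
    have good_add: "good (z \<oplus>\<^bsub>?Gp\<^esub> z')" if z: "z \<in> rad_series A ?Gp (1 + t)" "z' \<in> rad_series A ?Gp (1 + t)" "good z" "good z'" for z z'
      unfolding good_def
    proof (intro allI impI)
      fix l f' assume l: "lmap A ?Pa (regular_module A) l" and f': "rep l (z \<oplus>\<^bsub>?Gp\<^esub> z') f'"
      obtain f1 f2 where f12: "rep l z f1" "rep l z' f2" using rep_ex[OF l] z by blast
      then have N12: "f1 \<in> N" "f2 \<in> N" using z l by (auto simp: good_def)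
      have zc: "z \<in> carrier ?Gp" "z' \<in> carrier ?Gp" using z Gp.submoduleD(2)[OF Gp.rad_series_submodule] by blast+
      have "rep l (z \<oplus>\<^bsub>?Gp\<^esub> z') (f1 \<oplus>\<^bsub>H ?Gp\<^esub> f2)"
        using f12 lc[OF l] zc unfolding rep_def by (simp add: hs.H_add_apply Gp.smult_r_distr)
      then show "f' \<in> N" using rep_uniq[OF f'] Hp.submoduleD(4)[OF N N12] by simp
    qed
    have good0: "good \<zero>\<^bsub>?Gp\<^esub>"
      unfolding good_def
    proof (intro allI impI)
      fix l f' assume l: "lmap A ?Pa (regular_module A) l" and f': "rep l \<zero>\<^bsub>?Gp\<^esub> f'"
      have "rep l \<zero>\<^bsub>?Gp\<^esub> \<zero>\<^bsub>H ?Gp\<^esub>" using lc[OF l] unfolding rep_def by (simp add: hs.H_zero_apply)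
      then show "f' \<in> N" using rep_uniq[OF f'] Hp.submoduleD(3)[OF N] by simp
    qed
    have good_smult: "good (c \<odot>\<^bsub>?Gp\<^esub> z)" if z: "z \<in> carrier ?Gp" "good z" and c: "c \<in> carrier A" for c z
      unfolding good_def
    proof (intro allI impI)
      fix l f' assume l: "lmap A ?Pa (regular_module A) l" and f': "rep l (c \<odot>\<^bsub>?Gp\<^esub> z) f'"
      have "lmap A (regular_module A) (regular_module A) (\<lambda>x. x \<otimes> c)"
        using lmap_orbit[OF reg.left_module_axioms, of c] c by simp
      from lmap_comp[OF l this] have l': "lmap A ?Pa (regular_module A) (\<lambda>x. l x \<otimes> c)" .
      have "rep (\<lambda>x. l x \<otimes> c) z f'" using f' lc[OF l] c z unfolding rep_def by (simp add: Gp.smult_assoc)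
      then show "f' \<in> N" using z l' by (auto simp: good_def)
    qed
    let ?Z = "{z \<in> rad_series A ?Gp (1 + t). good z}"
    have XJ: "good (c \<odot>\<^bsub>?Gp\<^esub> z)" if c: "c \<in> Jpow A t" and z: "z \<in> ?X" for c z
    proof -
      have zc: "z \<in> carrier ?Gp" using Gp.submoduleD(2)[OF X z] .
      have cz: "d \<odot>\<^bsub>?Gp\<^esub> z \<in> rad_series A ?Gp (1 + t)" if "d \<in> Jpow A t" for d
        using Jpow_smult[OF Gp.left_module_axioms that, of z 1] z by simp
      \<comment> \<open>A left ideal that is shown to contain the values of all maps P_k -> A, hence
        the unit. This is how c z is decomposed into pieces of the form c p'(y) z.\<close>
      let ?B = "{w \<in> carrier A. \<forall>c\<in>Jpow A t. good ((c \<otimes> w) \<odot>\<^bsub>?Gp\<^esub> z)}"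
      have B: "submodule ?B A (regular_module A)"
      proof (rule reg.lsubmoduleI)
        show "\<zero>\<^bsub>regular_module A\<^esub> \<in> ?B" using good0 zc Jpow_closed by simp
        fix v w assume vw: "v \<in> ?B" "w \<in> ?B"
        have "good ((c \<otimes> (v \<oplus> w)) \<odot>\<^bsub>?Gp\<^esub> z)" if c: "c \<in> Jpow A t" for c
        proof -
          have "good ((c \<otimes> v) \<odot>\<^bsub>?Gp\<^esub> z \<oplus>\<^bsub>?Gp\<^esub> (c \<otimes> w) \<odot>\<^bsub>?Gp\<^esub> z)"
            using vw c by (intro good_add cz Jpow_ideal) auto
          then show ?thesis using vw c zc Jpow_closed[OF c] by (simp add: r_distr Gp.smult_l_distr)
        qed
        then show "v \<oplus>\<^bsub>regular_module A\<^esub> w \<in> ?B" using vw by simp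
      next
        fix u w assume u: "u \<in> carrier A" and w: "w \<in> ?B"
        have "good ((c \<otimes> (u \<otimes> w)) \<odot>\<^bsub>?Gp\<^esub> z)" if c: "c \<in> Jpow A t" for c
        proof -
          have "good (((c \<otimes> u) \<otimes> w) \<odot>\<^bsub>?Gp\<^esub> z)" using w Jpow_ideal(1)[OF c u] by simp
          then show ?thesis using w u Jpow_closed[OF c] by (simp add: m_assoc)
        qed
        then show "u \<odot>\<^bsub>regular_module A\<^esub> w \<in> ?B" using u w by simp
      qed auto
      have "p' y \<in> ?B" if k: "k \<in> {1..n}" and p': "lmap A (P k) (regular_module A) p'" and y: "y \<in> carrier (P k)" for k p' y
      proof -
        have pc: "p' v \<in> carrier A" if "v \<in> carrier (P k)" for v using lmap.closed[OF p' that] by simp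
        have "good ((c \<otimes> p' y) \<odot>\<^bsub>?Gp\<^esub> z)" if c: "c \<in> Jpow A t" for c
        \<comment> \<open>There are no labels (k, 0). For j = 1 the radical of \<open>Gs p\<close>
          is zero and nothing has to be factored.\<close>
        proof (cases "j = 1")
          case True
          then have "\<one> \<odot>\<^bsub>?Gp\<^esub> z = \<zero>\<^bsub>?Gp\<^esub>" using rad_killed[OF p _ z, of \<one>] by simp
          then have "z = \<zero>\<^bsub>?Gp\<^esub>" unfolding Gp.smult_one[OF zc] .
          then show ?thesis using good0 pc[OF y] Jpow_closed[OF c] by simp
        next
          case False
          then have kl: "(k, j - 1) \<in> \<Lambda>" using k j1 unfolding labels_iff by auto
          show ?thesis unfolding good_def
          proof (intro allI impI)
            fix l f' assume l: "lmap A ?Pa (regular_module A) l" and f': "rep l ((c \<otimes> p' y) \<odot>\<^bsub>?Gp\<^esub> z) f'"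
            obtain h where hK: "h \<in> K ?p" and h: "\<And>v. v \<in> carrier (P k) \<Longrightarrow> h (\<iota> (k, j - 1) (cls k (j - 1) v)) = p' v \<odot>\<^bsub>?Gp\<^esub> z"
              by (rule K_orbit[OF p z kl order_refl p']) blast
            have um: "lmap A ?Pa (P k) (\<lambda>x. (l x \<otimes> c) \<odot>\<^bsub>P k\<^esub> y)"
            proof -
              have "lmap A (regular_module A) (regular_module A) (\<lambda>x. x \<otimes> c)"
                using lmap_orbit[OF reg.left_module_axioms, of c] Jpow_closed[OF c] by simp
              from lmap_comp[OF lmap_comp[OF l this] lmap_orbit[OF left_module_P[OF k] y]] show ?thesis .
            qed
            have "cls k (j - 1) ((l x \<otimes> c) \<odot>\<^bsub>P k\<^esub> y) = \<zero>\<^bsub>Gs (k, j - 1)\<^esub>" if x: "x \<in> rad_series A ?Pa b" for x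
            proof -
              have "l x \<in> Jpow A b" using rad_series_lmap[OF l x] by (simp add: Jpow_def)
              then have "l x \<otimes> c \<in> Jpow A (t + b)" by (rule Jpow_mult[OF _ c])
              then have "l x \<otimes> c \<in> Jpow A (j - 1)" using Jpow_mono[OF tb] by (auto simp: add.commute)
              then have "(l x \<otimes> c) \<odot>\<^bsub>P k\<^esub> y \<in> rad_series A (P k) (j - 1)"
                using Jpow_smult[OF left_module_P[OF k], of "l x \<otimes> c" "j - 1" y 0] y by simp
              then show ?thesis using cls_zero_iff[OF k] left_module.submoduleD(2)[OF left_module_P[OF k] rad_P_submodule[OF k]] by blast
            qed
            from factor_Gs[OF a lmap_comp[OF um lmap_cls[OF k]] this] obtain w where w: "lmap A (Gs (a, b)) (Gs (k, j - 1)) w"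
              "\<And>x. x \<in> carrier ?Pa \<Longrightarrow> w (cls a b x) = cls k (j - 1) ((l x \<otimes> c) \<odot>\<^bsub>P k\<^esub> y)" by blast
            have m: "mat (a, b) (k, j - 1) w \<in> carrier R" by (rule mat_in_R[OF q(2) kl w(1)])
            have eN: "e (k, j - 1) \<odot>\<^bsub>H ?Gp\<^esub> h \<in> N" by (rule gen[OF kl hK])
            \<comment> \<open>The map factors as P_a/Rad^b -> P_k/Rad^(j-1) -> Rad(P_i/Rad^j): first
              x goes to the class of l(x) c y, then the class of v goes to p'(v) z. The second
              factor is a component covered by \<open>gen\<close>.\<close>
            let ?f = "mat (a, b) (k, j - 1) w \<odot>\<^bsub>H ?Gp\<^esub> (e (k, j - 1) \<odot>\<^bsub>H ?Gp\<^esub> h)"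
            have fN: "?f \<in> N" by (rule Hp.submoduleD(5)[OF N m eN])
            have "?f g = l x \<odot>\<^bsub>?Gp\<^esub> ((c \<otimes> p' y) \<odot>\<^bsub>?Gp\<^esub> z)" if g: "g \<in> carrier G" and x: "x \<in> carrier ?Pa" and gx: "g (a, b) = cls a b x" for g x
            proof -
              have wc: "w (g (a, b)) \<in> carrier (Gs (k, j - 1))" using lmap.closed[OF w(1)] pi_closed[OF q(2) g] by blast
              have yc: "(l x \<otimes> c) \<odot>\<^bsub>P k\<^esub> y \<in> carrier (P k)" using lmap.closed[OF um x] .
              have "?f g = h (\<iota> (k, j - 1) (w (g (a, b))))"
                using g iota_closed[OF kl wc] kl by (simp add: hs.H_smult_apply mat_apply e_apply pi_iota)
              also have "\<dots> = p' ((l x \<otimes> c) \<odot>\<^bsub>P k\<^esub> y) \<odot>\<^bsub>?Gp\<^esub> z" using w(2)[OF x] h[OF yc] gx by simp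
              also have "p' ((l x \<otimes> c) \<odot>\<^bsub>P k\<^esub> y) = l x \<otimes> (c \<otimes> p' y)"
                using lmap.smult[OF p', of "l x \<otimes> c" y] y lc[OF l x] Jpow_closed[OF c] pc[OF y] by (simp add: m_assoc)
              finally show ?thesis using zc lc[OF l x] Jpow_closed[OF c] pc[OF y] by (simp add: Gp.smult_assoc)
            qed
            then have "rep l ((c \<otimes> p' y) \<odot>\<^bsub>?Gp\<^esub> z) ?f" using Hp.submoduleD(2)[OF N fN] by (simp add: rep_def)
            then show "f' \<in> N" using rep_uniq[OF f'] fN by simp
          qed
        qed
        then show ?thesis using pc[OF y] by simp
      qed
      then have "?B = carrier A" by (rule regular_generated[OF B])
      then have "\<one> \<in> ?B" by simp
      then have "good ((c \<otimes> \<one>) \<odot>\<^bsub>?Gp\<^esub> z)" using c by blast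
      then show ?thesis using Jpow_closed[OF c] by simp
    qed
    have "submodule ?Z A (msub ?Gp ?X)"
    proof -
      have "submodule ?Z A ?Gp"
        by (rule Gp.lsubmoduleI) (use good0 good_add good_smult Gp.submoduleD[OF Gp.rad_series_submodule[of "1 + t"]] in auto)
      then show ?thesis using rad1 by (simp add: Gp.submodule_msub[OF X]) blast
    qed
    then have "rad_series A (msub ?Gp ?X) t \<subseteq> ?Z"
    proof (rule rad_series_le[OF Gp.left_module_msub[OF X]])
      fix c y assume c: "c \<in> Jpow A t" and "y \<in> carrier (msub ?Gp ?X)"
      then have y: "y \<in> ?X" by simp
      then show "c \<odot>\<^bsub>msub ?Gp ?X\<^esub> y \<in> ?Z" using XJ[OF c y] Jpow_smult[OF Gp.left_module_axioms c, of y 1] by simp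
    qed
    moreover have "rad_series A (msub ?Gp ?X) t = rad_series A ?Gp (1 + t)"
      using Gp.rad_series_add[of 1 t] by simp
    ultimately have allgood: "good z" if "z \<in> rad_series A ?Gp (1 + t)" for z using that by blast
    obtain \<theta> e0 where th: "lmap A ?Pa (regular_module A) \<theta>" "e0 \<in> carrier ?Pa" "\<And>u. u \<in> carrier ?Pa \<Longrightarrow> \<theta> u \<odot>\<^bsub>?Pa\<^esub> e0 = u"
      by (rule Pa.cyclic_dual_basis) blast
    let ?c0 = "cls a b e0"
    have c0: "?c0 \<in> carrier (Gs (a, b))" by (rule lmap.closed[OF lmap_cls[OF a] th(2)])
    note fe = lmap_entry[OF Gp.left_module_axioms q(2) fH]
    let ?z = "f (\<iota> (a, b) ?c0)"
    have zX: "?z \<in> ?X" using f iota_closed[OF q(2) c0] by (simp add: K_def)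
    have zr: "?z \<in> rad_series A ?Gp (1 + t)"
    proof (cases "b < j")
      case True
      have "c \<odot>\<^bsub>?Gp\<^esub> ?z = \<zero>\<^bsub>?Gp\<^esub>" if "c \<in> Jpow A b" for c
        using lmap.smult[OF fe Jpow_closed[OF that] c0] J_kills_Gs[OF q(2) that c0] lmap.zero[OF fe] by simp
      then have "?z \<in> rad_series A ?Gp (j - b)"
        using True lmap.closed[OF fe c0] by (intro rigid_socle[OF p]) auto
      moreover have "1 + t = j - b" using True by (simp add: t_def)
      ultimately show ?thesis by simp
    next
      case False
      then have "t = 0" by (simp add: t_def)
      then show ?thesis using zX by simp
    qed
    have "rep \<theta> ?z (e (a, b) \<odot>\<^bsub>H ?Gp\<^esub> f)"
      unfolding rep_def
    proof (intro conjI ballI impI)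
      show "e (a, b) \<odot>\<^bsub>H ?Gp\<^esub> f \<in> carrier (H ?Gp)" using fH e_in_R[OF q(2)] by simp
      fix g x assume g: "g \<in> carrier G" and x: "x \<in> carrier ?Pa" and gx: "g (a, b) = cls a b x"
      have tx: "\<theta> x \<in> carrier A" by (rule lc[OF th(1) x])
      have "cls a b x = \<theta> x \<odot>\<^bsub>Gs (a, b)\<^esub> ?c0" using lmap.smult[OF lmap_cls[OF a] tx th(2)] th(3)[OF x] by simp
      then show "(e (a, b) \<odot>\<^bsub>H ?Gp\<^esub> f) g = \<theta> x \<odot>\<^bsub>?Gp\<^esub> ?z"
        using g gx lmap.smult[OF fe tx c0] by (simp add: e_smult_apply)
    qed
    then show "e q \<odot>\<^bsub>H ?Gp\<^esub> f \<in> N" using allgood[OF zr] th(1) q(1) by (auto simp: good_def)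
  qed
qed

lemma tpG:
  assumes "(i, j) \<in> \<Lambda>"
  obtains t where "lmap A (Gs (i, j)) (Top i) t" "t ` carrier (Gs (i, j)) = carrier (Top i)" 
    "\<And>y. y \<in> carrier (Gs (i, j)) \<Longrightarrow> t y = \<zero>\<^bsub>Top i\<^esub> \<longleftrightarrow> y \<in> radical A (Gs (i, j))"
proof -
  have i: "i \<in> {1..n}" using assms by (auto simp: labels_iff)
  obtain t where t: "lmap A (Gs (i, j)) (Top i) t" "\<And>x. x \<in> carrier (P i) \<Longrightarrow> t (cls i j x) = tp i x"
    by (rule tpG_exists[OF assms]) blast
  have "t ` carrier (Gs (i, j)) = tp i ` carrier (P i)"
    unfolding cls_surj[OF i, of j, symmetric] using t(2) by (simp add: image_image)
  then have s: "t ` carrier (Gs (i, j)) = carrier (Top i)" by (simp add: tp_surj[OF i])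
  have "t y = \<zero>\<^bsub>Top i\<^esub> \<longleftrightarrow> y \<in> radical A (Gs (i, j))" if y: "y \<in> carrier (Gs (i, j))" for y
  proof -
    obtain x where x: "x \<in> carrier (P i)" "y = cls i j x" using y cls_surj[OF i, of j] by blast
    then show ?thesis using t(2)[OF x(1)] tp_zero_iff[OF i x(1)] cls_radical_iff[OF assms x(1)] by simp
  qed
  with that t(1) s show thesis by blast
qed

text \<open>\<open>DD i j\<close> is a copy of the standard module with label \<open>(i, j)\<close> inside \<open>H (Top i)\<close>.\<close>

definition DD :: "nat \<Rightarrow> nat \<Rightarrow> ((nat \<times> nat \<Rightarrow> 'v set) \<Rightarrow> 'v set) set" where
  "DD i j = {f \<in> carrier (H (Top i)). \<forall>a b. (a, b) \<in> \<Lambda> \<longrightarrow> b < j \<longrightarrow> (\<forall>y\<in>carrier (Gs (a, b)). f (\<iota> (a, b) y) = \<zero>\<^bsub>Top i\<^esub>)}"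

abbreviation "std p \<equiv> quot_module (H (Gs p)) (K p)"

lemma left_module_std: "p \<in> \<Lambda> \<Longrightarrow> left_module R (std p)"
  by (rule left_module.left_module_quot[OF left_module_HG K_submodule])

lemma left_module_HTop: "i \<in> {1..n} \<Longrightarrow> left_module R (H (Top i))"
  by (rule hs.left_module_H[OF left_module_top])

text \<open>\<open>F\<close> is composition with the projection to the top. Maps from P_a/Rad^b with
  b < j are not onto, so they die in the top. For b \<ge> j a map to the top lifts to P_a ->
  P_i/Rad^j, and the lift kills Rad^b P_a because Rad^j of the target is zero.\<close>

lemma H_to_DD:
  assumes p: "(i, j) \<in> \<Lambda>"
  obtains F where "lmap R (H (Gs (i, j))) (H (Top i)) F" "F ` carrier (H (Gs (i, j))) = DD i j"
    "\<And>f. f \<in> carrier (H (Gs (i, j))) \<Longrightarrow> F f = \<zero>\<^bsub>H (Top i)\<^esub> \<longleftrightarrow> f \<in> K (i, j)"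
proof -
  have i: "i \<in> {1..n}" "1 \<le> j" using p by (auto simp: labels_iff)
  obtain t where t: "lmap A (Gs (i, j)) (Top i) t" "t ` carrier (Gs (i, j)) = carrier (Top i)" 
    "\<And>y. y \<in> carrier (Gs (i, j)) \<Longrightarrow> t y = \<zero>\<^bsub>Top i\<^esub> \<longleftrightarrow> y \<in> radical A (Gs (i, j))" by (rule tpG[OF p]) blast
  let ?F = "\<lambda>f. compose (carrier G) t f"
  have F: "lmap R (H (Gs (i, j))) (H (Top i)) ?F" by (rule hs.lmap_post[OF t(1)])
  interpret F: lmap R "H (Gs (i, j))" "H (Top i)" ?F by (rule F)
  note lt = left_module_top[OF i(1)] and lg = left_module_Gs[OF p]
  have zero: "?F f = \<zero>\<^bsub>H (Top i)\<^esub> \<longleftrightarrow> f \<in> K (i, j)" if f: "f \<in> carrier (H (Gs (i, j)))" for f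
    using hs.H_zero_iff[OF lt F.closed[OF f]] f t(3)[OF hs.H_closed[OF lg f]] by (simp add: K_def compose_def)
  have im: "?F ` carrier (H (Gs (i, j))) = DD i j"
  proof
    show "?F ` carrier (H (Gs (i, j))) \<subseteq> DD i j"
    proof
      fix f' assume "f' \<in> ?F ` carrier (H (Gs (i, j)))"
      then obtain f where f: "f \<in> carrier (H (Gs (i, j)))" "f' = ?F f" by blast
      have "?F f (\<iota> (a, b) y) = \<zero>\<^bsub>Top i\<^esub>" if ab: "(a, b) \<in> \<Lambda>" "b < j" and y: "y \<in> carrier (Gs (a, b))" for a b y
        using rad_map[OF ab(1) p lmap_entry[OF lg ab(1) f(1)] y] ab(2) iota_closed[OF ab(1) y] 
          t(3)[OF lmap.closed[OF lmap_entry[OF lg ab(1) f(1)] y]] by (simp add: compose_def)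
      then show "f' \<in> DD i j" using F.closed[OF f(1)] f(2) by (simp add: DD_def)
    qed
    show "DD i j \<subseteq> ?F ` carrier (H (Gs (i, j)))"
    proof
      fix f assume f: "f \<in> DD i j"
      then have fH: "f \<in> carrier (H (Top i))" by (simp add: DD_def)
      note sI = F.image_submodule[OF F.dom.submodule_carrier]
      show "f \<in> ?F ` carrier (H (Gs (i, j)))"
      proof (rule e_decomp[OF F.cod.left_module_axioms sI fH])
        fix q assume "q \<in> \<Lambda>"
        then obtain a b where q: "q = (a, b)" "(a, b) \<in> \<Lambda>" by (cases q) auto
        have a: "a \<in> {1..n}" using q by (auto simp: labels_iff)
        note fe = lmap_entry[OF lt q(2) fH]
        have eH: "e (a, b) \<odot>\<^bsub>H (Top i)\<^esub> f \<in> carrier (H (Top i))" using fH e_in_R[OF q(2)] by simp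
        show "e q \<odot>\<^bsub>H (Top i)\<^esub> f \<in> ?F ` carrier (H (Gs (i, j)))"
        proof (cases "b < j")
          case True
          have "e (a, b) \<odot>\<^bsub>H (Top i)\<^esub> f = \<zero>\<^bsub>H (Top i)\<^esub>"
            using f q(2) True pi_closed[OF q(2)] by (subst hs.H_zero_iff[OF lt eH]) (auto simp: e_smult_apply DD_def)
          then show ?thesis using F.cod.submoduleD(3)[OF sI] q(1) by simp
        next
          case False
          obtain h where h: "lmap A (P a) (Gs (i, j)) h" "\<And>x. x \<in> carrier (P a) \<Longrightarrow> t (h x) = f (\<iota> (a, b) (cls a b x))"
            by (rule lift_Gs[OF a fe t(1,2) fg_Gs[OF p] fg_top[OF i(1)]]) blast
          have "h x = \<zero>\<^bsub>Gs (i, j)\<^esub>" if x: "x \<in> rad_series A (P a) b" for x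
          proof -
            have "h x \<in> rad_series A (Gs (i, j)) j" 
              using rad_series_lmap[OF h(1) x] left_module.rad_series_mono[OF lg, of j b] False by auto
            then show ?thesis using rad_series_Gs_zero[OF p] by simp
          qed
          from factor_Gs[OF a h(1) this] obtain w where w: "lmap A (Gs (a, b)) (Gs (i, j)) w" "\<And>x. x \<in> carrier (P a) \<Longrightarrow> w (cls a b x) = h x" by blast
          have "?F (ent (a, b) w) = e (a, b) \<odot>\<^bsub>H (Top i)\<^esub> f"
          proof (rule hs.H_eqI[OF F.closed[OF ent_in[OF q(2) w(1)]] eH])
            fix g assume g: "g \<in> carrier G"
            obtain x where x: "x \<in> carrier (P a)" "g (a, b) = cls a b x" using pi_closed[OF q(2) g] cls_surj[OF a, of b] by blast
            then show "?F (ent (a, b) w) g = (e (a, b) \<odot>\<^bsub>H (Top i)\<^esub> f) g"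
              using g w(2)[OF x(1)] h(2)[OF x(1)] by (simp add: compose_def ent_apply e_smult_apply)
          qed
          then show ?thesis using ent_in[OF q(2) w(1)] q(1) by (metis imageI)
        qed
      qed
    qed
  qed
  show thesis by (rule that[OF F im zero])
qed

lemma DD_submodule:
  assumes p: "(i, j) \<in> \<Lambda>"
  shows "submodule (DD i j) R (H (Top i))"
proof -
  obtain F where F: "lmap R (H (Gs (i, j))) (H (Top i)) F" "F ` carrier (H (Gs (i, j))) = DD i j"
    by (rule H_to_DD[OF p])
  show ?thesis
    using lmap.image_submodule[OF F(1) left_module.submodule_carrier[OF left_module_HG[OF p]]] by (simp add: F(2))
qed

lemma std_DD:
  assumes p: "(i, j) \<in> \<Lambda>"
  shows "mod_iso R (std (i, j)) (msub (H (Top i)) (DD i j))"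
proof -
  have i: "i \<in> {1..n}" using p by (auto simp: labels_iff)
  obtain F where F: "lmap R (H (Gs (i, j))) (H (Top i)) F" "F ` carrier (H (Gs (i, j))) = DD i j"
    "\<And>f. f \<in> carrier (H (Gs (i, j))) \<Longrightarrow> F f = \<zero>\<^bsub>H (Top i)\<^esub> \<longleftrightarrow> f \<in> K (i, j)" by (rule H_to_DD[OF p]) blast
  interpret T: left_module R "H (Top i)" by (rule left_module_HTop[OF i])
  have "lmap R (H (Gs (i, j))) (msub (H (Top i)) (DD i j)) F"
    by (rule lmap_msub_cod[OF F(1) DD_submodule[OF p]]) (use F(2) in blast)
  then show ?thesis by (rule first_iso) (use F K_def in auto)
qed

text \<open>The ring \<open>R\<close> acts by precomposition and not on \<open>X\<close>, so length
  is measured over the base ring \<open>C\<close>, which acts compatibly on both. Evaluation at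
  generators of the cyclic summands of \<open>G\<close> embeds Hom(G, X) over \<open>C\<close> into
  a finite power of \<open>X\<close>.\<close>

lemma finlen_H:
  assumes X: "finlen A X"
  shows "finlen R (H X)"
proof -
  interpret artin_alg C A \<gamma> by (rule artin_alg.intro[OF artin])
  interpret X: left_module A X using X by (rule finlen_left_module)
  \<comment> \<open>The structure map of \<open>R\<close> as an algebra over \<open>C\<close>.
    Centrality of the scalars makes multiplication by them linear over \<open>A\<close>.\<close>
  let ?\<psi> = "\<lambda>c. \<lambda>g\<in>carrier G. \<gamma> c \<odot>\<^bsub>G\<^esub> g"
  have psiR: "?\<psi> c \<in> carrier R" if c: "c \<in> carrier C" for c
  proof (rule hs.restrict_E[OF lmapI[OF Gf.left_module_dir_sum Gf.left_module_dir_sum]])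
    fix a g assume "a \<in> carrier A" "g \<in> carrier G"
    then show "\<gamma> c \<odot>\<^bsub>G\<^esub> (a \<odot>\<^bsub>G\<^esub> g) = a \<odot>\<^bsub>G\<^esub> (\<gamma> c \<odot>\<^bsub>G\<^esub> g)"
      using c central[of c a] by (simp flip: Gf.S.smult_assoc)
  qed (use c in \<open>simp_all add: Gf.S.smult_r_distr\<close>)
  have "?\<psi> \<in> ring_hom C R"
  proof (rule ring_hom_memI)
    fix c d assume c: "c \<in> carrier C" "d \<in> carrier C"
    show "?\<psi> (c \<otimes>\<^bsub>C\<^esub> d) = ?\<psi> c \<otimes>\<^bsub>R\<^esub> ?\<psi> d" "?\<psi> (c \<oplus>\<^bsub>C\<^esub> d) = ?\<psi> c \<oplus>\<^bsub>R\<^esub> ?\<psi> d"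
      using c central[OF c(1), of "\<gamma> d"] Gf.S.smult_closed[of "\<gamma> c"] 
      by (auto simp: opp_end_simps compose_def fun_eq_iff Gf.S.smult_l_distr simp flip: Gf.S.smult_assoc)
  qed (use psiR Gf.S.smult_one in \<open>simp_all add: opp_end_simps cong: restrict_cong\<close>)
  then interpret \<psi>: scalars C R ?\<psi>
    by (intro scalars.intro ring_hom_ring.intro ring_hom_ring_axioms.intro R.ring_axioms \<gamma>.R.ring_axioms)
  have lH: "left_module R (H X)" by (rule hs.left_module_H[OF X.left_module_axioms])
  \<comment> \<open>Each summand is cyclic, generated by the class of a generator of P_i.\<close>
  have "\<exists>y\<in>carrier (Gs p). \<forall>z\<in>carrier (Gs p). \<exists>a\<in>carrier A. z = a \<odot>\<^bsub>Gs p\<^esub> y" if p: "p \<in> \<Lambda>" for p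
  proof -
    obtain i j where ij: "p = (i, j)" and i: "i \<in> {1..n}" using p by (cases p) (auto simp: labels_iff)
    interpret Pi: indec_proj A "P i" by (rule indec_P[OF i])
    obtain \<theta> y where y: "lmap A (P i) (regular_module A) \<theta>" "y \<in> carrier (P i)" "\<And>u. u \<in> carrier (P i) \<Longrightarrow> \<theta> u \<odot>\<^bsub>P i\<^esub> y = u"
      by (rule Pi.cyclic_dual_basis) blast
    note c = lmap_cls[OF i, of j]
    have "z \<in> (\<lambda>a. a \<odot>\<^bsub>Gs p\<^esub> cls i j y) ` carrier A" if z: "z \<in> carrier (Gs p)" for z
    proof -
      obtain u where u: "u \<in> carrier (P i)" "z = cls i j u" using z cls_surj[OF i, of j] unfolding ij by blast
      have "\<theta> u \<in> carrier A" using lmap.closed[OF y(1) u(1)] by simp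
      then show ?thesis using lmap.smult[OF c _ y(2), of "\<theta> u"] y(3)[OF u(1)] u(2) ij by auto
    qed
    then show ?thesis using lmap.closed[OF c y(2)] unfolding ij by blast
  qed
  then obtain y where y: "\<And>p. p \<in> \<Lambda> \<Longrightarrow> y p \<in> carrier (Gs p)" 
    "\<And>p z. p \<in> \<Lambda> \<Longrightarrow> z \<in> carrier (Gs p) \<Longrightarrow> \<exists>a\<in>carrier A. z = a \<odot>\<^bsub>Gs p\<^esub> y p" by metis
  interpret D: module_family C \<Lambda> "\<lambda>_. restr X"
    by (rule module_family.intro[OF \<gamma>.R.ring_axioms left_module_restr[OF X.left_module_axioms]])
  note yG = iota_closed[OF _ y(1)]
  have "lmap C (\<psi>.restr (H X)) D.S (\<lambda>f. \<lambda>p\<in>\<Lambda>. f (\<iota> p (y p)))"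
  proof (rule D.lmap_tuple[OF \<psi>.left_module_restr[OF lH] lmapI[OF \<psi>.left_module_restr[OF lH] left_module_restr[OF X.left_module_axioms]]])
    fix p c f assume p: "p \<in> \<Lambda>" and c: "c \<in> carrier C" and "f \<in> carrier (\<psi>.restr (H X))"
    then have "lmap A G X f" using hs.H_lmap[OF X.left_module_axioms] by simp
    from lmap.smult[OF this, of "\<gamma> c" "\<iota> p (y p)"] show "(c \<odot>\<^bsub>\<psi>.restr (H X)\<^esub> f) (\<iota> p (y p)) = c \<odot>\<^bsub>restr X\<^esub> f (\<iota> p (y p))"
      using p c yG by (simp add: hs.H_smult_apply)
  qed (simp_all add: hs.H_closed[OF X.left_module_axioms] hs.H_add_apply yG)
  then interpret F: lmap C "\<psi>.restr (H X)" D.S "\<lambda>f. \<lambda>p\<in>\<Lambda>. f (\<iota> p (y p))" .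
  have ker: "f = \<zero>\<^bsub>H X\<^esub>" if f: "f \<in> F.ker" for f
  proof -
    have fH: "f \<in> carrier (H X)" and f0: "(\<lambda>p\<in>\<Lambda>. f (\<iota> p (y p))) = \<zero>\<^bsub>D.S\<^esub>"
      using f unfolding F.ker_def by simp_all
    have "f g \<in> {\<zero>\<^bsub>X\<^esub>}" if g: "g \<in> carrier G" for g
    proof (rule G_mem[OF hs.H_lmap[OF X.left_module_axioms fH] X.submodule_zero g])
      fix p assume p: "p \<in> \<Lambda>"
      note fe = lmap_entry[OF X.left_module_axioms p fH]
      obtain a where a: "a \<in> carrier A" "g p = a \<odot>\<^bsub>Gs p\<^esub> y p" using y(2)[OF p pi_closed[OF p g]] by blast
      have "f (\<iota> p (y p)) = \<zero>\<^bsub>X\<^esub>" using fun_cong[OF f0, of p] p by (simp add: dir_sum_simps(2))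
      then show "f (\<iota> p (g p)) \<in> {\<zero>\<^bsub>X\<^esub>}" using lmap.smult[OF fe a(1) y(1)[OF p]] a by simp
    qed
    then show ?thesis using hs.H_zero_iff[OF X.left_module_axioms fH] by blast
  qed
  have "F.ker = {\<zero>\<^bsub>\<psi>.restr (H X)\<^esub>}"
  proof
    show "F.ker \<subseteq> {\<zero>\<^bsub>\<psi>.restr (H X)\<^esub>}" using ker by (intro subsetI) simp
    show "{\<zero>\<^bsub>\<psi>.restr (H X)\<^esub>} \<subseteq> F.ker" using F.dom.submoduleD(3)[OF F.ker_submodule] by blast
  qed
  then have "inj_on (\<lambda>f. \<lambda>p\<in>\<Lambda>. f (\<iota> p (y p))) (carrier (\<psi>.restr (H X)))"
    unfolding F.inj_iff_ker .
  moreover have "finlen C D.S"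
    by (rule finlen_dir_sum[OF finite_labels \<gamma>.R.ring_axioms finlen_restr[OF fg_finlen[OF X]]])
  ultimately have "finlen C (\<psi>.restr (H X))" by (rule finlen_inj[OF F.lmap_axioms'])
  then show ?thesis using \<psi>.chain_cond_of_restr[OF lH] by (simp add: finlen_def)
qed

lemma finlen_G: "finlen A G"
  by (rule finlen_dir_sum[OF finite_labels ring_axioms finlen_Gs])

text \<open>As a left module the ring \<open>R\<close> is \<open>H G\<close>.\<close>

lemma finlen_R: "finlen R (regular_module R)"
proof -
  have "lmap R (regular_module R) (H G) (\<lambda>r. r)"
    by (rule lmapI[OF left_module_regular[OF R.ring_axioms] hs.left_module_H[OF Gf.left_module_dir_sum]])
      (simp_all add: opp_end_simps hom_module_simps)
  then show ?thesis by (rule finlen_inj[OF _ _ finlen_H[OF finlen_G]]) simp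
qed

lemma fg_R_finlen: "fg_module R M \<longleftrightarrow> finlen R M"
  using finlen_fg[OF finlen_R] fg_finlen by blast

lemma finlen_HG: "p \<in> \<Lambda> \<Longrightarrow> finlen R (H (Gs p))"
  by (rule finlen_H[OF finlen_Gs])

text \<open>By \<open>composition_factors_iff\<close> a submodule \<open>N\<close> is admissible iff
  it contains \<open>e q\<close> h for all h and all labels q not below p. \<open>K p\<close> is
  admissible because those summands map into the radical, and it is the least such because it is
  generated by its components at the labels (k, j - 1), none of which is below p.\<close>

lemma standard_eq:
  assumes p: "p \<in> \<Lambda>"
  shows "standard_module R \<Lambda> adr_le (\<lambda>p. H (Gs p)) p = std p"
proof -
  obtain i j where ij: "p = (i, j)" by (cases p)
  note p' = p[unfolded ij]
  interpret Hp: left_module R "H (Gs p)" by (rule left_module_HG[OF p])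
  let ?\<Phi> = "{q \<in> \<Lambda>. adr_le q p}"
  have crit: "composition_factors_among R Ls ?\<Phi> (quot_module (H (Gs p)) N) \<longleftrightarrow>
      (\<forall>q\<in>\<Lambda>. \<not> adr_le q p \<longrightarrow> (\<forall>f\<in>carrier (H (Gs p)). e q \<odot>\<^bsub>H (Gs p)\<^esub> f \<in> N))" if N: "submodule N R (H (Gs p))" for N
  proof -
    have "composition_factors_among R Ls ?\<Phi> (quot_module (H (Gs p)) N) \<longleftrightarrow>
      (\<forall>q\<in>\<Lambda> - ?\<Phi>. \<forall>x\<in>carrier (quot_module (H (Gs p)) N). e q \<odot>\<^bsub>quot_module (H (Gs p)) N\<^esub> x = \<zero>\<^bsub>quot_module (H (Gs p)) N\<^esub>)"
      by (rule composition_factors_iff[OF finlen_quot[OF finlen_HG[OF p] N]]) auto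
    also have "\<dots> \<longleftrightarrow> (\<forall>q\<in>\<Lambda>. \<not> adr_le q p \<longrightarrow> (\<forall>f\<in>carrier (H (Gs p)). e q \<odot>\<^bsub>H (Gs p)\<^esub> f \<in> N))"
      using e_in_R by (auto simp: Hp.quot_simps(1,2)[OF N] Hp.quot_smult[OF N] Hp.coset_eq_zero_iff[OF N])
    finally show ?thesis .
  qed
  have "(LEAST N. submodule N R (H (Gs p)) \<and> composition_factors_among R Ls ?\<Phi> (quot_module (H (Gs p)) N)) = K p"
  proof (rule Least_equality)
    have "e q \<odot>\<^bsub>H (Gs p)\<^esub> f \<in> K p" if q: "q \<in> \<Lambda>" "\<not> adr_le q p" and f: "f \<in> carrier (H (Gs p))" for q f
    proof -
      have no: "fst q \<noteq> fst p \<or> snd q < snd p" using q(2) by (auto simp: adr_le_def prod_eq_iff)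
      have "(e q \<odot>\<^bsub>H (Gs p)\<^esub> f) g \<in> radical A (Gs p)" if g: "g \<in> carrier G" for g
        using rad_map[OF q(1) p lmap_entry[OF left_module_Gs[OF p] q(1) f] pi_closed[OF q(1) g] no] g by (simp add: e_smult_apply)
      then show ?thesis using f e_in_R[OF q(1)] by (simp add: K_def)
    qed
    then show "submodule (K p) R (H (Gs p)) \<and> composition_factors_among R Ls ?\<Phi> (quot_module (H (Gs p)) (K p))"
      using K_submodule[OF p] crit by blast
  next
    fix N assume N: "submodule N R (H (Gs p)) \<and> composition_factors_among R Ls ?\<Phi> (quot_module (H (Gs p)) N)"
    then have c: "\<forall>q\<in>\<Lambda>. \<not> adr_le q p \<longrightarrow> (\<forall>f\<in>carrier (H (Gs p)). e q \<odot>\<^bsub>H (Gs p)\<^esub> f \<in> N)" using crit by blast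
    have j: "1 \<le> j" using p' by (simp add: labels_iff)
    show "K p \<le> N" unfolding ij
    proof (rule K_generated[OF p'])
      show "submodule N R (H (Gs (i, j)))" using N ij by simp
      fix k h assume k: "(k, j - 1) \<in> \<Lambda>" and h: "h \<in> K (i, j)"
      have "\<not> adr_le (k, j - 1) p" using j ij by (auto simp: adr_le_def)
      then show "e (k, j - 1) \<odot>\<^bsub>H (Gs (i, j))\<^esub> h \<in> N" using c k h ij by (auto simp: K_def)
    qed
  qed
  then show ?thesis by (simp add: standard_module_def)
qed

subsection \<open>Costandard modules\<close>

text \<open>Letting \<open>r\<close> range over the ring selects the largest submodule annihilated
  by all \<open>e p\<close> with p not below q. For an injective hull of the simple module with
  label q it is the costandard module.\<close>

definition NN :: "('v adr, 'r) module \<Rightarrow> nat \<times> nat \<Rightarrow> 'r set" where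
  "NN Q q = {x \<in> carrier Q. \<forall>p\<in>\<Lambda>. \<not> adr_le p q \<longrightarrow> (\<forall>r\<in>carrier R. e p \<odot>\<^bsub>Q\<^esub> (r \<odot>\<^bsub>Q\<^esub> x) = \<zero>\<^bsub>Q\<^esub>)}"

lemma NN_submodule:
  assumes Q: "left_module R Q"
  shows "submodule (NN Q q) R Q"
proof -
  interpret Q: left_module R Q by fact
  show ?thesis
    by (rule Q.lsubmoduleI) (auto simp: NN_def e_in_R Q.smult_r_distr simp flip: Q.smult_assoc)
qed

lemma costandard_eq:
  assumes Q: "fg_module R (Q q)"
  shows "costandard_module R \<Lambda> adr_le Ls Q q = msub (Q q) (NN (Q q) q)"
proof -
  have fin: "finlen R (Q q)" using Q fg_R_finlen by blast
  interpret Q: left_module R "Q q" using fin by (rule finlen_left_module)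
  let ?\<Phi> = "{p \<in> \<Lambda>. adr_le p q}"
  have crit: "composition_factors_among R Ls ?\<Phi> (msub (Q q) N) \<longleftrightarrow> 
      (\<forall>p\<in>\<Lambda>. \<not> adr_le p q \<longrightarrow> (\<forall>x\<in>N. e p \<odot>\<^bsub>Q q\<^esub> x = \<zero>\<^bsub>Q q\<^esub>))" if N: "submodule N R (Q q)" for N
  proof -
    have "composition_factors_among R Ls ?\<Phi> (msub (Q q) N) \<longleftrightarrow> 
      (\<forall>p\<in>\<Lambda> - ?\<Phi>. \<forall>x\<in>carrier (msub (Q q) N). e p \<odot>\<^bsub>msub (Q q) N\<^esub> x = \<zero>\<^bsub>msub (Q q) N\<^esub>)"
      by (rule composition_factors_iff[OF finlen_sub[OF fin N]]) auto
    then show ?thesis by auto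
  qed
  note s = NN_submodule[OF Q.left_module_axioms]
  have "(GREATEST N. submodule N R (Q q) \<and> composition_factors_among R Ls ?\<Phi> (msub (Q q) N)) = NN (Q q) q"
  proof (rule Greatest_equality)
    have "e p \<odot>\<^bsub>Q q\<^esub> x = \<zero>\<^bsub>Q q\<^esub>" if "p \<in> \<Lambda>" "\<not> adr_le p q" "x \<in> NN (Q q) q" for p x
    proof -
      have "e p \<odot>\<^bsub>Q q\<^esub> (\<one>\<^bsub>R\<^esub> \<odot>\<^bsub>Q q\<^esub> x) = \<zero>\<^bsub>Q q\<^esub>" "x \<in> carrier (Q q)" using that R.one_closed unfolding NN_def by blast+
      then show ?thesis by simp
    qed
    then show "submodule (NN (Q q) q) R (Q q) \<and> composition_factors_among R Ls ?\<Phi> (msub (Q q) (NN (Q q) q))"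
      using s crit by blast
  next
    fix N assume N: "submodule N R (Q q) \<and> composition_factors_among R Ls ?\<Phi> (msub (Q q) N)"
    then have sN: "submodule N R (Q q)" by blast
    then have c: "\<forall>p\<in>\<Lambda>. \<not> adr_le p q \<longrightarrow> (\<forall>x\<in>N. e p \<odot>\<^bsub>Q q\<^esub> x = \<zero>\<^bsub>Q q\<^esub>)" using crit N by blast
    show "N \<le> NN (Q q) q"
    proof
      fix x assume x: "x \<in> N"
      then have "r \<odot>\<^bsub>Q q\<^esub> x \<in> N" if "r \<in> carrier R" for r using Q.submoduleD(5)[OF sN that] by blast
      then show "x \<in> NN (Q q) q" using c Q.submoduleD(2)[OF sN x] by (simp add: NN_def)
    qed
  qed
  then show ?thesis by (simp add: costandard_module_def)
qed

end

section \<open>Extensions of homomorphisms\<close>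

text \<open>Here \<open>U'\<close> is the sum of \<open>U\<close> and the image of \<open>h\<close>,
  and the map sends u + h(k) to f(u) + g(k). Agreement on the overlap makes it well defined, as for
  a pushout.\<close>

lemma glue_lmap:
  assumes E: "left_module R E" and U': "submodule U' R E" and U: "submodule U R E" "U \<subseteq> U'"
    and h: "lmap R X (msub E U') h" and f: "lmap R (msub E U) M f" and g: "lmap R X M g"
    and agree: "\<And>k. k \<in> carrier X \<Longrightarrow> h k \<in> U \<Longrightarrow> f (h k) = g k"
    and cover: "\<And>x. x \<in> U' \<Longrightarrow> \<exists>k\<in>carrier X. x \<ominus>\<^bsub>E\<^esub> h k \<in> U"
  shows "\<exists>f'. lmap R (msub E U') M f' \<and> (\<forall>x\<in>U. f' x = f x)"
proof -
  interpret E: left_module R E by fact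
  interpret f: lmap R "msub E U" M f by fact
  interpret g: lmap R X M g by fact
  have hE: "lmap R X E h" by (rule lmap_of_msub[OF h E U'])
  interpret h: lmap R X E h by (rule hE)
  have Uc: "x \<in> carrier E" if "x \<in> U" for x using E.submoduleD(2)[OF U(1) that] .
  have U'c: "x \<in> carrier E" if "x \<in> U'" for x using E.submoduleD(2)[OF U' that] .
  define \<kappa> where "\<kappa> x = (SOME k. k \<in> carrier X \<and> x \<ominus>\<^bsub>E\<^esub> h k \<in> U)" for x
  define f' where "f' x = f (x \<ominus>\<^bsub>E\<^esub> h (\<kappa> x)) \<oplus>\<^bsub>M\<^esub> g (\<kappa> x)" for x
  have fadd: "f (x \<oplus>\<^bsub>E\<^esub> y) = f x \<oplus>\<^bsub>M\<^esub> f y" if "x \<in> U" "y \<in> U" for x y using f.add[of x y] that by simp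
  have fsm: "f (a \<odot>\<^bsub>E\<^esub> x) = a \<odot>\<^bsub>M\<^esub> f x" if "a \<in> carrier R" "x \<in> U" for a x using f.smult[of a x] that by simp
  have fc: "f x \<in> carrier M" if "x \<in> U" for x using f.closed[of x] that by simp
  \<comment> \<open>Independence of the chosen preimage: two choices differ by an element whose
    image under \<open>h\<close> lies in \<open>U\<close>, where \<open>agree\<close>
    applies.\<close>
  have key: "f' x = f (x \<ominus>\<^bsub>E\<^esub> h k) \<oplus>\<^bsub>M\<^esub> g k" if x: "x \<in> U'" and k: "k \<in> carrier X" "x \<ominus>\<^bsub>E\<^esub> h k \<in> U" for x k
  proof -
    have "\<kappa> x \<in> carrier X \<and> x \<ominus>\<^bsub>E\<^esub> h (\<kappa> x) \<in> U" unfolding \<kappa>_def by (rule someI_ex) (use cover[OF x] in blast)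
    then have k': "\<kappa> x \<in> carrier X" "x \<ominus>\<^bsub>E\<^esub> h (\<kappa> x) \<in> U" by auto
    let ?d = "k \<ominus>\<^bsub>X\<^esub> \<kappa> x"
    have dX: "?d \<in> carrier X" using k k' by simp
    have hd: "h ?d = (x \<ominus>\<^bsub>E\<^esub> h (\<kappa> x)) \<ominus>\<^bsub>E\<^esub> (x \<ominus>\<^bsub>E\<^esub> h k)"
    proof -
      have c: "x \<in> carrier E" "h k \<in> carrier E" "h (\<kappa> x) \<in> carrier E" using U'c[OF x] k(1) k'(1) by auto
      have "(x \<ominus>\<^bsub>E\<^esub> h (\<kappa> x)) \<ominus>\<^bsub>E\<^esub> (x \<ominus>\<^bsub>E\<^esub> h k) = (\<ominus>\<^bsub>E\<^esub> h (\<kappa> x)) \<oplus>\<^bsub>E\<^esub> (x \<oplus>\<^bsub>E\<^esub> (\<ominus>\<^bsub>E\<^esub> x \<oplus>\<^bsub>E\<^esub> h k))"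
        using c by (simp add: a_minus_def E.M.minus_add E.M.a_ac)
      also have "x \<oplus>\<^bsub>E\<^esub> (\<ominus>\<^bsub>E\<^esub> x \<oplus>\<^bsub>E\<^esub> h k) = h k" using c by (simp add: E.M.r_neg2)
      also have "(\<ominus>\<^bsub>E\<^esub> h (\<kappa> x)) \<oplus>\<^bsub>E\<^esub> h k = h ?d" using c k(1) k'(1) by (simp only: h.diff) (simp add: a_minus_def E.M.a_comm)
      finally show ?thesis ..
    qed
    then have hdU: "h ?d \<in> U" using E.submoduleD(7)[OF U(1) k'(2) k(2)] by simp
    have "x \<ominus>\<^bsub>E\<^esub> h (\<kappa> x) = h ?d \<oplus>\<^bsub>E\<^esub> (x \<ominus>\<^bsub>E\<^esub> h k)"
      using Uc[OF k'(2)] Uc[OF k(2)] by (simp only: hd) (simp add: a_minus_def E.M.a_assoc E.M.l_neg)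
    then have "f' x = (g ?d \<oplus>\<^bsub>M\<^esub> f (x \<ominus>\<^bsub>E\<^esub> h k)) \<oplus>\<^bsub>M\<^esub> g (\<kappa> x)"
      unfolding f'_def using fadd[OF hdU k(2)] agree[OF dX hdU] by simp
    also have "\<dots> = f (x \<ominus>\<^bsub>E\<^esub> h k) \<oplus>\<^bsub>M\<^esub> (g ?d \<oplus>\<^bsub>M\<^esub> g (\<kappa> x))"
      using fc[OF k(2)] g.closed[OF dX] g.closed[OF k'(1)] by (simp add: f.cod.M.a_ac)
    also have "g ?d \<oplus>\<^bsub>M\<^esub> g (\<kappa> x) = g k"
    proof -
      have "g (?d \<oplus>\<^bsub>X\<^esub> \<kappa> x) = g ?d \<oplus>\<^bsub>M\<^esub> g (\<kappa> x)" using dX k'(1) by (rule g.add)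
      then show ?thesis using k(1) k'(1) by (simp add: a_minus_def g.dom.M.a_assoc g.dom.M.l_neg)
    qed
    finally show ?thesis .
  qed
  have "lmap R (msub E U') M f'"
  proof (rule lmapI[OF E.left_module_msub[OF U'] f.cod.left_module_axioms])
    fix x assume "x \<in> carrier (msub E U')"
    then have x: "x \<in> U'" by simp
    obtain k where k: "k \<in> carrier X" "x \<ominus>\<^bsub>E\<^esub> h k \<in> U" using cover[OF x] by blast
    show "f' x \<in> carrier M" using key[OF x k] fc[OF k(2)] k(1) by simp
    fix y assume "y \<in> carrier (msub E U')"
    then have y: "y \<in> U'" by simp
    obtain k' where k': "k' \<in> carrier X" "y \<ominus>\<^bsub>E\<^esub> h k' \<in> U" using cover[OF y] by blast
    have c: "x \<in> carrier E" "h k \<in> carrier E" "y \<in> carrier E" "h k' \<in> carrier E" using U'c x y k(1) k'(1) by auto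
    have xy: "(x \<oplus>\<^bsub>E\<^esub> y) \<ominus>\<^bsub>E\<^esub> h (k \<oplus>\<^bsub>X\<^esub> k') = (x \<ominus>\<^bsub>E\<^esub> h k) \<oplus>\<^bsub>E\<^esub> (y \<ominus>\<^bsub>E\<^esub> h k')"
      using c k(1) k'(1) by (simp add: h.add a_minus_def E.M.minus_add E.M.a_ac)
    have "f' (x \<oplus>\<^bsub>E\<^esub> y) = f ((x \<oplus>\<^bsub>E\<^esub> y) \<ominus>\<^bsub>E\<^esub> h (k \<oplus>\<^bsub>X\<^esub> k')) \<oplus>\<^bsub>M\<^esub> g (k \<oplus>\<^bsub>X\<^esub> k')"
      by (rule key) (use xy k k' E.submoduleD(4)[OF U' x y] E.submoduleD(4)[OF U(1) k(2) k'(2)] in auto)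
    also have "\<dots> = (f (x \<ominus>\<^bsub>E\<^esub> h k) \<oplus>\<^bsub>M\<^esub> f (y \<ominus>\<^bsub>E\<^esub> h k')) \<oplus>\<^bsub>M\<^esub> (g k \<oplus>\<^bsub>M\<^esub> g k')"
      using fadd[OF k(2) k'(2)] k(1) k'(1) by (simp add: xy g.add)
    also have "\<dots> = f' x \<oplus>\<^bsub>M\<^esub> f' y"
      unfolding key[OF x k] key[OF y k'] using fc[OF k(2)] fc[OF k'(2)] k(1) k'(1) by (simp add: f.cod.M.a_ac)
    finally show "f' (x \<oplus>\<^bsub>msub E U'\<^esub> y) = f' x \<oplus>\<^bsub>M\<^esub> f' y" by simp
  next
    fix a x assume a: "a \<in> carrier R" and "x \<in> carrier (msub E U')"
    then have x: "x \<in> U'" by simp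
    obtain k where k: "k \<in> carrier X" "x \<ominus>\<^bsub>E\<^esub> h k \<in> U" using cover[OF x] by blast
    have ax: "(a \<odot>\<^bsub>E\<^esub> x) \<ominus>\<^bsub>E\<^esub> h (a \<odot>\<^bsub>X\<^esub> k) = a \<odot>\<^bsub>E\<^esub> (x \<ominus>\<^bsub>E\<^esub> h k)"
      using a U'c[OF x] k(1) by (simp add: h.smult a_minus_def E.smult_r_distr E.smult_neg)
    have "f' (a \<odot>\<^bsub>E\<^esub> x) = f ((a \<odot>\<^bsub>E\<^esub> x) \<ominus>\<^bsub>E\<^esub> h (a \<odot>\<^bsub>X\<^esub> k)) \<oplus>\<^bsub>M\<^esub> g (a \<odot>\<^bsub>X\<^esub> k)"
      by (rule key) (use ax k a E.submoduleD(5)[OF U' a x] E.submoduleD(5)[OF U(1) a k(2)] in auto)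
    also have "\<dots> = a \<odot>\<^bsub>M\<^esub> f' x"
      unfolding key[OF x k] ax using fsm[OF a k(2)] fc[OF k(2)] a k(1) by (simp add: g.smult f.cod.smult_r_distr)
    finally show "f' (a \<odot>\<^bsub>msub E U'\<^esub> x) = a \<odot>\<^bsub>M\<^esub> f' x" by simp
  qed
  moreover have "f' x = f x" if x: "x \<in> U" for x
  proof -
    have "x \<ominus>\<^bsub>E\<^esub> h \<zero>\<^bsub>X\<^esub> = x" using Uc[OF x] by simp
    then have "f' x = f x \<oplus>\<^bsub>M\<^esub> g \<zero>\<^bsub>X\<^esub>" using key[of x "\<zero>\<^bsub>X\<^esub>"] x U(2) by auto
    then show ?thesis using fc[OF x] by simp
  qed
  ultimately show ?thesis by blast
qed

lemma epik_vimage: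
  assumes f: "lmap R E Q f" "f ` carrier E = carrier Q" and e: "epik R Q U V X"
  shows "epik R E {x \<in> carrier E. f x \<in> U} {x \<in> carrier E. f x \<in> V} X"
proof -
  interpret f: lmap R E Q f by (rule f)
  have s: "submodule U R Q" "submodule V R Q" "V \<subseteq> U" using e by (auto simp: epik_def)
  obtain g where g: "lmap R (msub Q U) X g" "g ` U = carrier X" "{u \<in> U. g u = \<zero>\<^bsub>X\<^esub>} = V" using e by (auto simp: epik_def)
  let ?U = "{x \<in> carrier E. f x \<in> U}"
  have sU: "submodule ?U R E" by (rule f.vimage_submodule[OF s(1)])
  have "lmap R (msub E ?U) (msub Q U) f"
    by (rule lmap_msub_cod[OF lmap_msub_dom[OF f(1) sU] s(1)]) simp
  from lmap_comp[OF this g(1)] have "lmap R (msub E ?U) X (\<lambda>x. g (f x))" .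
  moreover have "(\<lambda>x. g (f x)) ` ?U = carrier X"
  proof -
    have "U \<subseteq> f ` carrier E" unfolding f(2) by (rule f.cod.submoduleD(1)[OF s(1)])
    then have "f ` ?U = U" by auto
    then show ?thesis using g(2) by (metis image_image)
  qed
  moreover have "{u \<in> ?U. g (f u) = \<zero>\<^bsub>X\<^esub>} = {x \<in> carrier E. f x \<in> V}" using g(3) s(3) by auto
  ultimately show ?thesis using sU by (intro f.dom.epikI)
qed

context adr
begin

text \<open>\<open>EI M p\<close> expresses that \<open>Ext\<^sup>1\<close> of the standard module with label \<open>p\<close> by \<open>M\<close> vanishes, in terms of
  the presentation of the standard module as \<open>H (Gs p) / K p\<close>.\<close>

definition EI :: "('v adr, 'm) module \<Rightarrow> nat \<times> nat \<Rightarrow> bool" where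
  "EI M p \<longleftrightarrow> (\<forall>f. lmap R (msub (H (Gs p)) (K p)) M f \<longrightarrow> (\<exists>g. lmap R (H (Gs p)) M g \<and> (\<forall>x\<in>K p. g x = f x)))"

text \<open>Extendability composes along chains of submodules, which replaces the long exact
  sequence in the first argument of Ext.\<close>

definition extends :: "('v adr, 'm) module \<Rightarrow> ('v adr, 'x) module \<Rightarrow> 'x set \<Rightarrow> 'x set \<Rightarrow> bool" where
  "extends M E U U' \<longleftrightarrow> (\<forall>f. lmap R (msub E U) M f \<longrightarrow> (\<exists>f'. lmap R (msub E U') M f' \<and> (\<forall>x\<in>U. f' x = f x)))"

lemma extends_trans: "extends M E U U' \<Longrightarrow> extends M E U' U'' \<Longrightarrow> U \<subseteq> U' \<Longrightarrow> extends M E U U''"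
proof -
  assume e: "extends M E U U'" "extends M E U' U''" and sub: "U \<subseteq> U'"
  show ?thesis unfolding extends_def
  proof (intro allI impI)
    fix f assume "lmap R (msub E U) M f"
    then obtain f' where f': "lmap R (msub E U') M f'" "\<forall>x\<in>U. f' x = f x" using e(1) unfolding extends_def by blast
    then obtain f'' where f'': "lmap R (msub E U'') M f''" "\<forall>x\<in>U'. f'' x = f' x" using e(2) unfolding extends_def by blast
    show "\<exists>f'. lmap R (msub E U'') M f' \<and> (\<forall>x\<in>U. f' x = f x)"
      using f' f'' sub by (intro exI[of _ f'']) auto
  qed
qed

lemma extends_refl: "extends M E U U"
  unfolding extends_def by blast

text \<open>The generator of \<open>std p\<close> lifts to \<open>U'\<close>, which defines
  \<open>h\<close> from \<open>H (Gs p)\<close> to \<open>U'\<close> carrying exactly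
  \<open>K p\<close> into \<open>U\<close>. The composite K -> U -> M extends to
  \<open>H (Gs p)\<close> by \<open>EI\<close>, and the extension is glued to
  \<open>f\<close>.\<close>

lemma ext_step:
  assumes E: "left_module R E" and ep: "epik R E U' U (std p)" and p: "p \<in> \<Lambda>" and EI: "EI M p"
  shows "extends M E U U'"
  unfolding extends_def
proof (intro allI impI)
  fix f assume f: "lmap R (msub E U) M f"
  interpret E: left_module R E by fact
  interpret Hp: left_module R "H (Gs p)" by (rule left_module_HG[OF p])
  have s: "submodule U' R E" "submodule U R E" "U \<subseteq> U'" using ep by (auto simp: epik_def)
  obtain \<phi> where phi: "lmap R (msub E U') (std p) \<phi>" "\<phi> ` U' = carrier (std p)" "{u \<in> U'. \<phi> u = \<zero>\<^bsub>std p\<^esub>} = U" using ep by (auto simp: epik_def)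
  interpret phi: lmap R "msub E U'" "std p" \<phi> by (rule phi(1))
  note Ks = K_submodule[OF p]
  have "K p +>\<^bsub>H (Gs p)\<^esub> pr p \<in> carrier (std p)" using pr_in[OF p] by (simp add: Hp.quot_simps(1)[OF Ks])
  then obtain u where u: "u \<in> U'" "\<phi> u = K p +>\<^bsub>H (Gs p)\<^esub> pr p" using phi(2) by (metis imageE)
  let ?h = "\<lambda>k. jj p k \<odot>\<^bsub>E\<^esub> u"
  have h: "lmap R (H (Gs p)) (msub E U') ?h"
    using lmap_yoneda[OF p E.left_module_msub[OF s(1)], of u] u(1) by simp
  have ph: "\<phi> (?h k) = K p +>\<^bsub>H (Gs p)\<^esub> k" if k: "k \<in> carrier (H (Gs p))" for k
    using phi.smult[OF jj_in[OF p k], of u] u Hp.quot_smult[OF Ks jj_in[OF p k] pr_in[OF p]] by (simp add: jj_smult_pr[OF p k])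
  have hU: "?h k \<in> U \<longleftrightarrow> k \<in> K p" if k: "k \<in> carrier (H (Gs p))" for k
  proof -
    have "?h k \<in> U'" using lmap.closed[OF h k] by simp
    then have "?h k \<in> U \<longleftrightarrow> \<phi> (?h k) = \<zero>\<^bsub>std p\<^esub>" using phi(3) by blast
    then show ?thesis using ph[OF k] Hp.coset_eq_zero_iff[OF Ks k] by (simp add: Hp.quot_simps(2)[OF Ks])
  qed
  have Kc: "k \<in> carrier (H (Gs p))" if "k \<in> K p" for k using that by (simp add: K_def)
  have "lmap R (msub (H (Gs p)) (K p)) (msub E U) ?h"
    by (rule lmap_msub_cod[OF lmap_of_msub[OF lmap_msub_dom[OF h Ks] E.left_module_axioms s(1)] s(2)]) (use hU Kc in simp)
  from lmap_comp[OF this f] obtain g where g: "lmap R (H (Gs p)) M g" "\<And>x. x \<in> K p \<Longrightarrow> g x = f (?h x)"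
    using EI unfolding EI_def by blast
  show "\<exists>f'. lmap R (msub E U') M f' \<and> (\<forall>x\<in>U. f' x = f x)"
  proof (rule glue_lmap[OF E s h f g(1)])
    show "f (?h k) = g k" if "k \<in> carrier (H (Gs p))" "?h k \<in> U" for k
      using g(2) hU that by simp
    fix x assume x: "x \<in> U'"
    then have "\<phi> x \<in> carrier (std p)" using phi(2) by blast
    then obtain k where k: "k \<in> carrier (H (Gs p))" "\<phi> x = K p +>\<^bsub>H (Gs p)\<^esub> k" by (auto simp: Hp.quot_simps(1)[OF Ks])
    have hk: "?h k \<in> U'" using lmap.closed[OF h k(1)] by simp
    have "x \<ominus>\<^bsub>msub E U'\<^esub> ?h k \<in> phi.ker" using phi.eq_iff_diff_ker[of x "?h k"] ph[OF k(1)] k x hk by simp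
    then have "\<phi> (x \<ominus>\<^bsub>msub E U'\<^esub> ?h k) = \<zero>\<^bsub>std p\<^esub>" "x \<ominus>\<^bsub>msub E U'\<^esub> ?h k \<in> U'" by (auto simp: phi.ker_def)
    moreover have "x \<ominus>\<^bsub>msub E U'\<^esub> ?h k = x \<ominus>\<^bsub>E\<^esub> ?h k"
    proof -
      have c: "x \<in> carrier E" "?h k \<in> carrier E" using E.submoduleD(2)[OF s(1)] x hk by auto
      have "\<ominus>\<^bsub>msub E U'\<^esub> ?h k = \<ominus>\<^bsub>E\<^esub> ?h k"
        using phi.dom.M.minus_equality[of "\<ominus>\<^bsub>E\<^esub> ?h k" "?h k"] E.submoduleD(6)[OF s(1) hk] hk c by (simp add: E.M.l_neg)
      then show ?thesis by (simp add: a_minus_def)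
    qed
    ultimately show "\<exists>k\<in>carrier (H (Gs p)). x \<ominus>\<^bsub>E\<^esub> ?h k \<in> U" using phi(3) k(1) by auto
  qed
qed

text \<open>The kernel \<open>V\<close> of one component lies between \<open>U\<close> and
  \<open>U'\<close>: the upper step is one standard module, the lower one is the sum of the
  others.\<close>

lemma ext_dir_sum:
  assumes E: "left_module R E" and fin: "finite \<Omega>" 
    and lab: "\<And>\<omega>. \<omega> \<in> \<Omega> \<Longrightarrow> lab \<omega> \<in> \<Lambda>" and EI: "\<And>\<omega>. \<omega> \<in> \<Omega> \<Longrightarrow> EI M (lab \<omega>)"
    and ep: "epik R E U' U (dir_sum \<Omega> (\<lambda>\<omega>. std (lab \<omega>)))"
  shows "extends M E U U'"
  using fin lab EI ep
proof (induction \<Omega> arbitrary: U' rule: finite_induct)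
  case empty
  from empty(3)[unfolded epik_def] obtain f where "f ` U' = carrier (dir_sum {} (\<lambda>\<omega>. std (lab \<omega>)))"
    "{u \<in> U'. f u = \<zero>\<^bsub>dir_sum {} (\<lambda>\<omega>. std (lab \<omega>))\<^esub>} = U" by blast
  then have f: "f ` U' = {\<lambda>_. undefined}" "{u \<in> U'. f u = (\<lambda>_. undefined)} = U"
    by (simp_all add: dir_sum_simps restrict_def)
  have "f u = (\<lambda>_. undefined)" if "u \<in> U'" for u using f(1) that by blast
  then have "U' = U" using f(2) by blast
  then show ?case by (simp add: extends_refl)
next
  case (insert \<omega> \<Omega>)
  interpret E: left_module R E by fact
  let ?X = "\<lambda>\<omega>. std (lab \<omega>)"
  have lmX: "left_module R (?X \<omega>')" if "\<omega>' \<in> insert \<omega> \<Omega>" for \<omega>' by (rule left_module_std[OF insert.prems(1)[OF that]])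
  interpret S: module_family R "insert \<omega> \<Omega>" ?X by (rule module_family.intro[OF R.ring_axioms lmX])
  interpret S': module_family R \<Omega> ?X by (rule module_family.intro[OF R.ring_axioms lmX]) simp
  have s: "submodule U' R E" "submodule U R E" "U \<subseteq> U'" using insert.prems(3) by (auto simp: epik_def)
  obtain \<phi> where phi: "lmap R (msub E U') S.S \<phi>" "\<phi> ` U' = carrier S.S" "{u \<in> U'. \<phi> u = \<zero>\<^bsub>S.S\<^esub>} = U"
    using insert.prems(3) by (auto simp: epik_def)
  let ?c = "\<lambda>u. \<phi> u \<omega>"
  have c: "lmap R (msub E U') (?X \<omega>) ?c" by (rule lmap_comp[OF phi(1) S.lmap_component]) simp
  define V where "V = {u \<in> U'. ?c u = \<zero>\<^bsub>?X \<omega>\<^esub>}"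
  have z: "\<zero>\<^bsub>?X \<omega>'\<^esub> \<in> carrier (?X \<omega>')" if "\<omega>' \<in> insert \<omega> \<Omega>" for \<omega>'
  proof -
    interpret left_module R "?X \<omega>'" by (rule lmX[OF that])
    show ?thesis by simp
  qed
  have "?c ` U' = carrier (?X \<omega>)"
  proof
    show "?c ` U' \<subseteq> carrier (?X \<omega>)" using lmap.closed[OF c] by auto
    show "carrier (?X \<omega>) \<subseteq> ?c ` U'"
    proof
      fix y assume y: "y \<in> carrier (?X \<omega>)"
      then have "single (insert \<omega> \<Omega>) ?X \<omega> y \<in> \<phi> ` U'" unfolding phi(2) by (intro lmap.closed[OF S.lmap_single]) simp
      then obtain u where u: "single (insert \<omega> \<Omega>) ?X \<omega> y = \<phi> u" "u \<in> U'" by (rule imageE)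
      have "?c u = y" unfolding u(1)[symmetric] by (simp add: single_def)
      then show "y \<in> ?c ` U'" using u(2) by blast
    qed
  qed
  then have e1: "epik R E U' V (?X \<omega>)" by (rule E.epikI[OF c _ V_def[symmetric] s(1)])
  then have sV: "submodule V R E" "V \<subseteq> U'" by (auto simp: epik_def)
  have UV: "U \<subseteq> V"
  proof
    fix u assume "u \<in> U"
    then have "u \<in> U'" "\<phi> u = \<zero>\<^bsub>S.S\<^esub>" using phi(3) by blast+
    then show "u \<in> V" by (simp add: V_def dir_sum_simps)
  qed
  have V': "submodule V R (msub E U')" by (rule E.submoduleI_msub[OF s(1) sV])
  let ?r = "\<lambda>u. \<lambda>j\<in>\<Omega>. \<phi> u j"
  have "lmap R (msub E V) (?X j) (\<lambda>u. \<phi> u j)" if "j \<in> \<Omega>" for j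
    using lmap_msub_dom[OF lmap_comp[OF phi(1) S.lmap_component] V'] that by simp
  from S'.lmap_tuple[OF E.left_module_msub[OF sV(1)] this] have r: "lmap R (msub E V) S'.S ?r" .
  have "?r ` V = carrier S'.S"
  proof
    show "?r ` V \<subseteq> carrier S'.S" using lmap.closed[OF r] by auto
    show "carrier S'.S \<subseteq> ?r ` V"
    proof
      fix y assume y: "y \<in> carrier S'.S"
      let ?y = "y(\<omega> := \<zero>\<^bsub>?X \<omega>\<^esub>)"
      have "?y \<in> carrier S.S" unfolding dir_sum_simps using y z by (auto simp: dir_sum_simps PiE_def extensional_def)
      then have "?y \<in> \<phi> ` U'" unfolding phi(2) .
      then obtain u where u: "?y = \<phi> u" "u \<in> U'" by (rule imageE)
      have "u \<in> V" using u(2) by (simp add: V_def flip: u(1))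
      moreover have "?r u = y" unfolding u(1)[symmetric] using y insert.hyps(2)
        by (intro ext) (auto simp: dir_sum_simps PiE_def extensional_def restrict_def)
      ultimately show "y \<in> ?r ` V" by blast
    qed
  qed
  moreover have "{u \<in> V. ?r u = \<zero>\<^bsub>S'.S\<^esub>} = U"
  proof -
    have "?r u = \<zero>\<^bsub>S'.S\<^esub> \<longleftrightarrow> \<phi> u = \<zero>\<^bsub>S.S\<^esub>" if u: "u \<in> V" for u
    proof -
      have uc: "\<phi> u \<in> carrier S.S" "\<phi> u \<omega> = \<zero>\<^bsub>?X \<omega>\<^esub>" using u phi(2) by (auto simp: V_def)
      have "?r u = \<zero>\<^bsub>S'.S\<^esub> \<longleftrightarrow> (\<forall>j\<in>\<Omega>. \<phi> u j = \<zero>\<^bsub>?X j\<^esub>)" 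
      proof
        assume z: "?r u = \<zero>\<^bsub>S'.S\<^esub>"
        show "\<forall>j\<in>\<Omega>. \<phi> u j = \<zero>\<^bsub>?X j\<^esub>"
        proof
          fix j assume "j \<in> \<Omega>"
          then show "\<phi> u j = \<zero>\<^bsub>?X j\<^esub>" using fun_cong[OF z, of j] by (simp add: dir_sum_simps(2))
        qed
      next
        assume "\<forall>j\<in>\<Omega>. \<phi> u j = \<zero>\<^bsub>?X j\<^esub>"
        then show "?r u = \<zero>\<^bsub>S'.S\<^esub>" unfolding dir_sum_simps(2) by (intro restrict_ext) simp
      qed
      also have "\<dots> \<longleftrightarrow> (\<forall>j\<in>insert \<omega> \<Omega>. \<phi> u j = \<zero>\<^bsub>?X j\<^esub>)" using uc(2) by blast
      also have "\<dots> \<longleftrightarrow> \<phi> u = \<zero>\<^bsub>S.S\<^esub>"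
      proof
        assume "\<forall>j\<in>insert \<omega> \<Omega>. \<phi> u j = \<zero>\<^bsub>?X j\<^esub>"
        moreover have "\<phi> u = restrict (\<phi> u) (insert \<omega> \<Omega>)"
          using uc(1) by (simp add: dir_sum_simps(1) PiE_def extensional_restrict)
        moreover have "restrict (\<phi> u) (insert \<omega> \<Omega>) = \<zero>\<^bsub>S.S\<^esub>"
          unfolding dir_sum_simps(2) using calculation(1) by (intro restrict_ext) blast
        ultimately show "\<phi> u = \<zero>\<^bsub>S.S\<^esub>" by simp
      qed (simp add: dir_sum_simps)
      finally show ?thesis .
    qed
    then have "{u \<in> V. ?r u = \<zero>\<^bsub>S'.S\<^esub>} = {u \<in> V. \<phi> u = \<zero>\<^bsub>S.S\<^esub>}" by blast
    also have "\<dots> = U" using phi(3) UV sV(2) by blast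
    finally show ?thesis .
  qed
  ultimately have e2: "epik R E V U (dir_sum \<Omega> ?X)" by (intro E.epikI[OF r _ _ sV(1)])
  have "extends M E U V" by (rule insert.IH[OF _ _ e2]) (use insert.prems in auto)
  moreover have "extends M E V U'" by (rule ext_step[OF E e1]) (use insert.prems in auto)
  ultimately show ?case using UV by (rule extends_trans)
qed

text \<open>The filtration of the quotient is pulled back to \<open>E\<close>, where it starts at
  \<open>U\<close>; then \<open>ext_step\<close> is applied along it.\<close>

lemma ext_filtered_quot:
  assumes E: "left_module R E" and U: "submodule U R E" and fl: "filtered_by R std \<Phi> (quot_module E U)"
    and Phi: "\<Phi> \<subseteq> \<Lambda>" and EI: "\<And>p. p \<in> \<Phi> \<Longrightarrow> EI M p"
  shows "extends M E U (carrier E)"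
proof -
  interpret E: left_module R E by fact
  let ?Q = "quot_module E U" and ?\<pi> = "\<lambda>x. U +>\<^bsub>E\<^esub> x"
  interpret pi: lmap R E ?Q ?\<pi> by (rule E.lmap_quot[OF U])
  have ps: "?\<pi> ` carrier E = carrier ?Q" by (simp add: E.quot_simps(1)[OF U])
  obtain m F where F: "filtration R ?Q m F" "\<And>i. i < m \<Longrightarrow> \<exists>p\<in>\<Phi>. mod_iso R (subquot ?Q (F (Suc i)) (F i)) (std p)"
    using fl by (auto simp: filtered_by_def)
  have F': "F 0 = {\<zero>\<^bsub>?Q\<^esub>}" "F m = carrier ?Q" "\<And>i. i \<le> m \<Longrightarrow> submodule (F i) R ?Q" "\<And>i. i < m \<Longrightarrow> F i \<subseteq> F (Suc i)"
    using F(1) by (auto simp: filtration_def)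
  let ?V = "\<lambda>i. {x \<in> carrier E. ?\<pi> x \<in> F i}"
  have V0: "?V 0 = U"
    using E.coset_eq_zero_iff[OF U] E.submoduleD(2)[OF U] by (auto simp: F' E.quot_simps(2)[OF U])
  have Vm: "?V m = carrier E" using F'(2) ps by auto
  have "i \<le> m \<Longrightarrow> U \<subseteq> ?V i \<and> extends M E U (?V i)" for i
  proof (induction i)
    case 0
    show ?case unfolding V0 by (simp add: extends_refl)
  next
    case (Suc i)
    have i: "i < m" "i \<le> m" using Suc by auto
    obtain p where p: "p \<in> \<Phi>" "mod_iso R (subquot ?Q (F (Suc i)) (F i)) (std p)" using F(2)[OF i(1)] by blast
    have pL: "p \<in> \<Lambda>" using p Phi by auto
    have "epik R ?Q (F (Suc i)) (F i) (std p)"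
      using p(2) mod_iso_subquot_iff[OF pi.cod.left_module_axioms left_module_std[OF pL] F'(3)[OF Suc.prems] F'(3)[OF i(2)] F'(4)[OF i(1)]] by simp
    from ext_step[OF E epik_vimage[OF pi.lmap_axioms' ps this] pL EI[OF p(1)]]
    have "extends M E (?V i) (?V (Suc i))" .
    moreover have "U \<subseteq> ?V i" "extends M E U (?V i)" using Suc.IH[OF i(2)] by auto
    moreover have "?V i \<subseteq> ?V (Suc i)" using F'(4)[OF i(1)] by auto
    ultimately show ?case using extends_trans by blast
  qed
  from this[OF order_refl] show ?thesis unfolding Vm by simp
qed

text \<open>The exact sequence in the second argument by hand: maps on \<open>K p\<close> with
  values in the \<open>i\<close>-th term of the filtration extend, by induction on
  \<open>i\<close>.\<close>

lemma EI_filtered: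
  assumes M: "left_module R M" and p: "p \<in> \<Lambda>" and fl: "filtered_by R N \<Phi> M"
    and N: "\<And>q. q \<in> \<Phi> \<Longrightarrow> left_module R (N q)" and EI: "\<And>q. q \<in> \<Phi> \<Longrightarrow> EI (N q) p"
  shows "EI M p"
proof -
  interpret M: left_module R M by fact
  interpret Hp: left_module R "H (Gs p)" by (rule left_module_HG[OF p])
  note Ks = K_submodule[OF p]
  have Kc: "k \<in> carrier (H (Gs p))" if "k \<in> K p" for k using that by (simp add: K_def)
  obtain m F where F: "filtration R M m F" "\<And>i. i < m \<Longrightarrow> \<exists>q\<in>\<Phi>. mod_iso R (subquot M (F (Suc i)) (F i)) (N q)"
    using fl by (auto simp: filtered_by_def)
  have F': "F 0 = {\<zero>\<^bsub>M\<^esub>}" "F m = carrier M" "\<And>i. i \<le> m \<Longrightarrow> submodule (F i) R M" "\<And>i. i < m \<Longrightarrow> F i \<subseteq> F (Suc i)"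
    using F(1) by (auto simp: filtration_def)
  have "i \<le> m \<Longrightarrow> (\<forall>f. lmap R (msub (H (Gs p)) (K p)) M f \<longrightarrow> f ` K p \<subseteq> F i \<longrightarrow> (\<exists>g. lmap R (H (Gs p)) M g \<and> (\<forall>x\<in>K p. g x = f x)))" for i
  proof (induction i)
    case 0
    show ?case
    proof (intro allI impI)
      fix f assume "f ` K p \<subseteq> F 0"
      then have "f x = \<zero>\<^bsub>M\<^esub>" if "x \<in> K p" for x using that by (auto simp: F')
      then show "\<exists>g. lmap R (H (Gs p)) M g \<and> (\<forall>x\<in>K p. g x = f x)"
        using lmap_const0[OF Hp.left_module_axioms M] by (intro exI[of _ "\<lambda>_. \<zero>\<^bsub>M\<^esub>"]) simp
    qed
  next
    case (Suc i)
    have i: "i < m" "i \<le> m" using Suc by auto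
    note sF = F'(3)[OF Suc.prems] F'(3)[OF i(2)] F'(4)[OF i(1)]
    obtain q where q: "q \<in> \<Phi>" "mod_iso R (subquot M (F (Suc i)) (F i)) (N q)" using F(2)[OF i(1)] by blast
    have "epik R M (F (Suc i)) (F i) (N q)"
      using q(2) mod_iso_subquot_iff[OF M N[OF q(1)] sF] by simp
    then obtain \<phi> where phi: "lmap R (msub M (F (Suc i))) (N q) \<phi>" "\<phi> ` F (Suc i) = carrier (N q)" "{u \<in> F (Suc i). \<phi> u = \<zero>\<^bsub>N q\<^esub>} = F i"
      by (auto simp: epik_def)
    interpret phi: lmap R "msub M (F (Suc i))" "N q" \<phi> by (rule phi(1))
    show ?case
    proof (intro allI impI)
      fix f assume f: "lmap R (msub (H (Gs p)) (K p)) M f" and im: "f ` K p \<subseteq> F (Suc i)"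
      have f': "lmap R (msub (H (Gs p)) (K p)) (msub M (F (Suc i))) f"
        by (rule lmap_msub_cod[OF f sF(1)]) (use im in auto)
      from lmap_comp[OF f' phi(1)] obtain g0 where g0: "lmap R (H (Gs p)) (N q) g0" "\<And>x. x \<in> K p \<Longrightarrow> g0 x = \<phi> (f x)"
        using EI[OF q(1)] unfolding EI_def by blast
      have "g0 (pr p) \<in> carrier (N q)" by (rule lmap.closed[OF g0(1) pr_in[OF p]])
      then obtain m0 where m0: "m0 \<in> F (Suc i)" "\<phi> m0 = g0 (pr p)" using phi(2) by (metis imageE)
      \<comment> \<open>The map induced to the factor extends to \<open>H (Gs p)\<close> by
        hypothesis. Lifting only the image of the generator \<open>pr p\<close> gives
        \<open>?g1\<close>, and subtracting it from \<open>f\<close> leaves values in the next lower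
        term.\<close>
      let ?g1 = "\<lambda>k. jj p k \<odot>\<^bsub>M\<^esub> m0"
      have g1: "lmap R (H (Gs p)) M ?g1" by (rule lmap_yoneda[OF p M M.submoduleD(2)[OF sF(1) m0(1)]])
      have g1F: "?g1 k \<in> F (Suc i)" if "k \<in> carrier (H (Gs p))" for k by (rule M.submoduleD(5)[OF sF(1) jj_in[OF p that] m0(1)])
      have pg: "\<phi> (?g1 k) = g0 k" if k: "k \<in> carrier (H (Gs p))" for k
        using phi.smult[OF jj_in[OF p k], of m0] m0 yoneda_pr[OF p g0(1) k] by simp
      let ?d = "\<lambda>k. f k \<ominus>\<^bsub>M\<^esub> ?g1 k"
      have d: "lmap R (msub (H (Gs p)) (K p)) M ?d" by (rule lmap_diff[OF f lmap_msub_dom[OF g1 Ks]])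
      have "?d ` K p \<subseteq> F i"
      proof
        fix y assume "y \<in> ?d ` K p"
        then obtain k where k: "k \<in> K p" "y = ?d k" by blast
        have fk: "f k \<in> F (Suc i)" and gk: "?g1 k \<in> F (Suc i)" using im k g1F Kc by auto
        have yF: "y \<in> F (Suc i)" unfolding k(2) by (rule M.submoduleD(7)[OF sF(1) fk gk])
        have "f k = y \<oplus>\<^bsub>M\<^esub> ?g1 k" unfolding k(2) using M.submoduleD(2)[OF sF(1)] fk gk by (simp add: a_minus_def M.M.a_assoc M.M.l_neg)
        then have "\<phi> (f k) = \<phi> y \<oplus>\<^bsub>N q\<^esub> \<phi> (?g1 k)" using phi.add[of y "?g1 k"] yF gk by simp
        then have "\<phi> (f k) = \<phi> y \<oplus>\<^bsub>N q\<^esub> \<phi> (f k)" using pg[OF Kc[OF k(1)]] g0(2)[OF k(1)] by simp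
        moreover have "\<phi> y \<in> carrier (N q)" "\<phi> (f k) \<in> carrier (N q)" using phi.closed yF fk by auto
        ultimately have "\<phi> y = \<zero>\<^bsub>N q\<^esub>" using phi.cod.M.add.l_cancel_one by (metis (no_types, lifting) phi.cod.M.add.r_cancel_one' phi.cod.M.a_comm)
        then show "y \<in> F i" using phi(3) yF by blast
      qed
      from Suc.IH[OF i(2), rule_format, OF d this]
      obtain g2 where g2: "lmap R (H (Gs p)) M g2" "\<And>x. x \<in> K p \<Longrightarrow> g2 x = ?d x" by auto
      have "g2 x \<oplus>\<^bsub>M\<^esub> ?g1 x = f x" if x: "x \<in> K p" for x
        using g2(2)[OF x] lmap.closed[OF f, of x] lmap.closed[OF g1 Kc[OF x]] x by (simp add: a_minus_def M.M.a_assoc M.M.l_neg)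
      then show "\<exists>g. lmap R (H (Gs p)) M g \<and> (\<forall>x\<in>K p. g x = f x)" using lmap_add[OF g2(1) g1] by blast
    qed
  qed
  from this[OF order_refl] show ?thesis unfolding EI_def F'(2) using lmap.closed by fastforce
qed

text \<open>If j is at most the second coordinate of \<open>q\<close>, the generators of
  \<open>K p\<close> sit at labels not below \<open>q\<close>, so every map from \<open>K p\<close>
  to the costandard module is zero. Otherwise \<open>f\<close> extends to the injective module; the
  components of \<open>H (Gs p)\<close> at labels not below \<open>q\<close> lie in
  \<open>K p\<close>, so they are killed and the extension has values in \<open>NN\<close>.\<close>

lemma EI_costandard:
  assumes p: "p \<in> \<Lambda>" and q: "q \<in> \<Lambda>" and fg: "fg_module R Q" and inj: "injective R Q"
  shows "EI (msub Q (NN Q q)) p"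
  unfolding EI_def
proof (intro allI impI)
  interpret Q: left_module R Q using fg by (simp add: fg_module_def)
  let ?N = "NN Q q"
  have sN: "submodule ?N R Q" by (rule NN_submodule[OF Q.left_module_axioms])
  interpret Hp: left_module R "H (Gs p)" by (rule left_module_HG[OF p])
  note Ks = K_submodule[OF p]
  have Kc: "k \<in> carrier (H (Gs p))" if "k \<in> K p" for k using that by (simp add: K_def)
  have eN: "e p' \<odot>\<^bsub>Q\<^esub> x = \<zero>\<^bsub>Q\<^esub>" if "p' \<in> \<Lambda>" "\<not> adr_le p' q" "x \<in> ?N" for p' x
  proof -
    have "e p' \<odot>\<^bsub>Q\<^esub> (\<one>\<^bsub>R\<^esub> \<odot>\<^bsub>Q\<^esub> x) = \<zero>\<^bsub>Q\<^esub>" "x \<in> carrier Q" using that R.one_closed unfolding NN_def by blast+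
    then show ?thesis by simp
  qed
  fix f assume f: "lmap R (msub (H (Gs p)) (K p)) (msub Q ?N) f"
  interpret f: lmap R "msub (H (Gs p)) (K p)" "msub Q ?N" f by (rule f)
  have fN: "f x \<in> ?N" if "x \<in> K p" for x using f.closed[of x] that by simp
  have fsm: "f (r \<odot>\<^bsub>H (Gs p)\<^esub> x) = r \<odot>\<^bsub>Q\<^esub> f x" if "r \<in> carrier R" "x \<in> K p" for r x using f.smult[of r x] that by simp
  obtain i j where ij: "p = (i, j)" by (cases p)
  have j1: "1 \<le> j" using p ij by (simp add: labels_iff)
  show "\<exists>g. lmap R (H (Gs p)) (msub Q ?N) g \<and> (\<forall>x\<in>K p. g x = f x)"
  proof (cases "j \<le> snd q")
    case True
    let ?Z = "{x \<in> K p. f x = \<zero>\<^bsub>Q\<^esub>}"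
    have "submodule ?Z R (msub (H (Gs p)) (K p))" using f.ker_submodule by (simp add: f.ker_def)
    then have sZ: "submodule ?Z R (H (Gs p))" by (simp add: Hp.submodule_msub[OF Ks])
    have "K (i, j) \<subseteq> ?Z"
    proof (rule K_generated)
      show "(i, j) \<in> \<Lambda>" "submodule ?Z R (H (Gs (i, j)))" using p sZ ij by auto
      fix k h assume k: "(k, j - 1) \<in> \<Lambda>" and h: "h \<in> K (i, j)"
      have "\<not> adr_le (k, j - 1) q" using True j1 by (auto simp: adr_le_def)
      then have "f (e (k, j - 1) \<odot>\<^bsub>H (Gs p)\<^esub> h) = \<zero>\<^bsub>Q\<^esub>"
        using fsm[OF e_in_R[OF k], of h] eN[OF k] fN h ij by simp
      then show "e (k, j - 1) \<odot>\<^bsub>H (Gs (i, j))\<^esub> h \<in> ?Z"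
        using Hp.submoduleD(5)[OF Ks e_in_R[OF k], of h] h ij by simp
    qed
    then have "\<forall>x\<in>K p. \<zero>\<^bsub>Q\<^esub> = f x" using ij by auto
    then show ?thesis using lmap_const0[OF Hp.left_module_axioms Q.left_module_msub[OF sN]]
      by (intro exI[of _ "\<lambda>_. \<zero>\<^bsub>Q\<^esub>"]) simp
  next
    case False
    have fgH: "fg_module R (H (Gs p))" "fg_module R (msub (H (Gs p)) (K p))"
      using finlen_HG[OF p] finlen_sub[OF finlen_HG[OF p] Ks] fg_finlen by blast+
    have fQ: "lmap R (msub (H (Gs p)) (K p)) Q f" by (rule lmap_of_msub[OF f Q.left_module_axioms sN])
    have "inj_on (\<lambda>x. x) (carrier (msub (H (Gs p)) (K p)))" by simp
    from inj_extend[OF inj fgH(2,1) lmap_incl[OF Hp.left_module_axioms Ks] this fQ]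
    obtain g where g: "lmap R (H (Gs p)) Q g" "\<And>x. x \<in> K p \<Longrightarrow> g x = f x" by (metis Hp.msub_simps(1))
    interpret g: lmap R "H (Gs p)" Q g by (rule g)
    have "g h \<in> ?N" if h: "h \<in> carrier (H (Gs p))" for h
      unfolding NN_def
    proof (intro CollectI conjI ballI impI)
      show "g h \<in> carrier Q" using h by simp
      fix p' r assume p': "p' \<in> \<Lambda>" "\<not> adr_le p' q" and r: "r \<in> carrier R"
      let ?h = "r \<odot>\<^bsub>H (Gs p)\<^esub> h" let ?eh = "e p' \<odot>\<^bsub>H (Gs p)\<^esub> ?h"
      have hH: "?h \<in> carrier (H (Gs p))" using r h by simp
      have lt: "snd p' < snd p" using p' False ij by (auto simp: adr_le_def)
      have "?eh g \<in> radical A (Gs p)" if gG: "g \<in> carrier G" for g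
        using rad_map[OF p'(1) p lmap_entry[OF left_module_Gs[OF p] p'(1) hH] pi_closed[OF p'(1) gG]] lt gG by (simp add: e_smult_apply)
      then have eK: "?eh \<in> K p" using hH e_in_R[OF p'(1)] by (simp add: K_def)
      have "e p' \<odot>\<^bsub>H (Gs p)\<^esub> ?eh = ?eh"
        using Hp.smult_assoc[OF e_in_R[OF p'(1)] e_in_R[OF p'(1)] hH] e_orth[OF p'(1) p'(1)] by simp
      then have "e p' \<odot>\<^bsub>Q\<^esub> (r \<odot>\<^bsub>Q\<^esub> g h) = g (e p' \<odot>\<^bsub>H (Gs p)\<^esub> ?eh)"
        using e_in_R[OF p'(1)] r h by (simp add: g.smult)
      also have "\<dots> = e p' \<odot>\<^bsub>Q\<^esub> f ?eh" using e_in_R[OF p'(1)] Kc[OF eK] g(2)[OF eK] by (simp add: g.smult)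
      also have "\<dots> = \<zero>\<^bsub>Q\<^esub>" by (rule eN[OF p' fN[OF eK]])
      finally show "e p' \<odot>\<^bsub>Q\<^esub> (r \<odot>\<^bsub>Q\<^esub> g h) = \<zero>\<^bsub>Q\<^esub>" .
    qed
    then have "lmap R (H (Gs p)) (msub Q ?N) g" by (rule lmap_msub_cod[OF g(1) sN])
    then show ?thesis using g(2) by blast
  qed
qed

end

lemma lmap_factor_surj:
  assumes f: "lmap R U S f" "f ` carrier U = carrier S" and g: "lmap R U Z g"
    and k: "\<And>x. x \<in> carrier U \<Longrightarrow> f x = \<zero>\<^bsub>S\<^esub> \<Longrightarrow> g x = \<zero>\<^bsub>Z\<^esub>"
  shows "\<exists>t. lmap R S Z t \<and> (\<forall>x\<in>carrier U. t (f x) = g x)"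
proof -
  interpret f: lmap R U S f by (rule f)
  interpret g: lmap R U Z g by (rule g)
  define t where "t s = g (SOME x. x \<in> carrier U \<and> f x = s)" for s
  have t: "t (f x) = g x" if x: "x \<in> carrier U" for x
  proof -
    define y where "y = (SOME y. y \<in> carrier U \<and> f y = f x)"
    have "y \<in> carrier U \<and> f y = f x" unfolding y_def by (rule someI[of _ x]) (use x in auto)
    then have y: "y \<in> carrier U" "f y = f x" by auto
    have "f (y \<ominus>\<^bsub>U\<^esub> x) = \<zero>\<^bsub>S\<^esub>" using x y by (simp add: f.diff f.cod.diff_zero_iff)
    then have "g (y \<ominus>\<^bsub>U\<^esub> x) = \<zero>\<^bsub>Z\<^esub>" using x y by (intro k) auto
    then have "g y = g x" using x y by (simp add: g.diff g.cod.diff_zero_iff)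
    then show ?thesis by (simp add: t_def y_def)
  qed
  have ex: "\<exists>x\<in>carrier U. s = f x" if "s \<in> carrier S" for s using that f(2) by blast
  have "lmap R S Z t"
  proof (rule lmapI[OF f.cod.left_module_axioms g.cod.left_module_axioms])
    fix s assume "s \<in> carrier S"
    then obtain x where x: "x \<in> carrier U" "s = f x" using ex by blast
    then show "t s \<in> carrier Z" by (simp add: t)
    fix s' assume "s' \<in> carrier S"
    then obtain x' where x': "x' \<in> carrier U" "s' = f x'" using ex by blast
    then show "t (s \<oplus>\<^bsub>S\<^esub> s') = t s \<oplus>\<^bsub>Z\<^esub> t s'" using x t[of "x \<oplus>\<^bsub>U\<^esub> x'"] by (simp add: f.add t g.add)
  next
    fix a s assume a: "a \<in> carrier R" and "s \<in> carrier S"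
    then obtain x where x: "x \<in> carrier U" "s = f x" using ex by blast
    then show "t (a \<odot>\<^bsub>S\<^esub> s) = a \<odot>\<^bsub>Z\<^esub> t s" using a t[of "a \<odot>\<^bsub>U\<^esub> x"] by (simp add: f.smult t g.smult)
  qed
  with t show ?thesis by blast
qed

lemma epik_mod_iso:
  assumes ep: "epik R M U V X" and Y: "left_module R Y" and iso: "mod_iso R X Y"
  shows "epik R M U V Y"
proof -
  obtain f where f: "lmap R (msub M U) X f" "f ` U = carrier X" "{u \<in> U. f u = \<zero>\<^bsub>X\<^esub>} = V" using ep by (auto simp: epik_def)
  interpret f: lmap R "msub M U" X f by (rule f)
  obtain g where g: "lmap R X Y g" "bij_betw g (carrier X) (carrier Y)"
    using iso mod_iso_iff[OF f.cod.left_module_axioms Y] by blast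
  interpret g: lmap R X Y g by (rule g)
  have cM: "carrier (msub M U) = U" by (simp add: msub_def)
  have "lmap R (msub M U) Y (\<lambda>x. g (f x))" by (rule lmap_comp[OF f(1) g(1)])
  moreover have "(\<lambda>x. g (f x)) ` U = carrier Y"
    using f(2) g(2) by (simp add: bij_betw_def flip: image_image)
  moreover have "{u \<in> U. g (f u) = \<zero>\<^bsub>Y\<^esub>} = V"
  proof -
    have "g (f u) = \<zero>\<^bsub>Y\<^esub> \<longleftrightarrow> f u = \<zero>\<^bsub>X\<^esub>" if "u \<in> U" for u
    proof -
      have "f u \<in> carrier X" using f.closed that cM by simp
      then have "g (f u) = g \<zero>\<^bsub>X\<^esub> \<longleftrightarrow> f u = \<zero>\<^bsub>X\<^esub>" using g(2) f.cod.M.zero_closed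
        unfolding bij_betw_def by (metis inj_onD)
      then show ?thesis by simp
    qed
    then have "{u \<in> U. g (f u) = \<zero>\<^bsub>Y\<^esub>} = {u \<in> U. f u = \<zero>\<^bsub>X\<^esub>}" by blast
    then show ?thesis using f(3) by simp
  qed
  ultimately show ?thesis using ep unfolding epik_def by blast
qed

lemma dir_sum_iso:
  assumes R: "ring R" and M: "\<And>i. i \<in> I \<Longrightarrow> left_module R (M i)" and N: "\<And>i. i \<in> I \<Longrightarrow> left_module R (N i)"
    and iso: "\<And>i. i \<in> I \<Longrightarrow> mod_iso R (M i) (N i)"
  shows "mod_iso R (dir_sum I M) (dir_sum I N)"
proof -
  interpret M: module_family R I M by (rule module_family.intro[OF R M])
  interpret N: module_family R I N by (rule module_family.intro[OF R N])
  have "\<forall>i\<in>I. \<exists>f. lmap R (M i) (N i) f \<and> bij_betw f (carrier (M i)) (carrier (N i))"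
    using iso mod_iso_iff[OF M N] by blast
  from bchoice[OF this] obtain f where f: "\<And>i. i \<in> I \<Longrightarrow> lmap R (M i) (N i) (f i)" 
    "\<And>i. i \<in> I \<Longrightarrow> bij_betw (f i) (carrier (M i)) (carrier (N i))" by blast
  let ?F = "\<lambda>x. \<lambda>i\<in>I. f i (x i)"
  have F: "lmap R M.S N.S ?F"
    using N.lmap_tuple[OF M.left_module_dir_sum, of "\<lambda>i x. f i (x i)"] lmap_comp[OF M.lmap_component f(1)] by blast
  have "bij_betw ?F (carrier M.S) (carrier N.S)"
    unfolding bij_betw_def
  proof
    show "inj_on ?F (carrier M.S)"
    proof (rule inj_onI)
      fix x y assume x: "x \<in> carrier M.S" and y: "y \<in> carrier M.S" and e: "?F x = ?F y"
      show "x = y"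
      proof (rule extensionalityI[of _ I])
        show "x \<in> extensional I" "y \<in> extensional I" using x y by (simp_all add: dir_sum_simps PiE_def)
        fix i assume i: "i \<in> I"
        then have "f i (x i) = f i (y i)" using fun_cong[OF e, of i] by simp
        then show "x i = y i"
          using f(2)[OF i] M.component_closed[OF x i] M.component_closed[OF y i] unfolding bij_betw_def by (metis inj_onD)
      qed
    qed
    show "?F ` carrier M.S = carrier N.S"
    proof
      show "?F ` carrier M.S \<subseteq> carrier N.S" using lmap.closed[OF F] by blast
      show "carrier N.S \<subseteq> ?F ` carrier M.S"
      proof
        fix y assume y: "y \<in> carrier N.S"
        let ?x = "\<lambda>i\<in>I. inv_into (carrier (M i)) (f i) (y i)"
        have s: "f i ` carrier (M i) = carrier (N i)" if "i \<in> I" for i using f(2)[OF that] by (simp add: bij_betw_def)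
        have "?x \<in> carrier M.S" using inv_into_into[of _ _ "carrier (M _)"] s N.component_closed[OF y]
          by (simp add: dir_sum_simps(1) inv_into_into)
        moreover have "?F ?x = restrict y I" 
          using s N.component_closed[OF y] by (intro restrict_ext) (simp add: f_inv_into_f)
        moreover have "restrict y I = y" using y by (simp add: dir_sum_simps(1) PiE_def extensional_restrict)
        ultimately show "y \<in> ?F ` carrier M.S" by (intro image_eqI[of _ _ ?x]) simp_all
      qed
    qed
  qed
  with F show ?thesis using mod_iso_iff[OF M.left_module_dir_sum N.left_module_dir_sum] by blast
qed

lemma dir_sum_cong: "(\<And>i. i \<in> I \<Longrightarrow> M i = N i) \<Longrightarrow> dir_sum I M = dir_sum I N"
  by (simp add: dir_sum_def restrict_def fun_eq_iff cong: PiE_cong if_cong)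

section \<open>The trace series\<close>

lemma trace_submodule:
  assumes "left_module R M"
  shows "submodule (trace_of R D J M) R M"
  unfolding trace_of_def
  by (rule left_module.mspan_submodule[OF assms]) (auto simp: mod_hom_def)

lemma trace_upper:
  assumes M: "left_module R M" and j: "j \<in> J" and f: "lmap R (D j) M f" and x: "x \<in> carrier (D j)"
  shows "f x \<in> trace_of R D J M"
proof -
  have "restrict f (carrier (D j)) \<in> mod_hom R (D j) M" by (rule restrict_mod_hom[OF f])
  moreover have "f x \<in> restrict f (carrier (D j)) ` carrier (D j)" using x by force
  ultimately have "f x \<in> (\<Union>j\<in>J. \<Union>f\<in>mod_hom R (D j) M. f ` carrier (D j))" using j by blast
  then show ?thesis unfolding trace_of_def by (rule subsetD[OF left_module.mspan_upper[OF M]])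
qed

lemma trace_least:
  assumes M: "left_module R M" and N: "submodule N R M" and D: "\<And>j. j \<in> J \<Longrightarrow> left_module R (D j)"
    and f: "\<And>j f x. j \<in> J \<Longrightarrow> lmap R (D j) M f \<Longrightarrow> x \<in> carrier (D j) \<Longrightarrow> f x \<in> N"
  shows "trace_of R D J M \<subseteq> N"
  unfolding trace_of_def
proof (rule left_module.mspan_least[OF M N], rule subsetI)
  fix x assume "x \<in> (\<Union>j\<in>J. \<Union>f\<in>mod_hom R (D j) M. f ` carrier (D j))"
  then obtain j g y where j: "j \<in> J" "g \<in> mod_hom R (D j) M" "y \<in> carrier (D j)" "x = g y" by blast
  then show "x \<in> N" using f[OF j(1) mod_hom_lmap[OF j(2) D[OF j(1)] M] j(3)] by simp
qed

lemma trace_lmap: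
  assumes f: "lmap R M N f" and D: "\<And>j. j \<in> J \<Longrightarrow> left_module R (D j)" and x: "x \<in> trace_of R D J M"
  shows "f x \<in> trace_of R D J N"
proof -
  interpret f: lmap R M N f by (rule f)
  have "trace_of R D J M \<subseteq> {x \<in> carrier M. f x \<in> trace_of R D J N}"
  proof (rule trace_least[OF f.dom.left_module_axioms f.vimage_submodule[OF trace_submodule[OF f.cod.left_module_axioms]] D])
    fix j g y assume j: "j \<in> J" and g: "lmap R (D j) M g" and y: "y \<in> carrier (D j)"
    show "g y \<in> {x \<in> carrier M. f x \<in> trace_of R D J N}"
      using lmap.closed[OF g y] trace_upper[where f = "\<lambda>x. f (g x)" and D = D and J = J and j = j, OF f.cod.left_module_axioms j lmap_comp[OF g f] y] by simp
  qed
  then show ?thesis using x by blast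
qed

lemma delta_submodule:
  assumes M: "left_module R M"
  shows "submodule (delta_series R D J M i) R M"
proof (induction i)
  case 0
  then show ?case using left_module.submodule_zero[OF M] by simp
next
  case (Suc i)
  interpret M: left_module R M by (rule M)
  from lmap.vimage_submodule[OF M.lmap_quot[OF Suc] trace_submodule[OF M.left_module_quot[OF Suc]]]
  show ?case by simp
qed

lemma delta_lmap:
  assumes f: "lmap R M N f" and D: "\<And>j. j \<in> J \<Longrightarrow> left_module R (D j)" and x: "x \<in> delta_series R D J M i"
  shows "f x \<in> delta_series R D J N i"
  using x
proof (induction i arbitrary: x)
  case 0
  then show ?case using lmap.zero[OF f] by simp
next
  case (Suc i)
  interpret f: lmap R M N f by (rule f)
  let ?X = "delta_series R D J M i" and ?Y = "delta_series R D J N i"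
  have sX: "submodule ?X R M" and sY: "submodule ?Y R N" by (simp_all add: delta_submodule f.dom.left_module_axioms f.cod.left_module_axioms)
  have x: "x \<in> carrier M" "?X +>\<^bsub>M\<^esub> x \<in> trace_of R D J (quot_module M ?X)" using Suc.prems by auto
  have "?Y +>\<^bsub>N\<^esub> f x = \<zero>\<^bsub>quot_module N ?Y\<^esub>" if "x \<in> ?X" for x
    using Suc.IH[OF that] f.cod.coset_eq_zero_iff[OF sY, of "f x"] f.closed f.dom.submoduleD(2)[OF sX that]
    by (simp add: f.cod.quot_simps(2)[OF sY])
  from lmap_factor[OF lmap_comp[OF f f.cod.lmap_quot[OF sY]] sX this]
  obtain g where g: "lmap R (quot_module M ?X) (quot_module N ?Y) g" "\<And>x. x \<in> carrier M \<Longrightarrow> g (?X +>\<^bsub>M\<^esub> x) = ?Y +>\<^bsub>N\<^esub> f x" by auto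
  have "?Y +>\<^bsub>N\<^esub> f x \<in> trace_of R D J (quot_module N ?Y)"
    using trace_lmap[OF g(1) D x(2)] g(2)[OF x(1)] by simp
  then show ?case using x f.closed by simp
qed

lemma delta_iso:
  assumes f: "lmap R M N f" "bij_betw f (carrier M) (carrier N)" and D: "\<And>j. j \<in> J \<Longrightarrow> left_module R (D j)"
  shows "delta_series R D J M i = {x \<in> carrier M. f x \<in> delta_series R D J N i}"
proof -
  let ?g = "inv_into (carrier M) f"
  have g: "lmap R N M ?g" by (rule lmap_inv[OF f])
  have gf: "?g (f x) = x" if "x \<in> carrier M" for x using f(2) that by (simp add: bij_betw_def)
  show ?thesis
  proof (intro equalityI subsetI)
    fix x assume x: "x \<in> delta_series R D J M i"
    then have "x \<in> carrier M" by (rule left_module.submoduleD(2)[OF lmapD(1)[OF f(1)] delta_submodule[OF lmapD(1)[OF f(1)]]])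
    then show "x \<in> {x \<in> carrier M. f x \<in> delta_series R D J N i}" using delta_lmap[OF f(1) D x] by simp
  next
    fix x assume x: "x \<in> {x \<in> carrier M. f x \<in> delta_series R D J N i}"
    then have "f x \<in> delta_series R D J N i" by simp
    from delta_lmap[OF g D this] have "?g (f x) \<in> delta_series R D J M i" .
    then show "x \<in> delta_series R D J M i" using gf x by simp
  qed
qed

text \<open>The projection of \<open>U\<close> to \<open>M/V\<close> factors through the direct sum,
  so each summand becomes the image of a standard module in \<open>M/V\<close>.\<close>

lemma epik_trace:
  assumes M: "left_module R M" and ep: "epik R M U V (dir_sum \<Omega> X)" and fin: "finite \<Omega>"
    and X: "\<And>\<omega>. \<omega> \<in> \<Omega> \<Longrightarrow> \<exists>j\<in>J. X \<omega> = D j" and D: "\<And>j. j \<in> J \<Longrightarrow> left_module R (D j)" and x: "x \<in> U"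
  shows "V +>\<^bsub>M\<^esub> x \<in> trace_of R D J (quot_module M V)"
proof -
  interpret M: left_module R M by (rule M)
  have s: "submodule U R M" "submodule V R M" "V \<subseteq> U" using ep by (auto simp: epik_def)
  have lmX: "left_module R (X \<omega>)" if "\<omega> \<in> \<Omega>" for \<omega> using X[OF that] D by auto
  interpret S: module_family R \<Omega> X by (rule module_family.intro[OF M.R.ring_axioms lmX])
  obtain f where f: "lmap R (msub M U) S.S f" "f ` U = carrier S.S" "{u \<in> U. f u = \<zero>\<^bsub>S.S\<^esub>} = V" using ep by (auto simp: epik_def)
  let ?Q = "quot_module M V"
  note lq = M.left_module_quot[OF s(2)]
  have pi: "lmap R (msub M U) ?Q (\<lambda>x. V +>\<^bsub>M\<^esub> x)" by (rule lmap_msub_dom[OF M.lmap_quot[OF s(2)] s(1)])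
  have "V +>\<^bsub>M\<^esub> x = \<zero>\<^bsub>?Q\<^esub>" if x: "x \<in> carrier (msub M U)" "f x = \<zero>\<^bsub>S.S\<^esub>" for x
  proof -
    have "x \<in> V" using x f(3) by auto
    then show ?thesis using M.coset_eq_zero_iff[OF s(2), of x] M.submoduleD(2)[OF s(2)] by (simp add: M.quot_simps(2)[OF s(2)])
  qed
  note k = this
  have fU: "f ` carrier (msub M U) = carrier S.S" using f(2) by simp
  have "\<exists>t. lmap R S.S ?Q t \<and> (\<forall>x\<in>carrier (msub M U). t (f x) = V +>\<^bsub>M\<^esub> x)"
    by (rule lmap_factor_surj[OF f(1) fU pi]) (rule k)
  then obtain t where t0: "lmap R S.S ?Q t" "\<forall>x\<in>carrier (msub M U). t (f x) = V +>\<^bsub>M\<^esub> x" by (elim exE conjE)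
  then have t: "lmap R S.S ?Q t" "\<And>x. x \<in> U \<Longrightarrow> t (f x) = V +>\<^bsub>M\<^esub> x" by simp_all
  have fx: "f x \<in> carrier S.S" using f(2) x by blast
  have "f x \<in> {s \<in> carrier S.S. t s \<in> trace_of R D J ?Q}"
  proof (rule S.dir_sum_mem[OF fin lmap.vimage_submodule[OF t(1) trace_submodule[OF lq]] fx])
    fix \<omega> assume w: "\<omega> \<in> \<Omega>"
    have y: "f x \<omega> \<in> carrier (X \<omega>)" by (rule S.component_closed[OF fx w])
    obtain j where j: "j \<in> J" "X \<omega> = D j" using X[OF w] by blast
    have "lmap R (D j) ?Q (\<lambda>y. t (single \<Omega> X \<omega> y))" using lmap_comp[OF S.lmap_single[OF w] t(1)] j by simp
    from trace_upper[where D = D and J = J and j = j and f = "\<lambda>y. t (single \<Omega> X \<omega> y)" and x = "f x \<omega>", OF lq j(1) this]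
    show "single \<Omega> X \<omega> (f x \<omega>) \<in> {s \<in> carrier S.S. t s \<in> trace_of R D J ?Q}"
      using y j lmap.closed[OF S.lmap_single[OF w] y] by simp
  qed
  then have "t (f x) \<in> trace_of R D J ?Q" by blast
  then show ?thesis using t(2)[OF x] by simp
qed

section \<open>The tilting modules\<close>

locale adr_tilt = adr A n P L C \<gamma> for A :: "('a, 'e) ring_scheme" (structure) and n :: nat
    and P :: "nat \<Rightarrow> ('a, 'v) module" and L :: nat and C :: "('c, 'd) ring_scheme" and \<gamma> :: "'c \<Rightarrow> 'a" +
  fixes k l :: nat and Qk :: "('a, 'q) module"
  assumes kl: "(k, l) \<in> adr_labels A n P" and hull: "injective_hull A (mtop A (P k)) Qk"
begin

lemma fg_Qk: "fg_module A Qk" and inj_Qk: "injective A Qk"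
  using hull by (auto simp: injective_hull_def)

sublocale Q: left_module A Qk using fg_Qk by (simp add: fg_module_def)

lemma finlen_Qk: "finlen A Qk" using fg_Qk fg_iff_finlen by blast

abbreviation "Sc \<equiv> soc_series A Qk"

lemma Sc_iff: "x \<in> Sc t \<longleftrightarrow> x \<in> carrier Qk \<and> (\<forall>c\<in>Jpow A t. c \<odot>\<^bsub>Qk\<^esub> x = \<zero>\<^bsub>Qk\<^esub>)"
  by (simp add: soc_series_eq[OF Q.left_module_axioms])

lemma Sc_submodule: "submodule (Sc t) A Qk"
  by (rule soc_series_submodule[OF Q.left_module_axioms])

lemma Sc_mono: "s \<le> t \<Longrightarrow> Sc s \<subseteq> Sc t"
  by (rule soc_series_mono[OF Q.left_module_axioms])

sublocale HQ: left_module R "H Qk" by (rule hs.left_module_H[OF Q.left_module_axioms])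

lemma k_in: "k \<in> {1..n}" and l_bounds: "1 \<le> l" "l \<le> L"
  using kl by (auto simp: labels_iff)

text \<open>\<open>b + 1 - l\<close> is truncated: the elements of \<open>TT\<close> vanish on \<open>P a / Rad\<^sup>b\<close> for \<open>b < l\<close>.\<close>

definition TT :: "((nat \<times> nat \<Rightarrow> 'v set) \<Rightarrow> 'q) set" where
  "TT = {f \<in> carrier (H Qk). \<forall>a b. (a, b) \<in> \<Lambda> \<longrightarrow> (\<forall>y\<in>carrier (Gs (a, b)). f (\<iota> (a, b) y) \<in> Sc (b + 1 - l))}"

definition DT :: "nat \<Rightarrow> ((nat \<times> nat \<Rightarrow> 'v set) \<Rightarrow> 'q) set" where
  "DT t = {f \<in> TT. \<forall>g\<in>carrier G. f g \<in> Sc t}"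

lemma TT_in: "f \<in> TT \<Longrightarrow> f \<in> carrier (H Qk)" by (simp add: TT_def)

text \<open>Only closure under the action of \<open>R\<close> has content. An entry P_a/Rad^b ->
  P_c/Rad^d of \<open>r\<close> is harmless for d \<le> b, since then the bound at (c, d) is the
  stronger one.\<close>

lemma TT_submodule: "submodule TT R (H Qk)"
proof (rule HQ.lsubmoduleI)
  show "TT \<subseteq> carrier (H Qk)" by (auto simp: TT_def)
  show "\<zero>\<^bsub>H Qk\<^esub> \<in> TT" using Q.submoduleD(3)[OF Sc_submodule] iota_closed by (auto simp: TT_def hs.H_zero_apply)
  fix f g assume "f \<in> TT" "g \<in> TT"
  then show "f \<oplus>\<^bsub>H Qk\<^esub> g \<in> TT"
    using Q.submoduleD(4)[OF Sc_submodule] iota_closed by (auto simp: TT_def hs.H_add_apply)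
next
  fix r f assume r: "r \<in> carrier R" and f: "f \<in> TT"
  have fH: "f \<in> carrier (H Qk)" using f by (rule TT_in)
  have "f (r (\<iota> (a, b) y)) \<in> Sc (b + 1 - l)" if ab: "(a, b) \<in> \<Lambda>" and y: "y \<in> carrier (Gs (a, b))" for a b y
  proof (rule G_mem[OF hs.H_lmap[OF Q.left_module_axioms fH] Sc_submodule])
    show "r (\<iota> (a, b) y) \<in> carrier G" by (rule hs.E_closed[OF r iota_closed[OF ab y]])
    fix q assume "q \<in> \<Lambda>"
    then obtain c d where q: "q = (c, d)" "(c, d) \<in> \<Lambda>" by (cases q) auto
    let ?u = "\<lambda>y. r (\<iota> (a, b) y) (c, d)"
    have u: "lmap A (Gs (a, b)) (Gs (c, d)) ?u" by (rule lmap_entry_R[OF ab q(2) r])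
    have v: "lmap A (Gs (c, d)) Qk (\<lambda>y. f (\<iota> (c, d) y))" by (rule lmap_entry[OF Q.left_module_axioms q(2) fH])
    have uy: "?u y \<in> carrier (Gs (c, d))" by (rule lmap.closed[OF u y])
    have vS: "f (\<iota> (c, d) z) \<in> Sc (d + 1 - l)" if "z \<in> carrier (Gs (c, d))" for z using f q(2) that by (auto simp: TT_def)
    have "f (\<iota> (c, d) (?u y)) \<in> Sc (b + 1 - l)"
    proof (cases "d \<le> b")
      case True
      then have "d + 1 - l \<le> b + 1 - l" by simp
      then show ?thesis using vS[OF uy] Sc_mono by blast
    next
      \<comment> \<open>For d > b the value of the entry is killed by J^b, so it lies in Rad^(d-b)
        by rigidity. J^(b+1-l) moves it into Rad^(d+1-l), and \<open>f\<close> sends that to zero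
        because it maps the summand into Soc_(d+1-l).\<close>
      case False
      have z: "x \<odot>\<^bsub>Gs (c, d)\<^esub> ?u y = \<zero>\<^bsub>Gs (c, d)\<^esub>" if "x \<in> Jpow A b" for x
        using lmap.smult[OF u Jpow_closed[OF that] y] J_kills_Gs[OF ab that y] lmap.zero[OF u] by simp
      have ur: "?u y \<in> rad_series A (Gs (c, d)) (d - b)"
        by (rule rigid_socle[OF q(2) _ uy z]) (use False in auto)
      show ?thesis unfolding Sc_iff
      proof (intro conjI ballI)
        show "f (\<iota> (c, d) (?u y)) \<in> carrier Qk" by (rule lmap.closed[OF v uy])
        fix x assume x: "x \<in> Jpow A (b + 1 - l)"
        note lcd = left_module_Gs[OF q(2)]
        have "x \<odot>\<^bsub>Gs (c, d)\<^esub> ?u y \<in> rad_series A (Gs (c, d)) ((d - b) + (b + 1 - l))"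
          by (rule Jpow_smult[OF lcd x ur])
        moreover have "d + 1 - l \<le> (d - b) + (b + 1 - l)" using False by linarith
        ultimately have xr: "x \<odot>\<^bsub>Gs (c, d)\<^esub> ?u y \<in> rad_series A (Gs (c, d)) (d + 1 - l)"
          using left_module.rad_series_mono[OF lcd] by blast
        have "rad_series A (msub Qk (Sc (d + 1 - l))) (d + 1 - l) = {\<zero>\<^bsub>Qk\<^esub>}"
          using rad_series_zero_iff[OF Q.left_module_msub[OF Sc_submodule], of "d + 1 - l" "d + 1 - l"] by (simp add: Sc_iff)
        moreover have "lmap A (Gs (c, d)) (msub Qk (Sc (d + 1 - l))) (\<lambda>y. f (\<iota> (c, d) y))"
          by (rule lmap_msub_cod[OF v Sc_submodule vS])
        ultimately have "f (\<iota> (c, d) (x \<odot>\<^bsub>Gs (c, d)\<^esub> ?u y)) = \<zero>\<^bsub>Qk\<^esub>"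
          using rad_series_lmap[OF _ xr] by fastforce
        then show "x \<odot>\<^bsub>Qk\<^esub> f (\<iota> (c, d) (?u y)) = \<zero>\<^bsub>Qk\<^esub>" using lmap.smult[OF v Jpow_closed[OF x] uy] by simp
      qed
    qed
    then show "f (\<iota> q (r (\<iota> (a, b) y) q)) \<in> Sc (b + 1 - l)" by (simp add: q(1))
  qed
  then show "r \<odot>\<^bsub>H Qk\<^esub> f \<in> TT" using r fH iota_closed by (auto simp: TT_def hs.H_smult_apply)
qed

abbreviation "M0 \<equiv> msub (H Qk) TT"

sublocale M0: left_module R M0 by (rule HQ.left_module_msub[OF TT_submodule])

lemma DT_submodule: "submodule (DT t) R (H Qk)"
proof -
  have "DT t = TT \<inter> {f \<in> carrier (H Qk). \<forall>g\<in>carrier G. f g \<in> Sc t}" using TT_in by (auto simp: DT_def)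
  then show ?thesis using HQ.submodule_Int[OF TT_submodule hs.sub_H[OF Q.left_module_axioms Sc_submodule]] by simp
qed

lemma DT_M0: "submodule (DT t) R M0"
  by (rule HQ.submoduleI_msub[OF TT_submodule DT_submodule]) (auto simp: DT_def)

lemma DT_mono: "s \<le> t \<Longrightarrow> DT s \<subseteq> DT t"
  using Sc_mono by (auto simp: DT_def)

lemma DT_0: "DT 0 = {\<zero>\<^bsub>H Qk\<^esub>}"
proof -
  have "f = \<zero>\<^bsub>H Qk\<^esub>" if "f \<in> DT 0" for f
    using that hs.H_zero_iff[OF Q.left_module_axioms TT_in] by (auto simp: DT_def)
  then show ?thesis using HQ.submoduleD(3)[OF DT_submodule] by blast
qed

text \<open>The number of layers that have to be treated: the socle series of Q_k ends at its Loewy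
  length, and maps in \<open>TT\<close> have values in Soc_(L+1-l). The second bound also keeps l +
  i - 1 \<le> \<open>L\<close>, so that the labels of the layers exist.\<close>

definition mm :: nat where "mm = min (loewy_length A Qk) (L + 1 - l)"

lemma TT_values:
  assumes f: "f \<in> TT" and g: "g \<in> carrier G"
  shows "f g \<in> Sc (L + 1 - l)"
proof (rule G_mem[OF hs.H_lmap[OF Q.left_module_axioms TT_in[OF f]] Sc_submodule g])
  fix p assume p: "p \<in> \<Lambda>"
  obtain a b where ab: "p = (a, b)" by (cases p)
  have "f (\<iota> (a, b) (g (a, b))) \<in> Sc (b + 1 - l)" using f p pi_closed[OF p g] by (auto simp: TT_def ab)
  moreover have "b + 1 - l \<le> L + 1 - l" using p ab by (auto simp: labels_iff)
  ultimately show "f (\<iota> p (g p)) \<in> Sc (L + 1 - l)" using Sc_mono ab by blast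
qed

lemma Sc_full: "Sc (loewy_length A Qk) = carrier Qk"
  using soc_series_full_iff[OF Q.left_module_axioms] by blast

lemma DT_mm: "DT mm = TT"
proof -
  have "f g \<in> Sc mm" if "f \<in> TT" "g \<in> carrier G" for f g
    using TT_values[OF that] hs.H_closed[OF Q.left_module_axioms TT_in[OF that(1)] that(2)] Sc_full
    by (auto simp: mm_def min_def)
  then show ?thesis by (auto simp: DT_def)
qed

subsection \<open>Maps from \<open>G\<close> to the regular module\<close>

text \<open>Forms on \<open>G\<close> that factor through a single longest truncation P_i/Rad^L,
  which is a copy of P_i. There the bound in the definition of \<open>TT\<close> is weakest, so that
  \<open>\<P>_TT\<close> holds, and yet these forms generate the ring by
  \<open>\<P>_gen\<close>.\<close>

definition \<P> :: "((nat \<times> nat \<Rightarrow> 'v set) \<Rightarrow> 'a) set" where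
  "\<P> = {p. lmap A G (regular_module A) p \<and> (\<exists>i\<in>{1..n}. \<forall>g\<in>carrier G. p g = p (\<iota> (i, L) (g (i, L))))}"

lemma L_pos: "1 \<le> L" using l_bounds by simp

lemma iL: "i \<in> {1..n} \<Longrightarrow> (i, L) \<in> \<Lambda>" using L_pos by (simp add: labels_iff)

lemma \<P>_gen:
  assumes B: "submodule B A (regular_module A)" and p: "\<And>p g. p \<in> \<P> \<Longrightarrow> g \<in> carrier G \<Longrightarrow> p g \<in> B"
  shows "B = carrier A"
proof (rule regular_generated[OF B])
  fix i p' y assume i: "i \<in> {1..n}" and p': "lmap A (P i) (regular_module A) p'" and y: "y \<in> carrier (P i)"
  have "rad_series A (P i) L = {\<zero>\<^bsub>P i\<^esub>}" using rad_series_loewy[OF left_module_P[OF i]] LL[OF i] by simp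
  then have "p' x = \<zero>\<^bsub>regular_module A\<^esub>" if "x \<in> rad_series A (P i) L" for x using that lmap.zero[OF p'] by auto
  from factor_Gs[OF i p' this] obtain f where f: "lmap A (Gs (i, L)) (regular_module A) f" "\<And>x. x \<in> carrier (P i) \<Longrightarrow> f (cls i L x) = p' x" by blast
  let ?p = "\<lambda>g. f (g (i, L))"
  have "lmap A G (regular_module A) ?p" by (rule lmap_comp[OF lmap_pi[OF iL[OF i]] f(1)])
  then have "?p \<in> \<P>" using i iL[OF i] by (auto simp: \<P>_def pi_iota)
  moreover have cy: "cls i L y \<in> carrier (Gs (i, L))" by (rule lmap.closed[OF lmap_cls[OF i] y])
  ultimately have "?p (\<iota> (i, L) (cls i L y)) \<in> B" using iota_closed[OF iL[OF i] cy] by (intro p) auto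
  then show "p' y \<in> B" using iL[OF i] f(2)[OF y] by (simp add: pi_iota)
qed

lemma \<P>_mult:
  assumes p: "p \<in> \<P>" and a: "a \<in> carrier A"
  shows "\<exists>p'\<in>\<P>. \<forall>g\<in>carrier G. p' g = p g \<otimes> a"
proof -
  have pl: "lmap A G (regular_module A) p" using p by (simp add: \<P>_def)
  have "lmap A (regular_module A) (regular_module A) (\<lambda>x. x \<otimes> a)"
    using lmap_orbit[OF reg.left_module_axioms, of a] a by simp
  from lmap_comp[OF pl this] have "lmap A G (regular_module A) (\<lambda>g. p g \<otimes> a)" .
  moreover obtain i where "i \<in> {1..n}" "\<forall>g\<in>carrier G. p g = p (\<iota> (i, L) (g (i, L)))" using p by (auto simp: \<P>_def)
  ultimately have "(\<lambda>g. p g \<otimes> a) \<in> \<P>" by (auto simp: \<P>_def)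
  then show ?thesis by (intro bexI[of _ "\<lambda>g. p g \<otimes> a"]) simp_all
qed

lemma \<P>_lmap: "p \<in> \<P> \<Longrightarrow> lmap A G (regular_module A) p" by (simp add: \<P>_def)

subsection \<open>Vanishing of extensions by \<open>TT\<close>\<close>

text \<open>By \<open>full_faithful\<close> a map from \<open>K p\<close> to \<open>TT\<close> is
  composition with a map \<open>\<phi>\<close> from Rad(P_i/Rad^j) to Q_k. Injectivity of Q_k
  extends \<open>\<phi>\<close> to P_i/Rad^j; what remains is that composition with the extension
  respects the socle bounds of \<open>TT\<close>.\<close>

lemma EI_TT:
  assumes p: "p \<in> \<Lambda>"
  shows "EI M0 p"
  unfolding EI_def
proof (intro allI impI)
  fix f assume f: "lmap R (msub (H (Gs p)) (K p)) M0 f"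
  obtain i j where ij: "p = (i, j)" by (cases p)
  note p' = p[unfolded ij]
  have j1: "1 \<le> j" "j \<le> L" using p' by (auto simp: labels_iff)
  let ?X = "radical A (Gs p)"
  interpret Gp: left_module A "Gs p" by (rule left_module_Gs[OF p])
  interpret Hp: left_module R "H (Gs p)" by (rule left_module_HG[OF p])
  have sX: "submodule ?X A (Gs p)" by (rule rad_submodule_Gs[OF p])
  let ?mX = "msub (Gs p) ?X"
  interpret mX: left_module A ?mX by (rule Gp.left_module_msub[OF sX])
  have HX: "H ?mX = msub (H (Gs p)) (K p)" using hs.msub_H[OF Gp.left_module_axioms sX] by (simp add: K_def)
  interpret HX: left_module R "H ?mX" by (rule hs.left_module_H[OF mX.left_module_axioms])
  have fQ: "lmap R (H ?mX) (H Qk) f" unfolding HX by (rule lmap_of_msub[OF f HQ.left_module_axioms TT_submodule])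
  have fT: "f x \<in> TT" if "x \<in> K p" for x using lmap.closed[OF f, of x] that by simp
  have XK: "carrier (H ?mX) = K p" unfolding HX by simp
  obtain \<phi> where phi: "lmap A ?mX Qk \<phi>" "\<And>x g. x \<in> K p \<Longrightarrow> g \<in> carrier G \<Longrightarrow> f x g = \<phi> (x g)"
  proof (rule hs.full_faithful[of ?mX Qk "carrier (H ?mX)" f \<P>])
    show "lmap R (msub (H ?mX) (carrier (H ?mX))) (H Qk) f" using fQ by simp
    show "(\<lambda>g\<in>carrier G. p' g \<odot>\<^bsub>?mX\<^esub> x) \<in> carrier (H ?mX)" if "p' \<in> \<P>" "x \<in> carrier ?mX" for p' x
      by (rule hs.restrict_H[OF lmap_comp[OF \<P>_lmap[OF that(1)] lmap_orbit[OF mX.left_module_axioms that(2)]]])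
  qed (use XK \<P>_lmap \<P>_mult \<P>_gen mX.left_module_axioms Q.left_module_axioms HX.submodule_carrier in \<open>auto\<close>)
  have phiX: "\<phi> x \<in> carrier Qk" if "x \<in> ?X" for x using lmap.closed[OF phi(1)] that by simp
  \<comment> \<open>The maps of \<open>K_orbit\<close> at label (a, b) take values q'(y) x, so their
    images in \<open>TT\<close> put \<open>\<phi>\<close> of these elements into Soc_(b+1-l); since
    the q'(y) generate the ring, \<phi> x lies there too. The sharpest case is b = j - 1, with bound
    j - l.\<close>
  have kill: "c \<odot>\<^bsub>Qk\<^esub> \<phi> x = \<zero>\<^bsub>Qk\<^esub>" if b: "1 \<le> b" "b \<le> L" "j - 1 \<le> b" and c: "c \<in> Jpow A (b + 1 - l)" and x: "x \<in> ?X" for b c x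
  proof -
    have xc: "x \<in> carrier (Gs p)" by (rule Gp.submoduleD(2)[OF sX x])
    let ?B = "{w \<in> carrier (regular_module A). \<phi> (w \<odot>\<^bsub>?mX\<^esub> x) \<in> Sc (b + 1 - l)}"
    have xm: "x \<in> carrier ?mX" using x by simp
    have "submodule ?B A (regular_module A)"
      by (rule lmap.vimage_submodule[OF lmap_comp[OF lmap_orbit[OF mX.left_module_axioms xm] phi(1)] Sc_submodule])
    moreover have "q' y \<in> ?B" if a: "a \<in> {1..n}" and q': "lmap A (P a) (regular_module A) q'" and y: "y \<in> carrier (P a)" for a q' y
    proof -
      have ab: "(a, b) \<in> \<Lambda>" using a b by (simp add: labels_iff)
      have qc: "q' v \<in> carrier A" if "v \<in> carrier (P a)" for v using lmap.closed[OF q' that] by simp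
      have jb: "j - 1 \<le> b" by (rule b(3))
      obtain h where hK: "h \<in> K p" and h: "\<And>v. v \<in> carrier (P a) \<Longrightarrow> h (\<iota> (a, b) (cls a b v)) = q' v \<odot>\<^bsub>Gs p\<^esub> x"
        using K_orbit[OF p' x[unfolded ij] ab jb q'] unfolding ij by blast
      have cy: "cls a b y \<in> carrier (Gs (a, b))" by (rule lmap.closed[OF lmap_cls[OF a] y])
      have io: "\<iota> (a, b) (cls a b y) \<in> carrier G" by (rule iota_closed[OF ab cy])
      have "f h (\<iota> (a, b) (cls a b y)) = \<phi> (q' y \<odot>\<^bsub>Gs p\<^esub> x)" using phi(2)[OF hK io] h[OF y] by simp
      moreover have "f h (\<iota> (a, b) (cls a b y)) \<in> Sc (b + 1 - l)" using fT[OF hK] ab cy by (auto simp: TT_def)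
      ultimately show ?thesis using qc[OF y] by simp
    qed
    ultimately have "?B = carrier A" by (rule regular_generated)
    then have "\<one> \<in> ?B" by simp
    then have "\<phi> x \<in> Sc (b + 1 - l)" using xc by simp
    then show ?thesis using c by (simp add: Sc_iff)
  qed
  show "\<exists>g. lmap R (H (Gs p)) M0 g \<and> (\<forall>x\<in>K p. g x = f x)"
  proof (cases "j \<le> l")
    case True
    \<comment> \<open>For j \<le> l the exponent at b = j - 1 truncates to zero, so the unit kills
      \<phi> x. The case j = 1 is separate because 0 is not a label; there the radical itself
      vanishes.\<close>
    have "\<phi> x = \<zero>\<^bsub>Qk\<^esub>" if x: "x \<in> ?X" for x
    proof (cases "j = 1")
      case True
      then have "\<one> \<odot>\<^bsub>Gs p\<^esub> x = \<zero>\<^bsub>Gs p\<^esub>" using rad_killed[OF p', of \<one> x] x ij by simp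
      then have "x = \<zero>\<^bsub>Gs p\<^esub>" using Gp.submoduleD(2)[OF sX x] by simp
      then show ?thesis using lmap.zero[OF phi(1)] by simp
    next
      case False
      have "(j - 1) + 1 - l = 0" using \<open>j \<le> l\<close> j1 by simp
      then have "\<one> \<in> Jpow A ((j - 1) + 1 - l)" by (simp only: Jpow_0 one_closed)
      from kill[OF _ _ order_refl this x] have "\<one> \<odot>\<^bsub>Qk\<^esub> \<phi> x = \<zero>\<^bsub>Qk\<^esub>" using False j1 by linarith
      then show ?thesis using phiX[OF x] by simp
    qed
    then have "f x = \<zero>\<^bsub>H Qk\<^esub>" if "x \<in> K p" for x
      using hs.H_zero_iff[OF Q.left_module_axioms TT_in[OF fT[OF that]]] phi(2)[OF that] that by (simp add: K_def)
    then show ?thesis using lmap_const0[OF Hp.left_module_axioms M0.left_module_axioms]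
      by (intro exI[of _ "\<lambda>_. \<zero>\<^bsub>H Qk\<^esub>"]) simp
  next
    case False
    have fg: "fg_module A ?mX" "fg_module A (Gs p)" using finlen_sub[OF finlen_Gs[OF p] sX] fg_finlen fg_Gs[OF p] by blast+
    have "inj_on (\<lambda>x. x) (carrier ?mX)" by simp
    from inj_extend[OF inj_Qk fg lmap_incl[OF Gp.left_module_axioms sX] this phi(1)]
    obtain \<Phi> where Phi: "lmap A (Gs p) Qk \<Phi>" "\<And>x. x \<in> ?X \<Longrightarrow> \<Phi> x = \<phi> x" by (metis Gp.msub_simps(1))
    let ?g = "\<lambda>h. compose (carrier G) \<Phi> h"
    have g: "lmap R (H (Gs p)) (H Qk) ?g" by (rule hs.lmap_post[OF Phi(1)])
    have gK: "?g x = f x" if x: "x \<in> K p" for x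
    proof (rule hs.H_eqI[of _ Qk])
      show "?g x \<in> carrier (H Qk)" using lmap.closed[OF g] x by (simp add: K_def)
      show "f x \<in> carrier (H Qk)" by (rule TT_in[OF fT[OF x]])
      fix y assume "y \<in> carrier G"
      then show "?g x y = f x y" using phi(2)[OF x] Phi(2) x by (simp add: compose_def K_def)
    qed
    have "?g h \<in> TT" if h: "h \<in> carrier (H (Gs p))" for h
      unfolding TT_def
    proof (intro CollectI conjI allI impI ballI)
      show "?g h \<in> carrier (H Qk)" by (rule lmap.closed[OF g h])
      fix a b y assume ab: "(a, b) \<in> \<Lambda>" and y: "y \<in> carrier (Gs (a, b))"
      have io: "\<iota> (a, b) y \<in> carrier G" by (rule iota_closed[OF ab y])
      have he: "lmap A (Gs (a, b)) (Gs p) (\<lambda>y. h (\<iota> (a, b) y))" by (rule lmap_entry[OF Gp.left_module_axioms ab h])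
      let ?z = "h (\<iota> (a, b) y)"
      have z: "?z \<in> carrier (Gs p)" by (rule lmap.closed[OF he y])
      have gz: "?g h (\<iota> (a, b) y) = \<Phi> ?z" using io by (simp add: compose_def)
      show "?g h (\<iota> (a, b) y) \<in> Sc (b + 1 - l)"
      proof (cases "b < j")
        case True
        \<comment> \<open>For b < j the component of h at (a, b) already belongs to
          \<open>K p\<close>, where the composite agrees with \<open>f\<close>, whose values satisfy
          the bound.\<close>
        let ?eh = "e (a, b) \<odot>\<^bsub>H (Gs p)\<^esub> h"
        have "?eh g \<in> ?X" if gG: "g \<in> carrier G" for g
          using rad_map[OF ab p he pi_closed[OF ab gG]] True ij gG by (simp add: e_smult_apply)
        then have eK: "?eh \<in> K p" using h e_in_R[OF ab] by (simp add: K_def)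
        have "f ?eh (\<iota> (a, b) y) \<in> Sc (b + 1 - l)" using fT[OF eK] ab y by (auto simp: TT_def)
        moreover have "f ?eh (\<iota> (a, b) y) = \<phi> ?z" using phi(2)[OF eK io] io ab by (simp add: e_smult_apply pi_iota)
        moreover have "?z \<in> ?X" using rad_map[OF ab p he y] True ij by simp
        ultimately show ?thesis using gz Phi(2) by simp
      next
        case jb: False
        \<comment> \<open>For b \<ge> j, multiplying z by \<open>J\<close> gives an element of the
          radical, which goes to Soc_(j-l) by \<open>kill\<close>. So z itself goes to Soc_(j-l+1),
          which is inside the required term.\<close>
        have "\<forall>c\<in>Jpow A (j - l). \<forall>d\<in>J. c \<odot>\<^bsub>Qk\<^esub> (d \<odot>\<^bsub>Qk\<^esub> \<Phi> ?z) = \<zero>\<^bsub>Qk\<^esub>"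
        proof (intro ballI)
          fix c d assume c: "c \<in> Jpow A (j - l)" and d: "d \<in> J"
          have dz: "d \<odot>\<^bsub>Gs p\<^esub> ?z \<in> ?X" using Jpow_smult[OF Gp.left_module_axioms d, of ?z 0] z by simp
          have "d \<odot>\<^bsub>Qk\<^esub> \<Phi> ?z = \<phi> (d \<odot>\<^bsub>Gs p\<^esub> ?z)" using lmap.smult[OF Phi(1) Jpow_closed[OF d] z] Phi(2)[OF dz] by simp
          moreover have "j - 1 + 1 - l = j - l" using j1 by simp
          ultimately show "c \<odot>\<^bsub>Qk\<^esub> (d \<odot>\<^bsub>Qk\<^esub> \<Phi> ?z) = \<zero>\<^bsub>Qk\<^esub>"
            using kill[of "j - 1" c, OF _ _ _ _ dz] c False l_bounds j1 by simp
        qed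
        then have "\<forall>c\<in>Jpow A (j - l + 1). c \<odot>\<^bsub>Qk\<^esub> \<Phi> ?z = \<zero>\<^bsub>Qk\<^esub>"
          using Jpow_ann_add[OF Q.left_module_axioms lmap.closed[OF Phi(1) z], of "j - l" 1] by simp
        moreover have "j - l + 1 \<le> b + 1 - l" using jb False by simp
        ultimately show ?thesis unfolding gz Sc_iff using Jpow_mono lmap.closed[OF Phi(1) z] by blast
      qed
    qed
    then have "lmap R (H (Gs p)) M0 ?g" by (rule lmap_msub_cod[OF g TT_submodule])
    then show ?thesis using gK by blast
  qed
qed

end

section \<open>The bottom standard module, the layers and the trace series of
  \<open>TT\<close>\<close>

context adr_tilt
begin

lemma left_module_topk: "left_module A (Top k)" by (rule left_module_top[OF k_in])

text \<open>By essentiality every simple submodule of Q_k meets the image of the simple top and is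
  therefore contained in it.\<close>

lemma socle_hull:
  obtains \<sigma> where "lmap A (Top k) Qk \<sigma>" "inj_on \<sigma> (carrier (Top k))" "\<sigma> ` carrier (Top k) = Sc 1"
    "\<And>N. submodule N A Qk \<Longrightarrow> N \<inter> Sc 1 = {\<zero>\<^bsub>Qk\<^esub>} \<Longrightarrow> N = {\<zero>\<^bsub>Qk\<^esub>}"
proof -
  obtain \<sigma> where s: "\<sigma> \<in> mod_hom A (Top k) Qk" "inj_on \<sigma> (carrier (Top k))"
    and ess: "\<And>N. submodule N A Qk \<Longrightarrow> N \<inter> \<sigma> ` carrier (Top k) = {\<zero>\<^bsub>Qk\<^esub>} \<Longrightarrow> N = {\<zero>\<^bsub>Qk\<^esub>}"
    using hull unfolding injective_hull_def by blast
  interpret s: lmap A "Top k" Qk \<sigma> by (rule mod_hom_lmap[OF s(1) left_module_topk Q.left_module_axioms])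
  let ?T = "\<sigma> ` carrier (Top k)"
  have sT: "submodule ?T A Qk" by (rule s.image_submodule[OF s.dom.submodule_carrier])
  have "socle A Qk \<subseteq> ?T"
    unfolding socle_def
  proof (rule Q.mspan_least[OF sT], rule Union_least)
    fix S assume "S \<in> {N. submodule N A Qk \<and> simple_module A (msub Qk N)}"
    then have S: "submodule S A Qk" "simple_module A (msub Qk S)" by auto
    have "submodule (S \<inter> ?T) A (msub Qk S)" by (rule Q.submoduleI_msub[OF S(1) Q.submodule_Int[OF S(1) sT]]) auto
    then have "S \<inter> ?T = {\<zero>\<^bsub>Qk\<^esub>} \<or> S \<inter> ?T = S" using S(2) by (simp add: simple_module_def)
    moreover have "S \<inter> ?T \<noteq> {\<zero>\<^bsub>Qk\<^esub>}" using ess[OF S(1)] S(2) by (auto simp: simple_module_def nonzero_module_def)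
    ultimately show "S \<subseteq> ?T" by blast
  qed
  moreover have "?T \<subseteq> Sc 1"
  proof
    fix y assume "y \<in> ?T"
    then obtain w where w: "w \<in> carrier (Top k)" "y = \<sigma> w" by blast
    obtain v where v: "w = tp k v" "v \<in> carrier (P k)" using w(1)[folded tp_surj[OF k_in]] by (rule imageE)
    note v = v(2) w(2)[unfolded v(1)]
    have "c \<odot>\<^bsub>Qk\<^esub> y = \<zero>\<^bsub>Qk\<^esub>" if c: "c \<in> J" for c
    proof -
      have "c \<odot>\<^bsub>P k\<^esub> v \<in> rad_series A (P k) (0 + Suc 0)" using Jpow_smult[OF left_module_P[OF k_in] c, of v 0] v by simp
      then have r: "c \<odot>\<^bsub>P k\<^esub> v \<in> radical A (P k)" by simp
      have cc: "c \<in> carrier A" by (rule Jpow_closed[OF c])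
      interpret tp: lmap A "P k" "Top k" "tp k" by (rule lmap_tp[OF k_in])
      have "c \<odot>\<^bsub>Top k\<^esub> tp k v = \<zero>\<^bsub>Top k\<^esub>"
        using tp_zero_iff[OF k_in, of "c \<odot>\<^bsub>P k\<^esub> v"] r tp.smult[OF cc v(1)] cc v(1) by simp
      then show ?thesis using s.smult[OF cc tp.closed[OF v(1)]] v(2) by simp
    qed
    moreover have "y \<in> carrier Qk" using \<open>y \<in> ?T\<close> by auto
    ultimately show "y \<in> Sc 1" unfolding Sc_iff by simp
  qed
  moreover have "Sc 1 = socle A Qk" using socle_eq[OF Q.left_module_axioms] unfolding set_eq_iff Sc_iff by simp
  ultimately have T: "?T = Sc 1" by blast
  show thesis by (rule that[OF s.lmap_axioms' s(2) T ess[unfolded T]])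
qed

text \<open>Composition with the embedding of the top as the socle of Q_k carries
  \<open>DD k l\<close> onto \<open>DT 1\<close>. For b < l the bound of \<open>TT\<close> is Soc_0
  = 0, the vanishing condition of \<open>DD\<close>; for b \<ge> l it contains the whole
  socle.\<close>

lemma std_DT1:
  obtains j where "lmap R (std (k, l)) M0 j" "inj_on j (carrier (std (k, l)))" "j ` carrier (std (k, l)) = DT 1"
proof -
  obtain \<sigma> where s: "lmap A (Top k) Qk \<sigma>" "inj_on \<sigma> (carrier (Top k))" "\<sigma> ` carrier (Top k) = Sc 1"
    by (rule socle_hull) blast
  interpret s: lmap A "Top k" Qk \<sigma> by (rule s(1))
  let ?D = "DD k l" and ?S = "compose (carrier G) \<sigma>"
  have lD: "submodule ?D R (H (Top k))" by (rule DD_submodule[OF kl])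
  interpret HT: left_module R "H (Top k)" by (rule left_module_HTop[OF k_in])
  have S: "lmap R (H (Top k)) (H Qk) ?S" by (rule hs.lmap_post[OF s(1)])
  have fG: "f g \<in> carrier (Top k)" if "f \<in> carrier (H (Top k))" "g \<in> carrier G" for f g
    by (rule hs.H_closed[OF left_module_topk that])
  have DH: "f \<in> carrier (H (Top k))" if "f \<in> ?D" for f by (rule HT.submoduleD(2)[OF lD that])
  have inj: "inj_on ?S (carrier (H (Top k)))"
  proof (rule inj_onI)
    fix f f' assume f: "f \<in> carrier (H (Top k))" "f' \<in> carrier (H (Top k))" and e: "?S f = ?S f'"
    show "f = f'"
    proof (rule hs.H_eqI[OF f])
      fix g assume g: "g \<in> carrier G"
      have "\<sigma> (f g) = \<sigma> (f' g)" using fun_cong[OF e, of g] g by (simp add: compose_def)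
      then show "f g = f' g" by (rule inj_onD[OF s(2) _ fG[OF f(1) g] fG[OF f(2) g]])
    qed
  qed
  have im: "?S ` ?D = DT 1"
  proof (intro equalityI subsetI)
    fix F assume "F \<in> ?S ` ?D"
    then obtain f where f: "f \<in> ?D" "F = ?S f" by blast
    note fH = DH[OF f(1)]
    have FH: "F \<in> carrier (H Qk)" unfolding f(2) by (rule lmap.closed[OF S fH])
    have Fg: "F g \<in> Sc 1" if "g \<in> carrier G" for g using fG[OF fH that] s(3) that by (auto simp: f(2) compose_def)
    moreover have "F (\<iota> (a, b) y) \<in> Sc (b + 1 - l)" if ab: "(a, b) \<in> \<Lambda>" and y: "y \<in> carrier (Gs (a, b))" for a b y
    proof (cases "b < l")
      case True
      then have "f (\<iota> (a, b) y) = \<zero>\<^bsub>Top k\<^esub>" using f(1) ab y by (auto simp: DD_def)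
      then show ?thesis using iota_closed[OF ab y] Q.submoduleD(3)[OF Sc_submodule] by (simp add: f(2) compose_def)
    next
      case False
      then have "1 \<le> b + 1 - l" by simp
      then show ?thesis using Fg[OF iota_closed[OF ab y]] Sc_mono by blast
    qed
    ultimately show "F \<in> DT 1" using FH by (auto simp: DT_def TT_def)
  next
    fix F assume F: "F \<in> DT 1"
    have FH: "F \<in> carrier (H Qk)" using F TT_in by (simp add: DT_def)
    let ?i = "inv_into (carrier (Top k)) \<sigma>"
    have sS: "lmap A (Top k) (msub Qk (Sc 1)) \<sigma>" by (rule lmap_msub_cod[OF s(1) Sc_submodule]) (use s(3) in blast)
    have "bij_betw \<sigma> (carrier (Top k)) (carrier (msub Qk (Sc 1)))" using s by (simp add: bij_betw_def)
    note i = lmap_inv[OF sS this]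
    have "F \<in> carrier (H (msub Qk (Sc 1)))"
      unfolding hs.carrier_H_msub[OF Q.left_module_axioms Sc_submodule] using FH F by (simp add: DT_def)
    from lmap.closed[OF hs.lmap_post[OF i] this] have fH: "compose (carrier G) ?i F \<in> carrier (H (Top k))" .
    have "?i \<zero>\<^bsub>Qk\<^esub> = \<zero>\<^bsub>Top k\<^esub>" using lmap.zero[OF i] by simp
    moreover have "F (\<iota> (a, b) y) = \<zero>\<^bsub>Qk\<^esub>" if "(a, b) \<in> \<Lambda>" "b < l" "y \<in> carrier (Gs (a, b))" for a b y
    proof -
      have "F (\<iota> (a, b) y) \<in> Sc (b + 1 - l)" using F that unfolding DT_def TT_def by blast
      moreover have "b + 1 - l = 0" using that(2) by simp
      ultimately have "F (\<iota> (a, b) y) \<in> Sc 0" by (simp only:)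
      then show ?thesis by simp
    qed
    ultimately have "compose (carrier G) ?i F \<in> ?D" using fH iota_closed by (auto simp: DD_def compose_def)
    moreover have "?S (compose (carrier G) ?i F) = F"
    proof (rule hs.H_eqI[of _ Qk])
      show "?S (compose (carrier G) ?i F) \<in> carrier (H Qk)" by (rule lmap.closed[OF S fH])
      fix g assume g: "g \<in> carrier G"
      have "F g \<in> \<sigma> ` carrier (Top k)" unfolding s(3) using F g by (simp add: DT_def)
      then show "?S (compose (carrier G) ?i F) g = F g" using g f_inv_into_f[of "F g" \<sigma>] by (simp add: compose_def)
    qed (rule FH)
    ultimately show "F \<in> ?S ` ?D" by (metis imageI)
  qed
  have lmD: "left_module R (msub (H (Top k)) ?D)" by (rule HT.left_module_msub[OF lD])
  obtain g where g: "lmap R (std (k, l)) (msub (H (Top k)) ?D) g" "bij_betw g (carrier (std (k, l))) ?D"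
    using std_DD[OF kl] mod_iso_iff[OF left_module_std[OF kl] lmD] by auto
  have gs: "g ` carrier (std (k, l)) = ?D" using g(2) by (simp add: bij_betw_def)
  have "lmap R (std (k, l)) (H Qk) (\<lambda>z. ?S (g z))"
    by (rule lmap_comp[OF g(1) lmap_msub_dom[OF S lD]])
  moreover have "?S (g z) \<in> TT" if "z \<in> carrier (std (k, l))" for z
  proof -
    have "?S (g z) \<in> DT 1" unfolding im[symmetric] gs[symmetric] using that by blast
    then show ?thesis by (simp add: DT_def)
  qed
  ultimately have 1: "lmap R (std (k, l)) M0 (\<lambda>z. ?S (g z))" by (rule lmap_msub_cod[OF _ TT_submodule])
  have "inj_on (?S \<circ> g) (carrier (std (k, l)))"
    using g(2) gs inj_on_subset[OF inj HT.submoduleD(1)[OF lD]] by (intro comp_inj_on) (simp_all add: bij_betw_def)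
  then have 2: "inj_on (\<lambda>z. ?S (g z)) (carrier (std (k, l)))" by (simp add: comp_def)
  have 3: "(\<lambda>z. ?S (g z)) ` carrier (std (k, l)) = DT 1" using im gs by (simp add: image_image[symmetric])
  show thesis by (rule that[OF 1 2 3])
qed

lemma mm_le: "mm \<le> L + 1 - l" "mm \<le> loewy_length A Qk" by (simp_all add: mm_def)

text \<open>Composition with the projection of Soc_i to its layer. Maps in \<open>DT i\<close> send
  P_a/Rad^b with b < l + i - 1 into Soc_(i-1), so their components lie in the copies
  \<open>DD\<close> of the standard modules with second label l + i - 1.\<close>

lemma layer_epik:
  assumes i: "1 \<le> i" "i \<le> mm" and x: "x ` \<Omega> \<subseteq> {1..n}" and fin: "finite \<Omega>"
    and ep: "epik A Qk (Sc i) (Sc (i - 1)) (dir_sum \<Omega> (\<lambda>\<omega>. Top (x \<omega>)))"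
  shows "epik R M0 (DT i) (DT (i - 1)) (dir_sum \<Omega> (\<lambda>\<omega>. std (x \<omega>, l + i - 1)))"
proof -
  let ?j = "l + i - 1" and ?QS = "msub Qk (Sc i)"
  have xi: "x \<omega> \<in> {1..n}" if "\<omega> \<in> \<Omega>" for \<omega> using x that by blast
  have "?j \<in> {1..L}" using i mm_le l_bounds by auto
  then have lab: "(x \<omega>, ?j) \<in> \<Lambda>" if "\<omega> \<in> \<Omega>" for \<omega> using xi[OF that] by (simp only: labels_iff)
  interpret S: module_family A \<Omega> "\<lambda>\<omega>. Top (x \<omega>)"
    by (rule module_family.intro[OF ring_axioms left_module_top[OF xi]])
  let ?N = "\<lambda>\<omega>. msub (H (Top (x \<omega>))) (DD (x \<omega>) ?j)"
  note lH = left_module_HTop[OF xi]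
  note lD = DD_submodule[OF lab]
  have lN: "left_module R (?N \<omega>)" if "\<omega> \<in> \<Omega>" for \<omega> by (rule left_module.left_module_msub[OF lH[OF that] lD[OF that]])
  have N0: "\<zero>\<^bsub>?N \<omega>\<^esub> = \<zero>\<^bsub>H (Top (x \<omega>))\<^esub>" "carrier (?N \<omega>) = DD (x \<omega>) ?j"
    "smult (?N \<omega>) = smult (H (Top (x \<omega>)))" for \<omega> by (simp_all add: msub_def)
  interpret N: module_family R \<Omega> ?N by (rule module_family.intro[OF R.ring_axioms lN])
  obtain \<psi> where psi: "lmap A ?QS S.S \<psi>" "\<psi> ` Sc i = carrier S.S" "{u \<in> Sc i. \<psi> u = \<zero>\<^bsub>S.S\<^esub>} = Sc (i - 1)"
    using ep by (auto simp: epik_def)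
  have psi_closed: "\<psi> u \<in> carrier S.S" if "u \<in> Sc i" for u using lmap.closed[OF psi(1)] that by simp
  have psi0: "\<psi> u = \<zero>\<^bsub>S.S\<^esub> \<longleftrightarrow> u \<in> Sc (i - 1)" if "u \<in> Sc i" for u using psi(3) that by blast
  let ?c = "\<lambda>\<omega>. compose (carrier G) (\<lambda>u. \<psi> u \<omega>)"
  have lQS: "left_module A ?QS" by (rule Q.left_module_msub[OF Sc_submodule])
  have DTS: "f g \<in> Sc i" if "f \<in> DT i" "g \<in> carrier G" for f g using that by (simp add: DT_def)
  have DTH: "f \<in> carrier (H Qk)" if "f \<in> DT i" for f using that TT_in by (simp add: DT_def)
  have c: "lmap R (msub (H Qk) (DT i)) (?N \<omega>) (?c \<omega>)" if w: "\<omega> \<in> \<Omega>" for \<omega>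
  proof (rule lmap_msub_cod[OF _ lD[OF w]])
    have 1: "lmap R (H ?QS) (H (Top (x \<omega>))) (?c \<omega>)"
      by (rule hs.lmap_post[OF lmap_comp[OF psi(1) S.lmap_component[OF w]]])
    have sub: "submodule (DT i) R (H ?QS)"
      unfolding hs.msub_H[OF Q.left_module_axioms Sc_submodule]
      by (rule HQ.submoduleI_msub[OF hs.sub_H[OF Q.left_module_axioms Sc_submodule] DT_submodule]) (use DTS DTH in auto)
    have "msub (H ?QS) (DT i) = msub (H Qk) (DT i)"
      unfolding hs.msub_H[OF Q.left_module_axioms Sc_submodule] by simp
    then show "lmap R (msub (H Qk) (DT i)) (H (Top (x \<omega>))) (?c \<omega>)" using lmap_msub_dom[OF 1 sub] by simp
    fix f assume "f \<in> carrier (msub (H Qk) (DT i))"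
    then have f: "f \<in> DT i" by simp
    have cf: "?c \<omega> f \<in> carrier (H (Top (x \<omega>)))" by (rule lmap.closed[OF lmap_msub_dom[OF 1 sub]]) (use f in \<open>simp add: msub_def\<close>)
    have "?c \<omega> f (\<iota> (a, b) y) = \<zero>\<^bsub>Top (x \<omega>)\<^esub>" if ab: "(a, b) \<in> \<Lambda>" "b < ?j" and y: "y \<in> carrier (Gs (a, b))" for a b y
    proof -
      have "f (\<iota> (a, b) y) \<in> Sc (b + 1 - l)" using f ab y by (auto simp: DT_def TT_def)
      moreover have "b + 1 - l \<le> i - 1" using ab(2) by simp
      ultimately have "f (\<iota> (a, b) y) \<in> Sc (i - 1)" using Sc_mono by blast
      then have "\<psi> (f (\<iota> (a, b) y)) = \<zero>\<^bsub>S.S\<^esub>" using psi0 DTS[OF f iota_closed[OF ab(1) y]] by blast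
      then show ?thesis using iota_closed[OF ab(1) y] w by (simp add: compose_def dir_sum_simps(2))
    qed
    then show "?c \<omega> f \<in> DD (x \<omega>) ?j" using cf unfolding DD_def by blast
  qed
  have cH: "?c \<omega> f \<in> carrier (H (Top (x \<omega>)))" if w: "\<omega> \<in> \<Omega>" and f: "f \<in> DT i" for \<omega> f
  proof -
    have "f \<in> carrier (msub (H Qk) (DT i))" using f by simp
    from lmap.closed[OF c[OF w] this] show ?thesis unfolding N0(2) by (rule left_module.submoduleD(2)[OF lH[OF w] lD[OF w]])
  qed
  let ?\<Psi> = "\<lambda>f. \<lambda>\<omega>\<in>\<Omega>. ?c \<omega> f"
  have lDT: "left_module R (msub (H Qk) (DT i))" by (rule HQ.left_module_msub[OF DT_submodule])
  have Psi: "lmap R (msub (H Qk) (DT i)) N.S ?\<Psi>" by (rule N.lmap_tuple[OF lDT c])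
  have eval: "?\<Psi> f \<omega> g = \<psi> (f g) \<omega>" if "\<omega> \<in> \<Omega>" "g \<in> carrier G" for f \<omega> g using that by (simp add: compose_def)
  have ker: "{f \<in> DT i. ?\<Psi> f = \<zero>\<^bsub>N.S\<^esub>} = DT (i - 1)"
  proof (intro equalityI subsetI)
    fix f assume "f \<in> {f \<in> DT i. ?\<Psi> f = \<zero>\<^bsub>N.S\<^esub>}"
    then have f: "f \<in> DT i" and z: "?\<Psi> f = \<zero>\<^bsub>N.S\<^esub>" by auto
    have "f g \<in> Sc (i - 1)" if g: "g \<in> carrier G" for g
    proof -
      have "\<psi> (f g) = \<zero>\<^bsub>S.S\<^esub>"
      proof (rule extensionalityI[of _ \<Omega>])
        show "\<psi> (f g) \<in> extensional \<Omega>" using psi_closed[OF DTS[OF f g]] by (simp add: dir_sum_simps(1) PiE_def)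
        show "\<zero>\<^bsub>S.S\<^esub> \<in> extensional \<Omega>" by (simp add: dir_sum_simps)
        fix \<omega> assume w: "\<omega> \<in> \<Omega>"
        show "\<psi> (f g) \<omega> = \<zero>\<^bsub>S.S\<^esub> \<omega>" using eval[OF w g, of f] unfolding z dir_sum_simps(2) restrict_apply'[OF w] N0(1) hs.H_zero_apply[OF g] by simp
      qed
      then show ?thesis using psi0[OF DTS[OF f g]] by simp
    qed
    then show "f \<in> DT (i - 1)" using f by (simp add: DT_def)
  next
    fix f assume f: "f \<in> DT (i - 1)"
    have fi: "f \<in> DT i" using f DT_mono[of "i - 1" i] by auto
    have "?\<Psi> f \<omega> = \<zero>\<^bsub>?N \<omega>\<^esub>" if w: "\<omega> \<in> \<Omega>" for \<omega>
    proof -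
      have z: "?\<Psi> f \<omega> g = \<zero>\<^bsub>Top (x \<omega>)\<^esub>" if g: "g \<in> carrier G" for g
      proof -
        have "\<psi> (f g) = \<zero>\<^bsub>S.S\<^esub>" using psi0[OF DTS[OF fi g]] f g by (simp add: DT_def)
        then show ?thesis using eval[OF w g, of f] w by (simp add: dir_sum_simps(2))
      qed
      have "?\<Psi> f \<omega> \<in> carrier (H (Top (x \<omega>)))"
        using cH[OF w fi] w by simp
      then show ?thesis using hs.H_zero_iff[OF left_module_top[OF xi[OF w]]] z unfolding N0(1) by blast
    qed
    then have "?\<Psi> f = \<zero>\<^bsub>N.S\<^esub>" unfolding dir_sum_simps(2) by (intro restrict_ext) simp
    then show "f \<in> {f \<in> DT i. ?\<Psi> f = \<zero>\<^bsub>N.S\<^esub>}" using fi by simp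
  qed
  have surj: "?\<Psi> ` DT i = carrier N.S"
  proof
    show "?\<Psi> ` DT i \<subseteq> carrier N.S" using lmap.closed[OF Psi] by auto
    show "carrier N.S \<subseteq> ?\<Psi> ` DT i"
    proof
      fix y assume y: "y \<in> carrier N.S"
      have sW: "submodule (?\<Psi> ` DT i) R N.S"
        using lmap.image_submodule[OF Psi left_module.submodule_carrier[OF lDT]] by simp
      show "y \<in> ?\<Psi> ` DT i"
      proof (rule e_decomp[OF N.left_module_dir_sum sW y])
        fix p assume p0: "p \<in> \<Lambda>"
        obtain a b where pe: "p = (a, b)" by (cases p)
        have p: "(a, b) \<in> \<Lambda>" and a: "a \<in> {1..n}" and b: "b \<le> L" using p0 pe by (auto simp: labels_iff)
        let ?y = "e p \<odot>\<^bsub>N.S\<^esub> y"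
        have yc: "?y \<in> carrier N.S" by (rule N.S.smult_closed[OF e_in_R[OF p0] y])
        have yw: "y \<omega> \<in> DD (x \<omega>) ?j" if "\<omega> \<in> \<Omega>" for \<omega> using N.component_closed[OF y that] unfolding N0(2) .
        have yH: "y \<omega> \<in> carrier (H (Top (x \<omega>)))" if "\<omega> \<in> \<Omega>" for \<omega>
          using left_module.submoduleD(2)[OF lH[OF that] lD[OF that] yw[OF that]] .
        have ey: "?y \<omega> g = y \<omega> (\<iota> p (g p))" if "\<omega> \<in> \<Omega>" "g \<in> carrier G" for \<omega> g
          unfolding dir_sum_simps(4) restrict_apply'[OF that(1)] N0(3) by (rule e_smult_apply[OF that(2)])
        show "?y \<in> ?\<Psi> ` DT i"
        \<comment> \<open>Surjectivity is tested on one component (a, b) at a time. Below the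
          threshold the component vanishes by the definition of \<open>DD\<close>.\<close>
        proof (cases "b < ?j")
          case True
          have "?y \<omega> = \<zero>\<^bsub>?N \<omega>\<^esub>" if w: "\<omega> \<in> \<Omega>" for \<omega>
          proof -
            have "?y \<omega> g = \<zero>\<^bsub>Top (x \<omega>)\<^esub>" if g: "g \<in> carrier G" for g
              unfolding ey[OF w g] using yw[OF w] p True pi_closed[OF p0 g] by (auto simp: DD_def pe)
            moreover have "?y \<omega> \<in> carrier (H (Top (x \<omega>)))"
              using N.component_closed[OF yc w] left_module.submoduleD(2)[OF lH[OF w] lD[OF w]] unfolding N0(2) by blast
            ultimately show ?thesis using hs.H_zero_iff[OF left_module_top[OF xi[OF w]]] unfolding N0(1) by blast
          qed
          then have "?y = \<zero>\<^bsub>N.S\<^esub>" using yc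
            by (intro extensionalityI[of _ \<Omega>]) (simp_all add: dir_sum_simps(1,2) PiE_def)
          then show ?thesis using left_module.submoduleD(3)[OF N.left_module_dir_sum sW] by simp
        next
          case False
          let ?u = "\<lambda>v. \<lambda>\<omega>\<in>\<Omega>. y \<omega> (\<iota> p v)"
          have u: "lmap A (Gs (a, b)) S.S ?u"
            using S.lmap_tuple[OF left_module_Gs[OF p0] lmap_entry[OF left_module_top[OF xi] p0 yH]] pe by simp
          have fg: "fg_module A ?QS" "fg_module A S.S"
            using finlen_sub[OF finlen_Qk Sc_submodule] finlen_surj[OF psi(1)] psi(2) by (simp_all add: fg_iff_finlen)
          obtain h where h: "lmap A (P a) ?QS h" "\<And>v. v \<in> carrier (P a) \<Longrightarrow> \<psi> (h v) = ?u (cls a b v)"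
            by (rule lift_Gs[OF a u psi(1) _ fg]) (use psi(2) in auto)
          \<comment> \<open>Both consequences of b \<ge> l + i - 1 are needed: i \<le> b makes the
            lift P_a -> Soc_i kill Rad^b P_a, and i \<le> b + 1 - l places the resulting map in
            \<open>TT\<close>.\<close>
          have ib: "i \<le> b + 1 - l" "i \<le> b" using False i l_bounds by auto
          have "rad_series A ?QS b = {\<zero>\<^bsub>?QS\<^esub>}"
            unfolding rad_series_zero_iff[OF lQS] using Sc_mono[OF ib(2)] by (auto simp: Sc_iff)
          then have "h v = \<zero>\<^bsub>?QS\<^esub>" if "v \<in> rad_series A (P a) b" for v using rad_series_lmap[OF h(1) that] by simp
          from factor_Gs[OF a h(1) this] obtain w where w: "lmap A (Gs (a, b)) ?QS w" "\<And>v. v \<in> carrier (P a) \<Longrightarrow> w (cls a b v) = h v"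
            by blast
          have pw: "\<psi> (w z) = ?u z" if z: "z \<in> carrier (Gs (a, b))" for z
          proof -
            obtain v where "v \<in> carrier (P a)" "z = cls a b v" using z cls_surj[OF a, of b] by blast
            then show ?thesis using w(2) h(2) by simp
          qed
          let ?F = "ent p w"
          have "?F \<in> carrier (H ?QS)" by (rule ent_in[OF p0]) (use w(1) pe in simp)
          then have F: "?F \<in> carrier (H Qk)" "\<And>g. g \<in> carrier G \<Longrightarrow> ?F g \<in> Sc i"
            unfolding hs.carrier_H_msub[OF Q.left_module_axioms Sc_submodule] by auto
          have "?F (\<iota> (c, d) z) \<in> Sc (d + 1 - l)" if cd: "(c, d) \<in> \<Lambda>" and z: "z \<in> carrier (Gs (c, d))" for c d z
          proof (cases "(c, d) = p")
            case True
            then have "i \<le> d + 1 - l" using ib pe by simp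
            then show ?thesis using F(2)[OF iota_closed[OF cd z]] Sc_mono by blast
          next
            case False
            then have "\<iota> (c, d) z p = \<zero>\<^bsub>Gs p\<^esub>" using pi_iota[OF p0, of "(c, d)" z] by auto
            then have "?F (\<iota> (c, d) z) = \<zero>\<^bsub>Qk\<^esub>" using lmap.zero[OF w(1)] pe by (simp add: ent_apply[OF iota_closed[OF cd z]])
            then show ?thesis using Q.submoduleD(3)[OF Sc_submodule] by simp
          qed
          then have FD: "?F \<in> DT i" using F by (auto simp: DT_def TT_def)
          have "?\<Psi> ?F = ?y"
          proof (rule extensionalityI[of _ \<Omega>])
            show "?y \<in> extensional \<Omega>" using yc by (simp add: dir_sum_simps(1) PiE_def)
            fix \<omega> assume om: "\<omega> \<in> \<Omega>"
            show "?\<Psi> ?F \<omega> = ?y \<omega>"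
            proof (rule hs.H_eqI[of _ "Top (x \<omega>)"])
              note sD = left_module.submoduleD(2)[OF lH[OF om] lD[OF om]]
              show "?\<Psi> ?F \<omega> \<in> carrier (H (Top (x \<omega>)))"
                using cH[OF om FD] om by simp
              show "?y \<omega> \<in> carrier (H (Top (x \<omega>)))"
                using N.component_closed[OF yc om] sD unfolding N0(2) by blast
              fix g assume g: "g \<in> carrier G"
              show "?\<Psi> ?F \<omega> g = ?y \<omega> g" unfolding eval[OF om g] ey[OF om g] ent_apply[OF g]
                using pw pi_closed[OF p0 g] pe om by simp
            qed
          qed simp
          then show ?thesis by (rule image_eqI[OF sym FD])
        qed
      qed
    qed
  qed
  have 1: "epik R M0 (DT i) (DT (i - 1)) N.S"
    by (rule M0.epikI[of _ _ ?\<Psi>]) (use Psi surj ker DT_M0 in simp_all)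
  have 2: "mod_iso R N.S (dir_sum \<Omega> (\<lambda>\<omega>. std (x \<omega>, ?j)))"
    by (rule dir_sum_iso[OF R.ring_axioms lN left_module_std[OF lab] mod_iso_sym[OF left_module_std[OF lab] lN std_DD[OF lab]]])
  have 3: "left_module R (dir_sum \<Omega> (\<lambda>\<omega>. std (x \<omega>, ?j)))"
    by (rule module_family.left_module_dir_sum[OF module_family.intro[OF R.ring_axioms left_module_std[OF lab]]])
  show ?thesis by (rule epik_mod_iso[OF 1 3 2])
qed

text \<open>The image of the generator \<open>pr p\<close> is the class of some \<open>t\<close> in
  \<open>TT\<close>. Since \<open>K p\<close> goes to zero, \<open>t\<close> sends the radical of
  \<open>Gs p\<close> into Soc_i, hence all of \<open>Gs p\<close> into Soc_(i+1).\<close>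

lemma delta_upper:
  assumes p: "p \<in> \<Lambda>" and f: "lmap R (std p) (quot_module M0 (DT i)) f" and z: "z \<in> carrier (std p)"
  shows "f z \<in> (\<lambda>s. DT i +>\<^bsub>M0\<^esub> s) ` DT (Suc i)"
proof -
  interpret HG: left_module R "H (Gs p)" by (rule left_module_HG[OF p])
  interpret Gp: left_module A "Gs p" by (rule left_module_Gs[OF p])
  note Ks = K_submodule[OF p]
  let ?Q = "quot_module M0 (DT i)" and ?q = "\<lambda>s. DT i +>\<^bsub>M0\<^esub> s"
  interpret q: lmap R M0 ?Q ?q by (rule M0.lmap_quot[OF DT_M0])
  have F: "lmap R (H (Gs p)) ?Q (\<lambda>h. f (K p +>\<^bsub>H (Gs p)\<^esub> h))"
    by (rule lmap_comp[OF HG.lmap_quot[OF Ks] f])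
  let ?F = "\<lambda>h. f (K p +>\<^bsub>H (Gs p)\<^esub> h)"
  have "?F (pr p) \<in> carrier ?Q" by (rule lmap.closed[OF F pr_in[OF p]])
  then obtain t where t: "t \<in> TT" "?F (pr p) = ?q t" using M0.quot_simps(1)[OF DT_M0] by auto
  have Fh: "?F h = ?q (jj p h \<odot>\<^bsub>H Qk\<^esub> t)" if h: "h \<in> carrier (H (Gs p))" for h
    using yoneda_pr[OF p F h] t q.smult[OF jj_in[OF p h], of t] by simp
  have jt: "jj p h \<odot>\<^bsub>H Qk\<^esub> t \<in> TT" if h: "h \<in> carrier (H (Gs p))" for h
    by (rule HQ.submoduleD(5)[OF TT_submodule jj_in[OF p h] t(1)])
  have jg: "(jj p h \<odot>\<^bsub>H Qk\<^esub> t) g = t (\<iota> p (h g))" if "g \<in> carrier G" for h g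
    using that by (simp add: hs.H_smult_apply jj_def)
  have KD: "t (\<iota> p (h g)) \<in> Sc i" if h: "h \<in> K p" and g: "g \<in> carrier G" for h g
  proof -
    have hH: "h \<in> carrier (H (Gs p))" by (rule HG.submoduleD(2)[OF Ks h])
    have "?F h = \<zero>\<^bsub>?Q\<^esub>" using HG.coset_eq_zero_iff[OF Ks hH] h lmap.zero[OF f] HG.quot_simps(2)[OF Ks] by simp
    then have "?q (jj p h \<odot>\<^bsub>H Qk\<^esub> t) = DT i" using Fh[OF hH] M0.quot_simps(2)[OF DT_M0] by simp
    then have "jj p h \<odot>\<^bsub>H Qk\<^esub> t \<in> DT i" using M0.coset_eq_zero_iff[OF DT_M0] jt[OF hH] by simp
    then show ?thesis using jg[OF g, of h] g by (auto simp: DT_def)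
  qed
  have tl: "lmap A (Gs p) Qk (\<lambda>y. t (\<iota> p y))" by (rule lmap_entry[OF Q.left_module_axioms p TT_in[OF t(1)]])
  \<comment> \<open>The maps a(g) y with a in \<open>\<P>\<close> belong to \<open>K p\<close>,
    which gives the claim for the multiples a(g) y; as the values a(g) generate the ring, it holds
    for y.\<close>
  have rad: "t (\<iota> p y) \<in> Sc i" if y: "y \<in> radical A (Gs p)" for y
  proof -
    note sr = rad_submodule_Gs[OF p]
    have yc: "y \<in> carrier (Gs p)" by (rule Gp.submoduleD(2)[OF sr y])
    let ?B = "{a \<in> carrier (regular_module A). t (\<iota> p (a \<odot>\<^bsub>Gs p\<^esub> y)) \<in> Sc i}"
    have "?B = carrier A"
    proof (rule \<P>_gen)
      show "submodule ?B A (regular_module A)"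
        by (rule lmap.vimage_submodule[OF lmap_comp[OF lmap_orbit[OF Gp.left_module_axioms yc] tl] Sc_submodule])
      fix a g assume a: "a \<in> \<P>" and g: "g \<in> carrier G"
      note al = \<P>_lmap[OF a]
      have ac: "a g \<in> carrier A" if "g \<in> carrier G" for g using lmap.closed[OF al that] by simp
      have "(\<lambda>g\<in>carrier G. a g \<odot>\<^bsub>Gs p\<^esub> y) \<in> K p"
        using hs.restrict_H[OF lmap_comp[OF al lmap_orbit[OF Gp.left_module_axioms yc]]] Gp.submoduleD(5)[OF sr ac y]
        by (simp add: K_def)
      from KD[OF this g] show "a g \<in> ?B" using g ac[OF g] by simp
    qed
    then have "\<one> \<in> ?B" by simp
    then show ?thesis using yc by simp
  qed
  \<comment> \<open>\<open>J\<close> carries \<open>Gs p\<close> into its radical, and an element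
    that \<open>J\<close> sends into Soc_i lies in the next socle term.\<close>
  have all: "t (\<iota> p y) \<in> Sc (Suc i)" if y: "y \<in> carrier (Gs p)" for y
  proof -
    have tc: "t (\<iota> p y) \<in> carrier Qk" by (rule lmap.closed[OF tl y])
    have "\<forall>c\<in>Jpow A i. \<forall>d\<in>J. c \<odot>\<^bsub>Qk\<^esub> (d \<odot>\<^bsub>Qk\<^esub> t (\<iota> p y)) = \<zero>\<^bsub>Qk\<^esub>"
    proof (intro ballI)
      fix c d assume c: "c \<in> Jpow A i" and d: "d \<in> J"
      have "d \<odot>\<^bsub>Gs p\<^esub> y \<in> radical A (Gs p)" using Jpow_smult[OF Gp.left_module_axioms d, of y 0] y by simp
      from rad[OF this] have "d \<odot>\<^bsub>Qk\<^esub> t (\<iota> p y) \<in> Sc i" unfolding lmap.smult[OF tl Jpow_closed[OF d] y] .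
      then show "c \<odot>\<^bsub>Qk\<^esub> (d \<odot>\<^bsub>Qk\<^esub> t (\<iota> p y)) = \<zero>\<^bsub>Qk\<^esub>" using c by (simp add: Sc_iff)
    qed
    then show ?thesis using Jpow_ann_add[OF Q.left_module_axioms tc, of i "Suc 0"] tc unfolding Sc_iff by simp
  qed
  obtain h where h: "h \<in> carrier (H (Gs p))" "z = K p +>\<^bsub>H (Gs p)\<^esub> h" using z HG.quot_simps(1)[OF Ks] by auto
  have "jj p h \<odot>\<^bsub>H Qk\<^esub> t \<in> DT (Suc i)"
    using jt[OF h(1)] jg all hs.H_closed[OF Gp.left_module_axioms h(1)] by (simp add: DT_def)
  then show ?thesis using Fh[OF h(1)] h(2) by blast
qed

text \<open>Modulo \<open>DT i\<close>, the trace is bounded above by \<open>delta_upper\<close>,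
  and it contains the next layer because that layer is a direct sum of standard modules.\<close>

lemma delta_M0:
  assumes ep: "\<And>i. 1 \<le> i \<Longrightarrow> i \<le> mm \<Longrightarrow> \<exists>\<Omega> lab. finite (\<Omega> :: 'w set) \<and> lab ` \<Omega> \<subseteq> \<Lambda> \<and> 
      epik R M0 (DT i) (DT (i - 1)) (dir_sum \<Omega> (\<lambda>\<omega>. std (lab \<omega>)))"
    and i: "i \<le> mm"
  shows "delta_series R std \<Lambda> M0 i = DT i"
  using i
proof (induction i)
  case 0
  then show ?case by (simp add: DT_0)
next
  case (Suc i)
  then have IH: "delta_series R std \<Lambda> M0 i = DT i" by simp
  obtain \<Omega> :: "'w set" and lab where e: "finite \<Omega>" "lab ` \<Omega> \<subseteq> \<Lambda>" 
    "epik R M0 (DT (Suc i)) (DT (Suc i - 1)) (dir_sum \<Omega> (\<lambda>\<omega>. std (lab \<omega>)))"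
    using ep[of "Suc i"] Suc.prems by auto
  have e3: "epik R M0 (DT (Suc i)) (DT i) (dir_sum \<Omega> (\<lambda>\<omega>. std (lab \<omega>)))" using e(3) by simp
  let ?Q = "quot_module M0 (DT i)" and ?q = "\<lambda>s. DT i +>\<^bsub>M0\<^esub> s"
  interpret q: lmap R M0 ?Q ?q by (rule M0.lmap_quot[OF DT_M0])
  have tr: "trace_of R std \<Lambda> ?Q \<subseteq> ?q ` DT (Suc i)"
    by (rule trace_least[OF q.cod.left_module_axioms q.image_submodule[OF DT_M0]], rule left_module_std, assumption, rule delta_upper)
  have sub: "DT i \<subseteq> DT (Suc i)" by (rule DT_mono) simp
  show ?case unfolding delta_series.simps IH
  proof (intro equalityI subsetI)
    fix x assume "x \<in> {x \<in> carrier M0. ?q x \<in> trace_of R std \<Lambda> ?Q}"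
    then have x: "x \<in> carrier M0" "?q x \<in> ?q ` DT (Suc i)" using tr by auto
    then obtain y where y: "y \<in> DT (Suc i)" "?q x = ?q y" by blast
    have yc: "y \<in> carrier M0" by (rule M0.submoduleD(2)[OF DT_M0 y(1)])
    have d: "x \<ominus>\<^bsub>M0\<^esub> y \<in> DT i" using y(2) M0.coset_eq_iff[OF DT_M0 x(1) yc] by simp
    then have "(x \<ominus>\<^bsub>M0\<^esub> y) \<oplus>\<^bsub>M0\<^esub> y \<in> DT (Suc i)" using sub by (intro M0.submoduleD(4)[OF DT_M0 _ y(1)]) blast
    moreover have "(x \<ominus>\<^bsub>M0\<^esub> y) \<oplus>\<^bsub>M0\<^esub> y = x" using x(1) yc by (simp only: M0.M.minus_eq M0.M.a_assoc M0.M.l_neg M0.M.r_zero M0.M.a_inv_closed)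
    ultimately show "x \<in> DT (Suc i)" by simp
  next
    fix x assume x: "x \<in> DT (Suc i)"
    have "?q x \<in> trace_of R std \<Lambda> ?Q"
    proof (rule epik_trace[OF M0.left_module_axioms e3 e(1) _ left_module_std x])
      fix \<omega> assume "\<omega> \<in> \<Omega>"
      then show "\<exists>j\<in>\<Lambda>. std (lab \<omega>) = std j" using e(2) by blast
    qed
    then show "x \<in> {x \<in> carrier M0. ?q x \<in> trace_of R std \<Lambda> ?Q}" using M0.submoduleD(2)[OF DT_M0 x] by simp
  qed
qed

end

lemma trace_cong: "(\<And>j. j \<in> J \<Longrightarrow> D j = D' j) \<Longrightarrow> trace_of R D J M = trace_of R D' J M"
  unfolding trace_of_def by simp

lemma delta_cong:
  assumes "\<And>j. j \<in> J \<Longrightarrow> D j = D' j"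
  shows "delta_series R D J M i = delta_series R D' J M i"
  by (induction i) (simp_all add: trace_cong[of J D D', OF assms])

lemma filtered_by_cong:
  assumes "filtered_by R X J M" "\<And>j. j \<in> J \<Longrightarrow> X j = Y j"
  shows "filtered_by R Y J M"
  using assms unfolding filtered_by_def by metis

section \<open>Identification of the tilting module with \<open>TT\<close>\<close>

context adr_tilt
begin

text \<open>Such a map vanishes on all summands except one (i, L), where the bound is Soc_(L+1-l),
  the term that contains \<open>x\<close>.\<close>

lemma \<P>_TT:
  assumes p: "p \<in> \<P>" and x: "x \<in> Sc (L + 1 - l)"
  shows "(\<lambda>g\<in>carrier G. p g \<odot>\<^bsub>Qk\<^esub> x) \<in> TT"
proof -
  have xc: "x \<in> carrier Qk" using x by (simp only: Sc_iff)
  have pl: "lmap A G (regular_module A) p" by (rule \<P>_lmap[OF p])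
  have pc: "p g \<in> carrier A" if "g \<in> carrier G" for g using lmap.closed[OF pl that] by simp
  obtain i where i: "i \<in> {1..n}" "\<And>g. g \<in> carrier G \<Longrightarrow> p g = p (\<iota> (i, L) (g (i, L)))" using p unfolding \<P>_def by blast
  note iL = iL[OF i(1)]
  have "p (\<iota> (a, b) y) \<odot>\<^bsub>Qk\<^esub> x \<in> Sc (b + 1 - l)" if ab: "(a, b) \<in> \<Lambda>" and y: "y \<in> carrier (Gs (a, b))" for a b y
  proof (cases "(a, b) = (i, L)")
    case True
    then show ?thesis using Q.submoduleD(5)[OF Sc_submodule pc[OF iota_closed[OF ab y]] x] by blast
  next
    case False
    then have "\<iota> (a, b) y (i, L) = \<zero>\<^bsub>Gs (i, L)\<^esub>" using pi_iota[OF iL, of "(a, b)" y] by auto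
    then have "p (\<iota> (a, b) y) = \<zero>" using i(2)[OF iota_closed[OF ab y]] iota_zero[OF iL] lmap.zero[OF pl] by simp
    then show ?thesis using xc Q.submoduleD(3)[OF Sc_submodule] by simp
  qed
  then show ?thesis
    using hs.restrict_H[OF lmap_comp[OF pl lmap_orbit[OF Q.left_module_axioms xc]]] iota_closed by (simp add: TT_def)
qed

text \<open>By \<open>full_faithful\<close> the endomorphism is composition with a map
  \<open>\<phi>\<close> from Soc_(L+1-l) to Q_k, which is extended to an endomorphism
  \<open>\<Phi>\<close> of Q_k. \<open>\<Phi>\<close> turns out to be an automorphism, and
  composition with its inverse preserves \<open>TT\<close>.\<close>

lemma endo_bij:
  assumes u: "lmap R M0 M0 u" and id: "\<And>f. f \<in> DT 1 \<Longrightarrow> u f = f"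
  shows "bij_betw u TT TT"
proof -
  let ?N = "Sc (L + 1 - l)" and ?X = "msub Qk (Sc (L + 1 - l))"
  interpret u: lmap R M0 M0 u by (rule u)
  have lX: "left_module A ?X" by (rule Q.left_module_msub[OF Sc_submodule])
  have TX: "submodule TT R (H ?X)" and TX': "msub (H ?X) TT = M0"
    unfolding hs.msub_H[OF Q.left_module_axioms Sc_submodule]
     by (rule HQ.submoduleI_msub[OF hs.sub_H[OF Q.left_module_axioms Sc_submodule] TT_submodule], use TT_in TT_values in auto)
  have uQ: "lmap R (msub (H ?X) TT) (H Qk) u" unfolding TX' by (rule lmap_of_msub[OF u HQ.left_module_axioms TT_submodule])
  obtain \<phi> where phi: "lmap A ?X Qk \<phi>" "\<And>f g. f \<in> TT \<Longrightarrow> g \<in> carrier G \<Longrightarrow> u f g = \<phi> (f g)"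
  proof (rule hs.full_faithful[of ?X Qk TT u \<P>])
    fix p x assume p: "p \<in> \<P>" and "x \<in> carrier ?X"
    then have "x \<in> ?N" by simp
    from \<P>_TT[OF p this] show "(\<lambda>g\<in>carrier G. p g \<odot>\<^bsub>?X\<^esub> x) \<in> TT" by simp
  qed (use lX TX uQ \<P>_lmap \<P>_mult \<P>_gen Q.left_module_axioms in \<open>auto\<close>)
  have "1 \<le> L + 1 - l" using l_bounds by simp
  then have S1: "Sc 1 \<subseteq> ?N" by (rule Sc_mono)
  \<comment> \<open>For y in the socle the test maps p(g) y belong to \<open>DT 1\<close> and are
    fixed by \<open>u\<close>. Hence \<open>\<phi>\<close> fixes p(g) y for all test forms, and
    therefore y.\<close>
  have phi1: "\<phi> y = y" if y: "y \<in> Sc 1" for y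
  proof -
    have yN: "y \<in> ?N" and yc: "y \<in> carrier Qk" using y S1 Q.submoduleD(2)[OF Sc_submodule y] by auto
    have d: "lmap A ?X Qk (\<lambda>x. \<phi> x \<ominus>\<^bsub>Qk\<^esub> x)" by (rule lmap_diff[OF phi(1) lmap_incl[OF Q.left_module_axioms Sc_submodule]])
    have oy: "lmap A (regular_module A) ?X (\<lambda>a. a \<odot>\<^bsub>?X\<^esub> y)" by (rule lmap_orbit[OF lX]) (use yN in simp)
    let ?B = "{a \<in> carrier (regular_module A). \<phi> (a \<odot>\<^bsub>?X\<^esub> y) \<ominus>\<^bsub>Qk\<^esub> (a \<odot>\<^bsub>?X\<^esub> y) \<in> {\<zero>\<^bsub>Qk\<^esub>}}"
    have "?B = carrier A"
    proof (rule \<P>_gen)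
      show "submodule ?B A (regular_module A)" by (rule lmap.vimage_submodule[OF lmap_comp[OF oy d] Q.submodule_zero])
      fix p g assume p: "p \<in> \<P>" and g: "g \<in> carrier G"
      let ?f = "\<lambda>g\<in>carrier G. p g \<odot>\<^bsub>Qk\<^esub> y"
      have pc: "p g \<in> carrier A" if "g \<in> carrier G" for g using lmap.closed[OF \<P>_lmap[OF p] that] by simp
      have fT: "?f \<in> TT" by (rule \<P>_TT[OF p yN])
      then have "?f \<in> DT 1" unfolding DT_def using Q.submoduleD(5)[OF Sc_submodule pc y] by simp
      from id[OF this] phi(2)[OF fT g] have "\<phi> (p g \<odot>\<^bsub>Qk\<^esub> y) = p g \<odot>\<^bsub>Qk\<^esub> y" using g by simp
      then show "p g \<in> ?B" using pc[OF g] yc by (simp add: Q.diff_zero_iff)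
    qed
    then have "\<one> \<in> ?B" by simp
    moreover have "\<phi> y \<in> carrier Qk" using lmap.closed[OF phi(1), of y] yN by simp
    ultimately show ?thesis using yc by (simp add: Q.diff_zero_iff)
  qed
  have fgX: "fg_module A ?X" using finlen_sub[OF finlen_Qk Sc_submodule] by (simp add: fg_iff_finlen)
  have "inj_on (\<lambda>x. x) (carrier ?X)" by simp
  from inj_extend[OF inj_Qk fgX fg_Qk lmap_incl[OF Q.left_module_axioms Sc_submodule] this phi(1)]
  obtain \<Phi> where Phi: "lmap A Qk Qk \<Phi>" "\<And>x. x \<in> carrier ?X \<Longrightarrow> \<Phi> x = \<phi> x" by blast
  \<comment> \<open>The kernel of a map that fixes the socle meets the socle in zero, and the socle
    is essential.\<close>
  have injective: "inj_on w (carrier Qk)" if w: "lmap A Qk Qk w" and w1: "\<And>y. y \<in> Sc 1 \<Longrightarrow> w y = y" for w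
  proof -
    interpret w: lmap A Qk Qk w by (rule w)
    have "w.ker \<inter> Sc 1 = {\<zero>\<^bsub>Qk\<^esub>}"
    proof (intro equalityI subsetI)
      fix y assume "y \<in> w.ker \<inter> Sc 1"
      then have y: "w y = \<zero>\<^bsub>Qk\<^esub>" "y \<in> Sc 1" unfolding w.ker_def by blast+
      show "y \<in> {\<zero>\<^bsub>Qk\<^esub>}" using y(1) unfolding w1[OF y(2)] by simp
    next
      fix y assume "y \<in> {\<zero>\<^bsub>Qk\<^esub>}"
      then show "y \<in> w.ker \<inter> Sc 1" using Q.submoduleD(3)[OF w.ker_submodule] Q.submoduleD(3)[OF Sc_submodule] by blast
    qed
    moreover obtain \<sigma> :: "'v set \<Rightarrow> 'q" where "\<And>N. submodule N A Qk \<Longrightarrow> N \<inter> Sc 1 = {\<zero>\<^bsub>Qk\<^esub>} \<Longrightarrow> N = {\<zero>\<^bsub>Qk\<^esub>}"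
      by (rule socle_hull) blast
    ultimately show ?thesis using w.ker_submodule unfolding w.inj_iff_ker by blast
  qed
  have Phi1: "\<Phi> y = y" if "y \<in> Sc 1" for y using Phi(2) phi1 that S1 by auto
  have injPhi: "inj_on \<Phi> (carrier Qk)" by (rule injective[OF Phi(1)]) (rule Phi1)
  \<comment> \<open>Injectivity of Q_k gives a left inverse \<open>v\<close> of
    \<open>\<Phi>\<close>. It fixes the socle as well and is thus injective, so it is also a right
    inverse.\<close>
  from inj_extend[OF inj_Qk fg_Qk fg_Qk Phi(1) injPhi lmap_id[OF Q.left_module_axioms]]
  obtain v where v: "lmap A Qk Qk v" "\<And>x. x \<in> carrier Qk \<Longrightarrow> v (\<Phi> x) = x" by blast
  have v1: "v y = y" if y: "y \<in> Sc 1" for y using v(2)[of y] Phi1[OF y] Q.submoduleD(2)[OF Sc_submodule y] by simp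
  have injv: "inj_on v (carrier Qk)" by (rule injective[OF v(1)]) (rule v1)
  have Phiv: "\<Phi> (v y) = y" if y: "y \<in> carrier Qk" for y
  proof (rule inj_onD[OF injv])
    show "v (\<Phi> (v y)) = v y" by (rule v(2)[OF lmap.closed[OF v(1) y]])
  qed (use y lmap.closed[OF v(1)] lmap.closed[OF Phi(1)] in auto)
  have TTX: "f g \<in> carrier ?X" if "f \<in> TT" "g \<in> carrier G" for f g using TT_values[OF that] by simp
  have uP: "u f g = \<Phi> (f g)" if "f \<in> TT" "g \<in> carrier G" for f g using phi(2)[OF that] Phi(2)[OF TTX[OF that]] by simp
  have TTQ: "f g \<in> carrier Qk" if "f \<in> TT" "g \<in> carrier G" for f g by (rule hs.H_closed[OF Q.left_module_axioms TT_in[OF that(1)] that(2)])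
  show ?thesis
    unfolding bij_betw_def
  proof
    show "inj_on u TT"
    proof (rule inj_onI)
      fix f f' assume f: "f \<in> TT" "f' \<in> TT" and e: "u f = u f'"
      show "f = f'"
      proof (rule hs.H_eqI[OF TT_in[OF f(1)] TT_in[OF f(2)]])
        fix g assume g: "g \<in> carrier G"
        have "\<Phi> (f g) = \<Phi> (f' g)" using uP[OF f(1) g] uP[OF f(2) g] e by simp
        then show "f g = f' g" by (rule inj_onD[OF injPhi _ TTQ[OF f(1) g] TTQ[OF f(2) g]])
      qed
    qed
    have uT: "u f \<in> TT" if "f \<in> TT" for f using u.closed[of f] that by simp
    have us: "F \<in> u ` TT" if F: "F \<in> TT" for F
    proof -
      let ?f = "compose (carrier G) v F"
      have fH: "?f \<in> carrier (H Qk)" by (rule lmap.closed[OF hs.lmap_post[OF v(1)] TT_in[OF F]])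
      \<comment> \<open>Socle terms are annihilators of powers of \<open>J\<close> and so are
        preserved by any endomorphism of Q_k; this keeps the composite with \<open>v\<close> inside
        the bounds of \<open>TT\<close>.\<close>
      have vS: "v y \<in> Sc t" if y: "y \<in> Sc t" for y t
        unfolding Sc_iff
      proof (intro conjI ballI)
        have yc: "y \<in> carrier Qk" by (rule Q.submoduleD(2)[OF Sc_submodule y])
        show "v y \<in> carrier Qk" by (rule lmap.closed[OF v(1) yc])
        fix c assume c: "c \<in> Jpow A t"
        then have "c \<odot>\<^bsub>Qk\<^esub> y = \<zero>\<^bsub>Qk\<^esub>" using y unfolding Sc_iff by blast
        then show "c \<odot>\<^bsub>Qk\<^esub> v y = \<zero>\<^bsub>Qk\<^esub>" using lmap.smult[OF v(1) Jpow_closed[OF c] yc] lmap.zero[OF v(1)] by simp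
      qed
      have fT: "?f \<in> TT"
        unfolding TT_def
      proof (intro CollectI conjI allI impI ballI)
        fix a b y assume ab: "(a, b) \<in> \<Lambda>" and y: "y \<in> carrier (Gs (a, b))"
        have "F (\<iota> (a, b) y) \<in> Sc (b + 1 - l)" using F ab y unfolding TT_def by blast
        from vS[OF this] show "?f (\<iota> (a, b) y) \<in> Sc (b + 1 - l)" using iota_closed[OF ab y] by (simp add: compose_def)
      qed (rule fH)
      have "u ?f = F"
      proof (rule hs.H_eqI[OF TT_in TT_in[OF F]])
        show "u ?f \<in> TT" by (rule uT[OF fT])
        fix g assume g: "g \<in> carrier G"
        show "u ?f g = F g" unfolding uP[OF fT g] using Phiv[OF TTQ[OF F g]] g by (simp add: compose_def)
      qed
      then show ?thesis by (rule image_eqI[OF sym fT])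
    qed
    show "u ` TT = TT" using uT us by (intro equalityI subsetI) (erule imageE, simp)+
  qed
qed

lemma std_nonzero: "p \<in> \<Lambda> \<Longrightarrow> \<exists>z\<in>carrier (std p). z \<noteq> \<zero>\<^bsub>std p\<^esub>"
proof -
  assume p: "p \<in> \<Lambda>"
  interpret HG: left_module R "H (Gs p)" by (rule left_module_HG[OF p])
  note Ks = K_submodule[OF p]
  have "K p \<subseteq> radH p" using iota_closed[OF p] by (auto simp: K_def radH_def)
  then have "pr p \<notin> K p" using pr_not_radH[OF p] by blast
  then have "K p +>\<^bsub>H (Gs p)\<^esub> pr p \<noteq> \<zero>\<^bsub>std p\<^esub>"
    using HG.coset_eq_zero_iff[OF Ks pr_in[OF p]] HG.quot_simps(2)[OF Ks] by simp
  moreover have "K p +>\<^bsub>H (Gs p)\<^esub> pr p \<in> carrier (std p)" using HG.quot_simps(1)[OF Ks] pr_in[OF p] by simp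
  ultimately show ?thesis by blast
qed

lemma extends_DT:
  assumes ep: "\<And>i. 1 \<le> i \<Longrightarrow> i \<le> mm \<Longrightarrow> \<exists>\<Omega> lab. finite (\<Omega> :: 'w set) \<and> lab ` \<Omega> \<subseteq> \<Lambda> \<and> 
      epik R M0 (DT i) (DT (i - 1)) (dir_sum \<Omega> (\<lambda>\<omega>. std (lab \<omega>)))"
    and EI: "\<And>p. p \<in> \<Lambda> \<Longrightarrow> EI T p" and i: "1 \<le> i" "i \<le> mm"
  shows "extends T M0 (DT 1) (DT i)"
  using i
proof (induction i rule: nat_induct_at_least)
  case base
  show ?case by (rule extends_refl)
next
  case (Suc i)
  have "extends T M0 (DT i) (DT (Suc i))"
  proof -
    obtain \<Omega> :: "'w set" and lab where e: "finite \<Omega>" "lab ` \<Omega> \<subseteq> \<Lambda>" 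
      "epik R M0 (DT (Suc i)) (DT (Suc i - 1)) (dir_sum \<Omega> (\<lambda>\<omega>. std (lab \<omega>)))"
      using ep[of "Suc i"] Suc.prems by auto
    have e3: "epik R M0 (DT (Suc i)) (DT i) (dir_sum \<Omega> (\<lambda>\<omega>. std (lab \<omega>)))" using e(3) by simp
    have lab: "lab \<omega> \<in> \<Lambda>" if "\<omega> \<in> \<Omega>" for \<omega> using e(2) that by blast
    show ?thesis by (rule ext_dir_sum[OF M0.left_module_axioms e(1) lab EI[OF lab] e3])
  qed
  from extends_trans[OF Suc.IH[OF Suc_leD[OF Suc.prems]] this DT_mono[OF Suc.hyps]] show ?case .
qed

lemma tilt_iso:
  fixes T :: "('v adr, 't) module"
  assumes ep: "\<And>i. 1 \<le> i \<Longrightarrow> i \<le> mm \<Longrightarrow> \<exists>\<Omega> lab. finite (\<Omega> :: 'w set) \<and> lab ` \<Omega> \<subseteq> \<Lambda> \<and> 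
      epik R M0 (DT i) (DT (i - 1)) (dir_sum \<Omega> (\<lambda>\<omega>. std (lab \<omega>)))"
    and T: "left_module R T" "indecomposable R T" and EI: "\<And>p. p \<in> \<Lambda> \<Longrightarrow> EI T p"
    and f: "lmap R (std (k, l)) T f" "inj_on f (carrier (std (k, l)))"
    and fl: "filtered_by R std \<Phi> (quot_module T (f ` carrier (std (k, l))))" "\<Phi> \<subseteq> \<Lambda>"
  obtains \<alpha> where "lmap R T M0 \<alpha>" "bij_betw \<alpha> (carrier T) (carrier M0)"
proof -
  interpret T: left_module R T by fact
  interpret f: lmap R "std (k, l)" T f by (rule f(1))
  let ?S = "carrier (std (k, l))" and ?D = "f ` carrier (std (k, l))"
  have sD: "submodule ?D R T" by (rule f.image_submodule[OF f.dom.submodule_carrier])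
  obtain j where j: "lmap R (std (k, l)) M0 j" "inj_on j ?S" "j ` ?S = DT 1" by (rule std_DT1) blast
  interpret j: lmap R "std (k, l)" M0 j by (rule j(1))
  \<comment> \<open>Maps are to be extended from submodules, while the standard module comes with
    embeddings into \<open>T\<close> and \<open>TT\<close>. This turns a map on the standard module
    into one on its embedded image.\<close>
  have flip: "\<exists>h. lmap R (msub Y (g ` ?S)) X h \<and> (\<forall>z\<in>?S. h (g z) = g' z)"
    if Y: "left_module R Y" and g: "lmap R (std (k, l)) Y g" "inj_on g ?S" and g': "lmap R (std (k, l)) X g'"
    for Y :: "('v adr, 'y) module" and X :: "('v adr, 'x) module" and g g'
  proof -
    have s: "submodule (g ` ?S) R Y" by (rule lmap.image_submodule[OF g(1) f.dom.submodule_carrier])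
    have 1: "lmap R (std (k, l)) (msub Y (g ` ?S)) g" by (rule lmap_msub_cod[OF g(1) s]) (rule imageI)
    have 2: "g ` ?S = carrier (msub Y (g ` ?S))" by (simp add: msub_def)
    have 3: "\<exists>t. lmap R (msub Y (g ` ?S)) X t \<and> (\<forall>x\<in>?S. t (g x) = g' x)"
    proof (rule lmap_factor_surj[OF 1 2 g'])
      fix z assume z: "z \<in> ?S" and "g z = \<zero>\<^bsub>msub Y (g ` ?S)\<^esub>"
      then have "g z = g \<zero>\<^bsub>std (k, l)\<^esub>" using lmap.zero[OF g(1)] by (simp add: msub_def)
      then have "z = \<zero>\<^bsub>std (k, l)\<^esub>" by (rule inj_onD[OF g(2) _ z f.dom.M.zero_closed])
      then show "g' z = \<zero>\<^bsub>X\<^esub>" using lmap.zero[OF g'] by simp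
    qed
    then show ?thesis .
  qed
  have jD: "\<exists>z\<in>?S. x = j z" if "x \<in> DT 1" for x using that unfolding j(3)[symmetric] by blast
  have jDT: "j z \<in> DT 1" if "z \<in> ?S" for z unfolding j(3)[symmetric] by (rule imageI[OF that])
  obtain z0 where z0: "z0 \<in> ?S" "z0 \<noteq> \<zero>\<^bsub>std (k, l)\<^esub>" using std_nonzero[OF kl] by blast
  have j0: "j z0 \<noteq> \<zero>\<^bsub>M0\<^esub>"
  proof
    assume "j z0 = \<zero>\<^bsub>M0\<^esub>"
    then have "j z0 = j \<zero>\<^bsub>std (k, l)\<^esub>" by (simp only: j.zero)
    then have "z0 = \<zero>\<^bsub>std (k, l)\<^esub>" by (rule inj_onD[OF j(2) _ z0(1) f.dom.M.zero_closed])
    then show False using z0(2) by blast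
  qed
  \<comment> \<open>The chain of extensions starts at \<open>DT 1\<close>, so at least one layer
    must exist; otherwise \<open>TT\<close> would be zero, yet it contains a standard
    module.\<close>
  have mm1: "1 \<le> mm"
  proof (rule ccontr)
    assume "\<not> 1 \<le> mm"
    then have "mm = 0" by simp
    then have "TT = {\<zero>\<^bsub>H Qk\<^esub>}" using DT_mm DT_0 by simp
    then show False using j0 j.closed[OF z0(1)] by simp
  qed
  obtain \<alpha>' where a': "lmap R (msub T ?D) M0 \<alpha>'" "\<And>z. z \<in> ?S \<Longrightarrow> \<alpha>' (f z) = j z"
    using flip[OF T(1) f j(1)] by blast
  have "extends M0 T ?D (carrier T)" by (rule ext_filtered_quot[OF T(1) sD fl EI_TT]) (use fl(2) in blast)
  then obtain \<alpha> where a: "lmap R T M0 \<alpha>" "\<And>x. x \<in> ?D \<Longrightarrow> \<alpha> x = \<alpha>' x"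
    using a'(1) unfolding extends_def msub_carrier by blast
  have af: "\<alpha> (f z) = j z" if z: "z \<in> ?S" for z using a(2)[OF imageI[OF z]] a'(2)[OF z] by simp
  obtain \<beta>' where b': "lmap R (msub M0 (DT 1)) T \<beta>'" "\<And>z. z \<in> ?S \<Longrightarrow> \<beta>' (j z) = f z"
    using flip[OF M0.left_module_axioms j(1,2) f(1)] unfolding j(3) by blast
  have M0M: "msub M0 TT = M0" by (simp add: msub_def)
  have "extends T M0 (DT 1) (DT mm)" by (rule extends_DT[OF ep EI mm1 order_refl])
  then obtain \<beta> where b: "lmap R M0 T \<beta>" "\<And>x. x \<in> DT 1 \<Longrightarrow> \<beta> x = \<beta>' x"
    using b'(1) unfolding extends_def DT_mm M0M by blast
  have bj: "\<beta> (j z) = f z" if z: "z \<in> ?S" for z using b(2)[OF jDT[OF z]] b'(2)[OF z] by simp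
  interpret a: lmap R T M0 \<alpha> by (rule a(1))
  interpret b: lmap R M0 T \<beta> by (rule b(1))
  let ?u = "\<lambda>x. \<alpha> (\<beta> x)"
  have "bij_betw ?u TT TT"
  proof (rule endo_bij[OF lmap_comp[OF b(1) a(1)]])
    fix x assume "x \<in> DT 1"
    then obtain z where "z \<in> ?S" "x = j z" using jD by blast
    then show "?u x = x" using bj af by simp
  qed
  then have u: "bij_betw ?u (carrier M0) (carrier M0)" by simp
  have u0: "x = \<zero>\<^bsub>M0\<^esub>" if x: "x \<in> carrier M0" "?u x = \<zero>\<^bsub>M0\<^esub>" for x
  proof (rule inj_onD[OF bij_betw_imp_inj_on[OF u] _ x(1) M0.M.zero_closed])
    show "?u x = ?u \<zero>\<^bsub>M0\<^esub>" using x(2) by (simp only: b.zero a.zero)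
  qed
  let ?N = "\<beta> ` carrier M0"
  have sN: "submodule ?N R T" by (rule b.image_submodule[OF M0.submodule_carrier])
  \<comment> \<open>Bijectivity of the composite \<open>\<alpha> \<beta>\<close> splits
    \<open>T\<close> as the image of \<open>\<beta>\<close> plus the kernel of
    \<open>\<alpha>\<close>. The image is non-zero, so indecomposability kills the kernel.\<close>
  have "?N \<inter> a.ker = {\<zero>\<^bsub>T\<^esub>}"
  proof (intro equalityI subsetI)
    fix y assume "y \<in> ?N \<inter> a.ker"
    then obtain x where x: "x \<in> carrier M0" "y = \<beta> x" "\<alpha> y = \<zero>\<^bsub>M0\<^esub>" unfolding a.ker_def by blast
    then have "x = \<zero>\<^bsub>M0\<^esub>" using u0[OF x(1)] by (simp only:)
    then have "y = \<zero>\<^bsub>T\<^esub>" using x(2) by (simp only: b.zero)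
    then show "y \<in> {\<zero>\<^bsub>T\<^esub>}" by blast
  next
    fix y assume "y \<in> {\<zero>\<^bsub>T\<^esub>}"
    then show "y \<in> ?N \<inter> a.ker" using T.submoduleD(3)[OF sN] T.submoduleD(3)[OF a.ker_submodule] by blast
  qed
  moreover have "?N <+>\<^bsub>T\<^esub> a.ker = carrier T"
    unfolding T.ssum_eq
  proof (intro equalityI subsetI)
    fix t assume "t \<in> T.ssum ?N a.ker"
    then show "t \<in> carrier T" by (rule T.submoduleD(2)[OF T.submodule_ssum[OF sN a.ker_submodule]])
  next
    fix t assume t: "t \<in> carrier T"
    have "\<alpha> t \<in> ?u ` carrier M0" unfolding bij_betw_imp_surj_on[OF u] by (rule a.closed[OF t])
    then obtain x where x: "x \<in> carrier M0" "\<alpha> t = ?u x" by blast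
    have bx: "\<beta> x \<in> carrier T" by (rule b.closed[OF x(1)])
    have k: "t \<ominus>\<^bsub>T\<^esub> \<beta> x \<in> a.ker" using a.eq_iff_diff_ker[OF t bx] x(2) by blast
    have "\<beta> x \<oplus>\<^bsub>T\<^esub> (t \<ominus>\<^bsub>T\<^esub> \<beta> x) = t"
      using t bx by (simp add: T.M.minus_eq T.M.a_lcomm[of "\<beta> x" t] T.M.r_neg)
    then show "t \<in> T.ssum ?N a.ker" using T.ssumI[OF imageI[OF x(1)] k, of \<beta>] by simp
  qed
  ultimately have "?N = {\<zero>\<^bsub>T\<^esub>} \<or> a.ker = {\<zero>\<^bsub>T\<^esub>}"
    using T(2) sN a.ker_submodule unfolding indecomposable_def by blast
  moreover have "?N \<noteq> {\<zero>\<^bsub>T\<^esub>}"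
  proof
    assume "?N = {\<zero>\<^bsub>T\<^esub>}"
    then have "\<beta> (j z0) = \<zero>\<^bsub>T\<^esub>" using j.closed[OF z0(1)] by blast
    then have "?u (j z0) = \<zero>\<^bsub>M0\<^esub>" by (simp only: a.zero)
    then show False using u0[OF j.closed[OF z0(1)]] j0 by blast
  qed
  ultimately have "inj_on \<alpha> (carrier T)" unfolding a.inj_iff_ker by blast
  moreover have "\<alpha> ` carrier T = carrier M0"
  proof (intro equalityI subsetI)
    fix x assume "x \<in> \<alpha> ` carrier T"
    then show "x \<in> carrier M0" using a.closed by blast
  next
    fix x assume "x \<in> carrier M0"
    then have "x \<in> ?u ` carrier M0" unfolding bij_betw_imp_surj_on[OF u] .
    then obtain y where y: "y \<in> carrier M0" "x = ?u y" by blast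
    show "x \<in> \<alpha> ` carrier T" unfolding y(2) by (rule imageI[OF b.closed[OF y(1)]])
  qed
  ultimately show thesis using that[OF a(1)] unfolding bij_betw_def by blast
qed

end

section \<open>Transport of the layers from \<open>TT\<close> to the tilting module\<close>

context adr_tilt
begin

lemma tilting_layers:
  fixes T :: "('v adr, 't) module" and Q :: "nat \<times> nat \<Rightarrow> ('v adr, 'r) module" and \<Omega> :: "nat \<Rightarrow> 'w set"
  defines "D \<equiv> standard_module R \<Lambda> adr_le (\<lambda>p. H (Gs p))"
  assumes lay: "\<And>i. i \<in> {1..loewy_length A Qk} \<Longrightarrow> finite (\<Omega> i) \<and> x ` \<Omega> i \<subseteq> {1..n} \<and>
      mod_iso A (subquot Qk (Sc i) (Sc (i - 1))) (dir_sum (\<Omega> i) (\<lambda>\<omega>. Top (x \<omega>)))"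
    and Q: "\<And>p. p \<in> \<Lambda> \<Longrightarrow> injective_hull R (Ls p) (Q p)"
    and T: "tilting_module R \<Lambda> adr_le (\<lambda>p. H (Gs p)) Q (k, l) T"
    and i: "i \<in> {1..delta_ssl R D \<Lambda> T}"
  shows "mod_iso R (subquot T (delta_series R D \<Lambda> T i) (delta_series R D \<Lambda> T (i - 1)))
    (dir_sum (\<Omega> i) (\<lambda>\<omega>. D (x \<omega>, l + i - 1)))"
proof -
  have Dp: "D p = std p" if "p \<in> \<Lambda>" for p unfolding D_def by (rule standard_eq[OF that])
  have lay': "epik R M0 (DT i) (DT (i - 1)) (dir_sum (\<Omega> i) (\<lambda>\<omega>. std (x \<omega>, l + i - 1)))"
      "finite (\<Omega> i)" "x ` \<Omega> i \<subseteq> {1..n}" "\<And>\<omega>. \<omega> \<in> \<Omega> i \<Longrightarrow> (x \<omega>, l + i - 1) \<in> \<Lambda>" if im: "1 \<le> i" "i \<le> mm" for i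
  proof -
    have "i \<in> {1..loewy_length A Qk}" using im mm_le(2) by simp
    from lay[OF this] have a: "finite (\<Omega> i)" "x ` \<Omega> i \<subseteq> {1..n}" 
      "mod_iso A (subquot Qk (Sc i) (Sc (i - 1))) (dir_sum (\<Omega> i) (\<lambda>\<omega>. Top (x \<omega>)))" by blast+
    have xi: "x \<omega> \<in> {1..n}" if "\<omega> \<in> \<Omega> i" for \<omega> using a(2) that by blast
    have ld: "left_module A (dir_sum (\<Omega> i) (\<lambda>\<omega>. Top (x \<omega>)))"
      by (rule module_family.left_module_dir_sum[OF module_family.intro[OF ring_axioms left_module_top[OF xi]]])
    have "Sc (i - 1) \<subseteq> Sc i" by (rule Sc_mono) simp
    then have "epik A Qk (Sc i) (Sc (i - 1)) (dir_sum (\<Omega> i) (\<lambda>\<omega>. Top (x \<omega>)))"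
      using a(3) mod_iso_subquot_iff[OF Q.left_module_axioms ld Sc_submodule Sc_submodule] by blast
    from layer_epik[OF im a(2) a(1) this] show "epik R M0 (DT i) (DT (i - 1)) (dir_sum (\<Omega> i) (\<lambda>\<omega>. std (x \<omega>, l + i - 1)))" .
    show "finite (\<Omega> i)" "x ` \<Omega> i \<subseteq> {1..n}" by (rule a)+
    have "l + i - 1 \<in> {1..L}" using im mm_le(1) l_bounds by auto
    then show "(x \<omega>, l + i - 1) \<in> \<Lambda>" if "\<omega> \<in> \<Omega> i" for \<omega> using xi[OF that] by (simp only: labels_iff)
  qed
  have ep: "\<exists>(\<Omega>' :: 'w set) lab. finite \<Omega>' \<and> lab ` \<Omega>' \<subseteq> \<Lambda> \<and> 
      epik R M0 (DT i) (DT (i - 1)) (dir_sum \<Omega>' (\<lambda>\<omega>. std (lab \<omega>)))" if "1 \<le> i" "i \<le> mm" for i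
    by (intro exI[of _ "\<Omega> i"] exI[of _ "\<lambda>\<omega>. (x \<omega>, l + i - 1)"] conjI lay'[OF that] image_subsetI)
  have T1: "fg_module R T" "indecomposable R T" 
    and T2: "filtered_by R (costandard_module R \<Lambda> adr_le Ls Q) \<Lambda> T"
    using T unfolding tilting_module_def by blast+
  have lT: "left_module R T" using T1(1) by (simp add: fg_module_def)
  obtain f where f: "f \<in> mod_hom R (std (k, l)) T" "inj_on f (carrier (std (k, l)))"
    and fl: "filtered_by R D {q \<in> \<Lambda>. adr_le q (k, l) \<and> q \<noteq> (k, l)} (quot_module T (f ` carrier (std (k, l))))"
    using T unfolding tilting_module_def D_def[symmetric] Dp[OF kl] by blast
  have fl': "filtered_by R std {q \<in> \<Lambda>. adr_le q (k, l) \<and> q \<noteq> (k, l)} (quot_module T (f ` carrier (std (k, l))))"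
    by (rule filtered_by_cong[OF fl Dp]) blast
  have Qp: "fg_module R (Q p)" "injective R (Q p)" if "p \<in> \<Lambda>" for p
    using Q[OF that] by (simp_all add: injective_hull_def)
  have cost: "costandard_module R \<Lambda> adr_le Ls Q q = msub (Q q) (NN (Q q) q)" if "q \<in> \<Lambda>" for q
    by (rule costandard_eq[of Q q, OF Qp(1)[OF that]])
  \<comment> \<open>The costandard filtration is used only here: it rules out extensions of standard
    modules by \<open>T\<close>.\<close>
  have EI: "EI T p" if p: "p \<in> \<Lambda>" for p
  proof (rule EI_filtered[OF lT p T2])
    fix q assume q: "q \<in> \<Lambda>"
    have lQ: "left_module R (Q q)" using Qp(1)[OF q] by (simp add: fg_module_def)
    show "left_module R (costandard_module R \<Lambda> adr_le Ls Q q)"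
      unfolding cost[OF q] by (rule left_module.left_module_msub[OF lQ NN_submodule[OF lQ]])
    show "EI (costandard_module R \<Lambda> adr_le Ls Q q) p"
      unfolding cost[OF q] by (rule EI_costandard[OF p q Qp[OF q]])
  qed
  obtain \<alpha> where a: "lmap R T M0 \<alpha>" "bij_betw \<alpha> (carrier T) (carrier M0)"
    by (rule tilt_iso[OF ep lT T1(2) EI mod_hom_lmap[OF f(1) left_module_std[OF kl] lT] f(2) fl']) auto
  have dc: "delta_series R D \<Lambda> M i = delta_series R std \<Lambda> M i" for M :: "('v adr, 'y) module" and i
    by (rule delta_cong[OF Dp])
  \<comment> \<open>The trace series is invariant under isomorphism, so its terms in
    \<open>T\<close> are the preimages of the \<open>DT i\<close>.\<close>
  have del: "delta_series R D \<Lambda> T i = {t \<in> carrier T. \<alpha> t \<in> DT i}" if "i \<le> mm" for i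
  proof -
    have 1: "delta_series R std \<Lambda> M0 i = DT i" by (rule delta_M0[OF ep that])
    have "delta_series R std \<Lambda> T i = {t \<in> carrier T. \<alpha> t \<in> delta_series R std \<Lambda> M0 i}"
      by (rule delta_iso[OF a]) (rule left_module_std)
    then show ?thesis unfolding 1 dc .
  qed
  have "delta_series R D \<Lambda> T mm = carrier T"
    unfolding del[OF order_refl] DT_mm using lmap.closed[OF a(1)] by auto
  \<comment> \<open>An upper bound for the length suffices: every index in question then falls in
    the range where the layers have been computed.\<close>
  then have "delta_ssl R D \<Lambda> T \<le> mm" unfolding delta_ssl_def by (rule Least_le)
  then have im: "1 \<le> i" "i \<le> mm" "i - 1 \<le> mm" using i by auto
  have e: "epik R T (delta_series R D \<Lambda> T i) (delta_series R D \<Lambda> T (i - 1)) (dir_sum (\<Omega> i) (\<lambda>\<omega>. std (x \<omega>, l + i - 1)))"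
    unfolding del[OF im(2)] del[OF im(3)]
    by (rule epik_vimage[OF a(1) bij_betw_imp_surj_on[OF a(2)] lay'(1)[OF im(1,2)]])
  have ds: "dir_sum (\<Omega> i) (\<lambda>\<omega>. D (x \<omega>, l + i - 1)) = dir_sum (\<Omega> i) (\<lambda>\<omega>. std (x \<omega>, l + i - 1))"
    by (rule dir_sum_cong[OF Dp[OF lay'(4)[OF im(1,2)]]])
  have ld: "left_module R (dir_sum (\<Omega> i) (\<lambda>\<omega>. std (x \<omega>, l + i - 1)))"
    by (rule module_family.left_module_dir_sum[OF module_family.intro[OF R.ring_axioms left_module_std[OF lay'(4)[OF im(1,2)]]]])
  have U: "submodule (delta_series R D \<Lambda> T i) R T" "submodule (delta_series R D \<Lambda> T (i - 1)) R T"
    "delta_series R D \<Lambda> T (i - 1) \<subseteq> delta_series R D \<Lambda> T i"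
    using e unfolding epik_def by blast+
  show ?thesis unfolding ds using e unfolding mod_iso_subquot_iff[OF lT ld U] .
qed

end

theorem theorem3p12:
  fixes K :: "('k, 'e) ring_scheme" and A :: "('a, 'f) ring_scheme" and \<phi> :: "'k \<Rightarrow> 'a"
    and n L k l :: nat
    and P :: "nat \<Rightarrow> ('a, 'v) module"
    and Qk :: "('a, 'q) module"
    and \<Omega> :: "nat \<Rightarrow> 'w set" and x :: "'w \<Rightarrow> nat"
    and Q :: "nat \<times> nat \<Rightarrow> ('v adr, 'r) module"
    and T :: "('v adr, 't) module"
  assumes "artin_algebra K A \<phi>"
    and "loewy_length A (regular_module A) = L"
    and "complete_proj_list A n P"
    and "\<forall>i\<in>{1..n}. loewy_length A (P i) = L \<and> rigid A (P i)"
    and "(k, l) \<in> adr_labels A n P"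
    and "injective_hull A (mtop A (P k)) Qk"
    and "\<forall>i\<in>{1..loewy_length A Qk}. finite (\<Omega> i) \<and> x ` \<Omega> i \<subseteq> {1..n} \<and>
           mod_iso A (subquot Qk (soc_series A Qk i) (soc_series A Qk (i - 1)))
                     (dir_sum (\<Omega> i) (\<lambda>\<omega>. mtop A (P (x \<omega>))))"
    and "\<forall>p\<in>adr_labels A n P. injective_hull (adr_algebra A n P) (adr_simple A n P p) (Q p)"
    and "adr_tilting A n P Q (k, l) T"
  shows "\<forall>i\<in>{1..adr_delta_ssl A n P T}.
           mod_iso (adr_algebra A n P)
             (subquot T (adr_delta A n P T i) (adr_delta A n P T (i - 1)))
             (dir_sum (\<Omega> i) (\<lambda>\<omega>. adr_standard A n P (x \<omega>, l + i - 1)))"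
proof -
  have "adr_tilt A n P L K \<phi> k l Qk"
    by (intro adr_tilt.intro adr.intro proj_list.intro artin_alg.artin_ring_A[OF artin_alg.intro[OF assms(1)]]
        adr_tilt_axioms.intro adr_axioms.intro proj_list_axioms.intro assms(1,3,5,6)) (use assms(4) in auto)
  note lay = adr_tilt.tilting_layers[OF this]
  have proj: "adr_proj A n P = (\<lambda>p. hom_module A (dir_sum (adr_labels A n P) (adr_summand A P)) (adr_summand A P p))"
    by (rule ext) (simp add: adr_proj_def adr_generator_def)
  show ?thesis
    unfolding adr_delta_ssl_def adr_delta_def adr_standard_def adr_algebra_def adr_generator_def proj
  proof (intro ballI, rule lay[where Q = Q], goal_cases)
    case (1 i i')
    then show ?case using assms(7) by blast
  next
    case (2 i p)
    then show ?case using assms(8) unfolding adr_simple_def adr_algebra_def adr_generator_def proj by blast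
  next
    case (3 i)
    show ?case using assms(9) unfolding adr_tilting_def adr_algebra_def adr_generator_def proj .
  qed
qed

end
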